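(* Let $A,B,C$ be positive integers with $\gcd(A,B,C)=1$. If \[ \frac{B^2}{(A+B)(B+C)}\notin\left\{\frac14,\frac12,\frac34\right\}, \] then the generating function $Q(x,y;t)$ of large tandem walks with parameters $(A,B,C)$ is not D-finite, and in particular the generating function $E(t)=Q(0,0;t)$ of large tandem excursions is not D-finite.
   Context: A large tandem walk with parameters $(A,B,C)$ is a walk in $\mathbb{Z}^2$ starting at $(0,0)$ using steps from $\{(A,0),(-B,B),(0,-C)\}$ all of whose points lie in the quarter plane $\{(x,y)\in\mathbb{Z}^2:x,y\ge0\}$; an excursion is such a walk ending at $(0,0)$. $Q(x,y;t)=\sum_{i,j,n\ge0}q_{ijn}x^iy^jt^n$, where $q_{ijn}$ is the number of such walks of length $n$ ending at $(i,j)$. A power series is D-finite if it satisfies a (nonzero) linear differential equation with polynomial coefficients (for multivariate series, in each variable). *)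

theory Defs
  imports Complex_Main "HOL-Library.Product_Plus"
    "HOL-Computational_Algebra.Polynomial_FPS"
begin

unbundle fps_syntax

definition tandem_steps :: "nat \<Rightarrow> nat \<Rightarrow> nat \<Rightarrow> (int \<times> int) set" where
  "tandem_steps A B C = {(int A, 0), (- int B, int B), (0, - int C)}"

text \<open>A walk of length \<open>n\<close> is given by the list of its \<open>n + 1\<close> points.\<close>

definition tandem_walks ::
    "nat \<Rightarrow> nat \<Rightarrow> nat \<Rightarrow> nat \<Rightarrow> int \<times> int \<Rightarrow> (int \<times> int) list set" where
  "tandem_walks A B C n e =
     {w. length w = Suc n \<and> w ! 0 = (0, 0) \<and> w ! n = e \<and>
         (\<forall>k<n. w ! Suc k - w ! k \<in> tandem_steps A B C) \<and>
         (\<forall>k\<le>n. 0 \<le> fst (w ! k) \<and> 0 \<le> snd (w ! k))}"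

lemma finite_tandem_walks: "finite (tandem_walks A B C n e)"
proof (rule inj_on_finite)
  let ?S = "tandem_steps A B C"
  let ?d = "\<lambda>w. map (\<lambda>k. w ! Suc k - w ! k) [0..<n]"
  show "finite {s. set s \<subseteq> ?S \<and> length s = n}"
    by (rule finite_lists_length_eq) (simp add: tandem_steps_def)
  show "?d ` tandem_walks A B C n e \<subseteq> {s. set s \<subseteq> ?S \<and> length s = n}"
    by (auto simp: tandem_walks_def)
  show "inj_on ?d (tandem_walks A B C n e)"
  proof (rule inj_onI)
    fix v w
    assume vw: "v \<in> tandem_walks A B C n e" "w \<in> tandem_walks A B C n e" "?d v = ?d w"
    have "k \<le> n \<Longrightarrow> v ! k = w ! k" for k
    proof (induction k)
      case 0
      then show ?case using vw by (simp add: tandem_walks_def)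
    next
      case (Suc k)
      have "?d v ! k = ?d w ! k" using vw(3) by (rule arg_cong)
      with Suc show ?case by simp
    qed
    with vw show "v = w"
      by (intro nth_equalityI) (auto simp: tandem_walks_def)
  qed
qed

text \<open>
  The ring \<open>K[[x, y, t]]\<close> is represented as \<open>K[[x]][[y]][[t]]\<close>: for \<open>f :: 'a fps fps fps\<close>,
  the coefficient of \<open>x\<^sup>i y\<^sup>j t\<^sup>n\<close> is \<open>f $ n $ j $ i\<close>. Likewise \<open>K[x, y, t]\<close> is
  \<open>K[x][y][t]\<close>.
\<close>

definition tandem_gf :: "nat \<Rightarrow> nat \<Rightarrow> nat \<Rightarrow> 'a::field_char_0 fps fps fps" where
  "tandem_gf A B C =
     Abs_fps (\<lambda>n. Abs_fps (\<lambda>j. Abs_fps (\<lambda>i.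
       of_nat (card (tandem_walks A B C n (int i, int j))))))"

text \<open>The specialisation \<open>Q(0, 0; t)\<close> of the series \<open>Q(x, y; t)\<close> above.\<close>

definition excursion_gf :: "nat \<Rightarrow> nat \<Rightarrow> nat \<Rightarrow> 'a::field_char_0 fps" where
  "excursion_gf A B C = Abs_fps (\<lambda>n. tandem_gf A B C $ n $ 0 $ 0)"

definition fps_of_poly3 :: "'a::comm_ring_1 poly poly poly \<Rightarrow> 'a fps fps fps" where
  "fps_of_poly3 p =
     Abs_fps (\<lambda>n. Abs_fps (\<lambda>j. Abs_fps (\<lambda>i. coeff (coeff (coeff p n) j) i)))"

definition deriv_x :: "'a::comm_ring_1 fps fps fps \<Rightarrow> 'a fps fps fps" where
  "deriv_x f = Abs_fps (\<lambda>n. Abs_fps (\<lambda>j. fps_deriv (f $ n $ j)))"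

definition deriv_y :: "'a::comm_ring_1 fps fps fps \<Rightarrow> 'a fps fps fps" where
  "deriv_y f = Abs_fps (\<lambda>n. fps_deriv (f $ n))"

definition deriv_t :: "'a::comm_ring_1 fps fps fps \<Rightarrow> 'a fps fps fps" where
  "deriv_t f = fps_deriv f"

text \<open>
  Nontrivial linear differential equation
  \<open>p\<^sub>0 f + p\<^sub>1 (D f) + \<dots> + p\<^sub>r (D\<^sup>r f) = 0\<close> for a derivation \<open>D\<close>, where \<open>emb\<close> is the embedding
  of the polynomials into the power series.
\<close>

definition satisfies_lde :: "('p::zero \<Rightarrow> 'f::comm_ring_1) \<Rightarrow> ('f \<Rightarrow> 'f) \<Rightarrow> 'f \<Rightarrow> bool" where
  "satisfies_lde emb D f \<longleftrightarrow>
     (\<exists>r p. (\<exists>k\<le>r. p k \<noteq> 0) \<and> (\<Sum>k\<le>r. emb (p k) * (D ^^ k) f) = 0)"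

definition D_finite :: "'a::field_char_0 fps \<Rightarrow> bool" where
  "D_finite f \<longleftrightarrow> satisfies_lde fps_of_poly fps_deriv f"

definition D_finite3 :: "'a::field_char_0 fps fps fps \<Rightarrow> bool" where
  "D_finite3 f \<longleftrightarrow>
     satisfies_lde fps_of_poly3 deriv_x f \<and>
     satisfies_lde fps_of_poly3 deriv_y f \<and>
     satisfies_lde fps_of_poly3 deriv_t f"

end

theory Submission
  imports Defs "HOL-Complex_Analysis.Complex_Analysis" "Jordan_Normal_Form.Determinant"
begin

text \<open>
  Weight the steps so that the walk is centred, and map the quadrant linearly to the cone on which it
  has identity covariance. The cone has the opening angle \<open>\<theta>\<close> with
  \<open>cos \<theta> = B / sqrt ((A + B) (B + C))\<close>. Comparing the weighted walk with explicit super- and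
  subsolutions built from \<open>Re \<zeta>\<^sup>\<beta>\<close>, with \<open>\<beta>\<close> slightly below or above \<open>\<alpha> = \<pi> / \<theta>\<close>, shows that the
  probability of an excursion of length \<open>n\<close> (a multiple of the period) is
  \<open>n\<^bsup>-1-\<alpha>\<^esup>\<close> up to factors \<open>n\<^bsup>\<epsilon>\<^esup>\<close>.

  If the series of excursions were D-finite, these probabilities times \<open>n\<^sup>M\<close> would be numbers
  \<open>b\<^sub>n\<close> with a linear recurrence with coefficients in \<open>\<rat>[n]\<close>, which translates into a difference
  equation over \<open>\<rat>[s]\<close> for the factorial series \<open>\<Sum> b\<^sub>n n! / (s (s + 1) \<dots> (s + n))\<close>. By
  positivity the series is singular at its abscissa of convergence \<open>\<sigma> = M - \<alpha>\<close>, but the difference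
  equation continues it past \<open>\<sigma>\<close> unless \<open>\<sigma>\<close> is a zero of a rational polynomial. So \<open>\<alpha>\<close> would be
  algebraic. However \<open>e\<^bsup>2i\<theta>\<^esup>\<close> is algebraic, and \<open>\<theta> / \<pi>\<close> is irrational by the assumption
  (Niven), so \<open>1 / \<alpha> = \<theta> / \<pi>\<close> is transcendental by the Gelfond--Schneider theorem.
\<close>

section \<open>The Gelfond--Schneider theorem\<close>

text \<open>The arithmetic theory of G-functions would make the exponent rational, at the price of a
  precise asymptotic formula for the excursions. The proof aims lower: \<alpha> is transcendental,
  so an algebraic exponent is already absurd, and to get one it suffices to have bounds up to
  \<open>n powr \<epsilon>\<close>, because Landau's argument only asks where a series of
  nonnegative terms converges. Constants in the asymptotics never enter. Taking \<beta> different
  from \<alpha> is also what makes the comparison work for long steps on a lattice. For \<beta> =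
  \<alpha> the harmonic function vanishes on the edges of the cone and leaves no room for steps that
  jump across them. For \<beta> below \<alpha> it is still positive a little beyond the edges, for
  \<beta> above \<alpha> it is already negative on them, and the sign at exterior points is all that
  the comparison needs. The three excluded values come from 2 cos 2\<theta> = 4 (cos \<theta>)^2 -
  2, which is an integer if \<theta> / \<pi> is rational: the possible integers -1, 0, 1 correspond
  to 1/4, 1/2, 3/4.\<close>

interpretation ratv: vector_space "\<lambda>(q::rat) (z::complex). of_rat q * z"
  by unfold_locales (auto simp: algebra_simps of_rat_add of_rat_mult)

section \<open>Lattices stable under multiplication by algebraic numbers\<close>

lemma common_denominator:
  fixes F :: "rat set"
  assumes "finite F"
  shows "\<exists>d::int. d > 0 \<and> (\<forall>q\<in>F. of_int d * q \<in> \<int>)"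
  using assms
proof (induction F)
  case empty
  then show ?case by (intro exI[of _ 1]) auto
next
  case (insert x F)
  then obtain d :: int where d: "d > 0" "\<forall>q\<in>F. of_int d * q \<in> \<int>" by blast
  obtain a b where ab: "quotient_of x = (a, b)" by force
  then have b: "b > 0" and x: "x = of_int a / of_int b"
    using quotient_of_denom_pos quotient_of_div by blast+
  have "of_int (d * b) * q \<in> \<int>" if "q \<in> insert x F" for q
  proof (cases "q = x")
    case True
    have "of_int (d * b) * x = of_int (d * a)" using b x by simp
    then show ?thesis using True by (metis Ints_of_int)
  next
    case False
    then have "of_int d * q \<in> \<int>" using d that by blast
    then have "of_int b * (of_int d * q) \<in> \<int>" by (rule Ints_mult[OF Ints_of_int])
    then show ?thesis by (simp only: of_int_mult mult_ac)
  qed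
  then show ?case using d b by (intro exI[of _ "d * b"]) auto
qed

lemma algebraic_power_in_rat_span:
  fixes x :: complex
  assumes "algebraic x"
  shows "\<exists>d>0. x ^ d \<in> ratv.span ((\<lambda>i. x ^ i) ` {..<d})"
proof -
  obtain p where p: "\<forall>i. coeff p i \<in> \<int>" "p \<noteq> 0" "poly p x = 0"
    using assms unfolding algebraic_def by blast
  let ?d = "degree p"
  have d0: "?d > 0"
  proof (rule ccontr)
    assume "\<not> ?d > 0"
    then obtain c where "p = [:c:]" using degree_eq_zeroE by blast
    then show False using p by simp
  qed
  have "\<forall>i. \<exists>c::int. coeff p i = of_int c" using p(1) Ints_cases by blast
  then obtain c :: "nat \<Rightarrow> int" where c: "\<And>i. coeff p i = of_int (c i)" by metis
  have cd: "c ?d \<noteq> 0" using p(2) c by (metis leading_coeff_0_iff of_int_0)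
  have "0 = (\<Sum>i\<le>?d. of_int (c i) * x ^ i)" using p(3) by (simp add: poly_altdef c)
  also have "\<dots> = (\<Sum>i<?d. of_int (c i) * x ^ i) + of_int (c ?d) * x ^ ?d"
    by (simp add: lessThan_Suc_atMost[symmetric])
  finally have e0: "of_int (c ?d) * x ^ ?d = - (\<Sum>i<?d. of_int (c i) * x ^ i)"
    by (simp add: eq_neg_iff_add_eq_0 add.commute)
  have "x ^ ?d = (- (\<Sum>i<?d. of_int (c i) * x ^ i)) / of_int (c ?d)"
    using cd e0 by (metis nonzero_mult_div_cancel_left of_int_eq_0_iff)
  also have "\<dots> = (\<Sum>i<?d. of_rat (- (of_int (c i) / of_int (c ?d))) * x ^ i)"
    by (simp add: sum_divide_distrib sum_negf of_rat_minus of_rat_divide)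
  finally have e: "x ^ ?d = (\<Sum>i<?d. of_rat (- (of_int (c i) / of_int (c ?d))) * x ^ i)" .
  show ?thesis
    by (intro exI[of _ ?d] conjI d0, subst e)
      (intro ratv.span_sum ratv.span_scale ratv.span_base, auto)
qed

lemma rat_span_mult:
  assumes "u \<in> ratv.span S" "v \<in> ratv.span T"
  shows "u * v \<in> ratv.span {s * t | s t. s \<in> S \<and> t \<in> T}" (is "_ \<in> ratv.span ?U")
  using assms(1)
proof (induction rule: ratv.span_induct_alt)
  case base
  then show ?case by (simp add: ratv.span_zero)
next
  case (step c x y)
  have "x * v \<in> ratv.span ?U"
    using assms(2)
  proof (induction rule: ratv.span_induct_alt)
    case base
    then show ?case by (simp add: ratv.span_zero)
  next
    case (step c' x' y')
    have "x * (of_rat c' * x' + y') = of_rat c' * (x * x') + x * y'" by (simp add: algebra_simps)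
    moreover have "x * x' \<in> ?U" using step \<open>x \<in> S\<close> by blast
    ultimately show ?case
      using step.IH by (simp only: ratv.span_add ratv.span_scale ratv.span_base)
  qed
  moreover have "(of_rat c * x + y) * v = of_rat c * (x * v) + y * v" by (simp add: algebra_simps)
  ultimately show ?case using step.IH by (simp only: ratv.span_add ratv.span_scale)
qed

text \<open>For finite sets this is the same as independence over the rationals; the integral form
  fits the integer matrices that act on \<open>B\<close>.\<close>

definition int_indep :: "complex set \<Rightarrow> bool" where
  "int_indep B \<longleftrightarrow> (\<forall>c::complex \<Rightarrow> int. (\<Sum>u\<in>B. of_int (c u) * u) = 0 \<longrightarrow> (\<forall>u\<in>B. c u = 0))"

text \<open>The products of powers of \<open>x\<close> and \<open>y\<close> below fixed exponents
  span a finite-dimensional rational space that is stable under multiplication by \<open>x\<close>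
  and by \<open>y\<close>. \<open>B\<close> is a basis chosen among these products, and
  \<open>d\<close> clears the denominators of both multiplication matrices. Integer matrices thus
  take the place of a number field with its integers and conjugates.\<close>

lemma algebraic_pair_lattice:
  fixes x y :: complex
  assumes "algebraic x" "algebraic y"
  obtains B :: "complex set" and d :: int and X Y :: "complex \<Rightarrow> complex \<Rightarrow> int"
  where "finite B" "B \<noteq> {}" "int_indep B" "d > 0"
    "\<forall>e\<in>B. of_int d * x * e = (\<Sum>u\<in>B. of_int (X e u) * u)"
    "\<forall>e\<in>B. of_int d * y * e = (\<Sum>u\<in>B. of_int (Y e u) * u)"
proof -
  obtain m n where m: "m > 0" "x ^ m \<in> ratv.span ((\<lambda>i. x ^ i) ` {..<m})"
    and n: "n > 0" "y ^ n \<in> ratv.span ((\<lambda>i. y ^ i) ` {..<n})"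
    using assms algebraic_power_in_rat_span by metis
  define Sx where "Sx = (\<lambda>i. x ^ i) ` {..<m}"
  define Sy where "Sy = (\<lambda>i. y ^ i) ` {..<n}"
  define S where "S = {s * t | s t. s \<in> Sx \<and> t \<in> Sy}"
  have S_alt: "S = (\<lambda>(s,t). s * t) ` (Sx \<times> Sy)" by (auto simp: S_def)
  have finS: "finite S" unfolding S_alt Sx_def Sy_def by auto
  have xS: "x * s \<in> ratv.span Sx" if "s \<in> Sx" for s
  proof -
    obtain i where i: "i < m" "s = x ^ i" using \<open>s \<in> Sx\<close> unfolding Sx_def by auto
    then have *: "x * s = x ^ Suc i" by simp
    show ?thesis
    proof (cases "Suc i = m")
      case True
      then show ?thesis using m * unfolding Sx_def by simp
    next
      case False
      then have "x * s \<in> Sx" using i(1) unfolding Sx_def * by (intro imageI) auto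
      then show ?thesis by (rule ratv.span_base)
    qed
  qed
  have yS: "y * s \<in> ratv.span Sy" if "s \<in> Sy" for s
  proof -
    obtain i where i: "i < n" "s = y ^ i" using \<open>s \<in> Sy\<close> unfolding Sy_def by auto
    then have *: "y * s = y ^ Suc i" by simp
    show ?thesis
    proof (cases "Suc i = n")
      case True
      then show ?thesis using n * unfolding Sy_def by simp
    next
      case False
      then have "y * s \<in> Sy" using i(1) unfolding Sy_def * by (intro imageI) auto
      then show ?thesis by (rule ratv.span_base)
    qed
  qed
  have xs: "x * s \<in> ratv.span S" and ys: "y * s \<in> ratv.span S" if s: "s \<in> S" for s
  proof -
    obtain a b where ab: "a \<in> Sx" "b \<in> Sy" "s = a * b" using s S_def by blast
    have "(x * a) * b \<in> ratv.span S" unfolding S_def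
      by (rule rat_span_mult) (use ab xS in \<open>auto intro: ratv.span_base\<close>)
    then show "x * s \<in> ratv.span S" using ab by (simp add: mult.assoc)
    have "a * (y * b) \<in> ratv.span S" unfolding S_def
      by (rule rat_span_mult) (use ab yS in \<open>auto intro: ratv.span_base\<close>)
    then show "y * s \<in> ratv.span S" using ab by (simp add: mult_ac)
  qed
  obtain B where B: "B \<subseteq> S" "ratv.independent B" "S \<subseteq> ratv.span B"
    using ratv.maximal_independent_subset by metis
  have finB: "finite B" using B finS finite_subset by blast
  have "1 \<in> S" unfolding S_def Sx_def Sy_def using m n
    by (auto intro!: exI[of _ 1] image_eqI[of _ _ 0])
  then have Bne: "B \<noteq> {}" using B by fastforce
  have spanSB: "ratv.span S \<subseteq> ratv.span B" using B(3) ratv.span_minimal ratv.subspace_span by blast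
  have indB: "int_indep B" unfolding int_indep_def
  proof (intro allI impI ballI)
    fix c :: "complex \<Rightarrow> int" and u assume c: "(\<Sum>u\<in>B. of_int (c u) * u) = 0" and u: "u \<in> B"
    have "(\<Sum>u\<in>B. of_rat (of_int (c u)) * u) = 0" using c by simp
    then have "rat_of_int (c u) = 0"
      using ratv.independentD[OF B(2) finB subset_refl, of "\<lambda>u. of_int (c u)" u] u by simp
    then show "c u = 0" by simp
  qed
  define F where "F = (\<lambda>(e,u). ratv.representation B (x * e) u) ` (B \<times> B)
     \<union> (\<lambda>(e,u). ratv.representation B (y * e) u) ` (B \<times> B)"
  have "finite F" unfolding F_def using finB by auto
  then obtain d :: int where d: "d > 0" "\<forall>q\<in>F. of_int d * q \<in> \<int>"
    using common_denominator by blast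
  have main: "of_int d * z * e = (\<Sum>u\<in>B. of_int \<lfloor>of_int d * ratv.representation B (z * e) u\<rfloor> * u)"
    if z: "z * e \<in> ratv.span S" "\<forall>u\<in>B. ratv.representation B (z * e) u \<in> F" for z e
  proof -
    have "z * e = (\<Sum>u\<in>B. of_rat (ratv.representation B (z * e) u) * u)"
      using ratv.sum_representation_eq[OF B(2) _ finB subset_refl] z(1) spanSB by (metis subsetD)
    then have "of_int d * z * e = of_int d * (\<Sum>u\<in>B. of_rat (ratv.representation B (z * e) u) * u)"
      by (simp add: mult.assoc)
    also have "\<dots> = (\<Sum>u\<in>B. of_rat (of_int d * ratv.representation B (z * e) u) * u)"
      by (simp add: sum_distrib_left of_rat_mult mult.assoc)
    also have "\<dots> = (\<Sum>u\<in>B. of_int \<lfloor>of_int d * ratv.representation B (z * e) u\<rfloor> * u)"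
    proof (rule sum.cong[OF refl])
      fix u assume "u \<in> B"
      then have "of_int d * ratv.representation B (z * e) u \<in> \<int>" using d z(2) by blast
      then have "rat_of_int \<lfloor>of_int d * ratv.representation B (z * e) u\<rfloor> = of_int d * ratv.representation B (z * e) u"
        using floor_of_int Ints_cases by metis
      then show "of_rat (of_int d * ratv.representation B (z * e) u) * u =
        of_int \<lfloor>of_int d * ratv.representation B (z * e) u\<rfloor> * u"
        by (metis of_rat_of_int_eq)
    qed
    finally show ?thesis .
  qed
  show thesis
  proof (rule that[OF finB Bne indB d(1)]; rule ballI)
    fix e assume e: "e \<in> B"
    show "of_int d * x * e = (\<Sum>u\<in>B. of_int \<lfloor>of_int d * ratv.representation B (x * e) u\<rfloor> * u)"
      by (rule main) (use e B xs in \<open>auto simp: F_def\<close>)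
    show "of_int d * y * e = (\<Sum>u\<in>B. of_int \<lfloor>of_int d * ratv.representation B (y * e) u\<rfloor> * u)"
      by (rule main) (use e B ys in \<open>auto simp: F_def\<close>)
  qed
qed

text \<open>\<open>M\<close> is an integer matrix of multiplication by \<open>x\<close> on the
  lattice spanned by \<open>B\<close>, and \<open>K\<close> bounds its entries. This stands in for
  the statement that \<open>x\<close> is an algebraic integer whose conjugates are bounded.\<close>

definition lattice_rep :: "complex set \<Rightarrow> complex \<Rightarrow> (complex \<Rightarrow> complex \<Rightarrow> int) \<Rightarrow> real \<Rightarrow> bool" where
  "lattice_rep B x M K \<longleftrightarrow> (\<forall>e\<in>B. x * e = (\<Sum>u\<in>B. of_int (M e u) * u)) \<and>
     (\<forall>e\<in>B. \<forall>u\<in>B. \<bar>of_int (M e u)\<bar> \<le> K)"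

lemma lattice_rep_mono: "lattice_rep B x M K \<Longrightarrow> K \<le> K' \<Longrightarrow> lattice_rep B x M K'"
  unfolding lattice_rep_def by (meson order_trans)

lemma lattice_rep_of_int:
  assumes "finite B"
  shows "lattice_rep B (of_int k) (\<lambda>e u. if e = u then k else 0) \<bar>of_int k\<bar>"
  unfolding lattice_rep_def
proof (intro conjI ballI)
  fix e assume e: "e \<in> B"
  have "(\<Sum>u\<in>B. of_int (if e = u then k else 0) * u) = (\<Sum>u\<in>B. if e = u then of_int k * u else 0)"
    by (intro sum.cong) auto
  then show "of_int k * e = (\<Sum>u\<in>B. of_int (if e = u then k else 0) * u)"
    using e assms by simp
qed auto

lemma lattice_rep_add:
  fixes K L :: real
  assumes "lattice_rep B x M K" "lattice_rep B y N L"
  shows "lattice_rep B (x + y) (\<lambda>e u. M e u + N e u) (K + L)"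
  unfolding lattice_rep_def
proof (intro conjI ballI)
  fix e assume e: "e \<in> B"
  then have "x * e = (\<Sum>u\<in>B. of_int (M e u) * u)" "y * e = (\<Sum>u\<in>B. of_int (N e u) * u)"
    using assms unfolding lattice_rep_def by blast+
  then show "(x + y) * e = (\<Sum>u\<in>B. of_int (M e u + N e u) * u)"
    by (simp add: distrib_right sum.distrib)
next
  fix e u assume eu: "e \<in> B" "u \<in> B"
  then have "\<bar>real_of_int (M e u)\<bar> \<le> K" "\<bar>real_of_int (N e u)\<bar> \<le> L"
    using assms unfolding lattice_rep_def by blast+
  then show "\<bar>real_of_int (M e u + N e u)\<bar> \<le> K + L" by simp
qed

lemma lattice_rep_mult:
  fixes K L :: real
  assumes "finite B" "lattice_rep B x M K" "lattice_rep B y N L"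
  shows "lattice_rep B (x * y) (\<lambda>e u. \<Sum>v\<in>B. N e v * M v u) (card B * (L * K))"
  unfolding lattice_rep_def
proof (intro conjI ballI)
  fix e assume e: "e \<in> B"
  have "y * e = (\<Sum>v\<in>B. of_int (N e v) * v)" using assms(3) e unfolding lattice_rep_def by blast
  then have "x * y * e = x * (\<Sum>v\<in>B. of_int (N e v) * v)" by (simp only: mult.assoc)
  also have "\<dots> = (\<Sum>v\<in>B. of_int (N e v) * (x * v))"
    unfolding sum_distrib_left by (intro sum.cong refl mult.left_commute)
  also have "\<dots> = (\<Sum>v\<in>B. of_int (N e v) * (\<Sum>u\<in>B. of_int (M v u) * u))"
  proof (rule sum.cong[OF refl])
    fix v assume "v \<in> B"
    then have "x * v = (\<Sum>u\<in>B. of_int (M v u) * u)" using assms(2) unfolding lattice_rep_def by blast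
    then show "of_int (N e v) * (x * v) = of_int (N e v) * (\<Sum>u\<in>B. of_int (M v u) * u)" by (simp only:)
  qed
  also have "\<dots> = (\<Sum>v\<in>B. \<Sum>u\<in>B. of_int (N e v * M v u) * u)"
    unfolding sum_distrib_left by (intro sum.cong refl) (simp add: mult.assoc)
  also have "\<dots> = (\<Sum>u\<in>B. \<Sum>v\<in>B. of_int (N e v * M v u) * u)" by (rule sum.swap)
  also have "\<dots> = (\<Sum>u\<in>B. of_int (\<Sum>v\<in>B. N e v * M v u) * u)" unfolding of_int_sum sum_distrib_right by (rule refl)
  finally show "x * y * e = (\<Sum>u\<in>B. of_int (\<Sum>v\<in>B. N e v * M v u) * u)" .
next
  fix e u assume eu: "e \<in> B" "u \<in> B"
  have "\<bar>real_of_int (\<Sum>v\<in>B. N e v * M v u)\<bar> \<le> (\<Sum>v\<in>B. \<bar>real_of_int (N e v * M v u)\<bar>)"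
    by (simp only: of_int_sum) (rule sum_abs)
  also have "\<dots> \<le> (\<Sum>v\<in>B. L * K)"
  proof (rule sum_mono)
    fix v assume v: "v \<in> B"
    have "\<bar>real_of_int (N e v)\<bar> \<le> L" "\<bar>real_of_int (M v u)\<bar> \<le> K"
      using assms eu v unfolding lattice_rep_def by blast+
    then show "\<bar>real_of_int (N e v * M v u)\<bar> \<le> L * K"
      unfolding of_int_mult abs_mult by (intro mult_mono') auto
  qed
  finally show "\<bar>real_of_int (\<Sum>v\<in>B. N e v * M v u)\<bar> \<le> card B * (L * K)" by simp
qed

lemma lattice_rep_power:
  fixes K :: real
  assumes "finite B" "lattice_rep B x M K"
  shows "\<exists>N. lattice_rep B (x ^ n) N ((card B * K) ^ n)"
proof (induction n)
  case 0
  have *: "lattice_rep B (x ^ 0) (\<lambda>e u. if e = u then 1 else 0) ((card B * K) ^ 0)"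
    using lattice_rep_of_int[OF assms(1), of 1] by simp
  show ?case by (rule exI) (rule *)
next
  case (Suc n)
  then obtain N where N: "lattice_rep B (x ^ n) N ((card B * K) ^ n)" ..
  have e: "card B * ((card B * K) ^ n * K) = (card B * K) ^ Suc n" by simp
  show ?case
    by (rule exI, subst power_Suc, subst e[symmetric], rule lattice_rep_mult[OF assms(1,2) N])
qed

lemma lattice_rep_sum:
  fixes K :: "_ \<Rightarrow> real"
  assumes "finite I" "finite B" "\<And>i. i \<in> I \<Longrightarrow> lattice_rep B (x i) (M i) (K i)"
  shows "lattice_rep B (\<Sum>i\<in>I. x i) (\<lambda>e u. \<Sum>i\<in>I. M i e u) (\<Sum>i\<in>I. K i)"
  using assms(1,3)
proof (induction I rule: finite_induct)
  case empty
  then show ?case by (simp add: lattice_rep_def)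
next
  case (insert i I)
  then show ?case using lattice_rep_add[of B "x i" "M i" "K i"] by simp
qed

text \<open>Pigeonhole on the box of all \<open>p\<close> with entries in \<open>{0..X}\<close>,
  where \<open>X = card I * K\<close>. With twice as many unknowns as equations the box has
  \<open>(X + 1) ^ (2 * card E)\<close> points, more than the \<open>(X * X + 1) ^ card E\<close>
  possible images. Two points with the same image differ by a solution. The factor two keeps the
  bound on the solution linear in \<open>K\<close>.\<close>

lemma siegel_lemma:
  fixes a :: "'e \<Rightarrow> 'i \<Rightarrow> int" and K :: nat
  assumes fin: "finite E" "finite I" and E0: "E \<noteq> {}" and card: "card I = 2 * card E" and K1: "K \<ge> 1"
    and a: "\<And>e i. e \<in> E \<Longrightarrow> i \<in> I \<Longrightarrow> \<bar>a e i\<bar> \<le> int K"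
  shows "\<exists>p. (\<exists>i\<in>I. p i \<noteq> 0) \<and> (\<forall>i\<in>I. \<bar>p i\<bar> \<le> int (card I * K)) \<and>
    (\<forall>e\<in>E. (\<Sum>i\<in>I. a e i * p i) = 0)"
proof -
  define X where "X = card I * K"
  define D where "D = I \<rightarrow>\<^sub>E {0..int X}"
  \<comment> \<open>Row \<open>e\<close> takes values in an interval that starts at the sum of the
    negative parts; its length is at most \<open>card I * K * X = X * X\<close>, whatever the signs
    of the coefficients.\<close>
  define lo where "lo e = (\<Sum>i\<in>I. min (a e i) 0 * int X)" for e
  define T where "T = (\<Pi>\<^sub>E e\<in>E. {lo e..lo e + int (X * X)})"
  define f where "f p = (\<lambda>e\<in>E. \<Sum>i\<in>I. a e i * p i)" for p
  have cardD: "card D = (X + 1) ^ card I" unfolding D_def using fin by (simp add: card_funcsetE nat_add_distrib)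
  have cardT: "card T = (X * X + 1) ^ card E" unfolding T_def using fin
    by (simp add: card_PiE nat_add_distrib flip: of_nat_mult)
  have finD: "finite D" and finT: "finite T" unfolding D_def T_def using fin by (auto intro!: finite_PiE)
  have "f p \<in> T" if p: "p \<in> D" for p
    unfolding T_def f_def
  proof (rule PiE_I)
    fix e assume e: "e \<in> E"
    have p': "0 \<le> p i" "p i \<le> int X" if "i \<in> I" for i using p that unfolding D_def by auto
    have lower: "min (a e i) 0 * int X \<le> a e i * p i" if i: "i \<in> I" for i
    proof (cases "a e i \<ge> 0")
      case True then show ?thesis using p'[OF i] by simp
    next
      case False then show ?thesis using p'[OF i] by (simp add: min_def mult_left_mono_neg)
    qed
    have upper: "a e i * p i \<le> min (a e i) 0 * int X + int K * int X" if i: "i \<in> I" for i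
    proof (cases "a e i \<ge> 0")
      case True
      then have "a e i * p i \<le> int K * int X" using p'[OF i] a[OF e i] by (intro mult_mono) auto
      then show ?thesis using True by simp
    next
      case False
      then have "a e i * p i \<le> 0" using p'[OF i] by (simp add: mult_nonpos_nonneg)
      moreover have "0 \<le> (a e i + int K) * int X" using a[OF e i] by (intro mult_nonneg_nonneg) auto
      ultimately show ?thesis using False by (simp add: min_def algebra_simps)
    qed
    have "(\<Sum>i\<in>I. a e i * p i) \<le> (\<Sum>i\<in>I. min (a e i) 0 * int X + int K * int X)"
      by (intro sum_mono upper)
    also have "\<dots> = lo e + int (X * X)" by (simp add: sum.distrib lo_def X_def algebra_simps)
    finally have "(\<Sum>i\<in>I. a e i * p i) \<le> lo e + int (X * X)" .
    moreover have "lo e \<le> (\<Sum>i\<in>I. a e i * p i)" unfolding lo_def by (intro sum_mono lower)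
    ultimately show "(\<lambda>e\<in>E. \<Sum>i\<in>I. a e i * p i) e \<in> {lo e..lo e + int (X * X)}" using e by simp
  qed auto
  then have sub: "f ` D \<subseteq> T" by blast
  have E1: "card E > 0" using E0 fin by (simp add: card_gt_0_iff)
  have X0: "X \<noteq> 0" using card E1 K1 unfolding X_def by auto
  obtain p p' where pp: "p \<in> D" "p' \<in> D" "p \<noteq> p'" "f p = f p'"
  proof -
    have "\<not> inj_on f D"
    proof
      assume "inj_on f D"
      then have "card D \<le> card T" using sub card_inj_on_le finT by blast
      moreover have "(X * X + 1) ^ card E < ((X + 1)^2) ^ card E"
        using E1 X0 by (intro power_strict_mono) (auto simp: power2_eq_square)
      ultimately show False unfolding cardD cardT card by (simp add: power_mult)
    qed
    then show thesis using that unfolding inj_on_def by blast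
  qed
  obtain i where i: "i \<in> I" "p i \<noteq> p' i"
    using pp unfolding D_def by (metis PiE_ext)
  show ?thesis
  proof (intro exI[of _ "\<lambda>i. p i - p' i"] conjI ballI)
    show "\<exists>i\<in>I. p i - p' i \<noteq> 0" using i by auto
  next
    fix i assume "i \<in> I"
    then have "0 \<le> p i" "p i \<le> int X" "0 \<le> p' i" "p' i \<le> int X" using pp unfolding D_def by auto
    then show "\<bar>p i - p' i\<bar> \<le> int (card I * K)" unfolding X_def by linarith
  next
    fix e assume "e \<in> E"
    then show "(\<Sum>i\<in>I. a e i * (p i - p' i)) = 0"
      using fun_cong[OF pp(4), of e] by (simp add: f_def algebra_simps sum_subtractf)
  qed
qed

lemma det_norm_bound:
  fixes A :: "complex mat"
  assumes A: "A \<in> carrier_mat n n" and K: "\<And>i j. i < n \<Longrightarrow> j < n \<Longrightarrow> cmod (A $$ (i,j)) \<le> K"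
  shows "cmod (Determinant.det A) \<le> fact n * K ^ n"
proof -
  have "cmod (Determinant.det A) \<le> (\<Sum>p | p permutes {0..<n}. cmod (signof p * (\<Prod>i = 0..<n. A $$ (i, p i))))"
    unfolding det_def'[OF A] by (rule norm_sum)
  also have "\<dots> \<le> (\<Sum>p | p permutes {0..<n}. K ^ n)"
  proof (rule sum_mono)
    fix p assume "p \<in> {p. p permutes {0..<n}}"
    then have p: "p permutes {0..<n}" by simp
    have "cmod (signof p * (\<Prod>i = 0..<n. A $$ (i, p i))) = (\<Prod>i = 0..<n. cmod (A $$ (i, p i)))"
      by (simp add: norm_mult prod_norm sign_def)
    also have "\<dots> \<le> (\<Prod>i = 0..<n. K)"
      using p permutes_in_image[OF p] by (intro prod_mono conjI K) auto
    finally show "cmod (signof p * (\<Prod>i = 0..<n. A $$ (i, p i))) \<le> K ^ n" by simp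
  qed
  also have "\<dots> = fact n * K ^ n" by (simp add: card_permutations)
  finally show ?thesis .
qed

text \<open>The vector \<open>v\<close> of basis elements is an eigenvector of the integer matrix
  \<open>A\<close> with eigenvalue \<open>x\<close>, so multiplying by the adjugate gives
  \<open>det A * v = x * (adj A * v)\<close>. The determinant is a nonzero integer, hence of modulus
  at least 1, while the entries of the adjugate are at most
  \<open>fact (n - 1) * K ^ (n - 1)\<close>. This bounds \<open>x\<close> away from zero.\<close>

lemma lattice_liouville:
  assumes B: "finite B" "B \<noteq> {}" "int_indep B"
  shows "\<exists>c>0. \<forall>x M K. lattice_rep B x M K \<longrightarrow> K \<ge> 1 \<longrightarrow> x \<noteq> 0 \<longrightarrow> c \<le> cmod x * K ^ card B"
proof -
  define n where "n = card B"
  obtain h where h: "bij_betw h {0..<n} B"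
    using ex_bij_betw_nat_finite[OF B(1)] n_def by metis
  have n0: "n > 0" using B n_def by (simp add: card_gt_0_iff)
  define v where "v = vec n h"
  have hB: "h i \<in> B" if "i < n" for i using h that by (auto simp: bij_betw_def)
  have h0: "h 0 \<noteq> 0"
  proof
    assume h00: "h 0 = 0"
    have "(\<Sum>u\<in>B. of_int (if u = h 0 then 1 else 0) * u) = (\<Sum>u\<in>B. if u = h 0 then u else 0)"
      by (intro sum.cong) auto
    also have "\<dots> = 0" using h00 B by simp
    finally have "\<forall>u\<in>B. (if u = h 0 then 1 else 0::int) = 0"
      using B(3)[unfolded int_indep_def, rule_format, of "\<lambda>u. if u = h 0 then 1 else 0"] by blast
    then show False using hB[OF n0] by auto
  qed
  define V where "V = (\<Sum>i<n. cmod (h i))"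
  have V: "cmod (h i) \<le> V" if "i < n" for i unfolding V_def using that by (intro member_le_sum) auto
  have Vp: "V > 0" using V[OF n0] h0 by (smt (verit) norm_le_zero_iff)
  define c where "c = cmod (h 0) / (real n * fact (n - 1) * V)"
  have "c \<le> cmod x * K ^ card B" if rep: "lattice_rep B x M K" and K: "K \<ge> 1" and x: "x \<noteq> 0" for x M K
  proof -
    define Mi where "Mi = mat n n (\<lambda>(i,j). M (h i) (h j))"
    define A where "A = (of_int_hom.mat_hom Mi :: complex mat)"
    have A: "A \<in> carrier_mat n n" unfolding A_def Mi_def by auto
    have v: "v \<in> carrier_vec n" unfolding v_def by auto
    have sumB: "(\<Sum>u\<in>B. g u) = (\<Sum>j=0..<n. g (h j))" for g :: "complex \<Rightarrow> complex"
      using sum.reindex_bij_betw[OF h, of g] by simp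
    have Av: "A *\<^sub>v v = x \<cdot>\<^sub>v v"
    proof (rule eq_vecI)
      fix i assume "i < dim_vec (x \<cdot>\<^sub>v v)"
      then have i: "i < n" unfolding v_def by simp
      have "x * h i = (\<Sum>u\<in>B. of_int (M (h i) u) * u)" using rep hB[OF i] unfolding lattice_rep_def by blast
      then show "vec_index (A *\<^sub>v v) i = vec_index (x \<cdot>\<^sub>v v) i"
        using i unfolding sumB by (simp add: A_def Mi_def v_def scalar_prod_def)
    qed (auto simp: A_def Mi_def v_def)
    \<comment> \<open>An integer vector \<open>w\<close> in the left kernel gives a combination of
      the basis elements that \<open>x\<close> annihilates. As \<open>x\<close> is nonzero, it is an
      integer relation between them, so \<open>w\<close> is zero.\<close>
    have det0: "Determinant.det Mi \<noteq> 0"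
    proof
      assume d0: "Determinant.det Mi = 0"
      have "Determinant.det (transpose_mat Mi) = 0" using d0 det_transpose[of Mi n] by (simp add: Mi_def)
      then obtain w where w: "w \<in> carrier_vec n" "w \<noteq> 0\<^sub>v n" "transpose_mat Mi *\<^sub>v w = 0\<^sub>v n"
        using det_0_iff_vec_prod_zero[of "transpose_mat Mi" n] unfolding Mi_def by auto
      have col: "(\<Sum>i=0..<n. vec_index w i * M (h i) (h j)) = 0" if j: "j < n" for j
      proof -
        have "vec_index (transpose_mat Mi *\<^sub>v w) j = 0" using w(3) j by simp
        then show ?thesis using j w(1) by (simp add: Mi_def scalar_prod_def mult.commute)
      qed
      have "x * (\<Sum>i=0..<n. of_int (vec_index w i) * h i) = (\<Sum>i=0..<n. of_int (vec_index w i) * (x * h i))"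
        by (simp add: sum_distrib_left mult_ac)
      also have "\<dots> = (\<Sum>i=0..<n. of_int (vec_index w i) * (\<Sum>j=0..<n. of_int (M (h i) (h j)) * h j))"
        using rep hB unfolding lattice_rep_def sumB by (intro sum.cong) auto
      also have "\<dots> = (\<Sum>i=0..<n. \<Sum>j=0..<n. of_int (vec_index w i * M (h i) (h j)) * h j)"
        by (simp add: sum_distrib_left mult.assoc)
      also have "\<dots> = (\<Sum>j=0..<n. of_int (\<Sum>i=0..<n. vec_index w i * M (h i) (h j)) * h j)"
        unfolding of_int_sum sum_distrib_right by (rule sum.swap)
      also have "\<dots> = 0" using col by simp
      finally have z: "(\<Sum>i=0..<n. of_int (vec_index w i) * h i) = 0" using x by simp
      have inv: "the_inv_into {0..<n} h (h i) = i" if "i < n" for i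
        using the_inv_into_f_f[of h "{0..<n}" i] h that by (auto simp: bij_betw_def)
      have "(\<Sum>u\<in>B. of_int (vec_index w (the_inv_into {0..<n} h u)) * u) = 0"
        unfolding sumB using z inv by simp
      then have wz: "vec_index w (the_inv_into {0..<n} h u) = 0" if "u \<in> B" for u
        using B(3)[unfolded int_indep_def, rule_format, of "\<lambda>u. vec_index w (the_inv_into {0..<n} h u)" u] that by simp
      have "w = 0\<^sub>v n"
      proof (rule eq_vecI)
        fix i assume "i < dim_vec (0\<^sub>v n :: int vec)"
        then have "i < n" by simp
        then show "vec_index w i = vec_index (0\<^sub>v n) i" using wz[OF hB] inv by auto
      qed (use w in auto)
      then show False using w by simp
    qed
    have "\<bar>Determinant.det Mi\<bar> \<ge> 1" using det0 by linarith
    then have det1: "cmod (Determinant.det A) \<ge> 1" unfolding A_def of_int_hom.hom_det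
      by (metis norm_of_int of_int_1_le_iff of_int_abs)
    have entry: "cmod (A $$ (i,j)) \<le> K" if "i < n" "j < n" for i j
      using rep hB that unfolding lattice_rep_def A_def Mi_def by simp
    have adj: "adj_mat A \<in> carrier_mat n n" using adj_mat(1)[OF A] .
    have "Determinant.det A \<cdot>\<^sub>v v = (Determinant.det A \<cdot>\<^sub>m 1\<^sub>m n) *\<^sub>v v"
    proof (rule eq_vecI)
      fix i assume "i < dim_vec ((Determinant.det A \<cdot>\<^sub>m 1\<^sub>m n) *\<^sub>v v)"
      then have i: "i < n" by simp
      have "(\<Sum>j = 0..<n. Determinant.det A * (if j = i then 1 else 0) * vec_index v j)
        = (\<Sum>j = 0..<n. if j = i then Determinant.det A * vec_index v j else 0)"
        by (intro sum.cong) auto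
      then show "vec_index (Determinant.det A \<cdot>\<^sub>v v) i = vec_index ((Determinant.det A \<cdot>\<^sub>m 1\<^sub>m n) *\<^sub>v v) i"
        using i v by (auto simp: scalar_prod_def)
    qed (use v in auto)
    also have "\<dots> = adj_mat A *\<^sub>v (A *\<^sub>v v)" using adj_mat(3)[OF A] A adj v by (metis assoc_mult_mat_vec)
    also have "\<dots> = x \<cdot>\<^sub>v (adj_mat A *\<^sub>v v)" unfolding Av using mult_mat_vec[OF adj v] .
    finally have "vec_index (Determinant.det A \<cdot>\<^sub>v v) 0 = vec_index (x \<cdot>\<^sub>v (adj_mat A *\<^sub>v v)) 0" by simp
    then have eq: "Determinant.det A * h 0 = x * (\<Sum>j=0..<n. adj_mat A $$ (0,j) * h j)"
      using n0 adj by (simp add: v_def scalar_prod_def)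
    have adjb: "cmod (adj_mat A $$ (0,j)) \<le> fact (n-1) * K ^ (n-1)" if j: "j < n" for j
    proof -
      have "adj_mat A $$ (0,j) = (-1) ^ j * Determinant.det (mat_delete A j 0)"
        using A j n0 by (simp add: adj_mat_def cofactor_def)
      moreover have "cmod (Determinant.det (mat_delete A j 0)) \<le> fact (n-1) * K ^ (n-1)"
      proof (rule det_norm_bound)
        show "mat_delete A j 0 \<in> carrier_mat (n-1) (n-1)" using A by (auto simp: mat_delete_def)
        fix a b assume ab: "a < n - 1" "b < n - 1"
        then show "cmod (mat_delete A j 0 $$ (a,b)) \<le> K"
          using A by (auto simp: mat_delete_def intro!: entry)
      qed
      ultimately show ?thesis by (simp add: norm_mult norm_power)
    qed
    have "cmod (h 0) \<le> cmod (Determinant.det A * h 0)" using det1 by (simp add: norm_mult mult_le_cancel_right1)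
    also have "\<dots> \<le> cmod x * (\<Sum>j=0..<n. cmod (adj_mat A $$ (0,j) * h j))"
      unfolding eq norm_mult[of x] by (intro mult_left_mono norm_sum) auto
    also have "\<dots> \<le> cmod x * (\<Sum>j=0..<n. (fact (n-1) * K ^ n) * V)"
    proof (intro mult_left_mono sum_mono)
      fix j assume "j \<in> {0..<n}"
      then have j: "j < n" by simp
      have "K ^ (n-1) \<le> K ^ n" using K by (intro power_increasing) auto
      then have "fact (n-1) * K ^ (n-1) \<le> fact (n-1) * K ^ n" by (intro mult_left_mono) auto
      then show "cmod (adj_mat A $$ (0,j) * h j) \<le> (fact (n-1) * K ^ n) * V"
        unfolding norm_mult using adjb[OF j] V[OF j] K by (intro mult_mono) (auto elim: order_trans)
    qed auto
    also have "\<dots> = (real n * fact (n - 1) * V) * (cmod x * K ^ n)" by simp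
    finally show ?thesis unfolding c_def using n0 Vp n_def by (simp add: divide_le_eq mult.commute)
  qed
  moreover have "c > 0" unfolding c_def using h0 n0 Vp by simp
  ultimately show ?thesis by blast
qed

section \<open>The auxiliary function: zeros, growth, first surviving derivative\<close>

lemma entire_factor_zeros:
  fixes g :: "complex \<Rightarrow> complex"
  assumes "finite S" "g holomorphic_on UNIV" "\<And>a. a \<in> S \<Longrightarrow> g a = 0"
  shows "\<exists>h. h holomorphic_on UNIV \<and> (\<forall>z. g z = (\<Prod>a\<in>S. z - a) * h z)"
  using assms(1,3)
proof (induction S rule: finite_induct)
  case empty
  then show ?case using assms(2) by auto
next
  case (insert a S)
  then obtain h where h: "h holomorphic_on UNIV" "\<And>z. g z = (\<Prod>a\<in>S. z - a) * h z" by auto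
  have "(\<Prod>b\<in>S. a - b) * h a = 0" using insert.prems[of a] h(2) by simp
  moreover have "(\<Prod>b\<in>S. a - b) \<noteq> 0" using insert.hyps by auto
  ultimately have ha: "h a = 0" by simp
  define k where "k z = (if z = a then deriv h a else h z / (z - a))" for z
  have k: "k holomorphic_on UNIV"
    by (rule pole_theorem_0[where a = a and g = h]) (use h ha in \<open>auto simp: k_def\<close>)
  have "h z = (z - a) * k z" for z using ha by (auto simp: k_def)
  then show ?case using h(2) k insert.hyps by (intro exI[of _ k]) (simp add: mult_ac)
qed

text \<open>Nonvanishing of the Vandermonde determinant: the weights annihilate all powers of the
  nodes, hence all polynomials, in particular the Lagrange polynomial \<open>P\<close> that vanishes
  at every node except \<open>s a\<close>.\<close>

lemma power_sums_zero_imp_zero: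
  fixes s :: "'i \<Rightarrow> complex" and p :: "'i \<Rightarrow> complex"
  assumes "finite I" "inj_on s I" "\<And>k. (\<Sum>i\<in>I. p i * s i ^ k) = 0" "a \<in> I"
  shows "p a = 0"
proof -
  define P where "P = (\<Prod>b\<in>I - {a}. [:- s b, 1:])"
  have "(\<Sum>i\<in>I. p i * poly P (s i)) = (\<Sum>i\<in>I. \<Sum>k\<le>degree P. p i * (coeff P k * s i ^ k))"
    by (simp add: poly_altdef sum_distrib_left)
  also have "\<dots> = (\<Sum>k\<le>degree P. coeff P k * (\<Sum>i\<in>I. p i * s i ^ k))"
    by (subst sum.swap) (simp add: sum_distrib_left mult_ac)
  also have "\<dots> = 0" using assms(3) by simp
  finally have "0 = (\<Sum>i\<in>I. p i * poly P (s i))" ..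
  also have "\<dots> = (\<Sum>i\<in>I. if i = a then p a * poly P (s a) else 0)"
  proof (rule sum.cong[OF refl])
    fix i assume i: "i \<in> I"
    show "p i * poly P (s i) = (if i = a then p a * poly P (s a) else 0)"
      using i assms(1) by (auto simp: P_def poly_prod prod_zero_iff)
  qed
  also have "\<dots> = p a * poly P (s a)" using assms by simp
  finally have "p a * poly P (s a) = 0" ..
  moreover have "poly P (s a) \<noteq> 0"
    using assms by (auto simp: P_def poly_prod inj_on_def)
  ultimately show ?thesis by simp
qed

context
  fixes \<beta> w :: complex
  assumes w: "w = exp (2 * of_real pi * \<i> * \<beta>)"
begin

definition gfreq :: "nat \<times> nat \<Rightarrow> complex" where
  "gfreq ij = of_nat (fst ij) + of_nat (snd ij) * \<beta>"

text \<open>Up to the factor \<open>(2 * pi * \<i>) ^ k\<close> this is the \<open>k\<close>-th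
  derivative of \<open>gfun\<close> at the natural number \<open>l\<close>. There the integral part
  of each frequency contributes 1 to the exponential, so only powers of \<open>w\<close> remain and
  the number is a polynomial in \<beta> and \<open>w\<close>.\<close>

definition gxi :: "nat \<Rightarrow> (nat \<times> nat \<Rightarrow> int) \<Rightarrow> nat \<Rightarrow> nat \<Rightarrow> complex" where
  "gxi q p k l = (\<Sum>ij\<in>{..<q}\<times>{..<q}. of_int (p ij) * (gfreq ij ^ k * w ^ (snd ij * l)))"

definition gfun :: "nat \<Rightarrow> (nat \<times> nat \<Rightarrow> int) \<Rightarrow> complex \<Rightarrow> complex" where
  "gfun q p z = (\<Sum>ij\<in>{..<q}\<times>{..<q}. of_int (p ij) * exp (2 * of_real pi * \<i> * gfreq ij * z))"

lemma gfun_holomorphic: "gfun q p holomorphic_on A"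
  unfolding gfun_def by (intro holomorphic_intros)

lemma gfun_expansion:
  "(\<lambda>k. (gxi q p k l * (2 * of_real pi * \<i>) ^ k / fact k) * z ^ k) sums gfun q p (of_nat l + z)"
proof -
  let ?c = "2 * of_real pi * \<i> :: complex"
  have e: "exp (?c * gfreq ij * (of_nat l + z)) = w ^ (snd ij * l) * exp (?c * gfreq ij * z)" for ij
  proof -
    have "exp (?c * gfreq ij * of_nat l) =
      exp (2 * of_nat (fst ij * l) * of_real pi * \<i>) * exp (of_nat (snd ij * l) * (?c * \<beta>))"
      by (simp add: gfreq_def exp_add[symmetric] algebra_simps)
    also have "exp (2 * of_nat (fst ij * l) * of_real pi * \<i>) = 1"
      using exp_integer_2pi[of "of_nat (fst ij * l)"] by simp
    also have "exp (of_nat (snd ij * l) * (?c * \<beta>)) = w ^ (snd ij * l)"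
      unfolding w by (rule exp_of_nat_mult)
    finally show ?thesis by (simp add: distrib_left exp_add)
  qed
  have "(\<lambda>k. \<Sum>ij\<in>{..<q}\<times>{..<q}. of_int (p ij) * (w ^ (snd ij * l) * ((?c * gfreq ij * z) ^ k /\<^sub>R fact k)))
    sums gfun q p (of_nat l + z)"
    unfolding gfun_def e by (intro sums_sum sums_mult exp_converges)
  moreover have "(\<Sum>ij\<in>{..<q}\<times>{..<q}. of_int (p ij) * (w ^ (snd ij * l) * ((?c * gfreq ij * z) ^ k /\<^sub>R fact k)))
    = (gxi q p k l * ?c ^ k / fact k) * z ^ k" for k
    unfolding gxi_def sum_distrib_right sum_divide_distrib
    by (intro sum.cong refl) (simp add: power_mult_distrib scaleR_conv_of_real field_simps)
  ultimately show ?thesis by simp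
qed

text \<open>Divide the Taylor series of the auxiliary function at \<open>l\<close> by the power
  \<open>r\<close> of the local variable and evaluate at the centre. Read off the series, the value
  is the coefficient of order \<open>r\<close>; read off the factorisation, it is the product of the
  other factors times \<open>G\<close>.\<close>

lemma gxi_factor:
  fixes m :: nat
  assumes G: "G holomorphic_on UNIV" "\<And>z. gfun q p z = (\<Prod>a\<in>of_nat ` {..<m}. z - a) ^ r * G z"
    and l: "l < m" and xi: "\<And>k. k < r \<Longrightarrow> gxi q p k l = 0"
  shows "gxi q p r l * (2 * of_real pi * \<i>) ^ r / fact r =
    (\<Prod>a\<in>of_nat ` {..<m} - {of_nat l}. of_nat l - a) ^ r * G (of_nat l)"
proof -
  let ?a = "\<lambda>k. gxi q p k l * (2 * of_real pi * \<i>) ^ k / fact k"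
  let ?S = "of_nat ` {..<m} :: complex set"
  define H where "H z = (\<Prod>a\<in>?S - {of_nat l}. of_nat l + z - a) ^ r * G (of_nat l + z)" for z
  have "continuous_on UNIV G" using G(1) by (rule holomorphic_on_imp_continuous_on)
  then have "isCont G z" for z by (simp add: continuous_on_eq_continuous_at)
  moreover have "isCont (\<lambda>z::complex. of_nat l + z) 0" by (intro continuous_intros)
  ultimately have contG: "isCont (\<lambda>z. G (of_nat l + z)) 0"
    using isCont_o2[where f = "\<lambda>z. of_nat l + z" and a = 0 and g = G] by blast
  have "isCont (\<lambda>z. \<Prod>a\<in>?S - {of_nat l}. of_nat l + z - a) 0"
    by (intro continuous_prod continuous_diff continuous_add continuous_const continuous_ident)
  then have "isCont H 0" unfolding H_def by (rule isCont_mult[OF isCont_power contG])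
  then have lim1: "(H \<longlongrightarrow> H 0) (at 0)" by (simp add: isCont_def)
  define K where "K z = (if z = 0 then ?a r else H z)" for z
  have sums: "(\<lambda>k. ?a (k + r) * z ^ k) sums K z" for z
  proof (cases "z = 0")
    case True
    have "(\<lambda>k. ?a (k + r) * 0 ^ k) sums ?a (0 + r)" by (rule powser_sums_zero)
    then show ?thesis using True by (simp add: K_def)
  next
    case False
    have "(\<lambda>k. ?a (k + r) * z ^ (k + r)) sums (gfun q p (of_nat l + z) - (\<Sum>k<r. ?a k * z ^ k))"
      using sums_split_initial_segment[OF gfun_expansion[of q p l z], of r] by simp
    then have "(\<lambda>k. ?a (k + r) * z ^ (k + r)) sums gfun q p (of_nat l + z)"
      using xi by simp
    moreover have "gfun q p (of_nat l + z) = z ^ r * H z"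
    proof -
      have "(\<Prod>a\<in>?S. of_nat l + z - a) = (of_nat l + z - of_nat l) * (\<Prod>a\<in>?S - {of_nat l}. of_nat l + z - a)"
        using l by (intro prod.remove) auto
      then show ?thesis by (simp add: G(2) H_def power_mult_distrib)
    qed
    ultimately have "(\<lambda>k. ?a (k + r) * z ^ (k + r) / z ^ r) sums (z ^ r * H z / z ^ r)"
      by (intro sums_divide) simp
    moreover have "?a (k + r) * z ^ (k + r) / z ^ r = ?a (k + r) * z ^ k" for k
      using False by (simp add: power_add)
    moreover have "z ^ r * H z / z ^ r = K z" using False by (simp add: K_def)
    ultimately show ?thesis by (simp only:)
  qed
  have "(K \<longlongrightarrow> ?a (0 + r)) (at 0)"
    by (rule powser_limit_0[of 1]) (use sums in auto)
  then have "(K \<longlongrightarrow> ?a r) (at 0)" by (simp only: add_0)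
  then have "(H \<longlongrightarrow> ?a r) (at 0)"
    by (rule Lim_transform_eventually) (auto simp: K_def eventually_at intro!: exI[of _ 1])
  then have "?a r = H 0" using lim1 by (rule tendsto_unique[OF at_neq_bot])
  then show ?thesis by (simp add: H_def)
qed

text \<open>One order at a time: after \<open>r\<close> factors have been split off, the vanishing
  of the \<open>gxi\<close> of order \<open>r\<close> makes the cofactor \<open>G\<close> vanish at
  the same points.\<close>

lemma gfun_factor:
  assumes "\<And>k l. k < r \<Longrightarrow> l < m \<Longrightarrow> gxi q p k l = 0"
  shows "\<exists>G. G holomorphic_on UNIV \<and> (\<forall>z. gfun q p z = (\<Prod>a\<in>of_nat ` {..<m}. z - a) ^ r * G z)"
  using assms
proof (induction r)
  case 0
  then show ?case using gfun_holomorphic by auto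
next
  case (Suc r)
  then obtain G where G: "G holomorphic_on UNIV" "\<And>z. gfun q p z = (\<Prod>a\<in>of_nat ` {..<m}. z - a) ^ r * G z"
    by (meson less_SucI)
  have "G a = 0" if "a \<in> of_nat ` {..<m}" for a
  proof -
    obtain l where l: "l < m" "a = of_nat l" using \<open>a \<in> _\<close> by auto
    have "(\<Prod>a\<in>of_nat ` {..<m} - {of_nat l}. of_nat l - a) ^ r * G (of_nat l) = 0"
      using gxi_factor[OF G l(1)] Suc.prems l by simp
    then show ?thesis using l by auto
  qed
  then obtain h where "h holomorphic_on UNIV" "\<And>z. G z = (\<Prod>a\<in>of_nat ` {..<m}. z - a) * h z"
    using entire_factor_zeros[of "of_nat ` {..<m}" G] G(1) by auto
  then show ?case using G(2) by (intro exI[of _ h]) (simp add: mult_ac)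
qed

lemma gfun_bound:
  assumes p: "\<And>ij. ij \<in> {..<q} \<times> {..<q} \<Longrightarrow> \<bar>real_of_int (p ij)\<bar> \<le> X" and z: "cmod z \<le> R"
  shows "cmod (gfun q p z) \<le> real (q^2) * (X * exp (2 * pi * (q * (1 + cmod \<beta>)) * R))"
proof -
  have "cmod (gfun q p z) \<le> (\<Sum>ij\<in>{..<q}\<times>{..<q}. cmod (of_int (p ij) * exp (2 * of_real pi * \<i> * gfreq ij * z)))"
    unfolding gfun_def by (rule norm_sum)
  also have "\<dots> \<le> (\<Sum>ij\<in>{..<q}\<times>{..<q}. X * exp (2 * pi * (q * (1 + cmod \<beta>)) * R))"
  proof (rule sum_mono)
    fix ij assume ij: "ij \<in> {..<q} \<times> {..<q}"
    have "cmod (gfreq ij) \<le> cmod (of_nat (fst ij)) + cmod (of_nat (snd ij) * \<beta>)"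
      unfolding gfreq_def by (rule norm_triangle_ineq)
    also have "\<dots> \<le> real q + real q * cmod \<beta>"
      using ij by (auto simp: norm_mult intro!: add_mono mult_right_mono)
    finally have f: "cmod (gfreq ij) \<le> q * (1 + cmod \<beta>)" by (simp add: algebra_simps)
    have "cmod (exp (2 * of_real pi * \<i> * gfreq ij * z)) \<le> exp (cmod (2 * of_real pi * \<i> * gfreq ij * z))"
      by (rule norm_exp)
    also have "cmod (2 * of_real pi * \<i> * gfreq ij * z) = 2 * pi * cmod (gfreq ij) * cmod z"
      by (simp add: norm_mult)
    also have "exp \<dots> \<le> exp (2 * pi * (q * (1 + cmod \<beta>)) * R)"
      unfolding exp_le_cancel_iff using f z by (intro mult_mono) (auto intro!: mult_nonneg_nonneg)
    finally have e: "cmod (exp (2 * of_real pi * \<i> * gfreq ij * z)) \<le> exp (2 * pi * (q * (1 + cmod \<beta>)) * R)" .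
    then show "cmod (of_int (p ij) * exp (2 * of_real pi * \<i> * gfreq ij * z)) \<le> X * exp (2 * pi * (q * (1 + cmod \<beta>)) * R)"
      unfolding norm_mult using p[OF ij] by (intro mult_mono) auto
  qed
  also have "\<dots> = real (q^2) * (X * exp (2 * pi * (q * (1 + cmod \<beta>)) * R))" by (simp add: power2_eq_square)
  finally show ?thesis .
qed

text \<open>On the circle of radius \<open>R\<close> every factor \<open>z - a\<close> has modulus
  at least \<open>R / 2\<close>, because \<open>R\<close> is at least \<open>2 * m\<close>. This
  bounds the cofactor \<open>G\<close> there, and at \<open>l\<close> by the maximum principle. The
  \<open>m * r\<close> zeros thus yield the decisive factor
  \<open>(2 / R) ^ (m * r)\<close>.\<close>

lemma gxi_upper:
  assumes xi: "\<And>k l. k < r \<Longrightarrow> l < m \<Longrightarrow> gxi q p k l = 0" and l: "l < m"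
    and p: "\<And>ij. ij \<in> {..<q} \<times> {..<q} \<Longrightarrow> \<bar>real_of_int (p ij)\<bar> \<le> X" and R: "R \<ge> 2 * real m"
  shows "cmod (gxi q p r l) \<le> fact r * real m ^ (m * r) *
    (real (q^2) * (X * exp (2 * pi * (q * (1 + cmod \<beta>)) * R)) * (2 / R) ^ (m * r))"
proof -
  obtain G where G: "G holomorphic_on UNIV" "\<And>z. gfun q p z = (\<Prod>a\<in>of_nat ` {..<m}. z - a) ^ r * G z"
    using gfun_factor[of r m q p] xi by blast
  have m0: "m > 0" using l by simp
  have Rp: "R > 0" using R m0 by simp
  let ?B = "real (q^2) * (X * exp (2 * pi * (q * (1 + cmod \<beta>)) * R)) * (2 / R) ^ (m * r)"
  have cardS: "card (of_nat ` {..<m} :: complex set) = m" by (simp add: card_image inj_on_def)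
  have Gz: "cmod (G z) \<le> ?B" if z: "cmod z = R" for z
  proof -
    have "(R / 2) ^ m = (\<Prod>a\<in>(of_nat ` {..<m} :: complex set). R / 2)" using cardS by simp
    also have "\<dots> \<le> (\<Prod>a\<in>of_nat ` {..<m}. cmod (z - a))"
    proof (intro prod_mono conjI)
      fix a :: complex assume "a \<in> of_nat ` {..<m}"
      then have "cmod a \<le> R / 2" using R by auto
      then show "R / 2 \<le> cmod (z - a)" using norm_triangle_ineq2[of z a] z by linarith
    qed (use Rp in auto)
    finally have w1: "(R / 2) ^ m \<le> cmod (\<Prod>a\<in>of_nat ` {..<m}. z - a)" by (simp add: prod_norm)
    have "((R / 2) ^ m) ^ r * cmod (G z) \<le> cmod (\<Prod>a\<in>of_nat ` {..<m}. z - a) ^ r * cmod (G z)"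
      using w1 Rp by (intro mult_right_mono power_mono) auto
    also have "\<dots> = cmod (gfun q p z)" by (simp add: G(2) norm_mult norm_power)
    also have "\<dots> \<le> real (q^2) * (X * exp (2 * pi * (q * (1 + cmod \<beta>)) * R))"
      using gfun_bound[OF p] z by simp
    finally have le: "(R / 2) ^ (m * r) * cmod (G z) \<le> real (q^2) * (X * exp (2 * pi * (q * (1 + cmod \<beta>)) * R))"
      by (simp only: power_mult)
    have "(R / 2) ^ (m * r) * (2 / R) ^ (m * r) = 1"
      using Rp by (simp add: power_mult_distrib[symmetric])
    then have "cmod (G z) = ((R / 2) ^ (m * r) * (2 / R) ^ (m * r)) * cmod (G z)" by simp
    also have "\<dots> = ((R / 2) ^ (m * r) * cmod (G z)) * (2 / R) ^ (m * r)" by (simp only: mult_ac)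
    also have "\<dots> \<le> ?B" using le Rp by (intro mult_right_mono) auto
    finally show ?thesis .
  qed
  have GB: "cmod (G (of_nat l)) \<le> ?B"
  proof (rule maximum_modulus_frontier[of G "cball 0 R"])
    show "G holomorphic_on interior (cball 0 R)" using G(1) by (rule holomorphic_on_subset) simp
    show "continuous_on (closure (cball 0 R)) G"
      by (rule holomorphic_on_imp_continuous_on, rule holomorphic_on_subset[OF G(1)]) simp
    show "cmod (G z) \<le> ?B" if "z \<in> frontier (cball 0 R)" for z
      using that Rp by (intro Gz) (simp add: frontier_cball)
    show "of_nat l \<in> cball (0::complex) R" using l R by simp
  qed simp
  have "cmod (\<Prod>a\<in>of_nat ` {..<m} - {of_nat l}. of_nat l - a) \<le> (\<Prod>a\<in>(of_nat ` {..<m} :: complex set) - {of_nat l}. real m)"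
    unfolding prod_norm[symmetric]
  proof (intro prod_mono conjI)
    fix a :: complex assume "a \<in> of_nat ` {..<m} - {of_nat l}"
    then obtain k where k: "k < m" "a = of_nat k" by auto
    have "cmod (of_nat l - a) = \<bar>real l - real k\<bar>" unfolding k
      by (metis norm_of_real of_real_diff of_real_of_nat_eq)
    then show "cmod (of_nat l - a) \<le> real m" using k l by linarith
  qed auto
  also have "\<dots> = real m ^ (m - 1)" using cardS l by (simp add: card_Diff_singleton)
  also have "\<dots> \<le> real m ^ m" using m0 by (intro power_increasing) auto
  finally have pb: "cmod (\<Prod>a\<in>of_nat ` {..<m} - {of_nat l}. of_nat l - a) \<le> real m ^ m" .
  have "cmod (gxi q p r l) \<le> cmod (gxi q p r l) * (2 * pi) ^ r"
  proof -
    have "1 \<le> (2 * pi) ^ r" using pi_gt3 by (intro one_le_power) simp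
    then show ?thesis using mult_left_mono[of 1 "(2 * pi) ^ r" "cmod (gxi q p r l)"] by simp
  qed
  also have "\<dots> = fact r * cmod (gxi q p r l * (2 * of_real pi * \<i>) ^ r / fact r)"
    by (simp add: norm_mult norm_power norm_divide)
  also have "\<dots> = fact r * (cmod (\<Prod>a\<in>of_nat ` {..<m} - {of_nat l}. of_nat l - a) ^ r * cmod (G (of_nat l)))"
    using gxi_factor[OF G l] xi l by (simp add: norm_mult norm_power)
  also have "\<dots> \<le> fact r * ((real m ^ m) ^ r * ?B)"
    using pb GB by (intro mult_left_mono mult_mono power_mono) auto
  also have "\<dots> = fact r * real m ^ (m * r) * ?B" by (simp only: power_mult mult.assoc)
  finally show ?thesis .
qed

end

text \<open>Everything is measured in powers of \<open>s = sqrt (c0 * r)\<close>, which bounds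
  \<open>q\<close>, up to factors \<open>C ^ r\<close>. The Liouville bound costs
  \<open>s ^ (2 * D * r)\<close>, the factorial and the solution of the linear system cost
  \<open>s ^ (3 * r)\<close>, and the zeros gain \<open>s ^ (m * r)\<close>. With
  \<open>m = 2 * D + 5\<close> there remains \<open>c * (c0 * r) ^ r \<le> C7 ^ r\<close>, which is
  false for large \<open>r\<close>.\<close>

lemma gelfond_numeric:
  fixes m D :: nat and c H C1 c0 b :: real
  assumes c: "c > 0" and D: "D \<ge> 1" and m: "m = 2 * D + 5" and H: "H \<ge> 1" and C1: "C1 \<ge> 1"
    and c0: "c0 = real (2 * D * m)" and b: "b \<ge> 0"
  shows "\<exists>h0::nat. \<forall>(h::nat) q n r X x \<xi>. h \<ge> h0 \<longrightarrow> h \<ge> 1 \<longrightarrow> real q = c0 * h \<longrightarrow> real n = c0 * h^2 \<longrightarrow> n \<le> r \<longrightarrow>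
     0 \<le> X \<longrightarrow> X \<le> 2 * real q^2 * ((C1 * q) ^ n * C1 ^ (2*q*m+2)) \<longrightarrow>
     0 \<le> \<xi> \<longrightarrow> \<xi> \<le> fact r * real m ^ (m * r) * (real q^2 * (X * exp (b * q * (r / q))) * (2 / (r / q)) ^ (m * r)) \<longrightarrow>
     x \<le> H ^ (r + q * m) * \<xi> \<longrightarrow>
     c \<le> x * (real q^2 * (D * (X * ((C1 * q) ^ r * C1 ^ (2*q*m+2))))) ^ D \<longrightarrow> False"
proof -
  define C3 where "C3 = C1 ^ (2*m+3)"
  define C4 where "C4 = 4 * c0 * C3"
  define C5 where "C5 = 2 * c0 * D * C4 * C3"
  define C2 where "C2 = exp b"
  define C6 where "C6 = real m ^ m * (2 * c0) * C4 * C2 * (2 * c0) ^ m"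
  define C7 where "C7 = H ^ (1 + m) * C6 * C5 ^ D"
  have m1: "m \<ge> 1" using m by simp
  have c01: "c0 \<ge> 1" unfolding c0 using D m1
    by (metis One_nat_def Suc_leI mult_is_0 nat_0_less_mult_iff not_less_eq_eq not_one_le_zero numeral_eq_one_iff of_nat_1 of_nat_le_iff semiring_norm(85) zero_less_numeral zero_less_iff_neq_zero le_0_eq)
  have C31: "C3 \<ge> 1" unfolding C3_def using C1 by (rule one_le_power)
  have C41: "C4 \<ge> 1" unfolding C4_def using c01 C31 mult_mono[of 1 "4 * c0" 1 C3] by simp
  have C50: "C5 \<ge> 0" unfolding C5_def using c01 C31 C41 by simp
  have C60: "C6 \<ge> 0" unfolding C6_def C2_def using c01 C41 by simp
  have C70: "C7 \<ge> 0" unfolding C7_def using H C60 C50 by simp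
  obtain N where N: "(1/2::real) ^ N < c" using real_arch_pow_inv[OF c, of "1/2"] by auto
  obtain h1 :: nat where h1: "real h1 \<ge> 2 * C7" using real_arch_simple by blast
  have "False" if h: "h \<ge> max h1 N" "h \<ge> 1" and q: "real q = c0 * h" and n: "real n = c0 * h^2" and nr: "n \<le> r"
    and X0: "0 \<le> X" and X: "X \<le> 2 * real q^2 * ((C1 * q) ^ n * C1 ^ (2*q*m+2))"
    and xi0: "0 \<le> \<xi>" and xi: "\<xi> \<le> fact r * real m ^ (m * r) * (real q^2 * (X * exp (b * q * (r / q))) * (2 / (r / q)) ^ (m * r))"
    and x: "x \<le> H ^ (r + q * m) * \<xi>"
    and cx: "c \<le> x * (real q^2 * (D * (X * ((C1 * q) ^ r * C1 ^ (2*q*m+2))))) ^ D"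
    for h q n r :: nat and X \<xi> x :: real
  proof -
    have h1': "real h \<ge> 1" using h by simp
    have hn: "real h \<le> real n"
    proof -
      have "1 * real h \<le> c0 * real h ^ 2" using c01 h1' by (intro mult_mono) (auto simp: power2_eq_square)
      then show ?thesis using n by simp
    qed
    have qn: "real q \<le> real n" unfolding q n using c01 h1' by (simp add: power2_eq_square)
    have q1: "real q \<ge> 1" unfolding q using c01 h1' mult_mono[of 1 c0 1 "real h"] by simp
    have rn: "real n \<le> real r" using nr by simp
    have r1: "real r \<ge> 1" using q1 qn rn by linarith
    then have r1': "r \<ge> 1" by simp
    define s where "s = sqrt (c0 * r)"
    have ss: "s^2 = c0 * r" unfolding s_def using c01 by simp
    have s1: "s \<ge> 1" unfolding s_def using c01 r1 mult_mono[of 1 c0 1 "real r"] by simp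
    have q2: "real q ^ 2 \<le> c0 * r"
    proof -
      have "real q ^ 2 = c0 * n" unfolding q n by (simp add: power2_eq_square)
      then show ?thesis using rn c01 by (simp add: mult_left_mono)
    qed
    have qs: "real q \<le> s" unfolding s_def using q2 by (rule real_le_rsqrt)
    have rpow: "real r \<le> 2 ^ r" using less_exp[of r] by (metis less_imp_le of_nat_le_iff of_nat_numeral of_nat_power)
    have ge_pow: "y \<le> y ^ r" if "y \<ge> 1" for y :: real
      using power_increasing[of 1 r y] r1' that by simp
    have q2r: "real q ^ 2 \<le> (2 * c0) ^ r"
    proof -
      have "c0 * r \<le> c0 ^ r * 2 ^ r" using ge_pow[OF c01] rpow c01 by (intro mult_mono) auto
      then show ?thesis using q2 by (simp add: power_mult_distrib mult.commute)
    qed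
    define T where "T k = (C1 * q) ^ k * C1 ^ (2*q*m+2)" for k
    have T0: "T k \<ge> 0" for k unfolding T_def using C1 by simp
    have KT: "T k \<le> C3 ^ r * s ^ r" if k: "k \<le> r" for k
    proof -
      have "(C1 * q) ^ k \<le> (C1 * s) ^ k" using C1 qs by (intro power_mono) auto
      also have "\<dots> \<le> (C1 * s) ^ r" using k C1 s1 mult_mono[of 1 C1 1 s] by (intro power_increasing) auto
      finally have 1: "(C1 * q) ^ k \<le> C1 ^ r * s ^ r" by (simp add: power_mult_distrib)
      have qr: "q \<le> r" using qn rn by simp
      have "q * m \<le> r * m" using qr by (rule mult_le_mono1)
      then have "2 * (q * m) + 2 \<le> 2 * (r * m) + 2 * r" using r1' by linarith
      then have "2*q*m+2 \<le> (2*m+2) * r" by (simp only: algebra_simps)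
      then have 2: "C1 ^ (2*q*m+2) \<le> C1 ^ ((2*m+2) * r)" using C1 by (intro power_increasing) auto
      have "(C1 * q) ^ k * C1 ^ (2*q*m+2) \<le> (C1 ^ r * s ^ r) * C1 ^ ((2*m+2) * r)"
        using 1 2 C1 s1 by (intro mult_mono) auto
      also have "\<dots> = C3 ^ r * s ^ r" unfolding C3_def by (simp flip: power_mult power_add add: algebra_simps)
      finally show ?thesis unfolding T_def .
    qed
    have Xb: "X \<le> C4 ^ r * s ^ r"
    proof -
      have g2: "(2::real) \<le> 2 ^ r" by (rule ge_pow) simp
      have "2 * real q^2 \<le> 2 ^ r * (2 * c0) ^ r"
        by (rule mult_mono[OF g2 q2r]) simp_all
      then have "2 * real q^2 * T n \<le> 2 ^ r * (2 * c0) ^ r * (C3 ^ r * s ^ r)"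
        using KT[OF nr] by (rule mult_mono) (simp_all add: T0 c01 order_trans[OF zero_le_one c01])
      then have "X \<le> 2 ^ r * (2 * c0) ^ r * (C3 ^ r * s ^ r)"
        using X unfolding T_def by (rule order_trans[rotated])
      also have "\<dots> = C4 ^ r * s ^ r"
      proof -
        have "(4::real) ^ r = 2 ^ r * 2 ^ r" by (simp only: power_mult_distrib[symmetric]) simp
        then show ?thesis unfolding C4_def power_mult_distrib by (simp only: mult_ac)
      qed
      finally show ?thesis .
    qed
    define K where "K = real q^2 * (D * (X * T r))"
    have K0: "K \<ge> 0" unfolding K_def using X0 T0 by simp
    have KB: "K \<le> C5 ^ r * s ^ (2 * r)"
    proof -
      have Dr: "real D \<le> real D ^ r" using D ge_pow[of "real D"] by simp
      have "X * T r \<le> (C4 ^ r * s ^ r) * (C3 ^ r * s ^ r)"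
        by (rule mult_mono[OF Xb KT[OF order_refl] _ T0]) (simp add: order_trans[OF zero_le_one C41] order_trans[OF zero_le_one s1])
      then have "real D * (X * T r) \<le> real D ^ r * ((C4 ^ r * s ^ r) * (C3 ^ r * s ^ r))"
        by (rule mult_mono[OF Dr]) (simp_all add: X0 T0)
      then have "K \<le> (2 * c0) ^ r * (real D ^ r * ((C4 ^ r * s ^ r) * (C3 ^ r * s ^ r)))"
        unfolding K_def by (rule mult_mono[OF q2r]) (simp_all add: X0 T0 order_trans[OF zero_le_one c01])
      also have "\<dots> = C5 ^ r * (s ^ r * s ^ r)" unfolding C5_def by (simp add: power_mult_distrib mult_ac)
      also have "s ^ r * s ^ r = s ^ (2 * r)" by (simp flip: power_add add: mult_2)
      finally show ?thesis .
    qed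
    have xiB: "\<xi> * s ^ (m * r) \<le> C6 ^ r * s ^ (3 * r)"
    proof -
      have f: "fact r \<le> s ^ (2 * r)"
      proof -
        have "fact r \<le> real r ^ r" by (metis fact_le_power of_nat_power)
        also have "\<dots> \<le> (s^2) ^ r" unfolding ss using c01 mult_right_mono[OF c01, of "real r"] by (intro power_mono) auto
        finally show ?thesis by (simp add: power_mult)
      qed
      have e: "exp (b * q * (r / q)) = C2 ^ r" unfolding C2_def using q1 by (simp add: exp_of_nat_mult[symmetric] mult.commute)
      have "2 / (r / q) * s \<le> 2 * c0"
      proof -
        have "q * s \<le> s * s" using qs s1 by (intro mult_right_mono) auto
        also have "\<dots> = c0 * r" using ss by (simp add: power2_eq_square)
        finally show ?thesis using r1 by (simp add: field_simps)
      qed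
      then have g: "(2 / (r / q)) ^ (m * r) * s ^ (m * r) \<le> (2 * c0) ^ (m * r)"
        unfolding power_mult_distrib[symmetric] using s1 by (intro power_mono) auto
      have "\<xi> * s ^ (m * r) \<le> fact r * real m ^ (m * r) * (real q^2 * (X * C2 ^ r) * (2 / (r / q)) ^ (m * r)) * s ^ (m * r)"
        using xi s1 unfolding e by (intro mult_right_mono) auto
      also have "\<dots> = fact r * (real m ^ (m * r) * (real q^2 * ((X * C2 ^ r) * ((2 / (r / q)) ^ (m * r) * s ^ (m * r)))))"
        by (simp only: mult_ac)
      also have "\<dots> \<le> s ^ (2 * r) * (real m ^ (m * r) * ((2 * c0) ^ r * (((C4 ^ r * s ^ r) * C2 ^ r) * (2 * c0) ^ (m * r))))"
        using f q2r Xb g X0 c01 s1 C41 by (intro mult_mono) (auto simp: C2_def)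
      also have "\<dots> = C6 ^ r * (s ^ (2 * r) * s ^ r)"
        unfolding C6_def by (simp add: power_mult_distrib power_mult mult_ac)
      also have "s ^ (2 * r) * s ^ r = s ^ (3 * r)" by (simp flip: power_add)
      finally show ?thesis .
    qed
    have HB: "H ^ (r + q * m) \<le> (H ^ (1 + m)) ^ r"
    proof -
      have "q \<le> r" using qn rn by simp
      then have "q * m \<le> r * m" by (rule mult_le_mono1)
      then have "r + q * m \<le> (1 + m) * r" by (simp add: distrib_right mult.commute[of m r])
      then show ?thesis unfolding power_mult[symmetric] using H by (intro power_increasing) auto
    qed
    have "c * s ^ (m * r) \<le> x * K ^ D * s ^ (m * r)" using cx s1 unfolding K_def T_def by (intro mult_right_mono) auto
    also have "\<dots> \<le> (H ^ (r + q * m) * \<xi>) * K ^ D * s ^ (m * r)" using x K0 s1 by (intro mult_right_mono) auto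
    also have "\<dots> = H ^ (r + q * m) * (K ^ D * (\<xi> * s ^ (m * r)))" by (simp only: mult_ac)
    also have "\<dots> \<le> (H ^ (1 + m)) ^ r * ((C5 ^ r * s ^ (2 * r)) ^ D * (C6 ^ r * s ^ (3 * r)))"
    proof -
      have "K ^ D * (\<xi> * s ^ (m * r)) \<le> (C5 ^ r * s ^ (2 * r)) ^ D * (C6 ^ r * s ^ (3 * r))"
        by (rule mult_mono[OF power_mono[OF KB K0] xiB]) (use C50 xi0 s1 in simp_all)
      then show ?thesis
        by (rule mult_mono[OF HB]) (use H K0 xi0 s1 in simp_all)
    qed
    also have "\<dots> = C7 ^ r * s ^ ((2 * D + 3) * r)"
    proof -
      have "(C5 ^ r * s ^ (2 * r)) ^ D = (C5 ^ D) ^ r * s ^ (2 * D * r)"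
        by (simp add: power_mult_distrib flip: power_mult) (simp add: mult_ac)
      moreover have "s ^ (2 * D * r) * s ^ (3 * r) = s ^ ((2 * D + 3) * r)"
        by (simp flip: power_add add: algebra_simps)
      ultimately show ?thesis unfolding C7_def by (simp only: power_mult_distrib mult_ac)
    qed
    finally have "c * s ^ (m * r) \<le> C7 ^ r * s ^ ((2 * D + 3) * r)" .
    moreover have "s ^ (m * r) = s ^ ((2 * D + 3) * r) * (s^2) ^ r"
      unfolding m by (simp flip: power_mult power_add add: algebra_simps)
    ultimately have "s ^ ((2 * D + 3) * r) * (c * (s^2) ^ r) \<le> s ^ ((2 * D + 3) * r) * C7 ^ r"
      by (simp only: mult_ac)
    then have 1: "c * (c0 * r) ^ r \<le> C7 ^ r" using s1 unfolding ss
      by (subst (asm) mult_le_cancel_left_pos) auto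
    have "2 * C7 \<le> real h" using h h1 by linarith
    also have "\<dots> \<le> c0 * r" using hn rn c01 mult_right_mono[OF c01, of "real r"] by simp
    finally have "C7 ^ r \<le> ((1/2) * (c0 * r)) ^ r" using C70 by (intro power_mono) auto
    then have "c * (c0 * r) ^ r \<le> (1/2) ^ r * (c0 * r) ^ r" using 1 by (simp only: power_mult_distrib)
    then have "c \<le> (1/2) ^ r" using c01 r1 by (subst (asm) mult_le_cancel_right_pos) auto
    also have "\<dots> \<le> (1/2) ^ N" using h hn rn by (intro power_decreasing) auto
    finally show False using N by simp
  qed
  then show ?thesis by (intro exI[of _ "max h1 N"] allI impI)
qed

text \<open>The Gelfond--Schneider theorem for the base 1 with logarithm
  \<open>2 * pi * \<i>\<close>. The coefficients of the auxiliary function are chosen so that its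
  derivatives of order below \<open>n\<close> vanish at the points below \<open>m\<close>. The least
  order \<open>r\<close> with a surviving derivative gives a nonzero number that is too small for
  \<open>lattice_liouville\<close>.\<close>

theorem gelfond_schneider_exp:
  fixes \<beta> :: complex
  assumes alg: "algebraic \<beta>" and irr: "\<beta> \<notin> \<rat>" and algw: "algebraic (exp (2 * of_real pi * \<i> * \<beta>))"
  shows False
proof -
  define w where "w = exp (2 * of_real pi * \<i> * \<beta>)"
  obtain B :: "complex set" and d :: int and X Y where
    B: "finite B" "B \<noteq> {}" "int_indep B" and d: "d > 0"
    and Xr: "\<forall>e\<in>B. of_int d * \<beta> * e = (\<Sum>u\<in>B. of_int (X e u) * u)"
    and Yr: "\<forall>e\<in>B. of_int d * w * e = (\<Sum>u\<in>B. of_int (Y e u) * u)"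
    by (rule algebraic_pair_lattice[OF alg algw[folded w_def]], rule that; assumption)
  define D where "D = card B"
  have D1: "D \<ge> 1" unfolding D_def using B by (simp add: Suc_le_eq card_gt_0_iff)
  then have D1': "real D \<ge> 1" by simp
  define H where "H = real_of_int d + (\<Sum>e\<in>B. \<Sum>u\<in>B. \<bar>real_of_int (X e u)\<bar>) + (\<Sum>e\<in>B. \<Sum>u\<in>B. \<bar>real_of_int (Y e u)\<bar>)"
  have dH: "real_of_int d \<le> H" unfolding H_def by (simp add: sum_nonneg)
  then have H1: "H \<ge> 1" using d by linarith
  have entry: "\<bar>real_of_int (Z e u)\<bar> \<le> (\<Sum>e\<in>B. \<Sum>u\<in>B. \<bar>real_of_int (Z e u)\<bar>)" if "e \<in> B" "u \<in> B" for Z :: "complex \<Rightarrow> complex \<Rightarrow> int" and e u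
  proof -
    have "\<bar>real_of_int (Z e u)\<bar> \<le> (\<Sum>u\<in>B. \<bar>real_of_int (Z e u)\<bar>)" using that B by (intro member_le_sum) auto
    also have "\<dots> \<le> (\<Sum>e\<in>B. \<Sum>u\<in>B. \<bar>real_of_int (Z e u)\<bar>)"
      using that B by (intro member_le_sum[where f = "\<lambda>e. \<Sum>u\<in>B. \<bar>real_of_int (Z e u)\<bar>"]) (auto intro: sum_nonneg)
    finally show ?thesis .
  qed
  have sumX: "(\<Sum>e\<in>B. \<Sum>u\<in>B. \<bar>real_of_int (X e u)\<bar>) \<le> H" and sumY: "(\<Sum>e\<in>B. \<Sum>u\<in>B. \<bar>real_of_int (Y e u)\<bar>) \<le> H"
    unfolding H_def using d by (simp_all add: sum_nonneg)
  have repX: "lattice_rep B (of_int d * \<beta>) X H" unfolding lattice_rep_def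
    using Xr order_trans[OF entry sumX] by blast
  have repY: "lattice_rep B (of_int d * w) Y H" unfolding lattice_rep_def
    using Yr order_trans[OF entry sumY] by blast
  define m where "m = 2 * D + 5"
  define c0 where "c0 = 2 * D * m"
  define C1 where "C1 = 2 * real D ^ 2 * H"
  have C11: "C1 \<ge> 1"
  proof -
    have "1 * 1 \<le> (2 * real D ^ 2) * H" using one_le_power[OF D1', of 2] H1 by (intro mult_mono) auto
    then show ?thesis unfolding C1_def by simp
  qed
  \<comment> \<open>Bound for the matrix of one term of \<open>gxi\<close> multiplied by
    \<open>d ^ (k + q * m)\<close>. The frequency costs \<open>(C1 * q) ^ k\<close>; the power of
    \<open>w\<close> and the powers of \<open>d\<close> that it leaves over cost
    \<open>C1 ^ (q * m)\<close> each; the last two factors \<open>C1\<close> absorb the dimension,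
    which enters once per product of matrices.\<close>
  define KT where "KT q k = (C1 * real q) ^ k * C1 ^ (2 * q * m + 2)" for q k :: nat
  have KT_mono: "KT q k \<le> KT q k'" if "k \<le> k'" "q \<ge> 1" for q k k'
  proof -
    have "1 \<le> C1 * real q" using C11 that mult_mono[of 1 C1 1 "real q"] by simp
    then show ?thesis unfolding KT_def using that C11 by (intro mult_right_mono power_increasing) auto
  qed
  have KT1: "KT q k \<ge> 1" if "q \<ge> 1" for q k
  proof -
    have "1 \<le> C1 * real q" using C11 that mult_mono[of 1 C1 1 "real q"] by simp
    then have "1 \<le> (C1 * real q) ^ k" by (rule one_le_power)
    moreover have "1 \<le> C1 ^ (2 * q * m + 2)" using C11 by (rule one_le_power)
    ultimately have "1 * 1 \<le> (C1 * real q) ^ k * C1 ^ (2 * q * m + 2)" by (rule mult_mono) (use C11 in simp_all)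
    then show ?thesis unfolding KT_def by simp
  qed
  have rep_term: "\<exists>M. lattice_rep B (of_int d ^ (k + q * m) * (gfreq \<beta> ij ^ k * w ^ (snd ij * l))) M (KT q k)"
    if ij: "ij \<in> {..<q} \<times> {..<q}" and l: "l < m" for q k l ij
  proof -
    let ?i = "fst ij" and ?j = "snd ij"
    have ijq: "?i < q" "?j < q" using ij by auto
    have jl: "?j * l \<le> q * m" using ijq l by (intro mult_mono) auto
    have f: "of_int d * gfreq \<beta> ij = of_int (d * int ?i) + of_int (int ?j) * (of_int d * \<beta>)"
      by (simp add: gfreq_def algebra_simps)
    have "lattice_rep B (of_int (int ?j) * (of_int d * \<beta>)) (\<lambda>e u. \<Sum>v\<in>B. X e v * (if v = u then int ?j else 0)) (card B * (H * \<bar>of_int (int ?j)\<bar>))"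
      by (rule lattice_rep_mult[OF B(1) lattice_rep_of_int[OF B(1)] repX])
    from lattice_rep_add[OF lattice_rep_of_int[OF B(1), of "d * int ?i"] this]
    obtain M0 where M0: "lattice_rep B (of_int d * gfreq \<beta> ij) M0 (\<bar>of_int (d * int ?i)\<bar> + card B * (H * \<bar>of_int (int ?j)\<bar>))"
      unfolding f by blast
    have "\<bar>real_of_int (d * int ?i)\<bar> + card B * (H * \<bar>real_of_int (int ?j)\<bar>) \<le> 2 * D * H * q"
    proof -
      have "\<bar>real_of_int (d * int ?i)\<bar> = real_of_int d * real ?i" using d by (simp add: abs_mult)
      also have "\<dots> \<le> H * real q" using dH H1 ijq by (intro mult_mono) auto
      also have "\<dots> \<le> D * (H * q)" using D1' H1 mult_right_mono[OF D1', of "H * q"] by simp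
      finally have 1: "\<bar>real_of_int (d * int ?i)\<bar> \<le> D * (H * q)" .
      have "card B * (H * \<bar>real_of_int (int ?j)\<bar>) \<le> D * (H * q)"
        unfolding D_def using H1 ijq by (intro mult_left_mono) auto
      then show ?thesis using 1 by (simp add: algebra_simps)
    qed
    from lattice_rep_mono[OF M0 this] have M0: "lattice_rep B (of_int d * gfreq \<beta> ij) M0 (2 * D * H * q)" .
    obtain M1 where "lattice_rep B ((of_int d * gfreq \<beta> ij) ^ k) M1 ((card B * (2 * D * H * q)) ^ k)"
      using lattice_rep_power[OF B(1) M0] by blast
    moreover have e: "card B * (2 * D * H * q) = C1 * q" unfolding C1_def D_def[symmetric] by (simp add: power2_eq_square)
    ultimately have M1: "lattice_rep B ((of_int d * gfreq \<beta> ij) ^ k) M1 ((C1 * q) ^ k)" by (simp only: e)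
    have HC: "H \<le> C1"
    proof -
      have "1 \<le> 2 * real D ^ 2" using one_le_power[OF D1', of 2] by linarith
      then have "1 * H \<le> 2 * real D ^ 2 * H" using H1 by (intro mult_right_mono) simp_all
      then show ?thesis unfolding C1_def by simp
    qed
    have DC: "real D \<le> C1"
    proof -
      have "real D \<le> 2 * real D ^ 2" using self_le_power[OF D1', of 2] zero_le_power2[of "real D"] by linarith
      then have "real D * 1 \<le> (2 * real D ^ 2) * H" using H1 by (intro mult_mono) simp_all
      then show ?thesis unfolding C1_def by simp
    qed
    have DHC: "real D * H \<le> C1" unfolding C1_def
      using D1' H1 self_le_power[OF D1', of 2] zero_le_power2[of "real D"] by (intro mult_right_mono) linarith+
    obtain M2 where "lattice_rep B ((of_int d * w) ^ (?j * l)) M2 ((card B * H) ^ (?j * l))"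
      using lattice_rep_power[OF B(1) repY] by blast
    moreover have "(card B * H) ^ (?j * l) \<le> C1 ^ (q * m)"
    proof -
      have "(card B * H) ^ (?j * l) \<le> C1 ^ (?j * l)" unfolding D_def[symmetric] using DHC H1 by (intro power_mono) auto
      also have "\<dots> \<le> C1 ^ (q * m)" using jl C11 by (intro power_increasing) auto
      finally show ?thesis .
    qed
    ultimately have M2: "lattice_rep B ((of_int d * w) ^ (?j * l)) M2 (C1 ^ (q * m))"
      by (rule lattice_rep_mono)
    have M3: "lattice_rep B (of_int (d ^ (q * m - ?j * l))) (\<lambda>e u. if e = u then d ^ (q * m - ?j * l) else 0) (C1 ^ (q * m))"
    proof (rule lattice_rep_mono[OF lattice_rep_of_int[OF B(1)]])
      have "\<bar>real_of_int (d ^ (q * m - ?j * l))\<bar> = real_of_int d ^ (q * m - ?j * l)" using d by simp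
      also have "\<dots> \<le> C1 ^ (q * m - ?j * l)" using d dH HC by (intro power_mono) auto
      also have "\<dots> \<le> C1 ^ (q * m)" using C11 by (intro power_increasing) auto
      finally show "\<bar>real_of_int (d ^ (q * m - ?j * l))\<bar> \<le> C1 ^ (q * m)" .
    qed
    obtain M4 where M4: "lattice_rep B ((of_int d * gfreq \<beta> ij) ^ k * ((of_int d * w) ^ (?j * l) * of_int (d ^ (q * m - ?j * l)))) M4
      (card B * ((card B * (C1 ^ (q * m) * C1 ^ (q * m))) * (C1 * q) ^ k))"
      using lattice_rep_mult[OF B(1) M1 lattice_rep_mult[OF B(1) M2 M3]] by blast
    have "of_int d ^ (k + q * m) * (gfreq \<beta> ij ^ k * w ^ (?j * l)) =
      (of_int d * gfreq \<beta> ij) ^ k * ((of_int d * w) ^ (?j * l) * of_int (d ^ (q * m - ?j * l)))"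
    proof -
      have "of_int d ^ (q * m) = (of_int d ^ (?j * l) * of_int d ^ (q * m - ?j * l) :: complex)"
        using jl by (simp flip: power_add)
      then show ?thesis by (simp add: power_add power_mult_distrib mult_ac)
    qed
    moreover have "card B * ((card B * (C1 ^ (q * m) * C1 ^ (q * m))) * (C1 * q) ^ k) \<le> KT q k"
    proof -
      have e: "C1 ^ (q * m) * C1 ^ (q * m) = C1 ^ (2 * q * m)" by (simp only: power_add[symmetric] mult_2 distrib_right)
      have "card B * ((card B * (C1 ^ (q * m) * C1 ^ (q * m))) * (C1 * q) ^ k) = (real D * real D) * (C1 ^ (2 * q * m) * (C1 * q) ^ k)"
        unfolding e D_def by simp
      also have "\<dots> \<le> (C1 * C1) * (C1 ^ (2 * q * m) * (C1 * q) ^ k)"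
        using DC C11 by (intro mult_right_mono mult_mono) auto
      also have "\<dots> = KT q k" unfolding KT_def by (simp add: power_add power2_eq_square)
      finally show ?thesis .
    qed
    ultimately show ?thesis using lattice_rep_mono[OF M4] by metis
  qed
  obtain cl where cl: "cl > 0" and liou: "\<And>x M K. lattice_rep B x M K \<Longrightarrow> K \<ge> 1 \<Longrightarrow> x \<noteq> 0 \<Longrightarrow> cl \<le> cmod x * K ^ card B"
    using lattice_liouville[OF B] by blast
  define bb where "bb = 2 * pi * (1 + cmod \<beta>)"
  have bb0: "bb \<ge> 0" unfolding bb_def by simp
  obtain h0 :: nat where h0: "\<And>(h::nat) (q::nat) (n::nat) (r::nat) X x \<xi>. h \<ge> h0 \<Longrightarrow> h \<ge> 1 \<Longrightarrow> real q = real c0 * h \<Longrightarrow> real n = real c0 * h^2 \<Longrightarrow> n \<le> r \<Longrightarrow>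
     0 \<le> X \<Longrightarrow> X \<le> 2 * real q^2 * ((C1 * q) ^ n * C1 ^ (2*q*m+2)) \<Longrightarrow>
     0 \<le> \<xi> \<Longrightarrow> \<xi> \<le> fact r * real m ^ (m * r) * (real q^2 * (X * exp (bb * q * (r / q))) * (2 / (r / q)) ^ (m * r)) \<Longrightarrow>
     x \<le> H ^ (r + q * m) * \<xi> \<Longrightarrow>
     cl \<le> x * (real q^2 * (D * (X * ((C1 * q) ^ r * C1 ^ (2*q*m+2))))) ^ D \<Longrightarrow> False"
    using gelfond_numeric[OF cl D1 m_def H1 C11 arg_cong[OF c0_def, of real] bb0] by blast
  \<comment> \<open>\<open>r\<close> will be at least \<open>n = q * h\<close>, so the entry
    \<open>2 * m\<close> makes the radius \<open>r / q\<close> large enough for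
    \<open>gxi_upper\<close>.\<close>
  define h where "h = max h0 (2 * m)"
  \<comment> \<open>\<open>q ^ 2 = c0 * n = 2 * (D * m * n)\<close>: twice as many coefficients as
    equations.\<close>
  define q where "q = c0 * h"
  define n where "n = c0 * h ^ 2"
  have hh: "h \<ge> h0" "h \<ge> 2 * m" "h \<ge> 1" unfolding h_def m_def by auto
  have c01: "c0 \<ge> 1" unfolding c0_def m_def using D1 by (simp add: Suc_le_eq)
  have q1: "q \<ge> 1" unfolding q_def using c01 hh by (simp add: Suc_le_eq)
  have n1: "n \<ge> 1" unfolding n_def using c01 hh by (simp add: Suc_le_eq)
  let ?I = "{..<q} \<times> {..<q}"
  have "\<forall>k l ij. \<exists>M. ij \<in> ?I \<longrightarrow> l < m \<longrightarrow> lattice_rep B (of_int d ^ (k + q * m) * (gfreq \<beta> ij ^ k * w ^ (snd ij * l))) M (KT q k)"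
    using rep_term by blast
  then obtain M where M: "\<And>k l ij. ij \<in> ?I \<Longrightarrow> l < m \<Longrightarrow>
     lattice_rep B (of_int d ^ (k + q * m) * (gfreq \<beta> ij ^ k * w ^ (snd ij * l))) (M k l ij) (KT q k)"
    by metis
  obtain e0 where e0: "e0 \<in> B" using B by blast
  have e00: "e0 \<noteq> 0"
  proof
    assume "e0 = 0"
    then have "(\<Sum>u\<in>B. of_int (if u = e0 then 1 else 0) * u) = 0"
      by (intro sum.neutral) auto
    then show False using B(3)[unfolded int_indep_def, rule_format, of "\<lambda>u. if u = e0 then 1 else 0" e0] e0 by simp
  qed
  define Kn where "Kn = nat \<lceil>KT q n\<rceil>"
  have Kn: "KT q n \<le> real Kn" "real Kn \<le> 2 * KT q n" using KT1[OF q1, of n] unfolding Kn_def by linarith+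
  \<comment> \<open>One equation for each order, each point and each coordinate. The matrix row of a
    single basis element \<open>e0\<close> is enough: if the product of a number with the nonzero
    \<open>e0\<close> has zero coordinates, the number is zero.\<close>
  define E where "E = {..<n} \<times> {..<m} \<times> B"
  have "\<exists>p. (\<exists>i\<in>?I. p i \<noteq> 0) \<and> (\<forall>i\<in>?I. \<bar>p i\<bar> \<le> int (card ?I * Kn)) \<and>
    (\<forall>e\<in>E. (\<Sum>i\<in>?I. (case e of (k,l,u) \<Rightarrow> \<lambda>ij. M k l ij e0 u) i * p i) = 0)"
  proof (rule siegel_lemma)
    show "finite E" "finite ?I" unfolding E_def using B by auto
    show "E \<noteq> {}" unfolding E_def using B n1 m_def by (auto simp: lessThan_empty_iff)
    show "card ?I = 2 * card E" unfolding E_def q_def n_def c0_def D_def by (simp add: card_cartesian_product power2_eq_square)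
    show "Kn \<ge> 1" using Kn(1) KT1[OF q1, of n] by linarith
    fix e ij assume e: "e \<in> E" and ij: "ij \<in> ?I"
    obtain k l u where klu: "e = (k,l,u)" "k < n" "l < m" "u \<in> B" using e unfolding E_def by auto
    have "\<bar>real_of_int (M k l ij e0 u)\<bar> \<le> KT q k" using M[OF ij klu(3)] e0 klu unfolding lattice_rep_def by blast
    also have "\<dots> \<le> KT q n" using klu q1 by (intro KT_mono) auto
    finally have "\<bar>real_of_int (M k l ij e0 u)\<bar> \<le> real Kn" using Kn by linarith
    then show "\<bar>(case e of (k,l,u) \<Rightarrow> \<lambda>ij. M k l ij e0 u) ij\<bar> \<le> int Kn" unfolding klu by simp
  qed
  then obtain p where p0: "\<exists>i\<in>?I. p i \<noteq> 0" and pb: "\<forall>i\<in>?I. \<bar>p i\<bar> \<le> int (card ?I * Kn)"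
    and pE: "\<forall>e\<in>E. (\<Sum>i\<in>?I. (case e of (k,l,u) \<Rightarrow> \<lambda>ij. M k l ij e0 u) i * p i) = 0" by blast
  define P where "P = real (card ?I * Kn)"
  have P: "\<bar>real_of_int (p ij)\<bar> \<le> P" if "ij \<in> ?I" for ij
    using pb[rule_format, OF that] unfolding P_def by linarith
  have cardI: "card ?I = q ^ 2" by (simp add: card_cartesian_product power2_eq_square)
  have PX: "P \<le> 2 * real q^2 * ((C1 * q) ^ n * C1 ^ (2*q*m+2))"
    unfolding P_def cardI using Kn(2) mult_left_mono[OF Kn(2), of "real q ^ 2"] by (simp add: KT_def mult_ac)
  have P1: "P \<ge> 1"
  proof -
    have "Kn \<ge> 1" using Kn(1) KT1[OF q1, of n] by linarith
    then have "card ?I * Kn \<ge> 1" unfolding cardI using q1 by (simp add: Suc_le_eq)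
    then show ?thesis unfolding P_def by linarith
  qed
  have rep_xi: "\<exists>N. lattice_rep B (of_int d ^ (k + q * m) * gxi \<beta> w q p k l) N (real q^2 * (D * (P * KT q k)))"
    if l: "l < m" for k l
  proof -
    let ?x = "\<lambda>ij. of_int d ^ (k + q * m) * (gfreq \<beta> ij ^ k * w ^ (snd ij * l))"
    have "\<exists>N. lattice_rep B (of_int (p ij) * ?x ij) N (D * (P * KT q k))" if ij: "ij \<in> ?I" for ij
    proof -
      have "lattice_rep B (of_int (p ij)) (\<lambda>e u. if e = u then p ij else 0) P"
        by (rule lattice_rep_mono[OF lattice_rep_of_int[OF B(1)] P[OF ij]])
      note rep = lattice_rep_mult[OF B(1) this M[OF ij l, of k]]
      have "card B * (KT q k * P) \<le> D * (P * KT q k)" unfolding D_def by simp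
      from lattice_rep_mono[OF rep this] show ?thesis by blast
    qed
    then obtain N where NN: "\<And>ij. ij \<in> ?I \<Longrightarrow> lattice_rep B (of_int (p ij) * ?x ij) (N ij) (D * (P * KT q k))"
      using bchoice[of ?I "\<lambda>ij N. lattice_rep B (of_int (p ij) * ?x ij) N (D * (P * KT q k))"] by blast
    have "lattice_rep B (\<Sum>ij\<in>?I. of_int (p ij) * ?x ij) (\<lambda>e u. \<Sum>ij\<in>?I. N ij e u) (\<Sum>ij\<in>?I. D * (P * KT q k))"
      by (rule lattice_rep_sum[OF _ B(1) NN]) simp_all
    moreover have "(\<Sum>ij\<in>?I. of_int (p ij) * ?x ij) = of_int d ^ (k + q * m) * gxi \<beta> w q p k l"
      unfolding gxi_def[OF w_def] sum_distrib_left by (intro sum.cong refl) (simp add: mult_ac)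
    moreover have "(\<Sum>ij\<in>?I. D * (P * KT q k)) = real q^2 * (D * (P * KT q k))" by (simp add: cardI)
    ultimately have "lattice_rep B (of_int d ^ (k + q * m) * gxi \<beta> w q p k l) (\<lambda>e u. \<Sum>ij\<in>?I. N ij e u) (real q^2 * (D * (P * KT q k)))"
      by (simp only:)
    then show ?thesis by blast
  qed
  have vanish: "gxi \<beta> w q p k l = 0" if kl: "k < n" "l < m" for k l
  proof -
    let ?x = "\<lambda>ij. of_int d ^ (k + q * m) * (gfreq \<beta> ij ^ k * w ^ (snd ij * l))"
    have "of_int d ^ (k + q * m) * gxi \<beta> w q p k l * e0 = (\<Sum>ij\<in>?I. of_int (p ij) * (?x ij * e0))"
      unfolding gxi_def[OF w_def] sum_distrib_left sum_distrib_right by (intro sum.cong refl) (simp add: mult_ac)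
    also have "\<dots> = (\<Sum>ij\<in>?I. of_int (p ij) * (\<Sum>u\<in>B. of_int (M k l ij e0 u) * u))"
    proof (rule sum.cong[OF refl])
      fix ij assume "ij \<in> ?I"
      then have "?x ij * e0 = (\<Sum>u\<in>B. of_int (M k l ij e0 u) * u)"
        using M[OF _ kl(2), of ij k] e0 unfolding lattice_rep_def by blast
      then show "of_int (p ij) * (?x ij * e0) = of_int (p ij) * (\<Sum>u\<in>B. of_int (M k l ij e0 u) * u)" by (simp only:)
    qed
    also have "\<dots> = (\<Sum>u\<in>B. of_int (\<Sum>ij\<in>?I. M k l ij e0 u * p ij) * u)"
      unfolding sum_distrib_left of_int_sum sum_distrib_right
      by (subst sum.swap) (intro sum.cong refl, simp add: mult_ac)
    also have "\<dots> = 0"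
    proof (rule sum.neutral, rule ballI)
      fix u assume u: "u \<in> B"
      have "(k, l, u) \<in> E" unfolding E_def using kl u by simp
      from pE[rule_format, OF this] show "of_int (\<Sum>ij\<in>?I. M k l ij e0 u * p ij) * u = 0" by simp
    qed
    finally show ?thesis using e00 d by simp
  qed
  have inj: "inj_on (gfreq \<beta>) ?I"
  proof (rule inj_onI)
    fix a b assume "a \<in> ?I" "b \<in> ?I" and eq: "gfreq \<beta> a = gfreq \<beta> b"
    have e: "(of_int (int (snd a) - int (snd b))) * \<beta> = of_int (int (fst b) - int (fst a))"
      using eq by (simp add: gfreq_def algebra_simps)
    show "a = b"
    proof (cases "snd a = snd b")
      case True
      then have "(of_int (int (fst b) - int (fst a)) :: complex) = 0" using e by simp
      then have "fst a = fst b" by (simp only: of_int_eq_0_iff)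
      then show ?thesis using True by (simp add: prod_eq_iff)
    next
      case False
      then have "(of_int (int (snd a) - int (snd b)) :: complex) \<noteq> 0" by (simp only: of_int_eq_0_iff)
      then have "\<beta> = of_int (int (fst b) - int (fst a)) / of_int (int (snd a) - int (snd b))"
        using e by (metis nonzero_mult_div_cancel_left)
      then have "\<beta> \<in> \<rat>" by (metis Rats_divide Rats_of_int)
      then show ?thesis using irr by simp
    qed
  qed
  \<comment> \<open>The point 0 alone decides this. There the \<open>gxi\<close> are power sums of
    the frequencies with weights \<open>p\<close>, and the frequencies are distinct because \<beta>
    is irrational.\<close>
  have ex: "\<exists>k l. l < m \<and> gxi \<beta> w q p k l \<noteq> 0"
  proof (rule ccontr)
    assume c: "\<not> ?thesis"
    have "gxi \<beta> w q p k 0 = 0" for k using c m_def by auto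
    then have z: "(\<Sum>ij\<in>?I. of_int (p ij) * gfreq \<beta> ij ^ k) = 0" for k
      unfolding gxi_def[OF w_def] by simp
    obtain i where i: "i \<in> ?I" "p i \<noteq> 0" using p0 by blast
    have "(of_int (p i) :: complex) = 0"
      by (rule power_sums_zero_imp_zero[where s = "gfreq \<beta>" and I = ?I and p = "\<lambda>i. of_int (p i)"]) (use z inj i in auto)
    then show False using i by simp
  qed
  define r where "r = (LEAST k. \<exists>l. l < m \<and> gxi \<beta> w q p k l \<noteq> 0)"
  obtain l where l: "l < m" "gxi \<beta> w q p r l \<noteq> 0"
    using LeastI_ex[OF ex] unfolding r_def by blast
  have below: "gxi \<beta> w q p k l' = 0" if "k < r" "l' < m" for k l'
    using not_less_Least[of k "\<lambda>k. \<exists>l. l < m \<and> gxi \<beta> w q p k l \<noteq> 0"] that unfolding r_def by blast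
  have nr: "n \<le> r"
  proof (rule ccontr)
    assume "\<not> n \<le> r"
    then show False using vanish[of r l] l by simp
  qed
  obtain N where N: "lattice_rep B (of_int d ^ (r + q * m) * gxi \<beta> w q p r l) N (real q^2 * (D * (P * KT q r)))"
    using rep_xi[OF l(1)] by blast
  have K1: "real q^2 * (D * (P * KT q r)) \<ge> 1"
  proof -
    have "1 * (1 * (1 * 1)) \<le> real q^2 * (D * (P * KT q r))"
      using q1 D1' P1 KT1[OF q1, of r] by (intro mult_mono) (auto simp: one_le_power)
    then show ?thesis by simp
  qed
  have Rm: "2 * real m \<le> real r / real q"
  proof -
    have "2 * real m * real q \<le> real h * real q" using hh by (intro mult_right_mono) auto
    also have "\<dots> = real n" unfolding q_def n_def by (simp add: power2_eq_square)
    also have "\<dots> \<le> real r" using nr by simp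
    finally show ?thesis using q1 by (simp add: field_simps)
  qed
  have up: "cmod (gxi \<beta> w q p r l) \<le> fact r * real m ^ (m * r) *
    (real (q^2) * (P * exp (2 * pi * (q * (1 + cmod \<beta>)) * (r / q))) * (2 / (r / q)) ^ (m * r))"
    by (rule gxi_upper[OF w_def below l(1) P Rm]) auto
  show False
  proof (rule h0[of h q n r P "cmod (gxi \<beta> w q p r l)" "cmod (of_int d ^ (r + q * m) * gxi \<beta> w q p r l)"])
    show "h0 \<le> h" "1 \<le> h" "n \<le> r" using hh nr by auto
    show "real q = real c0 * real h" unfolding q_def by simp
    show "real n = real c0 * real (h^2)" unfolding n_def by simp
    show "0 \<le> P" using P1 by simp
    show "P \<le> 2 * (real q)^2 * ((C1 * real q) ^ n * C1 ^ (2 * q * m + 2))" by (rule PX)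
    show "0 \<le> cmod (gxi \<beta> w q p r l)" by simp
    show "cmod (gxi \<beta> w q p r l) \<le> fact r * real m ^ (m * r) *
      ((real q)^2 * (P * exp (bb * real q * (real r / real q))) * (2 / (real r / real q)) ^ (m * r))"
    proof -
      have "2 * pi * (q * (1 + cmod \<beta>)) * (r / q) = bb * real q * (real r / real q)" by (simp add: bb_def)
      then show ?thesis using up by (simp only: of_nat_power)
    qed
    have "cmod (of_int d ^ (r + q * m)) \<le> H ^ (r + q * m)"
      unfolding norm_power using d dH by (intro power_mono) auto
    then show "cmod (of_int d ^ (r + q * m) * gxi \<beta> w q p r l) \<le> H ^ (r + q * m) * cmod (gxi \<beta> w q p r l)"
      unfolding norm_mult by (rule mult_right_mono) simp
    show "cl \<le> cmod (of_int d ^ (r + q * m) * gxi \<beta> w q p r l) *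
      ((real q)^2 * (real D * (P * ((C1 * real q) ^ r * C1 ^ (2 * q * m + 2))))) ^ D"
    proof -
      have "of_int d ^ (r + q * m) * gxi \<beta> w q p r l \<noteq> 0" using l(2) d by simp
      from liou[OF N K1 this] show ?thesis unfolding KT_def D_def .
    qed
  qed
qed

section \<open>Algebraicity of the exponent of a P-recursive sequence\<close>

text \<open>The beta function at \<open>s\<close> and \<open>n + 1\<close>, that is the integral of
  \<open>x powr (s - 1) * (1 - x) ^ n\<close> over the unit interval. A series in these terms is a
  Mellin transform of the generating function of its coefficients taken at \<open>1 - x\<close>,
  which is why a recurrence in \<open>n\<close> becomes a difference equation in
  \<open>s\<close>.\<close>

definition bk :: "'a::field_char_0 \<Rightarrow> nat \<Rightarrow> 'a" where
  "bk s n = fact n / pochhammer s (Suc n)"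

lemma pochhammer_not_Ints: "(s::complex) \<notin> \<int> \<Longrightarrow> pochhammer s n \<noteq> 0"
  by (metis Ints_minus Ints_of_nat pochhammer_eq_0_iff)

text \<open>Under the integral this is
  \<open>(1 - x) ^ Suc n = (1 - x) ^ n - x * (1 - x) ^ n\<close>: raising the index is a difference
  in the argument.\<close>

lemma bk_shift_index:
  assumes "(s::complex) \<notin> \<int>"
  shows "bk s (Suc n) = bk s n - bk (s + 1) n"
proof -
  have p1: "pochhammer s (Suc (Suc n)) = pochhammer s (Suc n) * (s + of_nat (Suc n))" by (rule pochhammer_Suc)
  have p2: "pochhammer s (Suc (Suc n)) = s * pochhammer (s + 1) (Suc n)" by (rule pochhammer_rec)
  have nz: "pochhammer s (Suc n) \<noteq> 0" "pochhammer s (Suc (Suc n)) \<noteq> 0" "s \<noteq> 0"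
    using assms pochhammer_not_Ints by auto
  have nz': "s + of_nat (Suc n) \<noteq> 0" using nz(2) unfolding p1 by simp
  have nz2: "pochhammer (s + 1) (Suc n) \<noteq> 0" using nz(2) unfolding p2 by simp
  have a: "bk s n = fact n * (s + of_nat (Suc n)) / pochhammer s (Suc (Suc n))"
    unfolding bk_def p1 using nz nz' by simp
  have b: "bk (s + 1) n = fact n * s / pochhammer s (Suc (Suc n))"
    unfolding bk_def p2 using nz nz2 by simp
  have c: "bk s (Suc n) = fact n * of_nat (Suc n) / pochhammer s (Suc (Suc n))"
    unfolding bk_def by (simp add: mult.commute)
  show ?thesis unfolding a b c by (simp add: diff_divide_distrib[symmetric] algebra_simps)
qed

text \<open>Rests on the contiguity relation \<open>s * bk s n = (s + n + 1) * bk (s + 1) n\<close>.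
  A factor \<open>n\<close> can be expressed only at the shifted argument; this is the origin of the
  shift \<open>e\<close> in \<open>bk_rep\<close>.\<close>

lemma bk_mult_index:
  assumes "(s::complex) \<notin> \<int>"
  shows "of_nat n * bk (s + 1) n = s * bk s n - (s + 1) * bk (s + 1) n"
proof -
  have p1: "s * pochhammer (s + 1) (Suc n) = pochhammer s (Suc n) * (s + of_nat (Suc n))"
    using pochhammer_rec[of s "Suc n"] pochhammer_Suc[of s "Suc n"] by simp
  have nz: "pochhammer s (Suc n) \<noteq> 0" "s \<noteq> 0"
    using assms pochhammer_not_Ints by auto
  have nz2: "pochhammer (s + 1) (Suc n) \<noteq> 0"
    using pochhammer_not_Ints[OF assms, of "Suc (Suc n)"] pochhammer_rec[of s "Suc n"] by auto
  have "s * bk s n = (s + of_nat (Suc n)) * bk (s + 1) n"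
    unfolding bk_def times_divide_eq_right
    by (subst frac_eq_eq[OF nz(1) nz2]) (use arg_cong[OF p1, of "\<lambda>x. fact n * x"] in \<open>simp only: mult_ac\<close>)
  then show ?thesis by (simp add: algebra_simps)
qed

section \<open>Difference operators with rational polynomial coefficients\<close>

definition ev :: "rat poly \<Rightarrow> complex \<Rightarrow> complex" where
  "ev p s = poly (map_poly of_rat p) s"

lemma ev_0 [simp]: "ev 0 s = 0" by (simp add: ev_def)

lemma ev_pCons [simp]: "ev (pCons a p) s = of_rat a + s * ev p s"
  unfolding ev_def by (subst map_poly_pCons) auto

lemma ev_add [simp]: "ev (p + q) s = ev p s + ev q s"
  by (induction p q rule: poly_induct2) (auto simp: of_rat_add algebra_simps)

lemma ev_uminus [simp]: "ev (- p) s = - ev p s"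
  using ev_add[of "-p" p s] by (simp add: eq_neg_iff_add_eq_0)

lemma ev_diff [simp]: "ev (p - q) s = ev p s - ev q s"
  using ev_add[of p "-q" s] by simp

lemma ev_smult [simp]: "ev (Polynomial.smult a p) s = of_rat a * ev p s"
  by (induction p) (auto simp: of_rat_mult algebra_simps)

lemma ev_mult [simp]: "ev (p * q) s = ev p s * ev q s"
  by (induction p) (auto simp: algebra_simps)

lemma ev_pcompose_shift [simp]: "ev (p \<circ>\<^sub>p [:a, 1:]) s = ev p (s + of_rat a)"
  by (induction p) (auto simp: pcompose_pCons algebra_simps)

lemma ev_holomorphic: "ev p holomorphic_on A"
  unfolding ev_def by (intro holomorphic_intros)

lemma ev_nonzero_roots:
  assumes "p \<noteq> 0" shows "map_poly of_rat p \<noteq> (0 :: complex poly)"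
  using assms by (metis coeff_map_poly leading_coeff_0_iff of_rat_0 of_rat_eq_0_iff poly_eqI coeff_0)

lemma ev_root_algebraic:
  assumes "p \<noteq> 0" "ev p s = 0" shows "algebraic s"
  unfolding algebraic_altdef
  using assms ev_nonzero_roots[of p] by (intro exI[of _ "map_poly of_rat p"]) (auto simp: ev_def coeff_map_poly)

text \<open>After translation of the argument by \<open>e\<close>, \<open>F\<close> is a combination
  of shifted terms whose coefficients are rational polynomials in \<open>s\<close> and do not depend
  on \<open>n\<close>; so the identity survives multiplication by \<open>b n\<close> and summation
  over \<open>n\<close>. Integers are excluded because denominators may vanish there and division by
  zero returns zero.\<close>

definition bk_rep :: "(complex \<Rightarrow> nat \<Rightarrow> complex) \<Rightarrow> nat \<Rightarrow> bool" where
  "bk_rep F e \<longleftrightarrow> (\<exists>N c. \<forall>s n. s \<notin> \<int> \<longrightarrow>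
     F (s + of_nat e) n = (\<Sum>i\<le>N. ev (c i) s * bk (s + of_nat i) n))"

lemma add_Ints_iff: "s + of_nat i \<in> \<int> \<longleftrightarrow> (s::complex) \<in> \<int>"
  by simp

lemma bk_rep_self: "bk_rep bk 0"
  unfolding bk_rep_def by (intro exI[of _ 0] exI[of _ "\<lambda>_. [:1:]"]) auto

lemma bk_rep_raise:
  assumes "bk_rep F e" shows "bk_rep F (Suc e)"
proof -
  obtain N c where c: "\<And>s n. s \<notin> \<int> \<Longrightarrow> F (s + of_nat e) n = (\<Sum>i\<le>N. ev (c i) s * bk (s + of_nat i) n)"
    using assms unfolding bk_rep_def by blast
  define c' where "c' i = (if i = 0 then 0 else c (i - 1) \<circ>\<^sub>p [:1, 1:])" for i
  have "F (s + of_nat (Suc e)) n = (\<Sum>i\<le>Suc N. ev (c' i) s * bk (s + of_nat i) n)" if s: "s \<notin> \<int>" for s n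
  proof -
    have "F (s + of_nat (Suc e)) n = (\<Sum>i\<le>N. ev (c i) (s + 1) * bk (s + 1 + of_nat i) n)"
      using c[of "s + 1" n] s add_Ints_iff[of s 1] by (simp add: add_ac)
    also have "\<dots> = (\<Sum>i\<le>N. ev (c' (Suc i)) s * bk (s + of_nat (Suc i)) n)"
      by (simp add: c'_def add_ac)
    also have "\<dots> = (\<Sum>i\<le>Suc N. ev (c' i) s * bk (s + of_nat i) n)"
      by (subst sum.atMost_Suc_shift) (simp add: c'_def)
    finally show ?thesis .
  qed
  then show ?thesis unfolding bk_rep_def by (intro exI[of _ "Suc N"] exI[of _ c']) blast
qed

lemma bk_rep_mono:
  assumes "bk_rep F e" "e \<le> e'" shows "bk_rep F e'"
  using assms(2,1) by (induction e' rule: dec_induct) (auto intro: bk_rep_raise)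

lemma bk_rep_add:
  assumes "bk_rep F e" "bk_rep G e"
  shows "bk_rep (\<lambda>s n. F s n + G s n) e"
proof -
  obtain N c where c: "\<And>s n. s \<notin> \<int> \<Longrightarrow> F (s + of_nat e) n = (\<Sum>i\<le>N. ev (c i) s * bk (s + of_nat i) n)"
    using assms unfolding bk_rep_def by blast
  obtain L d where d: "\<And>s n. s \<notin> \<int> \<Longrightarrow> G (s + of_nat e) n = (\<Sum>i\<le>L. ev (d i) s * bk (s + of_nat i) n)"
    using assms unfolding bk_rep_def by blast
  define K where "K = max N L"
  define c' where "c' i = (if i \<le> N then c i else 0)" for i
  define d' where "d' i = (if i \<le> L then d i else 0)" for i
  have 1: "(\<Sum>i\<le>N. ev (c i) s * bk (s + of_nat i) n) = (\<Sum>i\<le>K. ev (c' i) s * bk (s + of_nat i) n)" for s n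
    unfolding c'_def K_def by (intro sum.mono_neutral_cong_left) auto
  have 2: "(\<Sum>i\<le>L. ev (d i) s * bk (s + of_nat i) n) = (\<Sum>i\<le>K. ev (d' i) s * bk (s + of_nat i) n)" for s n
    unfolding d'_def K_def by (intro sum.mono_neutral_cong_left) auto
  have "F (s + of_nat e) n + G (s + of_nat e) n = (\<Sum>i\<le>K. ev (c' i + d' i) s * bk (s + of_nat i) n)"
    if "s \<notin> \<int>" for s n
    unfolding c[OF that] d[OF that] 1 2 by (simp add: sum.distrib algebra_simps)
  then show ?thesis unfolding bk_rep_def by (intro exI[of _ K] exI[of _ "\<lambda>i. c' i + d' i"]) blast
qed

lemma bk_rep_scale:
  assumes "bk_rep F e" shows "bk_rep (\<lambda>s n. of_rat a * F s n) e"
proof -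
  obtain N c where c: "\<And>s n. s \<notin> \<int> \<Longrightarrow> F (s + of_nat e) n = (\<Sum>i\<le>N. ev (c i) s * bk (s + of_nat i) n)"
    using assms unfolding bk_rep_def by blast
  then show ?thesis unfolding bk_rep_def
    by (intro exI[of _ N] exI[of _ "\<lambda>i. Polynomial.smult a (c i)"]) (simp add: sum_distrib_left mult.assoc)
qed

lemma bk_rep_Suc:
  assumes "bk_rep F e" shows "bk_rep (\<lambda>s n. F s (Suc n)) e"
proof -
  obtain N c where c: "\<And>s n. s \<notin> \<int> \<Longrightarrow> F (s + of_nat e) n = (\<Sum>i\<le>N. ev (c i) s * bk (s + of_nat i) n)"
    using assms unfolding bk_rep_def by blast
  define c1 where "c1 i = (if i \<le> N then c i else 0)" for i
  define c2 where "c2 i = (if i = 0 then 0 else c (i - 1))" for i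
  have "F (s + of_nat e) (Suc n) = (\<Sum>i\<le>Suc N. ev (c1 i - c2 i) s * bk (s + of_nat i) n)" if s: "s \<notin> \<int>" for s n
  proof -
    have "F (s + of_nat e) (Suc n) = (\<Sum>i\<le>N. ev (c i) s * (bk (s + of_nat i) n - bk (s + of_nat (Suc i)) n))"
      unfolding c[OF s] by (intro sum.cong refl, subst bk_shift_index) (use s in \<open>auto simp: add_ac\<close>)
    also have "\<dots> = (\<Sum>i\<le>N. ev (c i) s * bk (s + of_nat i) n) - (\<Sum>i\<le>N. ev (c i) s * bk (s + of_nat (Suc i)) n)"
      by (simp add: algebra_simps sum_subtractf)
    also have "(\<Sum>i\<le>N. ev (c i) s * bk (s + of_nat i) n) = (\<Sum>i\<le>Suc N. ev (c1 i) s * bk (s + of_nat i) n)"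
      unfolding c1_def by (intro sum.mono_neutral_cong_left) auto
    also have "(\<Sum>i\<le>N. ev (c i) s * bk (s + of_nat (Suc i)) n) = (\<Sum>i\<le>Suc N. ev (c2 i) s * bk (s + of_nat i) n)"
      by (subst sum.atMost_Suc_shift) (simp add: c2_def)
    finally show ?thesis by (simp add: sum_subtractf left_diff_distrib)
  qed
  then show ?thesis unfolding bk_rep_def by (intro exI[of _ "Suc N"] exI[of _ "\<lambda>i. c1 i - c2 i"]) blast
qed

lemma bk_rep_mult_index:
  assumes "bk_rep F e" shows "bk_rep (\<lambda>s n. of_nat n * F s n) (Suc e)"
proof -
  obtain N c where c: "\<And>s n. s \<notin> \<int> \<Longrightarrow> F (s + of_nat e) n = (\<Sum>i\<le>N. ev (c i) s * bk (s + of_nat i) n)"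
    using assms unfolding bk_rep_def by blast
  define d where "d i = c i \<circ>\<^sub>p [:1, 1:]" for i
  define c1 where "c1 i = (if i \<le> N then d i * [:of_nat i, 1:] else 0)" for i
  define c2 where "c2 i = (if i = 0 then 0 else d (i - 1) * [:of_nat i, 1:])" for i
  have "of_nat n * F (s + of_nat (Suc e)) n = (\<Sum>i\<le>Suc N. ev (c1 i - c2 i) s * bk (s + of_nat i) n)" if s: "s \<notin> \<int>" for s n
  proof -
    have "F (s + of_nat (Suc e)) n = (\<Sum>i\<le>N. ev (c i) (s + 1) * bk (s + 1 + of_nat i) n)"
      using c[of "s + 1" n] s add_Ints_iff[of s 1] by (simp add: add_ac)
    then have "of_nat n * F (s + of_nat (Suc e)) n = (\<Sum>i\<le>N. ev (d i) s * (of_nat n * bk (s + of_nat i + 1) n))"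
      by (simp add: d_def sum_distrib_left mult_ac add_ac)
    also have "\<dots> = (\<Sum>i\<le>N. ev (d i) s * ((s + of_nat i) * bk (s + of_nat i) n - (s + of_nat (Suc i)) * bk (s + of_nat (Suc i)) n))"
      by (intro sum.cong refl, subst bk_mult_index) (use s in \<open>auto simp: add_ac\<close>)
    also have "\<dots> = (\<Sum>i\<le>N. (ev (d i) s * (s + of_nat i)) * bk (s + of_nat i) n) - (\<Sum>i\<le>N. (ev (d i) s * (s + of_nat (Suc i))) * bk (s + of_nat (Suc i)) n)"
      by (simp add: algebra_simps sum_subtractf)
    also have "(\<Sum>i\<le>N. (ev (d i) s * (s + of_nat i)) * bk (s + of_nat i) n) = (\<Sum>i\<le>Suc N. ev (c1 i) s * bk (s + of_nat i) n)"
      unfolding c1_def by (intro sum.mono_neutral_cong_left) (auto simp: algebra_simps)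
    also have "(\<Sum>i\<le>N. (ev (d i) s * (s + of_nat (Suc i))) * bk (s + of_nat (Suc i)) n) = (\<Sum>i\<le>Suc N. ev (c2 i) s * bk (s + of_nat i) n)"
      by (subst sum.atMost_Suc_shift) (simp add: c2_def of_rat_add algebra_simps)
    finally show ?thesis by (simp add: sum_subtractf left_diff_distrib)
  qed
  then show ?thesis unfolding bk_rep_def by (intro exI[of _ "Suc N"] exI[of _ "\<lambda>i. c1 i - c2 i"]) blast
qed

lemma bk_rep_poly: "\<exists>e. bk_rep (\<lambda>s n. ev p (of_nat n) * bk s n) e"
proof (induction p)
  case 0
  have "bk_rep (\<lambda>s n. of_rat 0 * bk s n) 0" by (rule bk_rep_scale[OF bk_rep_self])
  then show ?case by auto
next
  case (pCons a p)
  then obtain e where "bk_rep (\<lambda>s n. ev p (of_nat n) * bk s n) e" by blast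
  from bk_rep_mult_index[OF this]
  have 1: "bk_rep (\<lambda>s n. of_nat n * (ev p (of_nat n) * bk s n)) (Suc e)" .
  have "bk_rep (\<lambda>s n. of_rat a * bk s n) (Suc e)"
    by (rule bk_rep_mono[OF bk_rep_scale[OF bk_rep_self]]) simp
  from bk_rep_add[OF this 1] show ?case by (auto simp: algebra_simps)
qed

lemma bk_rep_shift: "bk_rep F e \<Longrightarrow> bk_rep (\<lambda>s n. F s (n + j)) e"
proof (induction j)
  case (Suc j)
  then have "bk_rep (\<lambda>s n. F s (Suc n + j)) e" by (intro bk_rep_Suc) auto
  then show ?case by simp
qed simp

lemma bk_rep_operator:
  "\<exists>e. \<forall>j\<le>J. bk_rep (\<lambda>s n. ev (P j) (of_nat (n + j)) * bk s (n + j)) e"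
proof -
  have "\<forall>j. \<exists>e. bk_rep (\<lambda>s n. ev (P j) (of_nat n) * bk s n) e" using bk_rep_poly by blast
  then obtain e where e: "\<And>j. bk_rep (\<lambda>s n. ev (P j) (of_nat n) * bk s n) (e j)" by metis
  have "bk_rep (\<lambda>s n. ev (P j) (of_nat (n + j)) * bk s (n + j)) (Max (e ` {..J}))" if "j \<le> J" for j
    using bk_rep_shift[OF bk_rep_mono[OF e], where j = j] that by simp
  then show ?thesis by blast
qed

section \<open>Size and holomorphy of the terms\<close>

lemma bk_prod: "bk s n = fact n / (\<Prod>i\<le>n. s + of_nat i)"
  by (simp add: bk_def pochhammer_Suc_prod atLeast0AtMost)

lemma bk_of_real: "bk (of_real s :: complex) n = of_real (bk s n)"
  by (simp add: bk_prod)

lemma bk_pos: "s > 0 \<Longrightarrow> bk (s::real) n > 0"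
  unfolding bk_prod by (intro divide_pos_pos prod_pos) auto

lemma norm_bk_le:
  assumes "Re s > 0" shows "cmod (bk s n) \<le> bk (Re s) n"
proof -
  have "(\<Prod>i\<le>n. Re s + of_nat i) \<le> (\<Prod>i\<le>n. cmod (s + of_nat i))"
    using assms complex_Re_le_cmod[of "s + of_nat i" for i] by (intro prod_mono) auto
  moreover have "(\<Prod>i\<le>n. Re s + of_nat i) > 0" using assms by (intro prod_pos) auto
  ultimately show ?thesis unfolding bk_prod norm_divide prod_norm[symmetric]
    by (intro frac_le) auto
qed

lemma bk_antimono:
  assumes "0 < (s::real)" "s \<le> t" shows "bk t n \<le> bk s n"
  unfolding bk_prod using assms by (intro frac_le prod_mono prod_pos) auto

text \<open>Gauss's limit formula: \<open>bk s n * n powr s\<close> is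
  \<open>Gamma_series s n\<close>, which tends to the positive number
  \<open>Gamma s\<close>.\<close>

lemma bk_asymp:
  assumes "(s::real) > 0"
  shows "\<exists>c C. c > 0 \<and> C > 0 \<and> (\<forall>\<^sub>F n in sequentially. c * n powr (-s) \<le> bk s n \<and> bk s n \<le> C * n powr (-s))"
proof -
  have G: "Gamma s > 0" using assms by (rule Gamma_real_pos)
  have lim: "Gamma_series s \<longlonglongrightarrow> Gamma s" by (rule Gamma_series_LIMSEQ)
  have "\<forall>\<^sub>F n in sequentially. Gamma s / 2 < Gamma_series s n"
    using order_tendstoD(1)[OF lim, of "Gamma s / 2"] G by simp
  moreover have "\<forall>\<^sub>F n in sequentially. Gamma_series s n < 2 * Gamma s"
    using order_tendstoD(2)[OF lim, of "2 * Gamma s"] G by simp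
  ultimately have "\<forall>\<^sub>F n in sequentially. Gamma s / 2 * n powr (-s) \<le> bk s n \<and> bk s n \<le> (2 * Gamma s) * n powr (-s)"
    using eventually_gt_at_top[of 0]
  proof eventually_elim
    case (elim n)
    have "Gamma_series s n = bk s n * n powr s"
      using elim by (simp add: Gamma_series_def bk_def powr_def mult.commute)
    then have "bk s n = Gamma_series s n * n powr (-s)"
      using elim by (simp add: powr_minus field_simps)
    then show ?case using elim by (auto intro!: mult_right_mono)
  qed
  then show ?thesis using G by (intro exI[of _ "Gamma s / 2"] exI[of _ "2 * Gamma s"]) auto
qed

lemma bk_holomorphic:
  assumes "\<And>s. s \<in> A \<Longrightarrow> s \<notin> \<int>\<^sub>\<le>\<^sub>0"
  shows "(\<lambda>s. bk (s::complex) n) holomorphic_on A"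
proof -
  have "s + of_nat i \<noteq> 0" if "s \<in> A" for s i
  proof
    assume "s + of_nat i = 0"
    then have "s = - of_nat i" by (simp add: eq_neg_iff_add_eq_0)
    then show False using assms[OF that] by simp
  qed
  then show ?thesis unfolding bk_prod by (intro holomorphic_intros) auto
qed

section \<open>Complete monotonicity and Landau's theorem\<close>

definition compl_mono_at :: "(complex \<Rightarrow> complex) \<Rightarrow> complex \<Rightarrow> bool" where
  "compl_mono_at f s \<longleftrightarrow> (\<forall>m. (-1) ^ m * (deriv ^^ m) f s \<in> \<real>\<^sub>\<ge>\<^sub>0)"

lemma nonneg_Reals_sum: "(\<And>i. i \<in> A \<Longrightarrow> f i \<in> \<real>\<^sub>\<ge>\<^sub>0) \<Longrightarrow> sum f A \<in> (\<real>\<^sub>\<ge>\<^sub>0 :: complex set)"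
  by (induction A rule: infinite_finite_induct) auto

lemma higher_deriv_inverse_shift:
  fixes a :: complex
  shows "s + a \<noteq> 0 \<Longrightarrow> (deriv ^^ m) (\<lambda>s. inverse (s + a)) s = (-1) ^ m * fact m * inverse (s + a) ^ Suc m"
proof (induction m arbitrary: s)
  case (Suc m)
  have "open ((\<lambda>s. s + a) -` (- {0}))" by (intro open_vimage continuous_intros)
  then have "\<forall>\<^sub>F t in nhds s. t \<in> (\<lambda>s. s + a) -` (- {0})"
    using Suc.prems by (intro eventually_nhds_in_open) auto
  then have "\<forall>\<^sub>F t in nhds s. (deriv ^^ m) (\<lambda>s. inverse (s + a)) t = (-1) ^ m * fact m * inverse (t + a) ^ Suc m"
    by (rule eventually_mono) (use Suc.IH in auto)
  then have "deriv ((deriv ^^ m) (\<lambda>s. inverse (s + a))) s = deriv (\<lambda>t. (-1) ^ m * fact m * inverse (t + a) ^ Suc m) s"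
    by (rule deriv_cong_ev) simp
  also have "\<dots> = (-1) ^ m * fact m * (of_nat (Suc m) * (- (inverse (s + a) * inverse (s + a))) * inverse (s + a) ^ m)"
  proof (rule DERIV_imp_deriv)
    have "((\<lambda>t. inverse (t + a)) has_field_derivative - (inverse (s + a) * 1 * inverse (s + a))) (at s)"
      using Suc.prems by (intro DERIV_inverse' derivative_eq_intros) auto
    from DERIV_cmult[OF DERIV_power[OF this, of "Suc m"], of "(-1) ^ m * fact m"]
    show "((\<lambda>t. (-1) ^ m * fact m * inverse (t + a) ^ Suc m) has_field_derivative
      (-1) ^ m * fact m * (of_nat (Suc m) * (- (inverse (s + a) * inverse (s + a))) * inverse (s + a) ^ m)) (at s)"
      by (simp add: mult.assoc)
  qed
  finally show ?case by (simp add: algebra_simps)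
qed simp

lemma compl_mono_mult:
  assumes "f holomorphic_on S" "g holomorphic_on S" "open S" "s \<in> S" "compl_mono_at f s" "compl_mono_at g s"
  shows "compl_mono_at (\<lambda>s. f s * g s) s"
  unfolding compl_mono_at_def
proof
  fix m
  have "(-1) ^ m * (deriv ^^ m) (\<lambda>s. f s * g s) s =
    (\<Sum>i = 0..m. of_nat (m choose i) * (((-1) ^ i * (deriv ^^ i) f s) * ((-1) ^ (m - i) * (deriv ^^ (m - i)) g s)))"
    unfolding higher_deriv_mult[OF assms(1-4)] sum_distrib_left
  proof (rule sum.cong[OF refl])
    fix i assume "i \<in> {0..m}"
    then have "(-1 :: complex) ^ m = (-1) ^ i * (-1) ^ (m - i)" by (simp flip: power_add)
    then show "(- 1) ^ m * (of_nat (m choose i) * (deriv ^^ i) f s * (deriv ^^ (m - i)) g s) =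
      of_nat (m choose i) * (((-1) ^ i * (deriv ^^ i) f s) * ((-1) ^ (m - i) * (deriv ^^ (m - i)) g s))"
      by simp
  qed
  also have "\<dots> \<in> \<real>\<^sub>\<ge>\<^sub>0"
  proof (rule nonneg_Reals_sum)
    fix i
    have "(-1) ^ i * (deriv ^^ i) f s \<in> \<real>\<^sub>\<ge>\<^sub>0" "(-1) ^ (m - i) * (deriv ^^ (m - i)) g s \<in> \<real>\<^sub>\<ge>\<^sub>0"
      using assms(5,6) unfolding compl_mono_at_def by blast+
    then show "of_nat (m choose i) * (((-1) ^ i * (deriv ^^ i) f s) * ((-1) ^ (m - i) * (deriv ^^ (m - i)) g s)) \<in> \<real>\<^sub>\<ge>\<^sub>0"
      by (intro nonneg_Reals_mult_I[OF _ nonneg_Reals_mult_I]) simp_all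
  qed
  finally show "(-1) ^ m * (deriv ^^ m) (\<lambda>s. f s * g s) s \<in> \<real>\<^sub>\<ge>\<^sub>0" .
qed

text \<open>\<open>bk s n\<close> is a positive constant times a product of factors
  \<open>inverse (s + i)\<close>, each of them completely monotone on the positive axis.\<close>

lemma compl_mono_bk:
  assumes "s > 0" shows "compl_mono_at (\<lambda>s. bk s n) (of_real s)"
proof -
  have inv: "compl_mono_at (\<lambda>s. inverse (s + of_nat i)) (of_real s)" for i
    unfolding compl_mono_at_def
  proof
    fix m
    have nz: "of_real s + of_nat i \<noteq> (0::complex)"
      using assms by (metis add_pos_nonneg less_irrefl of_nat_0_le_iff of_real_add of_real_eq_0_iff of_real_of_nat_eq)
    have "(-1) ^ m * (deriv ^^ m) (\<lambda>s::complex. inverse (s + of_nat i)) (of_real s)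
      = ((-1) ^ m * (-1) ^ m) * (fact m * inverse (of_real s + of_nat i) ^ Suc m)"
      unfolding higher_deriv_inverse_shift[OF nz] by (simp only: mult.assoc)
    also have "(-1) ^ m * (-1) ^ m = (1 :: complex)" by (simp flip: power_mult_distrib)
    also have "1 * (fact m * inverse (of_real s + of_nat i) ^ Suc m) = (of_real (fact m * inverse (s + of_nat i) ^ Suc m) :: complex)"
      by simp
    also have "\<dots> \<in> \<real>\<^sub>\<ge>\<^sub>0" using assms by (subst nonneg_Reals_of_real_iff) auto
    finally show "(-1) ^ m * (deriv ^^ m) (\<lambda>s::complex. inverse (s + of_nat i)) (of_real s) \<in> \<real>\<^sub>\<ge>\<^sub>0" .
  qed
  let ?S = "{s. Re s > 0}"
  have op: "open ?S" by (rule open_halfspace_Re_gt)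
  have hol: "(\<lambda>s. inverse (s + of_nat i)) holomorphic_on ?S" for i
    by (intro holomorphic_intros) (auto simp: complex_eq_iff)
  have np: "Re t > 0 \<Longrightarrow> t \<notin> \<int>\<^sub>\<le>\<^sub>0" for t by (auto elim!: nonpos_Ints_cases)
  show ?thesis
  proof (induction n)
    case 0
    have "bk t 0 = inverse (t + of_nat 0)" for t :: complex by (simp add: bk_prod divide_inverse)
    then show ?case using inv[of 0] by simp
  next
    case (Suc n)
    have e: "bk t (Suc n) = bk t n * (of_nat (Suc n) * inverse (t + of_nat (Suc n)))" for t :: complex
      by (simp add: bk_prod divide_inverse mult_ac)
    have hol2: "(\<lambda>t::complex. of_nat (Suc n)) holomorphic_on ?S" by simp
    have cm: "compl_mono_at (\<lambda>t::complex. of_nat (Suc n)) (of_real s)"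
      unfolding compl_mono_at_def by (auto simp: higher_deriv_const simp del: of_nat_Suc)
    have hol3: "(\<lambda>t::complex. bk t n) holomorphic_on ?S" by (rule bk_holomorphic) (use np in auto)
    have s: "of_real s \<in> ?S" using assms by simp
    have "compl_mono_at (\<lambda>t. of_nat (Suc n) * inverse (t + of_nat (Suc n))) (of_real s)"
      by (rule compl_mono_mult[OF hol2 hol op s cm inv])
    then show ?case unfolding e
      by (rule compl_mono_mult[OF hol3 holomorphic_on_mult[OF hol2 hol] op s Suc.IH])
  qed
qed

text \<open>Landau's argument in finite form. At the centre \<open>s\<close> the derivatives of the
  partial sums, taken with the sign \<open>(-1) ^ m\<close>, increase to those of \<open>G\<close>.
  In the Taylor series at \<open>s - u\<close> the powers of the displacement carry the same sign,
  so the comparison holds term by term: the partial sums stay below \<open>G\<close> even at points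
  where convergence was not known.\<close>

lemma landau_bound:
  fixes f :: "nat \<Rightarrow> complex \<Rightarrow> complex"
  assumes f: "\<And>n. f n holomorphic_on ball (of_real s) R" and G: "G holomorphic_on ball (of_real s) R"
    and cm: "\<And>n. compl_mono_at (f n) (of_real s)"
    and r: "0 < r" "r \<le> R" and lim: "uniform_limit (ball (of_real s) r) (\<lambda>N z. \<Sum>n<N. f n z) G sequentially"
    and u: "0 \<le> u" "u < R"
  shows "(\<Sum>n<N. Re (f n (of_real (s - u)))) \<le> Re (G (of_real (s - u)))"
proof -
  let ?s = "of_real s :: complex"
  let ?B = "\<lambda>N z. \<Sum>n<N. f n z"
  have B: "?B N holomorphic_on ball ?s R" for N using f by (intro holomorphic_intros)
  have sub: "ball ?s r \<subseteq> ball ?s R" using r by (rule_tac subset_ball) simp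
  have dB: "(deriv ^^ m) (?B N) ?s = (\<Sum>n<N. (deriv ^^ m) (f n) ?s)" for m N
  proof (induction N)
    case 0
    then show ?case by (simp add: higher_deriv_const)
  next
    case (Suc N)
    have "(deriv ^^ m) (\<lambda>z. ?B N z + f N z) ?s = (deriv ^^ m) (?B N) ?s + (deriv ^^ m) (f N) ?s"
      by (rule higher_deriv_add[of _ "ball ?s R"]) (use B f r in auto)
    then show ?case using Suc by simp
  qed
  have conv: "(\<lambda>N. (deriv ^^ m) (?B N) ?s) \<longlonglongrightarrow> (deriv ^^ m) G ?s" for m
    by (rule higher_deriv_complex_uniform_limit[OF lim always_eventually[OF allI[OF holomorphic_on_subset[OF B sub]]]])
      (use r in auto)
  have nn: "0 \<le> Re ((-1) ^ m * (deriv ^^ m) (f n) ?s)" for m n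
    using cm[of n] unfolding compl_mono_at_def by (auto simp: complex_nonneg_Reals_iff)
  have le: "Re ((-1) ^ m * (deriv ^^ m) (?B N) ?s) \<le> Re ((-1) ^ m * (deriv ^^ m) G ?s)" for m
  proof (rule LIMSEQ_le_const)
    show "(\<lambda>N. Re ((-1) ^ m * (deriv ^^ m) (?B N) ?s)) \<longlonglongrightarrow> Re ((-1) ^ m * (deriv ^^ m) G ?s)"
      by (intro tendsto_intros conv)
    show "\<exists>M. \<forall>n\<ge>M. Re ((-1) ^ m * (deriv ^^ m) (?B N) ?s) \<le> Re ((-1) ^ m * (deriv ^^ m) (?B n) ?s)"
    proof (intro exI[of _ N] allI impI)
      fix n assume "N \<le> n"
      then have "(\<Sum>n<N. Re ((-1) ^ m * (deriv ^^ m) (f n) ?s)) \<le> (\<Sum>n<n. Re ((-1) ^ m * (deriv ^^ m) (f n) ?s))"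
        by (intro sum_mono2) (use nn in auto)
      then show "Re ((-1) ^ m * (deriv ^^ m) (?B N) ?s) \<le> Re ((-1) ^ m * (deriv ^^ m) (?B n) ?s)"
        unfolding dB sum_distrib_left Re_sum .
    qed
  qed
  let ?z = "of_real (s - u) :: complex"
  have z: "?z \<in> ball ?s R" using u by (simp add: dist_norm)
  have zs: "(?z - ?s) ^ m = (-1) ^ m * of_real (u ^ m)" for m
    by (simp add: power_minus[of "of_real u"])
  have ser: "(\<lambda>m. Re ((-1) ^ m * (deriv ^^ m) h ?s) * (u ^ m / fact m)) sums Re (h ?z)" if "h holomorphic_on ball ?s R" for h
  proof -
    have "(\<lambda>m. Re ((deriv ^^ m) h ?s / fact m * (?z - ?s) ^ m)) sums Re (h ?z)"
      by (intro sums_Re holomorphic_power_series[OF that z])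
    moreover have "Re ((deriv ^^ m) h ?s / fact m * (?z - ?s) ^ m) = Re ((-1) ^ m * (deriv ^^ m) h ?s) * (u ^ m / fact m)" for m
    proof -
      have "(deriv ^^ m) h ?s / fact m * (?z - ?s) ^ m = ((-1) ^ m * (deriv ^^ m) h ?s) * of_real (u ^ m / fact m)"
        unfolding zs by simp
      then show ?thesis by (simp only: times_complex.sel Re_complex_of_real Im_complex_of_real mult_zero_right diff_zero)
    qed
    ultimately show ?thesis by simp
  qed
  have "Re (?B N ?z) \<le> Re (G ?z)"
  proof (rule sums_le[OF _ ser[OF B] ser[OF G]])
    fix m
    have "0 \<le> u ^ m / fact m" using u by simp
    then show "Re ((-1) ^ m * (deriv ^^ m) (?B N) ?s) * (u ^ m / fact m) \<le> Re ((-1) ^ m * (deriv ^^ m) G ?s) * (u ^ m / fact m)"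
      by (rule mult_right_mono[OF le])
  qed
  then show ?thesis by simp
qed

lemma bk_rep_sum:
  fixes J :: nat
  assumes "\<And>j. j \<le> J \<Longrightarrow> bk_rep (F j) e"
  shows "bk_rep (\<lambda>s n. \<Sum>j\<le>J. F j s n) e"
  using assms
proof (induction J)
  case 0
  then show ?case by simp
next
  case (Suc J)
  have "bk_rep (\<lambda>s n. (\<Sum>j\<le>J. F j s n) + F (Suc J) s n) e"
    by (intro bk_rep_add Suc) auto
  then show ?case by simp
qed

lemma add_inverse_not_Ints: "(- of_nat a + inverse (of_nat (k + 2)) :: complex) \<notin> \<int>"
proof
  assume "(- of_nat a + inverse (of_nat (k + 2)) :: complex) \<in> \<int>"
  then have "of_nat a + (- of_nat a + inverse (of_nat (k + 2)) :: complex) \<in> \<int>" by (intro Ints_add) auto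
  then obtain m where "(inverse (of_nat (k + 2)) :: complex) = of_int m" by (auto elim: Ints_cases)
  then have "complex_of_real (inverse (of_nat (k + 2))) = of_real (of_int m)" by simp
  then have "inverse (real (k + 2)) = of_int m" by (simp only: of_real_eq_iff)
  moreover have "0 < inverse (real (k + 2))" "inverse (real (k + 2)) < 1" by (auto simp: field_simps)
  ultimately have "0 < real_of_int m" "real_of_int m < 1" by simp_all
  then show False by simp
qed

text \<open>Residues. Let \<open>K\<close> be the last index with \<open>P K\<close> nonzero. At
  \<open>t = - (n + K)\<close> the terms with \<open>j < K\<close> are regular and those with
  \<open>j > K\<close> have coefficient zero, so the residue is the value of \<open>P K\<close> at
  \<open>n + K\<close> times a nonzero number. For some \<open>n\<close> that value is
  nonzero.\<close>

lemma operator_nonzero: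
  assumes "\<exists>j\<le>J. P j \<noteq> 0"
    and zero: "\<And>t n. t \<notin> \<int> \<Longrightarrow> (\<Sum>j\<le>J. ev (P j) (of_nat (n + j)) * bk t (n + j)) = 0"
  shows False
proof -
  define K where "K = (GREATEST j. j \<le> J \<and> P j \<noteq> 0)"
  have K: "K \<le> J" "P K \<noteq> 0" and above: "\<And>j. j \<le> J \<Longrightarrow> K < j \<Longrightarrow> P j = 0"
    using GreatestI_ex_nat[of "\<lambda>j. j \<le> J \<and> P j \<noteq> 0" J] Greatest_le_nat[of "\<lambda>j. j \<le> J \<and> P j \<noteq> 0" _ J] assms(1)
    unfolding K_def by (fastforce simp: not_less)+
  have "finite {z. poly (map_poly of_rat (P K)) z = (0::complex)}"
    using ev_nonzero_roots[OF K(2)] by (rule poly_roots_finite)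
  moreover have "infinite ((\<lambda>n. of_nat (n + K) :: complex) ` UNIV)"
    by (rule range_inj_infinite) (auto intro: injI)
  ultimately have "\<not> (\<lambda>n. of_nat (n + K) :: complex) ` UNIV \<subseteq> {z. poly (map_poly of_rat (P K)) z = 0}"
    using finite_subset by blast
  then obtain n where n: "ev (P K) (of_nat (n + K)) \<noteq> 0" unfolding ev_def by auto
  define t0 where "t0 = (- of_nat (n + K) :: complex)"
  \<comment> \<open>An approach to the pole that avoids the integers; the offset 2 keeps the added
    fraction strictly between 0 and 1.\<close>
  define t where "t k = t0 + inverse (of_nat (k + 2))" for k
  have tI: "t k \<notin> \<int>" for k unfolding t_def t0_def by (rule add_inverse_not_Ints)
  have "(\<lambda>k. inverse (of_nat (k + 2)) :: complex) \<longlonglongrightarrow> 0"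
    using LIMSEQ_ignore_initial_segment[OF lim_inverse_n, of 2] by simp
  then have t: "t \<longlonglongrightarrow> t0" unfolding t_def using tendsto_add[OF tendsto_const] by fastforce
  have poch: "(\<lambda>k. pochhammer (t k) m) \<longlonglongrightarrow> pochhammer t0 m" for m
    unfolding pochhammer_prod by (intro tendsto_intros t)
  have nz: "pochhammer t0 m \<noteq> 0" if "m \<le> n + K" for m
    unfolding t0_def pochhammer_eq_0_iff using that by (auto simp del: of_nat_add)
  have lim_low: "(\<lambda>k. (t k - t0) * bk (t k) (n + j)) \<longlonglongrightarrow> 0" if "j < K" for j
  proof -
    have "(\<lambda>k. (t k - t0) * bk (t k) (n + j)) \<longlonglongrightarrow> (t0 - t0) * (fact (n + j) / pochhammer t0 (Suc (n + j)))"
      unfolding bk_def using that by (intro tendsto_intros t poch nz) auto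
    then show ?thesis by simp
  qed
  have lim_top: "(\<lambda>k. (t k - t0) * bk (t k) (n + K)) \<longlonglongrightarrow> fact (n + K) / pochhammer t0 (n + K)"
  proof -
    have "(t k - t0) * bk (t k) (n + K) = fact (n + K) / pochhammer (t k) (n + K)" for k
    proof -
      have e: "t k - t0 = t k + of_nat (n + K)" unfolding t0_def by simp
      moreover have "t k + of_nat (n + K) \<noteq> 0"
        using pochhammer_not_Ints[OF tI, of k "Suc (n + K)"] unfolding pochhammer_Suc by auto
      ultimately show ?thesis unfolding bk_def pochhammer_Suc e by (simp del: of_nat_add)
    qed
    moreover have "(\<lambda>k. fact (n + K) / pochhammer (t k) (n + K)) \<longlonglongrightarrow> fact (n + K) / pochhammer t0 (n + K)"
      by (intro tendsto_intros poch nz) auto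
    ultimately show ?thesis by simp
  qed
  have L: "(\<lambda>k. \<Sum>j\<le>J. ev (P j) (of_nat (n + j)) * ((t k - t0) * bk (t k) (n + j))) \<longlonglongrightarrow>
    (\<Sum>j\<le>J. ev (P j) (of_nat (n + j)) * (if j = K then fact (n + K) / pochhammer t0 (n + K) else 0))"
  proof (rule tendsto_sum)
    fix j assume j: "j \<in> {..J}"
    consider "j < K" | "j = K" | "j > K" by linarith
    then show "(\<lambda>k. ev (P j) (of_nat (n + j)) * ((t k - t0) * bk (t k) (n + j))) \<longlonglongrightarrow>
      ev (P j) (of_nat (n + j)) * (if j = K then fact (n + K) / pochhammer t0 (n + K) else 0)"
    proof cases
      case 1
      then show ?thesis using tendsto_mult_left[OF lim_low[OF 1]] by auto
    next
      case 2
      then show ?thesis using tendsto_mult_left[OF lim_top] by simp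
    next
      case 3
      then have "P j = 0" using above j by simp
      then show ?thesis by simp
    qed
  qed
  have Z: "(\<Sum>j\<le>J. ev (P j) (of_nat (n + j)) * ((t k - t0) * bk (t k) (n + j))) = 0" for k
  proof -
    have "(\<Sum>j\<le>J. ev (P j) (of_nat (n + j)) * ((t k - t0) * bk (t k) (n + j))) =
      (t k - t0) * (\<Sum>j\<le>J. ev (P j) (of_nat (n + j)) * bk (t k) (n + j))"
      by (simp add: sum_distrib_left mult_ac)
    then show ?thesis using zero[OF tI] by simp
  qed
  have R: "(\<Sum>j\<le>J. ev (P j) (of_nat (n + j)) * (if j = K then fact (n + K) / pochhammer t0 (n + K) else 0))
    = ev (P K) (of_nat (n + K)) * (fact (n + K) / pochhammer t0 (n + K))"
    using K(1) by (simp add: if_distrib[of "\<lambda>x. _ * x"] cong: if_cong)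
  have "(0::complex) = ev (P K) (of_nat (n + K)) * (fact (n + K) / pochhammer t0 (n + K))"
    using L unfolding Z R by (simp only: LIMSEQ_const_iff)
  then show False using n nz[of "n + K"] by simp
qed

text \<open>Up to factors \<open>n powr \<epsilon>\<close> the sequence is
  \<open>n powr (\<sigma> - 1)\<close>, so \<sigma> is the abscissa of convergence of the factorial
  series. The condition \<open>\<sigma> > 0\<close> keeps it to the right of the poles of the terms
  at 0, -1, -2 and so on.\<close>

locale algebraic_exponent =
  fixes b :: "nat \<Rightarrow> real" and \<sigma> :: real and P :: "nat \<Rightarrow> rat poly" and J :: nat
  assumes \<sigma>: "\<sigma> > 0" and b0: "\<And>n. b n \<ge> 0"
    and upper: "\<And>\<epsilon>. \<epsilon> > 0 \<Longrightarrow> \<exists>C. \<forall>\<^sub>F n in sequentially. b n \<le> C * n powr (\<sigma> - 1 + \<epsilon>)"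
    and lower: "\<And>\<epsilon>. \<epsilon> > 0 \<Longrightarrow> \<exists>c>0. \<forall>\<^sub>F n in sequentially. c * n powr (\<sigma> - 1 - \<epsilon>) \<le> b n"
    and rec: "\<And>k. k \<ge> J \<Longrightarrow> (\<Sum>j\<le>J. ev (P j) (of_nat k) * of_real (b (k - j))) = 0"
    and nz: "\<exists>j\<le>J. P j \<noteq> 0"
begin

definition M :: "complex \<Rightarrow> complex" where "M z = (\<Sum>n. of_real (b n) * bk z n)"

lemma summable_b:
  assumes "s > \<sigma>" shows "summable (\<lambda>n. b n * bk s n)"
proof -
  define \<epsilon> where "\<epsilon> = (s - \<sigma>) / 2"
  have \<epsilon>: "\<epsilon> > 0" and s0: "s > 0" using assms \<sigma> unfolding \<epsilon>_def by simp_all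
  obtain C where C: "\<forall>\<^sub>F n in sequentially. b n \<le> C * n powr (\<sigma> - 1 + \<epsilon>)" using upper[OF \<epsilon>] by blast
  obtain c D where D: "\<forall>\<^sub>F n in sequentially. c * n powr (-s) \<le> bk s n \<and> bk s n \<le> D * n powr (-s)"
    using bk_asymp[OF s0] by blast
  have "summable (\<lambda>n. (C * D) * real n powr (-1 - \<epsilon>))"
    using \<epsilon> by (intro summable_mult) (simp add: summable_real_powr_iff)
  moreover have "\<forall>\<^sub>F n in sequentially. norm (b n * bk s n) \<le> (C * D) * real n powr (-1 - \<epsilon>)"
    using C D eventually_gt_at_top[of 0]
  proof eventually_elim
    case (elim n)
    have "b n * bk s n \<le> (C * n powr (\<sigma> - 1 + \<epsilon>)) * (D * n powr (-s))"
      using elim b0[of n] bk_pos[OF s0, of n] by (intro mult_mono) auto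
    also have "\<dots> = (C * D) * n powr ((\<sigma> - 1 + \<epsilon>) + (-s))" unfolding powr_add by simp
    also have "(\<sigma> - 1 + \<epsilon>) + (-s) = -1 - \<epsilon>" unfolding \<epsilon>_def by (simp add: field_simps)
    finally show ?case using b0[of n] bk_pos[OF s0, of n] by simp
  qed
  ultimately show ?thesis by (rule summable_comparison_test_ev[rotated])
qed

lemma term_bound:
  assumes "Re z \<ge> s" "s > 0" shows "norm (of_real (b n) * bk z n) \<le> b n * bk s n"
proof -
  have "cmod (bk z n) \<le> bk (Re z) n" using assms by (intro norm_bk_le) auto
  also have "\<dots> \<le> bk s n" using assms by (intro bk_antimono) auto
  finally show ?thesis using b0[of n] by (simp add: norm_mult mult_left_mono)
qed

lemma uniform_M:
  assumes "s > \<sigma>"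
  shows "uniform_limit {z. Re z \<ge> s} (\<lambda>N z. \<Sum>n<N. of_real (b n) * bk z n) M sequentially"
  unfolding M_def
  by (rule Weierstrass_m_test[OF _ summable_b[OF assms]]) (use term_bound assms \<sigma> in auto)

lemma sums_M: "Re z > \<sigma> \<Longrightarrow> (\<lambda>n. of_real (b n) * bk z n) sums M z"
  unfolding M_def
  by (intro summable_sums summable_comparison_test[OF _ summable_b[of "Re z"]] exI[of _ 0] allI impI term_bound)
    (use \<sigma> in auto)

lemma not_nonpos: "Re z > 0 \<Longrightarrow> z \<notin> \<int>\<^sub>\<le>\<^sub>0"
  by (auto elim!: nonpos_Ints_cases)

lemma holomorphic_M: "M holomorphic_on {z. Re z > \<sigma>}"
proof (rule holomorphic_uniform_sequence[where f = "\<lambda>N z. \<Sum>n<N. of_real (b n) * bk z n"])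
  show "open {z. Re z > \<sigma>}" by (rule open_halfspace_Re_gt)
  show "(\<lambda>z. \<Sum>n<N. of_real (b n) * bk z n) holomorphic_on {z. Re z > \<sigma>}" for N
    using \<sigma> by (intro holomorphic_intros bk_holomorphic not_nonpos) auto
  fix z assume "z \<in> {z. Re z > \<sigma>}"
  then have z: "Re z > \<sigma>" by simp
  define d where "d = (Re z - \<sigma>) / 2"
  have d: "d > 0" using z unfolding d_def by simp
  have sub: "cball z d \<subseteq> {w. Re w \<ge> \<sigma> + d}"
  proof
    fix w assume "w \<in> cball z d"
    then have "Re z - Re w \<le> d" using complex_Re_le_cmod[of "z - w"] by (simp add: dist_norm)
    then show "w \<in> {w. Re w \<ge> \<sigma> + d}" unfolding d_def by (simp add: field_simps)
  qed
  show "\<exists>d>0. cball z d \<subseteq> {z. Re z > \<sigma>} \<and> uniform_limit (cball z d) (\<lambda>N z. \<Sum>n<N. of_real (b n) * bk z n) M sequentially"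
  proof (intro exI[of _ d] conjI d)
    show "cball z d \<subseteq> {z. Re z > \<sigma>}" using sub d by auto
    show "uniform_limit (cball z d) (\<lambda>N z. \<Sum>n<N. of_real (b n) * bk z n) M sequentially"
      by (rule uniform_limit_on_subset[OF uniform_M[of "\<sigma> + d"] sub]) (use d in simp)
  qed
qed

text \<open>The recurrence at \<open>k\<close> is multiplied by \<open>bk (s + e) k\<close>, summed
  over \<open>k\<close>, and rearranged by the index \<open>n = k - j\<close> of the sequence. The
  coefficient of \<open>b n\<close> is then the adjoint operator applied to \<open>bk\<close>, which
  \<open>bk_rep\<close> expresses through shifts of \<open>bk\<close>. The finitely many
  \<open>k < J\<close>, for which the recurrence says nothing, make up \<open>B\<close>.\<close>

lemma M_relation:
  obtains N :: nat and c :: "nat \<Rightarrow> rat poly" and B :: "complex \<Rightarrow> complex" where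
    "\<forall>s. s \<notin> \<int> \<longrightarrow> Re s > \<sigma> \<longrightarrow> (\<Sum>i\<le>N. ev (c i) s * M (s + of_nat i)) = B s"
    "\<exists>i\<le>N. c i \<noteq> 0" "B holomorphic_on (- \<int>)"
proof -
  obtain e where e: "\<And>j. j \<le> J \<Longrightarrow> bk_rep (\<lambda>s n. ev (P j) (of_nat (n + j)) * bk s (n + j)) e"
    using bk_rep_operator[of J P] by blast
  have "bk_rep (\<lambda>s n. \<Sum>j\<le>J. ev (P j) (of_nat (n + j)) * bk s (n + j)) e" by (rule bk_rep_sum) (rule e)
  then obtain N c where
    c': "\<forall>s n. s \<notin> \<int> \<longrightarrow> (\<Sum>j\<le>J. ev (P j) (of_nat (n + j)) * bk (s + of_nat e) (n + j)) = (\<Sum>i\<le>N. ev (c i) s * bk (s + of_nat i) n)"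
    unfolding bk_rep_def by blast
  note c = c'[rule_format]
  \<comment> \<open>The guard discards the pairs with \<open>k < j\<close>, where truncated
    subtraction would read off \<open>b 0\<close>.\<close>
  define t where "t s k j = (if k < j then 0 else ev (P j) (of_nat k) * of_real (b (k - j)) * bk (s + of_nat e) k)" for s k j
  define B where "B s = (\<Sum>k<J. \<Sum>j\<le>J. t s k j)" for s
  show thesis
  proof (rule that[where N = N and c = c and B = B]; (intro allI impI)?)
    fix s :: complex assume sI: "s \<notin> \<int>" and s: "Re s > \<sigma>"
    have Mi: "(\<lambda>n. of_real (b n) * bk (s + of_nat i) n) sums M (s + of_nat i)" for i
      by (rule sums_M) (use s in simp)
    have "(\<lambda>n. \<Sum>i\<le>N. ev (c i) s * (of_real (b n) * bk (s + of_nat i) n)) sums (\<Sum>i\<le>N. ev (c i) s * M (s + of_nat i))"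
      by (intro sums_sum sums_mult Mi)
    moreover have "(\<Sum>i\<le>N. ev (c i) s * (of_real (b n) * bk (s + of_nat i) n)) =
      (\<Sum>j\<le>J. of_real (b n) * (ev (P j) (of_nat (n + j)) * bk (s + of_nat e) (n + j)))" for n
    proof -
      have "(\<Sum>i\<le>N. ev (c i) s * (of_real (b n) * bk (s + of_nat i) n)) = of_real (b n) * (\<Sum>i\<le>N. ev (c i) s * bk (s + of_nat i) n)"
        by (simp add: sum_distrib_left mult_ac)
      then show ?thesis unfolding c[OF sI, symmetric] by (simp add: sum_distrib_left)
    qed
    ultimately have S1: "(\<lambda>n. \<Sum>j\<le>J. of_real (b n) * (ev (P j) (of_nat (n + j)) * bk (s + of_nat e) (n + j))) sums (\<Sum>i\<le>N. ev (c i) s * M (s + of_nat i))"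
      by (simp only:)
    have "\<exists>A. (\<lambda>n. of_real (b n) * (ev (P j) (of_nat (n + j)) * bk (s + of_nat e) (n + j))) sums A" if j: "j \<le> J" for j
    proof -
      obtain L d where d': "\<forall>s n. s \<notin> \<int> \<longrightarrow> ev (P j) (of_nat (n + j)) * bk (s + of_nat e) (n + j) = (\<Sum>i\<le>L. ev (d i) s * bk (s + of_nat i) n)"
        using e[OF j] unfolding bk_rep_def by blast
      note d = d'[rule_format]
      have "(\<lambda>n. \<Sum>i\<le>L. ev (d i) s * (of_real (b n) * bk (s + of_nat i) n)) sums (\<Sum>i\<le>L. ev (d i) s * M (s + of_nat i))"
        by (intro sums_sum sums_mult Mi)
      moreover have "(\<Sum>i\<le>L. ev (d i) s * (of_real (b n) * bk (s + of_nat i) n)) = of_real (b n) * (\<Sum>i\<le>L. ev (d i) s * bk (s + of_nat i) n)" for n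
        by (simp add: sum_distrib_left mult_ac)
      ultimately show ?thesis unfolding d[OF sI] by auto
    qed
    then obtain A where A: "\<And>j. j \<le> J \<Longrightarrow> (\<lambda>n. of_real (b n) * (ev (P j) (of_nat (n + j)) * bk (s + of_nat e) (n + j))) sums A j"
      using choice[of "\<lambda>j A. j \<le> J \<longrightarrow> (\<lambda>n. of_real (b n) * (ev (P j) (of_nat (n + j)) * bk (s + of_nat e) (n + j))) sums A"] by blast
    have At: "(\<lambda>k. t s k j) sums A j" if j: "j \<le> J" for j
    proof -
      have "(\<lambda>n. t s (n + j) j) sums A j" using A[OF j] by (simp add: t_def mult_ac)
      moreover have "(\<Sum>k<j. t s k j) = 0" by (simp add: t_def)
      ultimately show ?thesis using sums_iff_shift[of "\<lambda>k. t s k j" j "A j"] by simp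
    qed
    have "(\<lambda>k. \<Sum>j\<le>J. t s k j) sums (\<Sum>j\<le>J. A j)" by (intro sums_sum At) auto
    moreover have "(\<lambda>k. \<Sum>j\<le>J. t s k j) sums B s" unfolding B_def
    proof (rule sums_finite)
      fix k assume "k \<notin> {..<J}"
      then have k: "k \<ge> J" by simp
      have "(\<Sum>j\<le>J. t s k j) = (\<Sum>j\<le>J. ev (P j) (of_nat k) * of_real (b (k - j))) * bk (s + of_nat e) k"
        unfolding sum_distrib_right by (intro sum.cong refl) (use k in \<open>auto simp: t_def\<close>)
      then show "(\<Sum>j\<le>J. t s k j) = 0" using rec[OF k] by simp
    qed simp
    moreover have "(\<lambda>n. \<Sum>j\<le>J. of_real (b n) * (ev (P j) (of_nat (n + j)) * bk (s + of_nat e) (n + j))) sums (\<Sum>j\<le>J. A j)"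
      by (intro sums_sum A) auto
    ultimately show "(\<Sum>i\<le>N. ev (c i) s * M (s + of_nat i)) = B s"
      using sums_unique2[OF S1] sums_unique2[of "\<lambda>k. \<Sum>j\<le>J. t s k j" "\<Sum>j\<le>J. A j" "B s"] by simp
  next
    show "\<exists>i\<le>N. c i \<noteq> 0"
    proof (rule ccontr)
      assume "\<not> (\<exists>i\<le>N. c i \<noteq> 0)"
      then have c0: "\<And>i. i \<le> N \<Longrightarrow> c i = 0" by blast
      show False
      proof (rule operator_nonzero[OF nz])
        fix u :: complex and n assume u: "u \<notin> \<int>"
        then have "u - of_nat e \<notin> \<int>" using add_Ints_iff[of "u - of_nat e" e] by simp
        from c[OF this, of n] c0 show "(\<Sum>j\<le>J. ev (P j) (of_nat (n + j)) * bk u (n + j)) = 0" by simp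
      qed
    qed
  next
    have "s + of_nat e \<notin> \<int>\<^sub>\<le>\<^sub>0" if "s \<in> - \<int>" for s :: complex
      using that add_Ints_iff[of s e] nonpos_Ints_Int by auto
    then have "(\<lambda>s. bk (s + of_nat e) k) holomorphic_on - \<int>" for k
      by (intro holomorphic_on_compose_gen[OF _ bk_holomorphic, unfolded o_def, where t = "{s. s \<notin> \<int>\<^sub>\<le>\<^sub>0}"] holomorphic_intros) auto
    then show "B holomorphic_on (- \<int>)" unfolding B_def t_def
    proof (intro holomorphic_on_sum)
      fix k j
      show "(\<lambda>s. if k < j then 0 else ev (P j) (of_nat k) * of_real (b (k - j)) * bk (s + of_nat e) k) holomorphic_on - \<int>"
        using \<open>\<And>k. (\<lambda>s. bk (s + of_nat e) k) holomorphic_on - \<int>\<close>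
        by (cases "k < j") (auto intro: holomorphic_on_mult)
    qed
  qed
qed

end

context algebraic_exponent
begin

lemma exponent_algebraic: "algebraic (of_real \<sigma> :: complex)"
proof (rule ccontr)
  assume nalg: "\<not> algebraic (of_real \<sigma> :: complex)"
  have \<sigma>I: "(of_real \<sigma> :: complex) \<notin> \<int>"
  proof
    assume "(of_real \<sigma> :: complex) \<in> \<int>"
    then obtain m where "(of_real \<sigma> :: complex) = of_int m" by (auto elim: Ints_cases)
    then have "ev [:- of_int m, 1:] (of_real \<sigma>) = 0" by (simp add: of_rat_minus)
    then have "algebraic (of_real \<sigma> :: complex)" by (rule ev_root_algebraic[rotated]) simp
    then show False using nalg by simp
  qed
  obtain N c B where rel': "\<forall>s. s \<notin> \<int> \<longrightarrow> Re s > \<sigma> \<longrightarrow> (\<Sum>i\<le>N. ev (c i) s * M (s + of_nat i)) = B s"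
    and cnz: "\<exists>i\<le>N. c i \<noteq> 0" and holB: "B holomorphic_on (- \<int>)"
    by (rule M_relation, rule that; assumption)
  note rel = rel'[rule_format]
  define i0 where "i0 = (LEAST i. i \<le> N \<and> c i \<noteq> 0)"
  have i0: "i0 \<le> N" "c i0 \<noteq> 0" using LeastI_ex[of "\<lambda>i. i \<le> N \<and> c i \<noteq> 0"] cnz unfolding i0_def by blast+
  have below: "c i = 0" if "i < i0" for i
    using not_less_Least[of i "\<lambda>i. i \<le> N \<and> c i \<noteq> 0"] that i0(1) unfolding i0_def by auto
  define I where "I z = ev (c i0) (z - of_nat i0)" for z
  \<comment> \<open>The equation solved for the lowest shift that occurs. The other terms use
    \<open>M\<close> at distance at least 1 to the right of \<open>z\<close>, so \<open>T\<close> is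
    holomorphic already for real parts above \<open>\<sigma> - 1\<close>, off the integers.\<close>
  define T where "T z = B (z - of_nat i0) - (\<Sum>i\<in>{i0<..N}. ev (c i) (z - of_nat i0) * M (z + of_nat (i - i0)))" for z
  define S where "S a = {z. Re z > a} - (\<int> :: complex set)" for a :: real
  have closedI: "closed (\<int> :: complex set)" by (rule closed_Ints)
  have openS: "open (S a)" for a unfolding S_def by (intro open_Diff open_halfspace_Re_gt closedI)
  have shiftI: "z - of_nat k \<in> \<int> \<longleftrightarrow> z \<in> \<int>" for z :: complex and k
    using add_Ints_iff[of "z - of_nat k" k] by simp
  have holI: "I holomorphic_on A" for A
    unfolding I_def by (rule holomorphic_on_compose_gen[OF _ ev_holomorphic, unfolded o_def, where t = UNIV]) (auto intro: holomorphic_intros)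
  have holev: "(\<lambda>z. ev (c i) (z - of_nat i0)) holomorphic_on A" for i A
    by (rule holomorphic_on_compose_gen[OF _ ev_holomorphic, unfolded o_def, where t = UNIV]) (auto intro: holomorphic_intros)
  have holT: "T holomorphic_on S (\<sigma> - 1)"
  proof -
    have 1: "(\<lambda>z. B (z - of_nat i0)) holomorphic_on S (\<sigma> - 1)"
      by (rule holomorphic_on_compose_gen[OF _ holB, unfolded o_def]) (auto simp: S_def shiftI intro: holomorphic_intros)
    have 2: "(\<lambda>z. M (z + of_nat (i - i0))) holomorphic_on S (\<sigma> - 1)" if "i \<in> {i0<..N}" for i
    proof (rule holomorphic_on_compose_gen[OF _ holomorphic_M, unfolded o_def])
      show "(\<lambda>z. z + of_nat (i - i0)) ` S (\<sigma> - 1) \<subseteq> {z. \<sigma> < Re z}"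
      proof
        fix y assume "y \<in> (\<lambda>z. z + of_nat (i - i0)) ` S (\<sigma> - 1)"
        then obtain z where z: "z \<in> S (\<sigma> - 1)" "y = z + of_nat (i - i0)" by blast
        have "Re (z + of_nat k) > \<sigma>" if "1 \<le> k" for k :: nat using z(1) that by (simp add: S_def)
        moreover have "1 \<le> i - i0" using that by auto
        ultimately show "y \<in> {z. \<sigma> < Re z}" unfolding z(2) by blast
      qed
    qed (intro holomorphic_intros)
    show ?thesis unfolding T_def
      by (intro holomorphic_on_diff 1 holomorphic_on_sum holomorphic_on_mult holev 2)
  qed
  have holM: "M holomorphic_on S \<sigma>" by (rule holomorphic_on_subset[OF holomorphic_M]) (auto simp: S_def)
  have rel1: "I z * M z = T z" if z: "z \<notin> \<int>" "Re z > \<sigma> + i0" for z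
  proof -
    have "(\<Sum>i\<le>N. ev (c i) (z - of_nat i0) * M (z - of_nat i0 + of_nat i)) = B (z - of_nat i0)"
      by (rule rel) (use z shiftI in auto)
    also have "(\<Sum>i\<le>N. ev (c i) (z - of_nat i0) * M (z - of_nat i0 + of_nat i)) =
      (\<Sum>i\<in>insert i0 {i0<..N}. ev (c i) (z - of_nat i0) * M (z - of_nat i0 + of_nat i))"
    proof (rule sum.mono_neutral_right)
      show "\<forall>i\<in>{..N} - insert i0 {i0<..N}. ev (c i) (z - of_nat i0) * M (z - of_nat i0 + of_nat i) = 0"
        using below by (auto simp: not_less_iff_gr_or_eq)
    qed (use i0 in auto)
    also have "\<dots> = I z * M z + (\<Sum>i\<in>{i0<..N}. ev (c i) (z - of_nat i0) * M (z - of_nat i0 + of_nat i))"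
      by (simp add: I_def)
    also have "(\<Sum>i\<in>{i0<..N}. ev (c i) (z - of_nat i0) * M (z - of_nat i0 + of_nat i)) =
      (\<Sum>i\<in>{i0<..N}. ev (c i) (z - of_nat i0) * M (z + of_nat (i - i0)))"
      by (intro sum.cong refl) (simp add: of_nat_diff algebra_simps)
    finally show ?thesis unfolding T_def by (simp add: algebra_simps)
  qed
  have subS: "S \<sigma> \<subseteq> S (\<sigma> - 1)" unfolding S_def by auto
  \<comment> \<open>Translation by \<open>i0\<close> has moved the domain of validity to the right.
    The half-plane without the integers is still connected, since only countably many points are
    missing, and continuation brings the relation back down to \<sigma>.\<close>
  have rel2: "I z * M z = T z" if z: "z \<in> S \<sigma>" for z
  proof (rule analytic_continuation_open[of "S (\<sigma> + i0)" "S \<sigma>" "\<lambda>z. I z * M z" T])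
    show "open (S (\<sigma> + i0))" "open (S \<sigma>)" by (rule openS)+
    have "Complex (\<sigma> + i0 + 1) 1 \<in> S (\<sigma> + i0)" unfolding S_def by (auto simp: complex_is_Int_iff)
    then show "S (\<sigma> + i0) \<noteq> {}" by blast
    show "connected (S \<sigma>)" unfolding S_def
    proof (rule connected_open_diff_countable)
      show "connected {z. \<sigma> < Re z}" by (intro convex_connected convex_halfspace_Re_gt)
      show "countable (\<int> :: complex set)" by (simp add: Ints_def)
    qed (auto intro: open_halfspace_Re_gt)
    show "S (\<sigma> + i0) \<subseteq> S \<sigma>" unfolding S_def by auto
    show "(\<lambda>z. I z * M z) holomorphic_on S \<sigma>" by (intro holomorphic_on_mult holI holM)
    show "T holomorphic_on S \<sigma>" by (rule holomorphic_on_subset[OF holT subS])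
    show "I z * M z = T z" if "z \<in> S (\<sigma> + i0)" for z using that unfolding S_def by (intro rel1) auto
  qed (rule z)
  have I0: "I (of_real \<sigma>) \<noteq> 0"
  proof
    assume "I (of_real \<sigma>) = 0"
    then have "ev (c i0 \<circ>\<^sub>p [:- of_nat i0, 1:]) (of_real \<sigma>) = 0" unfolding I_def by (simp add: of_rat_minus)
    moreover have "c i0 \<circ>\<^sub>p [:- of_nat i0, 1:] \<noteq> 0"
    proof
      assume "c i0 \<circ>\<^sub>p [:- of_nat i0, 1:] = 0"
      then have "c i0 = 0" by (rule pcompose_eq_0) simp
      then show False using i0 by simp
    qed
    ultimately show False using nalg ev_root_algebraic by blast
  qed
  define U where "U = S (\<sigma> - 1) \<inter> I -` (- {0})"
  have contI: "continuous_on UNIV I" using holI holomorphic_on_imp_continuous_on by blast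
  have "open (I -` (- {0}))" by (rule open_vimage[OF open_Compl[OF closed_singleton] contI])
  then have "open U" unfolding U_def using openS by blast
  moreover have "of_real \<sigma> \<in> U" unfolding U_def S_def using \<sigma>I I0 by simp
  ultimately obtain \<rho> where \<rho>: "\<rho> > 0" "ball (of_real \<sigma>) \<rho> \<subseteq> U" using open_contains_ball by metis
  have \<rho>\<sigma>: "\<rho> \<le> \<sigma>"
  proof (rule ccontr)
    assume "\<not> \<rho> \<le> \<sigma>"
    then have "(0::complex) \<in> ball (of_real \<sigma>) \<rho>" using \<sigma> by (simp add: dist_norm)
    then have "(0::complex) \<in> U" using \<rho> by blast
    then show False unfolding U_def S_def by simp
  qed
  \<comment> \<open>With a third of the radius, the disc of radius \<open>2 * \<eta>\<close> about
    \<open>\<sigma> + \<eta>\<close> lies in the disc of radius \<rho> about \<sigma>, yet contains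
    the point \<open>\<sigma> - \<eta> / 2\<close> to the left of the abscissa, where the series is
    then forced to converge.\<close>
  define \<eta> where "\<eta> = \<rho> / 3"
  have \<eta>: "\<eta> > 0" "\<eta> < \<sigma>" unfolding \<eta>_def using \<rho> \<rho>\<sigma> \<sigma> by simp_all
  define s1 where "s1 = \<sigma> + \<eta>"
  have ballU: "ball (of_real s1 :: complex) (2 * \<eta>) \<subseteq> U"
  proof
    fix z :: complex assume "z \<in> ball (of_real s1) (2 * \<eta>)"
    then have "dist (of_real s1) z < 2 * \<eta>" by simp
    moreover have "dist (of_real \<sigma>) (of_real s1 :: complex) = \<eta>"
      unfolding s1_def using \<eta> by (simp add: dist_norm)
    ultimately have "dist (of_real \<sigma>) z < 3 * \<eta>" using dist_triangle[of "of_real \<sigma>" z "of_real s1"] by linarith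
    then show "z \<in> U" using \<rho> unfolding \<eta>_def by auto
  qed
  define G where "G z = T z / I z" for z
  have holG: "G holomorphic_on ball (of_real s1) (2 * \<eta>)"
    unfolding G_def
    by (intro holomorphic_on_divide holomorphic_on_subset[OF holT] holI) (use ballU in \<open>auto simp: U_def\<close>)
  have Re_near: "Re z > s1 - \<eta> / 2" if "z \<in> ball (of_real s1) (\<eta> / 2)" for z
  proof -
    have "s1 - Re z \<le> cmod (of_real s1 - z)" using complex_Re_le_cmod[of "of_real s1 - z"] by simp
    then show ?thesis using that by (simp add: dist_norm)
  qed
  have GM: "M z = G z" if z: "z \<in> ball (of_real s1) (\<eta> / 2)" for z
  proof -
    have zU: "z \<in> U" using ballU z \<eta> by (auto simp: subset_iff)
    have "Re z > \<sigma>" using Re_near[OF z] \<eta> unfolding s1_def by simp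
    then have "z \<in> S \<sigma>" using zU unfolding U_def S_def by simp
    from rel2[OF this] show ?thesis using zU unfolding G_def U_def by (simp add: field_simps)
  qed
  let ?f = "\<lambda>n z. of_real (b n) * bk z n"
  have lim: "uniform_limit (ball (of_real s1) (\<eta> / 2)) (\<lambda>N z. \<Sum>n<N. ?f n z) G sequentially"
  proof -
    have "uniform_limit {z. Re z \<ge> s1 - \<eta> / 2} (\<lambda>N z. \<Sum>n<N. ?f n z) M sequentially"
      by (rule uniform_M) (use \<eta> in \<open>simp add: s1_def\<close>)
    then have "uniform_limit (ball (of_real s1) (\<eta> / 2)) (\<lambda>N z. \<Sum>n<N. ?f n z) M sequentially"
      by (rule uniform_limit_on_subset) (use Re_near in \<open>auto intro: less_imp_le\<close>)
    then show ?thesis by (rule uniform_limit_cong'[THEN iffD1, rotated -1]) (use GM in auto)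
  qed
  define t where "t = \<sigma> - \<eta> / 2"
  have t0: "t > 0" unfolding t_def using \<eta> by simp
  have s10: "s1 > 0" unfolding s1_def using \<eta> \<sigma> by simp
  have bound: "(\<Sum>n<n'. b n * bk t n) \<le> Re (G (of_real t))" for n'
  proof -
    have "(\<Sum>n<n'. Re (?f n (of_real (s1 - 3 * \<eta> / 2)))) \<le> Re (G (of_real (s1 - 3 * \<eta> / 2)))"
    proof (rule landau_bound[where R = "2 * \<eta>" and r = "\<eta> / 2"])
      show "?f n holomorphic_on ball (of_real s1) (2 * \<eta>)" for n
      proof (intro holomorphic_intros bk_holomorphic)
        fix z :: complex assume "z \<in> ball (of_real s1) (2 * \<eta>)"
        then show "z \<notin> \<int>\<^sub>\<le>\<^sub>0" using ballU nonpos_Ints_Int unfolding U_def S_def by blast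
      qed
      show "compl_mono_at (?f n) (of_real s1)" for n
      proof -
        have hol: "(\<lambda>z. bk z n) holomorphic_on {z. Re z > 0}"
          by (rule bk_holomorphic) (use not_nonpos in auto)
        have "compl_mono_at (\<lambda>z. of_real (b n)) (of_real s1)"
          unfolding compl_mono_at_def using b0[of n] by (auto simp: higher_deriv_const)
        then show ?thesis
          by (intro compl_mono_mult[OF holomorphic_on_const hol open_halfspace_Re_gt _ _ compl_mono_bk]) (use s10 in auto)
      qed
      show "uniform_limit (ball (of_real s1) (\<eta> / 2)) (\<lambda>N z. \<Sum>n<N. ?f n z) G sequentially" by (rule lim)
    qed (use holG \<eta> in auto)
    moreover have "s1 - 3 * \<eta> / 2 = t" unfolding s1_def t_def by (simp add: field_simps)
    ultimately show ?thesis by (simp add: bk_of_real)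
  qed
  have sm: "summable (\<lambda>n. b n * bk t n)"
    by (rule summableI_nonneg_bounded[OF _ bound]) (use b0 bk_pos[OF t0] in \<open>simp add: less_imp_le\<close>)
  obtain c1 C1 where c1: "c1 > 0" "\<forall>\<^sub>F n in sequentially. c1 * n powr (-t) \<le> bk t n \<and> bk t n \<le> C1 * n powr (-t)"
    using bk_asymp[OF t0] by blast
  \<comment> \<open>The loss \<open>\<eta> / 4\<close> is half of the distance from \<open>t\<close>
    to \<sigma>: the terms at \<open>t\<close> are still at least of order
    \<open>n powr (-1 + \<eta> / 4)\<close>, so the series diverges there.\<close>
  obtain c2 where c2: "c2 > 0" "\<forall>\<^sub>F n in sequentially. c2 * n powr (\<sigma> - 1 - \<eta> / 4) \<le> b n"
    using lower[of "\<eta> / 4"] \<eta> by auto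
  have "\<forall>\<^sub>F n in sequentially. norm (real n powr (-1 + \<eta> / 4)) \<le> (b n * bk t n) / (c1 * c2)"
    using c1(2) c2(2) eventually_gt_at_top[of 0]
  proof eventually_elim
    case (elim n)
    have "c1 * c2 * n powr (-1 + \<eta> / 4) = c1 * c2 * n powr ((\<sigma> - 1 - \<eta> / 4) + (-t))"
      unfolding t_def by (simp add: algebra_simps)
    also have "\<dots> = (c2 * n powr (\<sigma> - 1 - \<eta> / 4)) * (c1 * n powr (-t))" unfolding powr_add by simp
    also have "\<dots> \<le> b n * bk t n"
      using elim c1 c2 b0[of n] by (intro mult_mono) auto
    finally show ?case using c1 c2 by (simp add: field_simps)
  qed
  then have "summable (\<lambda>n. real n powr (-1 + \<eta> / 4))"
    by (rule summable_comparison_test_ev) (intro summable_divide sm)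
  then show False using \<eta> by (simp add: summable_real_powr_iff)
qed

end

section \<open>Power functions along a martingale\<close>

lemma powr_expansion_complex:
  fixes p :: real
  shows "\<exists>C\<ge>0. \<forall>x::complex. cmod x \<le> 1/2 \<longrightarrow>
    cmod ((1 + x) powr of_real p - (1 + of_real p * x + of_real (p * (p - 1) / 2) * x^2)) \<le> C * cmod x ^ 3"
proof -
  define S where "S = cball (1::complex) (1/2)"
  define f where "f i z = (\<Prod>j<i. of_real p - of_nat j) * z powr (of_real p - of_nat i)" for i and z :: complex
  have Re: "Re z > 0" if "z \<in> S" for z
  proof -
    have "Re (1 - z) \<le> 1/2" using that complex_Re_le_cmod[of "1 - z"] unfolding S_def by (simp add: dist_norm)
    then show ?thesis by simp
  qed
  have np: "z \<notin> \<real>\<^sub>\<le>\<^sub>0" if "z \<in> S" for z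
    using Re[OF that] by (auto simp: complex_nonpos_Reals_iff)
  have der: "(f i has_field_derivative f (Suc i) z) (at z within S)" if "z \<in> S" for i z
  proof -
    have "((\<lambda>z. z powr (of_real p - of_nat i)) has_field_derivative
      (of_real p - of_nat i) * z powr (of_real p - of_nat i - 1)) (at z within S)"
      using np[OF that] by (intro has_field_derivative_powr has_field_derivative_at_within)
    from DERIV_cmult[OF this, of "\<Prod>j<i. of_real p - of_nat j"]
    show ?thesis unfolding f_def by (simp add: mult.assoc diff_diff_eq add.commute)
  qed
  have "continuous_on S (f 3)" by (rule DERIV_continuous_on[OF der])
  then have "compact (f 3 ` S)" unfolding S_def by (intro compact_continuous_image) auto
  then have "bounded (f 3 ` S)" by (rule compact_imp_bounded)
  then obtain B where B': "\<forall>y\<in>f 3 ` S. cmod y \<le> B" unfolding bounded_iff by blast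
  then have B: "cmod (f 3 z) \<le> B" if "z \<in> S" for z using that by blast
  have "1 \<in> S" unfolding S_def by simp
  then have B0: "B \<ge> 0" using order_trans[OF norm_ge_zero B] by blast
  have "cmod ((1 + x) powr of_real p - (1 + of_real p * x + of_real (p * (p - 1) / 2) * x^2)) \<le> (B / 2) * cmod x ^ 3"
    if x: "cmod x \<le> 1/2" for x :: complex
  proof -
    have "cmod (f 0 (1 + x) - (\<Sum>i\<le>2. f i 1 * ((1 + x) - 1) ^ i / fact i)) \<le> B * cmod ((1 + x) - 1) ^ Suc 2 / fact 2"
    proof (rule complex_Taylor[of S 2 f B 1 "1 + x"])
      show "convex S" unfolding S_def by simp
      show "1 \<in> S" "1 + x \<in> S" unfolding S_def using x by (simp_all add: dist_norm)
      show "cmod (f (Suc 2) z) \<le> B" if "z \<in> S" for z using B[OF that] by (simp add: numeral_3_eq_3 numeral_2_eq_2)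
    qed (use der in auto)
    moreover have "(\<Sum>i\<le>2. f i 1 * ((1 + x) - 1) ^ i / fact i) = 1 + of_real p * x + of_real (p * (p - 1) / 2) * x^2"
      by (simp add: f_def numeral_2_eq_2 algebra_simps)
    moreover have "f 0 (1 + x) = (1 + x) powr of_real p" by (simp add: f_def)
    ultimately show ?thesis by (simp add: eval_nat_numeral)
  qed
  then show ?thesis using B0 by (intro exI[of _ "B / 2"]) auto
qed

lemma powr_expansion_real:
  fixes p :: real
  shows "\<exists>C\<ge>0. \<forall>y::real. \<bar>y\<bar> \<le> 1/2 \<longrightarrow>
    \<bar>(1 + y) powr p - (1 + p * y + p * (p - 1) / 2 * y^2)\<bar> \<le> C * \<bar>y\<bar> ^ 3"
proof -
  obtain C where C: "C \<ge> 0" "\<And>x::complex. cmod x \<le> 1/2 \<Longrightarrow>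
    cmod ((1 + x) powr of_real p - (1 + of_real p * x + of_real (p * (p - 1) / 2) * x^2)) \<le> C * cmod x ^ 3"
    using powr_expansion_complex[of p] by blast
  have "\<bar>(1 + y) powr p - (1 + p * y + p * (p - 1) / 2 * y^2)\<bar> \<le> C * \<bar>y\<bar> ^ 3" if y: "\<bar>y\<bar> \<le> 1/2" for y :: real
  proof -
    have e: "(1 + of_real y) powr of_real p = complex_of_real ((1 + y) powr p)"
      using y powr_of_real[of "1 + y" p] by (simp add: abs_le_iff)
    have "(1 + of_real y) powr of_real p - (1 + of_real p * of_real y + of_real (p * (p - 1) / 2) * (of_real y)^2)
      = complex_of_real ((1 + y) powr p - (1 + p * y + p * (p - 1) / 2 * y^2))"
      unfolding e by simp
    then show ?thesis using C(2)[of "of_real y"] y by (simp only: norm_of_real)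
  qed
  then show ?thesis using C(1) by blast
qed

text \<open>An expansion to second order in the step size \<open>h\<close>: \<open>a\<close> is the
  first-order part, \<open>b\<close> the second-order part, and one constant bounds them and the
  remainder. Carrying the sizes of \<open>a\<close> and \<open>b\<close> along is what makes the
  notion stable under products.\<close>

definition ex2 :: "real \<Rightarrow> real \<Rightarrow> complex \<Rightarrow> complex \<Rightarrow> complex \<Rightarrow> bool" where
  "ex2 K h A a b \<longleftrightarrow> cmod (A - (1 + a + b)) \<le> K * h ^ 3 \<and> cmod a \<le> K * h \<and> cmod b \<le> K * h ^ 2"

lemma ex2_mult:
  assumes h: "0 \<le> h" "h \<le> 1" and K: "0 \<le> K" "0 \<le> L" and A: "ex2 K h A a1 a2" and B: "ex2 L h B b1 b2"
  shows "ex2 (K + L + 8 * K * L) h (A * B) (a1 + b1) (a2 + b2 + a1 * b1)"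
proof -
  define r where "r = A - (1 + a1 + a2)"
  define s where "s = B - (1 + b1 + b2)"
  have r: "cmod r \<le> K * h ^ 3" and s: "cmod s \<le> L * h ^ 3"
    and a: "cmod a1 \<le> K * h" "cmod a2 \<le> K * h ^ 2" and b: "cmod b1 \<le> L * h" "cmod b2 \<le> L * h ^ 2"
    using A B unfolding ex2_def r_def s_def by auto
  have h2: "h ^ 2 \<le> h" "h ^ 3 \<le> h ^ 2" "h ^ 3 \<le> 1" "h ^ 4 \<le> h ^ 3" "h ^ 2 \<le> 1"
    using h by (auto intro: power_decreasing[of 1 2 h, simplified] power_decreasing power_le_one)
  have KL: "0 \<le> K * L" using K by simp
  have a1': "cmod a1 \<le> K" "cmod a2 \<le> K" using a h h2 K mult_left_mono[of h 1 K] mult_left_mono[of "h^2" 1 K] by auto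
  have b': "cmod b1 \<le> L" "cmod b2 \<le> L" "cmod s \<le> L"
    using b s h h2 K mult_left_mono[of h 1 L] mult_left_mono[of "h^2" 1 L] mult_left_mono[of "h^3" 1 L] by auto
  have m1: "cmod (a1 * b2) \<le> K * L * h ^ 3"
    unfolding norm_mult using mult_mono[OF a(1) b(2)] K h by (simp add: eval_nat_numeral mult_ac)
  have m2: "cmod (a2 * b1) \<le> K * L * h ^ 3"
    unfolding norm_mult using mult_mono[OF a(2) b(1)] K h by (simp add: eval_nat_numeral mult_ac)
  have m3: "cmod (a2 * b2) \<le> K * L * h ^ 3"
  proof -
    have "cmod (a2 * b2) \<le> K * L * h ^ 4"
      unfolding norm_mult using mult_mono[OF a(2) b(2)] K h by (simp add: eval_nat_numeral mult_ac)
    also have "\<dots> \<le> K * L * h ^ 3" using h2 KL by (intro mult_left_mono) auto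
    finally show ?thesis .
  qed
  have Bn: "cmod B \<le> 1 + 3 * L"
  proof -
    have "B = 1 + b1 + b2 + s" unfolding s_def by simp
    then have "cmod B \<le> cmod (1::complex) + cmod b1 + cmod b2 + cmod s"
      by (simp only:) (intro norm_triangle_mono order_refl)
    then show ?thesis using b' by simp
  qed
  have m4: "cmod (r * B) \<le> (K + 3 * (K * L)) * h ^ 3"
    unfolding norm_mult using mult_mono[OF r Bn] K h by (simp add: algebra_simps)
  have An: "cmod (1 + a1 + a2) \<le> 1 + 2 * K"
  proof -
    have "cmod (1 + a1 + a2) \<le> cmod (1::complex) + cmod a1 + cmod a2"
      by (intro norm_triangle_mono order_refl)
    then show ?thesis using a1' by simp
  qed
  have m5: "cmod ((1 + a1 + a2) * s) \<le> (L + 2 * (K * L)) * h ^ 3"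
    unfolding norm_mult using mult_mono[OF An s] K h by (simp add: algebra_simps)
  have "A * B - (1 + (a1 + b1) + (a2 + b2 + a1 * b1)) = a1 * b2 + a2 * b1 + a2 * b2 + r * B + (1 + a1 + a2) * s"
    unfolding r_def s_def by (simp add: algebra_simps)
  also have "cmod \<dots> \<le> cmod (a1 * b2) + cmod (a2 * b1) + cmod (a2 * b2) + cmod (r * B) + cmod ((1 + a1 + a2) * s)"
    by (intro norm_triangle_mono order_refl)
  also have "\<dots> \<le> (K + L + 8 * K * L) * h ^ 3"
    using m1 m2 m3 m4 m5 by (simp add: algebra_simps)
  finally have 1: "cmod (A * B - (1 + (a1 + b1) + (a2 + b2 + a1 * b1))) \<le> (K + L + 8 * K * L) * h ^ 3" .
  have "cmod (a1 + b1) \<le> K * h + L * h" using a b by (intro norm_triangle_mono) auto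
  also have "\<dots> \<le> (K + L + 8 * K * L) * h" using mult_nonneg_nonneg[OF KL h(1)] by (simp add: algebra_simps)
  finally have 2: "cmod (a1 + b1) \<le> (K + L + 8 * K * L) * h" .
  have "cmod (a1 * b1) \<le> K * L * h ^ 2"
    unfolding norm_mult using mult_mono[OF a(1) b(1)] K h by (simp add: eval_nat_numeral mult_ac)
  then have "cmod (a2 + b2 + a1 * b1) \<le> K * h ^ 2 + L * h ^ 2 + K * L * h ^ 2" using a b by (intro norm_triangle_mono) auto
  also have "\<dots> \<le> (K + L + 8 * K * L) * h ^ 2" using mult_nonneg_nonneg[OF KL zero_le_power2[of h]] by (simp add: algebra_simps)
  finally show ?thesis using 1 2 unfolding ex2_def by blast
qed

lemma ex2_powr:
  fixes p :: real
  shows "\<exists>C\<ge>0. \<forall>x h. cmod x \<le> h \<longrightarrow> h \<le> 1/8 \<longrightarrow>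
    ex2 C h ((1 + x) powr of_real p) (of_real p * x) (of_real (p * (p - 1) / 2) * x^2)"
proof -
  obtain C where C: "C \<ge> 0" "\<And>x::complex. cmod x \<le> 1/2 \<Longrightarrow>
    cmod ((1 + x) powr of_real p - (1 + of_real p * x + of_real (p * (p - 1) / 2) * x^2)) \<le> C * cmod x ^ 3"
    using powr_expansion_complex[of p] by blast
  define K where "K = C + \<bar>p\<bar> + \<bar>p * (p - 1) / 2\<bar>"
  have K: "C \<le> K" "\<bar>p\<bar> \<le> K" "\<bar>p * (p - 1) / 2\<bar> \<le> K" unfolding K_def using C by auto
  have "ex2 K h ((1 + x) powr of_real p) (of_real p * x) (of_real (p * (p - 1) / 2) * x^2)" if x: "cmod x \<le> h" "h \<le> 1/8" for x h
  proof -
    have h0: "0 \<le> h" using x(1) norm_ge_zero order_trans by blast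
    have x2: "cmod x ^ 2 \<le> h ^ 2" "cmod x ^ 3 \<le> h ^ 3" using x by (intro power_mono; simp)+
    have "C * cmod x ^ 3 \<le> K * h ^ 3" by (rule mult_mono[OF K(1) x2(2)]) (use K C h0 in auto)
    moreover have "\<bar>p\<bar> * cmod x \<le> K * h" by (rule mult_mono[OF K(2) x(1)]) (use K C h0 in auto)
    moreover have "\<bar>p * (p - 1) / 2\<bar> * cmod x ^ 2 \<le> K * h ^ 2" by (rule mult_mono[OF K(3) x2(1)]) (use K C h0 in auto)
    moreover have "cmod x \<le> 1 / 2" using x by linarith
    ultimately show ?thesis unfolding ex2_def norm_mult norm_power norm_of_real
      using order_trans[OF C(2)[of x]] by blast
  qed
  moreover have "K \<ge> 0" using K C by linarith
  ultimately show ?thesis by blast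
qed

definition incr :: "complex \<Rightarrow> real" where "incr x = 2 * Re x + (cmod x)^2"

lemma cmod_one_plus: "(cmod (1 + x))^2 = 1 + incr x"
  unfolding incr_def cmod_power2 by (simp add: power2_eq_square algebra_simps)

lemma incr_bound:
  assumes "cmod x \<le> h" "h \<le> 1/8" shows "\<bar>incr x\<bar> \<le> 3 * h" "\<bar>incr x\<bar> \<le> 1/2" "\<bar>incr x - 2 * Re x\<bar> \<le> h^2"
proof -
  have h0: "0 \<le> h" using assms(1) norm_ge_zero order_trans by blast
  have "(cmod x)^2 \<le> h^2" using assms by (intro power_mono) auto
  moreover have "h^2 \<le> h" unfolding power2_eq_square using assms h0 mult_left_mono[of h 1 h] by simp
  moreover have "\<bar>Re x\<bar> \<le> h" using abs_Re_le_cmod[of x] assms by linarith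
  moreover have "0 \<le> (cmod x)^2" by simp
  ultimately show 1: "\<bar>incr x\<bar> \<le> 3 * h" unfolding incr_def by linarith
  then show "\<bar>incr x\<bar> \<le> 1/2" using assms by linarith
  show "\<bar>incr x - 2 * Re x\<bar> \<le> h^2" unfolding incr_def using \<open>(cmod x)^2 \<le> h^2\<close> by simp
qed

text \<open>The constant does not depend on \<tau>. In its use \<tau> is the share of
  \<open>\<kappa> * (cmod \<zeta>)^2\<close> in \<open>n + \<kappa> * (cmod \<zeta>)^2\<close>, so
  the estimates built on this lemma are uniform in \<open>n\<close> and \<kappa>.\<close>

lemma ex2_powr_incr:
  fixes p :: real
  shows "\<exists>C\<ge>0. \<forall>x h \<tau>. cmod x \<le> h \<longrightarrow> h \<le> 1/8 \<longrightarrow> 0 \<le> \<tau> \<longrightarrow> \<tau> \<le> 1 \<longrightarrow>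
    ex2 C h (of_real ((1 + \<tau> * incr x) powr p)) (of_real (p * \<tau> * (2 * Re x)))
      (of_real (p * \<tau> * (cmod x)^2 + p * (p - 1) / 2 * \<tau>^2 * (2 * Re x)^2))"
proof -
  obtain C where C: "C \<ge> 0" "\<And>y::real. \<bar>y\<bar> \<le> 1/2 \<Longrightarrow>
    \<bar>(1 + y) powr p - (1 + p * y + p * (p - 1) / 2 * y^2)\<bar> \<le> C * \<bar>y\<bar> ^ 3"
    using powr_expansion_real[of p] by blast
  define E where "E = \<bar>p * (p - 1) / 2\<bar>"
  define K where "K = 27 * C + 5 * E + 2 * \<bar>p\<bar>"
  have E0: "E \<ge> 0" unfolding E_def by simp
  have "ex2 K h (of_real ((1 + \<tau> * incr x) powr p)) (of_real (p * \<tau> * (2 * Re x)))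
      (of_real (p * \<tau> * (cmod x)^2 + p * (p - 1) / 2 * \<tau>^2 * (2 * Re x)^2))"
    if x: "cmod x \<le> h" "h \<le> 1/8" and \<tau>: "0 \<le> \<tau>" "\<tau> \<le> 1" for x h \<tau>
  proof -
    have h0: "0 \<le> h" using x(1) norm_ge_zero order_trans by blast
    note y = incr_bound[OF x]
    let ?y = "incr x"
    have R: "\<bar>2 * Re x\<bar> \<le> 2 * h" using abs_Re_le_cmod[of x] x by simp
    have R2: "(2 * Re x)^2 \<le> 4 * h^2" using power_mono[OF R, of 2] by (simp add: power_mult_distrib)
    have X2: "(cmod x)^2 \<le> h^2" using x by (intro power_mono) auto
    have \<tau>2: "\<tau>^2 \<le> 1" using \<tau> by (simp add: power_le_one)
    have ty: "\<bar>\<tau> * ?y\<bar> \<le> \<bar>?y\<bar>" using \<tau> by (simp add: abs_mult mult_left_le_one_le)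
    have "\<bar>(1 + \<tau> * ?y) powr p - (1 + p * (\<tau> * ?y) + p * (p - 1) / 2 * (\<tau> * ?y)^2)\<bar> \<le> C * \<bar>\<tau> * ?y\<bar> ^ 3"
      by (rule C(2)) (use ty y in linarith)
    also have "\<dots> \<le> C * (3 * h) ^ 3" using C ty y by (intro mult_left_mono power_mono) auto
    finally have 1: "\<bar>(1 + \<tau> * ?y) powr p - (1 + p * (\<tau> * ?y) + p * (p - 1) / 2 * (\<tau> * ?y)^2)\<bar> \<le> 27 * C * h ^ 3"
      by (simp add: power_mult_distrib)
    have d: "?y^2 - (2 * Re x)^2 = (?y - 2 * Re x) * (?y + 2 * Re x)" by (simp add: power2_eq_square algebra_simps)
    have "\<bar>?y^2 - (2 * Re x)^2\<bar> \<le> h^2 * (5 * h)"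
      unfolding d abs_mult using y R by (intro mult_mono) auto
    then have *: "E * (\<tau>^2 * \<bar>?y^2 - (2 * Re x)^2\<bar>) \<le> E * (1 * (h^2 * (5 * h)))"
      using \<tau>2 E0 h0 by (intro mult_left_mono mult_mono) auto
    have 2: "\<bar>p * (p - 1) / 2 * \<tau>^2 * (?y^2 - (2 * Re x)^2)\<bar> \<le> 5 * E * h ^ 3"
    proof -
      have "\<bar>p * (p - 1) / 2 * \<tau>^2 * (?y^2 - (2 * Re x)^2)\<bar> = E * (\<tau>^2 * \<bar>?y^2 - (2 * Re x)^2\<bar>)"
        unfolding E_def abs_mult[of "p * (p - 1) / 2 * \<tau>^2"] abs_mult[of "p * (p - 1) / 2"] by simp
      moreover have "E * (1 * (h^2 * (5 * h))) = 5 * E * h ^ 3" by (simp add: eval_nat_numeral)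
      ultimately show ?thesis using * by (simp only:)
    qed
    have eq: "(1 + \<tau> * ?y) powr p - (1 + p * \<tau> * (2 * Re x) + (p * \<tau> * (cmod x)^2 + p * (p - 1) / 2 * \<tau>^2 * (2 * Re x)^2))
      = ((1 + \<tau> * ?y) powr p - (1 + p * (\<tau> * ?y) + p * (p - 1) / 2 * (\<tau> * ?y)^2)) + p * (p - 1) / 2 * \<tau>^2 * (?y^2 - (2 * Re x)^2)"
    proof -
      define e where "e = p * (p - 1) / 2"
      show ?thesis unfolding incr_def e_def[symmetric] by (simp add: algebra_simps power2_eq_square)
    qed
    have 3: "\<bar>(1 + \<tau> * ?y) powr p - (1 + p * \<tau> * (2 * Re x) + (p * \<tau> * (cmod x)^2 + p * (p - 1) / 2 * \<tau>^2 * (2 * Re x)^2))\<bar> \<le> K * h ^ 3"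
    proof -
      have "0 \<le> 2 * \<bar>p\<bar> * h ^ 3" using h0 by simp
      then show ?thesis unfolding eq K_def using 1 2 by (simp add: distrib_right)
    qed
    have pt: "\<bar>p * \<tau>\<bar> \<le> \<bar>p\<bar>" using \<tau> by (simp add: abs_mult mult_left_le)
    have 4: "\<bar>p * \<tau> * (2 * Re x)\<bar> \<le> K * h"
    proof -
      have "\<bar>p * \<tau> * (2 * Re x)\<bar> \<le> \<bar>p\<bar> * (2 * h)" unfolding abs_mult[of "p * \<tau>"] using pt R by (intro mult_mono) auto
      also have "\<dots> \<le> K * h" unfolding K_def using C E0 h0 by (simp add: algebra_simps)
      finally show ?thesis .
    qed
    have 5: "\<bar>p * \<tau> * (cmod x)^2 + p * (p - 1) / 2 * \<tau>^2 * (2 * Re x)^2\<bar> \<le> K * h^2"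
    proof -
      have "\<bar>p * \<tau> * (cmod x)^2\<bar> \<le> \<bar>p\<bar> * h^2" unfolding abs_mult[of "p * \<tau>"] using pt X2 by (intro mult_mono) auto
      moreover have "\<bar>p * (p - 1) / 2 * \<tau>^2 * (2 * Re x)^2\<bar> \<le> (E * 1) * (4 * h^2)"
        unfolding abs_mult[of _ "(2 * Re x)^2"] abs_mult[of _ "\<tau>^2"] E_def[symmetric]
        using \<tau>2 R2 E0 by (intro mult_mono) auto
      moreover have "0 \<le> C * h^2" "0 \<le> E * h^2" "0 \<le> \<bar>p\<bar> * h^2" using C E0 by auto
      ultimately show ?thesis unfolding K_def by (simp add: distrib_right)
    qed
    show ?thesis unfolding ex2_def
    proof (intro conjI)
      have "of_real ((1 + \<tau> * ?y) powr p) - (1 + of_real (p * \<tau> * (2 * Re x)) + of_real (p * \<tau> * (cmod x)^2 + p * (p - 1) / 2 * \<tau>^2 * (2 * Re x)^2))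
        = complex_of_real ((1 + \<tau> * ?y) powr p - (1 + p * \<tau> * (2 * Re x) + (p * \<tau> * (cmod x)^2 + p * (p - 1) / 2 * \<tau>^2 * (2 * Re x)^2)))"
        by simp
      then show "cmod (of_real ((1 + \<tau> * ?y) powr p) - (1 + of_real (p * \<tau> * (2 * Re x)) + of_real (p * \<tau> * (cmod x)^2 + p * (p - 1) / 2 * \<tau>^2 * (2 * Re x)^2))) \<le> K * h ^ 3"
        using 3 by (simp only: norm_of_real)
    qed (use 4 5 in \<open>simp_all only: norm_of_real\<close>)
  qed
  moreover have "K \<ge> 0" unfolding K_def using C E0 by simp
  ultimately show ?thesis by blast
qed

text \<open>The vanishing complex second moment \<open>s2\<close> says that the two coordinates are
  uncorrelated with equal variances; together with \<open>s3\<close> the covariance is the identity.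
  To second order the generator is therefore half the Laplacian.\<close>

locale iso_walk =
  fixes p :: "nat \<Rightarrow> real" and s :: "nat \<Rightarrow> complex" and L :: real
  assumes p0: "\<And>i. p i \<ge> 0" and p1: "(\<Sum>i<3. p i) = 1"
    and s1: "(\<Sum>i<3. of_real (p i) * s i) = 0" and s2: "(\<Sum>i<3. of_real (p i) * (s i)^2) = 0"
    and s3: "(\<Sum>i<3. p i * (cmod (s i))^2) = 2"
    and sL: "\<And>i. i < 3 \<Longrightarrow> cmod (s i) \<le> L" and L: "L > 0"
begin

lemma avg_ex2:
  assumes "\<And>i. i < 3 \<Longrightarrow> ex2 K h (A i) (a i) (b i)"
  shows "cmod ((\<Sum>i<3. of_real (p i) * A i) - (1 + (\<Sum>i<3. of_real (p i) * a i) + (\<Sum>i<3. of_real (p i) * b i))) \<le> K * h ^ 3"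
proof -
  have "(1::complex) = (\<Sum>i<3. of_real (p i))" using p1 by (metis of_real_1 of_real_sum)
  then have "(\<Sum>i<3. of_real (p i) * A i) - (1 + (\<Sum>i<3. of_real (p i) * a i) + (\<Sum>i<3. of_real (p i) * b i))
    = (\<Sum>i<3. of_real (p i) * (A i - (1 + a i + b i)))"
    by (simp add: sum.distrib sum_subtractf algebra_simps)
  also have "cmod \<dots> \<le> (\<Sum>i<3. p i * (K * h ^ 3))"
  proof (rule sum_norm_le)
    fix i assume "i \<in> {..<3::nat}"
    then have "cmod (A i - (1 + a i + b i)) \<le> K * h ^ 3" using assms unfolding ex2_def by simp
    then show "cmod (of_real (p i) * (A i - (1 + a i + b i))) \<le> p i * (K * h ^ 3)"
      using p0[of i] by (simp add: norm_mult mult_left_mono)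
  qed
  also have "\<dots> = K * h ^ 3" by (simp only: sum_distrib_right[symmetric] p1 mult_1)
  finally show ?thesis .
qed

lemma avg_moments:
  assumes z: "\<zeta> \<noteq> 0"
  defines "x \<equiv> \<lambda>i. s i / \<zeta>"
  shows "(\<Sum>i<3. of_real (p i) * x i) = 0" "(\<Sum>i<3. of_real (p i) * (x i)^2) = 0"
    "(\<Sum>i<3. p i * (cmod (x i))^2) = 2 / (cmod \<zeta>)^2"
    "(\<Sum>i<3. p i * Re (x i)) = 0" "(\<Sum>i<3. p i * (2 * Re (x i))^2) = 4 / (cmod \<zeta>)^2"
    "(\<Sum>i<3. of_real (p i) * (of_real (2 * Re (x i)) * x i)) = of_real (2 / (cmod \<zeta>)^2)"
proof -
  show m1: "(\<Sum>i<3. of_real (p i) * x i) = 0"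
    using s1 by (simp add: x_def sum_divide_distrib[symmetric])
  show m2: "(\<Sum>i<3. of_real (p i) * (x i)^2) = 0"
    using s2 by (simp add: x_def power_divide sum_divide_distrib[symmetric])
  show m3: "(\<Sum>i<3. p i * (cmod (x i))^2) = 2 / (cmod \<zeta>)^2"
    using s3 by (simp add: x_def norm_divide power_divide sum_divide_distrib[symmetric])
  have "Re (\<Sum>i<3. of_real (p i) * x i) = 0" unfolding m1 by simp
  then show m4: "(\<Sum>i<3. p i * Re (x i)) = 0" by simp
  have xx: "of_real (2 * Re (x i)) * x i = (x i)^2 + of_real ((cmod (x i))^2)" for i
    by (simp add: complex_eq_iff cmod_power2 Re_power2 Im_power2) (simp add: power2_eq_square)
  have m3': "(\<Sum>i<3. of_real (p i) * of_real ((cmod (x i))^2)) = complex_of_real (2 / (cmod \<zeta>)^2)"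
    unfolding m3[symmetric] by simp
  show "(\<Sum>i<3. of_real (p i) * (of_real (2 * Re (x i)) * x i)) = of_real (2 / (cmod \<zeta>)^2)"
    unfolding xx distrib_left sum.distrib m2 m3' by simp
  have "(2 * Re (x i))^2 = 2 * (cmod (x i))^2 + 2 * Re ((x i)^2)" for i
    by (simp add: cmod_power2 Re_power2)
  then have "(\<Sum>i<3. p i * (2 * Re (x i))^2) = 2 * (\<Sum>i<3. p i * (cmod (x i))^2) + 2 * Re (\<Sum>i<3. of_real (p i) * (x i)^2)"
    by (simp add: sum.distrib sum_distrib_left algebra_simps)
  then show "(\<Sum>i<3. p i * (2 * Re (x i))^2) = 4 / (cmod \<zeta>)^2" unfolding m2 m3 by simp
qed

text \<open>Half the Laplacian of \<open>(n + \<kappa> * (cmod \<zeta>)^2) powr (-k)\<close> times a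
  function homogeneous of degree \<gamma> gives, relative to the product and apart from the
  Laplacian of that function, this number divided by \<open>(cmod \<zeta>)^2\<close>. The part with
  \<gamma> is the product of the two gradients, the rest is the Laplacian of the first
  factor.\<close>

definition Q :: "real \<Rightarrow> real \<Rightarrow> real \<Rightarrow> real" where
  "Q k \<tau> \<gamma> = - 2 * k * \<tau> * (1 + \<gamma>) + 2 * k * (k + 1) * \<tau>^2"

text \<open>The power is analytic in the step, so its own second-order part is a multiple of the
  complex second moment and averages to zero. What survives is \<open>Q\<close>.\<close>

lemma avg_harmonic:
  fixes k \<beta> :: real
  shows "\<exists>C\<ge>0. \<forall>\<zeta> \<tau>. cmod \<zeta> \<ge> 8 * L \<longrightarrow> 0 \<le> \<tau> \<longrightarrow> \<tau> \<le> 1 \<longrightarrow>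
    cmod ((\<Sum>i<3. of_real (p i) * (of_real ((1 + \<tau> * incr (s i / \<zeta>)) powr (-k)) * (1 + s i / \<zeta>) powr of_real \<beta>))
      - of_real (1 + Q k \<tau> \<beta> / (cmod \<zeta>)^2)) \<le> C / (cmod \<zeta>) ^ 3"
proof -
  obtain C1 where C1: "C1 \<ge> 0" "\<forall>x h \<tau>. cmod x \<le> h \<longrightarrow> h \<le> 1/8 \<longrightarrow> 0 \<le> \<tau> \<longrightarrow> \<tau> \<le> 1 \<longrightarrow>
    ex2 C1 h (of_real ((1 + \<tau> * incr x) powr (-k))) (of_real ((-k) * \<tau> * (2 * Re x)))
      (of_real ((-k) * \<tau> * (cmod x)^2 + (-k) * ((-k) - 1) / 2 * \<tau>^2 * (2 * Re x)^2))"
    using ex2_powr_incr[of "-k"] by blast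
  obtain C2 where C2: "C2 \<ge> 0" "\<forall>x h. cmod x \<le> h \<longrightarrow> h \<le> 1/8 \<longrightarrow>
    ex2 C2 h ((1 + x) powr of_real \<beta>) (of_real \<beta> * x) (of_real (\<beta> * (\<beta> - 1) / 2) * x^2)"
    using ex2_powr[of \<beta>] by blast
  define K where "K = C1 + C2 + 8 * C1 * C2"
  have K0: "K \<ge> 0" unfolding K_def using C1 C2 by simp
  have "cmod ((\<Sum>i<3. of_real (p i) * (of_real ((1 + \<tau> * incr (s i / \<zeta>)) powr (-k)) * (1 + s i / \<zeta>) powr of_real \<beta>))
      - of_real (1 + Q k \<tau> \<beta> / (cmod \<zeta>)^2)) \<le> (K * L ^ 3) / (cmod \<zeta>) ^ 3"
    if z: "cmod \<zeta> \<ge> 8 * L" and \<tau>: "0 \<le> \<tau>" "\<tau> \<le> 1" for \<zeta> \<tau>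
  proof -
    have zp: "cmod \<zeta> > 0" using z L by linarith
    then have z0: "\<zeta> \<noteq> 0" by auto
    define x where "x i = s i / \<zeta>" for i
    define h where "h = L / cmod \<zeta>"
    have h: "0 \<le> h" "h \<le> 1/8" "h \<le> 1" unfolding h_def using z L zp by (simp_all add: field_simps)
    have xh: "cmod (x i) \<le> h" if "i < 3" for i
      unfolding x_def h_def norm_divide using sL[OF that] zp by (simp add: divide_right_mono)
    let ?a = "\<lambda>i. of_real ((-k) * \<tau> * (2 * Re (x i))) + of_real \<beta> * x i"
    let ?b = "\<lambda>i. of_real ((-k) * \<tau> * (cmod (x i))^2 + (-k) * ((-k) - 1) / 2 * \<tau>^2 * (2 * Re (x i))^2)
      + of_real (\<beta> * (\<beta> - 1) / 2) * (x i)^2 + of_real ((-k) * \<tau> * (2 * Re (x i))) * (of_real \<beta> * x i)"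
    have e: "ex2 K h (of_real ((1 + \<tau> * incr (x i)) powr (-k)) * (1 + x i) powr of_real \<beta>) (?a i) (?b i)" if i: "i < 3" for i
    proof -
      have "ex2 C1 h (of_real ((1 + \<tau> * incr (x i)) powr (-k))) (of_real ((-k) * \<tau> * (2 * Re (x i))))
        (of_real ((-k) * \<tau> * (cmod (x i))^2 + (-k) * ((-k) - 1) / 2 * \<tau>^2 * (2 * Re (x i))^2))"
        using C1(2) xh[OF i] h \<tau> by blast
      moreover have "ex2 C2 h ((1 + x i) powr of_real \<beta>) (of_real \<beta> * x i) (of_real (\<beta> * (\<beta> - 1) / 2) * (x i)^2)"
        using C2(2) xh[OF i] h by blast
      ultimately show ?thesis unfolding K_def by (rule ex2_mult[OF h(1,3) C1(1) C2(1)])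
    qed
    note m = avg_moments[OF z0, folded x_def]
    have suma: "(\<Sum>i<3. of_real (p i) * ?a i) = 0"
    proof -
      have "(\<Sum>i<3. of_real (p i) * ?a i) = of_real ((-k) * \<tau> * 2 * (\<Sum>i<3. p i * Re (x i))) + of_real \<beta> * (\<Sum>i<3. of_real (p i) * x i)"
        by (simp add: eval_nat_numeral algebra_simps)
      then show ?thesis unfolding m by simp
    qed
    have sumb: "(\<Sum>i<3. of_real (p i) * ?b i) = of_real (Q k \<tau> \<beta> / (cmod \<zeta>)^2)"
    proof -
      have "(\<Sum>i<3. of_real (p i) * ?b i) =
        of_real ((-k) * \<tau> * (\<Sum>i<3. p i * (cmod (x i))^2)) + of_real ((-k) * ((-k) - 1) / 2 * \<tau>^2 * (\<Sum>i<3. p i * (2 * Re (x i))^2))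
        + of_real (\<beta> * (\<beta> - 1) / 2) * (\<Sum>i<3. of_real (p i) * (x i)^2)
        + of_real ((-k) * \<tau> * \<beta>) * (\<Sum>i<3. of_real (p i) * (of_real (2 * Re (x i)) * x i))"
        unfolding of_real_add of_real_mult of_real_sum distrib_left sum.distrib sum_distrib_left
        by (simp only: mult_ac)
      also have "\<dots> = of_real (Q k \<tau> \<beta> / (cmod \<zeta>)^2)"
      proof -
        define R where "R = 1 / (cmod \<zeta>)^2"
        have R: "c / (cmod \<zeta>)^2 = c * R" for c unfolding R_def by simp
        show ?thesis
          unfolding m Q_def R of_real_mult[symmetric] of_real_add[symmetric] mult_zero_right add_0_right
          by (rule arg_cong[where f = of_real]) (simp add: field_simps power2_eq_square)
      qed
      finally show ?thesis .
    qed
    have "cmod ((\<Sum>i<3. of_real (p i) * (of_real ((1 + \<tau> * incr (x i)) powr (-k)) * (1 + x i) powr of_real \<beta>))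
      - (1 + (\<Sum>i<3. of_real (p i) * ?a i) + (\<Sum>i<3. of_real (p i) * ?b i))) \<le> K * h ^ 3"
      by (rule avg_ex2) (rule e)
    then show ?thesis unfolding suma sumb x_def[symmetric] unfolding h_def
      by (simp only: power_divide of_real_add of_real_1 add_0_right times_divide_eq_right)
  qed
  moreover have "K * L ^ 3 \<ge> 0" using K0 L by simp
  ultimately show ?thesis by blast
qed

text \<open>\<open>\<gamma>^2 / 2\<close> comes from half the Laplacian of the radial power. The
  modulus is treated as the square root of \<open>1 + incr\<close>, so that both factors are covered
  by \<open>ex2_powr_incr\<close>, the second one with \<tau> equal to 1.\<close>

lemma avg_radial:
  fixes k \<gamma> :: real
  shows "\<exists>C\<ge>0. \<forall>\<zeta> \<tau>. cmod \<zeta> \<ge> 8 * L \<longrightarrow> 0 \<le> \<tau> \<longrightarrow> \<tau> \<le> 1 \<longrightarrow>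
    \<bar>(\<Sum>i<3. p i * ((1 + \<tau> * incr (s i / \<zeta>)) powr (-k) * cmod (1 + s i / \<zeta>) powr \<gamma>))
      - (1 + (\<gamma>^2 / 2 + Q k \<tau> \<gamma>) / (cmod \<zeta>)^2)\<bar> \<le> C / (cmod \<zeta>) ^ 3"
proof -
  obtain C1 where C1: "C1 \<ge> 0" "\<forall>x h \<tau>. cmod x \<le> h \<longrightarrow> h \<le> 1/8 \<longrightarrow> 0 \<le> \<tau> \<longrightarrow> \<tau> \<le> 1 \<longrightarrow>
    ex2 C1 h (of_real ((1 + \<tau> * incr x) powr (-k))) (of_real ((-k) * \<tau> * (2 * Re x)))
      (of_real ((-k) * \<tau> * (cmod x)^2 + (-k) * ((-k) - 1) / 2 * \<tau>^2 * (2 * Re x)^2))"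
    using ex2_powr_incr[of "-k"] by blast
  define g where "g = \<gamma> / 2"
  obtain C2 where C2: "C2 \<ge> 0" "\<forall>x h \<tau>. cmod x \<le> h \<longrightarrow> h \<le> 1/8 \<longrightarrow> 0 \<le> \<tau> \<longrightarrow> \<tau> \<le> 1 \<longrightarrow>
    ex2 C2 h (of_real ((1 + \<tau> * incr x) powr g)) (of_real (g * \<tau> * (2 * Re x)))
      (of_real (g * \<tau> * (cmod x)^2 + g * (g - 1) / 2 * \<tau>^2 * (2 * Re x)^2))"
    using ex2_powr_incr[of g] by blast
  define K where "K = C1 + C2 + 8 * C1 * C2"
  have K0: "K \<ge> 0" unfolding K_def using C1 C2 by simp
  have "\<bar>(\<Sum>i<3. p i * ((1 + \<tau> * incr (s i / \<zeta>)) powr (-k) * cmod (1 + s i / \<zeta>) powr \<gamma>))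
      - (1 + (\<gamma>^2 / 2 + Q k \<tau> \<gamma>) / (cmod \<zeta>)^2)\<bar> \<le> (K * L ^ 3) / (cmod \<zeta>) ^ 3"
    if z: "cmod \<zeta> \<ge> 8 * L" and \<tau>: "0 \<le> \<tau>" "\<tau> \<le> 1" for \<zeta> \<tau>
  proof -
    have zp: "cmod \<zeta> > 0" using z L by linarith
    then have z0: "\<zeta> \<noteq> 0" by auto
    define x where "x i = s i / \<zeta>" for i
    define h where "h = L / cmod \<zeta>"
    have h: "0 \<le> h" "h \<le> 1/8" "h \<le> 1" unfolding h_def using z L zp by (simp_all add: field_simps)
    have xh: "cmod (x i) \<le> h" if "i < 3" for i
      unfolding x_def h_def norm_divide using sL[OF that] zp by (simp add: divide_right_mono)
    have pw: "cmod (1 + x i) powr \<gamma> = (1 + 1 * incr (x i)) powr g" if "i < 3" for i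
    proof -
      have "1 + incr (x i) > 0" using incr_bound(2)[OF xh[OF that] h(2)] by (simp add: abs_le_iff)
      moreover have "cmod (1 + x i) = sqrt (1 + incr (x i))" using cmod_one_plus[of "x i"] by (metis norm_ge_zero real_sqrt_abs2 real_sqrt_unique)
      ultimately show ?thesis unfolding g_def by (simp add: powr_half_sqrt[symmetric] powr_powr)
    qed
    let ?a = "\<lambda>i. complex_of_real ((-k) * \<tau> * (2 * Re (x i))) + of_real (g * 1 * (2 * Re (x i)))"
    let ?b = "\<lambda>i. complex_of_real ((-k) * \<tau> * (cmod (x i))^2 + (-k) * ((-k) - 1) / 2 * \<tau>^2 * (2 * Re (x i))^2)
      + of_real (g * 1 * (cmod (x i))^2 + g * (g - 1) / 2 * 1^2 * (2 * Re (x i))^2)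
      + of_real ((-k) * \<tau> * (2 * Re (x i))) * of_real (g * 1 * (2 * Re (x i)))"
    let ?A = "\<lambda>i. (1 + \<tau> * incr (x i)) powr (-k) * cmod (1 + x i) powr \<gamma>"
    have e: "ex2 K h (of_real (?A i)) (?a i) (?b i)" if i: "i < 3" for i
    proof -
      have "ex2 C1 h (of_real ((1 + \<tau> * incr (x i)) powr (-k))) (of_real ((-k) * \<tau> * (2 * Re (x i))))
        (of_real ((-k) * \<tau> * (cmod (x i))^2 + (-k) * ((-k) - 1) / 2 * \<tau>^2 * (2 * Re (x i))^2))"
        using C1(2) xh[OF i] h \<tau> by blast
      moreover have "ex2 C2 h (of_real ((1 + 1 * incr (x i)) powr g)) (of_real (g * 1 * (2 * Re (x i))))
        (of_real (g * 1 * (cmod (x i))^2 + g * (g - 1) / 2 * 1^2 * (2 * Re (x i))^2))"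
        using C2(2)[rule_format, of "x i" h 1] xh[OF i] h by simp
      ultimately show ?thesis unfolding K_def pw[OF i] of_real_mult[of "(1 + \<tau> * incr (x i)) powr (-k)"]
        by (rule ex2_mult[OF h(1,3) C1(1) C2(1)])
    qed
    note m = avg_moments[OF z0, folded x_def]
    have suma: "(\<Sum>i<3. of_real (p i) * ?a i) = 0"
    proof -
      have "(\<Sum>i<3. of_real (p i) * ?a i) = complex_of_real (((-k) * \<tau> * 2 + 2 * g) * (\<Sum>i<3. p i * Re (x i)))"
        unfolding of_real_add[symmetric] of_real_mult[symmetric] of_real_sum[symmetric]
        by (rule arg_cong[where f = of_real]) (simp add: eval_nat_numeral algebra_simps)
      then show ?thesis unfolding m by simp
    qed
    have sumb: "(\<Sum>i<3. of_real (p i) * ?b i) = complex_of_real ((\<gamma>^2 / 2 + Q k \<tau> \<gamma>) / (cmod \<zeta>)^2)"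
    proof -
      have "(\<Sum>i<3. of_real (p i) * ?b i) =
        complex_of_real (((-k) * \<tau> + g) * (\<Sum>i<3. p i * (cmod (x i))^2)
         + ((-k) * ((-k) - 1) / 2 * \<tau>^2 + g * (g - 1) / 2 + (-k) * \<tau> * g) * (\<Sum>i<3. p i * (2 * Re (x i))^2))"
        unfolding of_real_add[symmetric] of_real_mult[symmetric] of_real_sum[symmetric]
        by (rule arg_cong[where f = of_real]) (simp add: eval_nat_numeral algebra_simps)
      also have "\<dots> = complex_of_real ((\<gamma>^2 / 2 + Q k \<tau> \<gamma>) / (cmod \<zeta>)^2)"
      proof -
        define R where "R = 1 / (cmod \<zeta>)^2"
        have R: "c / (cmod \<zeta>)^2 = c * R" for c unfolding R_def by simp
        show ?thesis
          unfolding m Q_def R g_def by (rule arg_cong[where f = of_real]) (simp add: field_simps power2_eq_square)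
      qed
      finally show ?thesis .
    qed
    have "cmod ((\<Sum>i<3. of_real (p i) * of_real (?A i))
      - (1 + (\<Sum>i<3. of_real (p i) * ?a i) + (\<Sum>i<3. of_real (p i) * ?b i))) \<le> K * h ^ 3"
      by (rule avg_ex2) (rule e)
    moreover have "(\<Sum>i<3. of_real (p i) * of_real (?A i)) - (1 + 0 + complex_of_real ((\<gamma>^2 / 2 + Q k \<tau> \<gamma>) / (cmod \<zeta>)^2))
      = of_real ((\<Sum>i<3. p i * ?A i) - (1 + (\<gamma>^2 / 2 + Q k \<tau> \<gamma>) / (cmod \<zeta>)^2))" by simp
    ultimately have "\<bar>(\<Sum>i<3. p i * ?A i) - (1 + (\<gamma>^2 / 2 + Q k \<tau> \<gamma>) / (cmod \<zeta>)^2)\<bar> \<le> K * h ^ 3"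
      unfolding suma sumb by (simp only: norm_of_real)
    then show ?thesis unfolding x_def h_def by (simp only: power_divide times_divide_eq_right)
  qed
  moreover have "K * L ^ 3 \<ge> 0" using K0 L by simp
  ultimately show ?thesis by blast
qed

end

lemma powr_mult_Re_pos:
  fixes z w :: complex
  assumes "Re z > 0" "Re w > 0"
  shows "(z * w) powr c = z powr c * w powr c"
proof -
  have nz: "z \<noteq> 0" "w \<noteq> 0" using assms by auto
  have "\<bar>Im (Ln z)\<bar> < pi / 2" "\<bar>Im (Ln w)\<bar> < pi / 2"
    using assms nz Re_Ln_pos_lt by blast+
  then have "Ln (z * w) = Ln z + Ln w" using nz by (intro Ln_times_simple) auto
  then show ?thesis using nz by (simp add: powr_def distrib_left exp_add)
qed

lemma norm_powr_of_real: "z \<noteq> 0 \<Longrightarrow> cmod (z powr of_real b) = cmod z powr b"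
  by (simp add: norm_powr_real_powr')

lemma powr_expansion_first:
  fixes p :: real
  shows "\<exists>C\<ge>0. \<forall>y::real. 0 \<le> y \<longrightarrow> y \<le> 1/2 \<longrightarrow> \<bar>(1 + y) powr p - (1 + p * y)\<bar> \<le> C * y^2"
proof -
  obtain C where C: "C \<ge> 0" "\<And>y::real. \<bar>y\<bar> \<le> 1/2 \<Longrightarrow>
    \<bar>(1 + y) powr p - (1 + p * y + p * (p - 1) / 2 * y^2)\<bar> \<le> C * \<bar>y\<bar> ^ 3"
    using powr_expansion_real[of p] by blast
  have "\<bar>(1 + y) powr p - (1 + p * y)\<bar> \<le> (C + \<bar>p * (p - 1) / 2\<bar>) * y^2" if y: "0 \<le> y" "y \<le> 1/2" for y
  proof -
    have "\<bar>(1 + y) powr p - (1 + p * y + p * (p - 1) / 2 * y^2)\<bar> \<le> C * y ^ 3" using C(2)[of y] y by simp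
    moreover have "C * y ^ 3 \<le> C * y ^ 2" using C y by (intro mult_left_mono power_decreasing) auto
    moreover have "\<bar>p * (p - 1) / 2 * y^2\<bar> = \<bar>p * (p - 1) / 2\<bar> * y^2" by (simp add: abs_mult)
    ultimately show ?thesis by (simp add: distrib_right)
  qed
  then show ?thesis using C(1) by (intro exI[of _ "C + \<bar>p * (p - 1) / 2\<bar>"]) auto
qed

lemma time_factor:
  fixes q k :: real
  shows "\<exists>C\<ge>0. \<forall>n m. 2 \<le> n \<longrightarrow> n \<le> m \<longrightarrow>
    \<bar>(1 + 1 / n) powr q * (1 + 1 / m) powr (-k) - (1 + q / n - k / m)\<bar> \<le> C / n^2"
proof -
  obtain C where C: "C \<ge> 0" "\<And>y::real. 0 \<le> y \<Longrightarrow> y \<le> 1/2 \<Longrightarrow> \<bar>(1 + y) powr q - (1 + q * y)\<bar> \<le> C * y^2"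
    using powr_expansion_first[of q] by blast
  obtain D where D: "D \<ge> 0" "\<And>y::real. 0 \<le> y \<Longrightarrow> y \<le> 1/2 \<Longrightarrow> \<bar>(1 + y) powr (-k) - (1 + (-k) * y)\<bar> \<le> D * y^2"
    using powr_expansion_first[of "-k"] by blast
  define E where "E = C * (1 + \<bar>k\<bar> + D) + D * (1 + \<bar>q\<bar>) + \<bar>q\<bar> * \<bar>k\<bar>"
  have "\<bar>(1 + 1 / n) powr q * (1 + 1 / m) powr (-k) - (1 + q / n - k / m)\<bar> \<le> E / n^2"
    if n: "2 \<le> n" "n \<le> m" for n m :: real
  proof -
    define y where "y = 1 / n"
    define z where "z = 1 / m"
    have y: "0 \<le> y" "y \<le> 1/2" unfolding y_def using n by (simp_all add: field_simps)
    have z: "0 \<le> z" "z \<le> y" unfolding z_def y_def using n by (simp_all add: field_simps)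
    define r where "r = (1 + y) powr q - (1 + q * y)"
    define s where "s = (1 + z) powr (-k) - (1 + (-k) * z)"
    have r: "\<bar>r\<bar> \<le> C * y^2" unfolding r_def using C(2)[OF y] .
    have s: "\<bar>s\<bar> \<le> D * z^2" unfolding s_def using D(2)[of z] y z by simp
    have "z^2 \<le> y^2" using z by (intro power_mono) auto
    then have s': "\<bar>s\<bar> \<le> D * y^2" using s D mult_left_mono[of "z^2" "y^2" D] by linarith
    have y2: "y^2 \<le> 1" using y by (simp add: power_le_one)
    have "\<bar>s\<bar> \<le> D" using s' D y2 mult_left_mono[of "y^2" 1 D] by linarith
    moreover have "\<bar>k * z\<bar> \<le> \<bar>k\<bar>" using y z mult_left_mono[of z 1 "\<bar>k\<bar>"] by (simp add: abs_mult)
    ultimately have b: "\<bar>1 - k * z + s\<bar> \<le> 1 + \<bar>k\<bar> + D" by linarith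
    have 1: "\<bar>r * (1 - k * z + s)\<bar> \<le> (C * y^2) * (1 + \<bar>k\<bar> + D)"
      unfolding abs_mult using r b by (intro mult_mono) auto
    have "\<bar>q * y\<bar> \<le> \<bar>q\<bar>" using y mult_left_mono[of y 1 "\<bar>q\<bar>"] by (simp add: abs_mult)
    then have "\<bar>1 + q * y\<bar> \<le> 1 + \<bar>q\<bar>" by linarith
    then have 2: "\<bar>(1 + q * y) * s\<bar> \<le> (1 + \<bar>q\<bar>) * (D * y^2)"
      unfolding abs_mult using s' by (intro mult_mono) auto
    have "y * z \<le> y * y" using y z by (intro mult_left_mono) auto
    then have 3: "\<bar>q * k * (y * z)\<bar> \<le> \<bar>q\<bar> * \<bar>k\<bar> * y^2"
      unfolding abs_mult using y z by (intro mult_mono) (auto simp: power2_eq_square abs_mult)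
    have "(1 + y) powr q * (1 + z) powr (-k) - (1 + q * y - k * z) = r * (1 - k * z + s) + (1 + q * y) * s - q * k * (y * z)"
      unfolding r_def s_def by (simp add: algebra_simps)
    also have "\<bar>\<dots>\<bar> \<le> (C * y^2) * (1 + \<bar>k\<bar> + D) + (1 + \<bar>q\<bar>) * (D * y^2) + \<bar>q\<bar> * \<bar>k\<bar> * y^2"
      using 1 2 3 by linarith
    also have "\<dots> = E * y^2" unfolding E_def by (simp add: algebra_simps)
    finally show ?thesis unfolding y_def z_def by (simp add: power_divide)
  qed
  moreover have "E \<ge> 0" unfolding E_def using C D by simp
  ultimately show ?thesis by blast
qed

context iso_walk
begin

definition mm :: "real \<Rightarrow> real \<Rightarrow> complex \<Rightarrow> real" where "mm \<kappa> n \<zeta> = n + \<kappa> * (cmod \<zeta>)^2"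

lemma mm_step:
  assumes "n > 0" "\<kappa> > 0" "cmod \<zeta> \<ge> 8 * L" "i < 3"
  defines "\<tau> \<equiv> \<kappa> * (cmod \<zeta>)^2 / mm \<kappa> n \<zeta>"
  shows "mm \<kappa> n (\<zeta> + s i) powr (-k) = mm \<kappa> n \<zeta> powr (-k) * (1 + \<tau> * incr (s i / \<zeta>)) powr (-k)"
    "\<zeta> + s i = \<zeta> * (1 + s i / \<zeta>)" "Re (1 + s i / \<zeta>) > 0" "0 \<le> \<tau>" "\<tau> \<le> 1" "1 + \<tau> * incr (s i / \<zeta>) > 0"
proof -
  have zp: "cmod \<zeta> > 0" using assms L by linarith
  then have z0: "\<zeta> \<noteq> 0" by auto
  show e: "\<zeta> + s i = \<zeta> * (1 + s i / \<zeta>)" using z0 by (simp add: distrib_left)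
  have mp: "mm \<kappa> n \<zeta> > 0" unfolding mm_def using assms by (intro add_pos_nonneg) auto
  show \<tau>: "0 \<le> \<tau>" "\<tau> \<le> 1" unfolding \<tau>_def using assms mp by (auto simp: divide_le_eq mm_def)
  have "cmod (s i / \<zeta>) \<le> L / cmod \<zeta>" unfolding norm_divide using sL[OF assms(4)] zp by (simp add: divide_right_mono)
  also have "\<dots> \<le> 1/8" using assms zp by (simp add: field_simps)
  finally have x: "cmod (s i / \<zeta>) \<le> 1/8" .
  then show "Re (1 + s i / \<zeta>) > 0" using abs_Re_le_cmod[of "s i / \<zeta>"] by simp
  have "\<bar>\<tau> * incr (s i / \<zeta>)\<bar> \<le> 1 / 2"
    using incr_bound(2)[OF x order_refl] \<tau> mult_mono[of \<tau> 1 "\<bar>incr (s i / \<zeta>)\<bar>" "1/2"] by (simp add: abs_mult)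
  then show pos: "1 + \<tau> * incr (s i / \<zeta>) > 0" by linarith
  have "(cmod (\<zeta> + s i))^2 = (cmod \<zeta>)^2 * (1 + incr (s i / \<zeta>))"
    unfolding e norm_mult power_mult_distrib cmod_one_plus ..
  then have "mm \<kappa> n (\<zeta> + s i) = mm \<kappa> n \<zeta> + \<kappa> * (cmod \<zeta>)^2 * incr (s i / \<zeta>)"
    unfolding mm_def by (simp add: algebra_simps)
  also have "\<dots> = mm \<kappa> n \<zeta> * (1 + \<tau> * incr (s i / \<zeta>))" unfolding \<tau>_def using mp by (simp add: field_simps)
  finally show "mm \<kappa> n (\<zeta> + s i) powr (-k) = mm \<kappa> n \<zeta> powr (-k) * (1 + \<tau> * incr (s i / \<zeta>)) powr (-k)"
    using mp pos by (simp add: powr_mult)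
qed

lemma step_radial:
  fixes k \<gamma> :: real
  shows "\<exists>C\<ge>0. \<forall>\<zeta> n \<kappa>. cmod \<zeta> \<ge> 8 * L \<longrightarrow> n > 0 \<longrightarrow> \<kappa> > 0 \<longrightarrow>
    (\<exists>e. \<bar>e\<bar> \<le> C / cmod \<zeta> ^ 3 \<and>
    (\<Sum>i<3. p i * (mm \<kappa> n (\<zeta> + s i) powr (-k) * cmod (\<zeta> + s i) powr \<gamma>)) =
     mm \<kappa> n \<zeta> powr (-k) * cmod \<zeta> powr \<gamma> *
      (1 + (\<gamma>^2 / 2 + Q k (\<kappa> * (cmod \<zeta>)^2 / mm \<kappa> n \<zeta>) \<gamma>) / (cmod \<zeta>)^2 + e))"
proof -
  obtain C where C: "C \<ge> 0" "\<And>\<zeta> \<tau>. cmod \<zeta> \<ge> 8 * L \<Longrightarrow> 0 \<le> \<tau> \<Longrightarrow> \<tau> \<le> 1 \<Longrightarrow>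
    \<bar>(\<Sum>i<3. p i * ((1 + \<tau> * incr (s i / \<zeta>)) powr (-k) * cmod (1 + s i / \<zeta>) powr \<gamma>))
      - (1 + (\<gamma>^2 / 2 + Q k \<tau> \<gamma>) / (cmod \<zeta>)^2)\<bar> \<le> C / (cmod \<zeta>) ^ 3"
    using avg_radial[of k \<gamma>] by blast
  show ?thesis
  proof (rule exI[of _ C], rule conjI[OF C(1)], intro allI impI)
    fix \<zeta> n \<kappa> assume z: "cmod \<zeta> \<ge> 8 * L" and n: "n > (0::real)" and k: "\<kappa> > (0::real)"
    define \<tau> where "\<tau> = \<kappa> * (cmod \<zeta>)^2 / mm \<kappa> n \<zeta>"
    note st = mm_step[OF n k z, folded \<tau>_def]
    define E where "E = (\<Sum>i<3. p i * ((1 + \<tau> * incr (s i / \<zeta>)) powr (-k) * cmod (1 + s i / \<zeta>) powr \<gamma>))"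
    have "(\<Sum>i<3. p i * (mm \<kappa> n (\<zeta> + s i) powr (-k) * cmod (\<zeta> + s i) powr \<gamma>)) =
      (\<Sum>i<3. mm \<kappa> n \<zeta> powr (-k) * cmod \<zeta> powr \<gamma> * (p i * ((1 + \<tau> * incr (s i / \<zeta>)) powr (-k) * cmod (1 + s i / \<zeta>) powr \<gamma>)))"
    proof (rule sum.cong[OF refl])
      fix i assume "i \<in> {..<3::nat}"
      then have i: "i < 3" by simp
      have "cmod (\<zeta> + s i) powr \<gamma> = cmod \<zeta> powr \<gamma> * cmod (1 + s i / \<zeta>) powr \<gamma>"
        unfolding st(2)[OF i] norm_mult by (simp add: powr_mult)
      then show "p i * (mm \<kappa> n (\<zeta> + s i) powr (-k) * cmod (\<zeta> + s i) powr \<gamma>) =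
        mm \<kappa> n \<zeta> powr (-k) * cmod \<zeta> powr \<gamma> * (p i * ((1 + \<tau> * incr (s i / \<zeta>)) powr (-k) * cmod (1 + s i / \<zeta>) powr \<gamma>))"
        unfolding st(1)[OF i] by simp
    qed
    also have "\<dots> = mm \<kappa> n \<zeta> powr (-k) * cmod \<zeta> powr \<gamma> * E" unfolding E_def sum_distrib_left ..
    finally have S: "(\<Sum>i<3. p i * (mm \<kappa> n (\<zeta> + s i) powr (-k) * cmod (\<zeta> + s i) powr \<gamma>)) = mm \<kappa> n \<zeta> powr (-k) * cmod \<zeta> powr \<gamma> * E" .
    have "\<bar>E - (1 + (\<gamma>^2 / 2 + Q k \<tau> \<gamma>) / (cmod \<zeta>)^2)\<bar> \<le> C / (cmod \<zeta>) ^ 3"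
      unfolding E_def by (rule C(2)[OF z]) (use st(4,5)[of 0] in auto)
    then show "\<exists>e. \<bar>e\<bar> \<le> C / cmod \<zeta> ^ 3 \<and>
      (\<Sum>i<3. p i * (mm \<kappa> n (\<zeta> + s i) powr (-k) * cmod (\<zeta> + s i) powr \<gamma>)) =
      mm \<kappa> n \<zeta> powr (-k) * cmod \<zeta> powr \<gamma> * (1 + (\<gamma>^2 / 2 + Q k (\<kappa> * (cmod \<zeta>)^2 / mm \<kappa> n \<zeta>) \<gamma>) / (cmod \<zeta>)^2 + e)"
      unfolding S \<tau>_def[symmetric]
      by (intro exI[of _ "E - (1 + (\<gamma>^2 / 2 + Q k \<tau> \<gamma>) / (cmod \<zeta>)^2)"]) simp
  qed
qed

lemma step_harmonic:
  fixes k \<beta> :: real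
  shows "\<exists>C\<ge>0. \<forall>\<zeta> n \<kappa>. cmod \<zeta> \<ge> 8 * L \<longrightarrow> n > 0 \<longrightarrow> \<kappa> > 0 \<longrightarrow> Re \<zeta> > 0 \<longrightarrow>
    (\<exists>e. \<bar>e\<bar> \<le> C / cmod \<zeta> ^ 3 \<and>
    (\<Sum>i<3. p i * (mm \<kappa> n (\<zeta> + s i) powr (-k) * Re ((\<zeta> + s i) powr of_real \<beta>))) =
     mm \<kappa> n \<zeta> powr (-k) * (Re (\<zeta> powr of_real \<beta>) *
      (1 + Q k (\<kappa> * (cmod \<zeta>)^2 / mm \<kappa> n \<zeta>) \<beta> / (cmod \<zeta>)^2) + cmod \<zeta> powr \<beta> * e))"
proof -
  obtain C where C: "C \<ge> 0" "\<And>\<zeta> \<tau>. cmod \<zeta> \<ge> 8 * L \<Longrightarrow> 0 \<le> \<tau> \<Longrightarrow> \<tau> \<le> 1 \<Longrightarrow>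
    cmod ((\<Sum>i<3. of_real (p i) * (of_real ((1 + \<tau> * incr (s i / \<zeta>)) powr (-k)) * (1 + s i / \<zeta>) powr of_real \<beta>))
      - of_real (1 + Q k \<tau> \<beta> / (cmod \<zeta>)^2)) \<le> C / (cmod \<zeta>) ^ 3"
    using avg_harmonic[of k \<beta>] by blast
  show ?thesis
  proof (rule exI[of _ C], rule conjI[OF C(1)], intro allI impI)
    fix \<zeta> n \<kappa> assume z: "cmod \<zeta> \<ge> 8 * L" and n: "n > (0::real)" and k: "\<kappa> > (0::real)" and Re: "Re \<zeta> > 0"
    define \<tau> where "\<tau> = \<kappa> * (cmod \<zeta>)^2 / mm \<kappa> n \<zeta>"
    note st = mm_step[OF n k z, folded \<tau>_def]
    define W where "W = \<zeta> powr of_real \<beta>"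
    define X where "X = (\<Sum>i<3. of_real (p i) * (of_real ((1 + \<tau> * incr (s i / \<zeta>)) powr (-k)) * (1 + s i / \<zeta>) powr of_real \<beta>))"
    define E where "E = X - of_real (1 + Q k \<tau> \<beta> / (cmod \<zeta>)^2)"
    have z0: "\<zeta> \<noteq> 0" using Re by auto
    then have rp: "cmod \<zeta> powr \<beta> > 0" by simp
    have "(\<Sum>i<3. p i * (mm \<kappa> n (\<zeta> + s i) powr (-k) * Re ((\<zeta> + s i) powr of_real \<beta>))) =
      (\<Sum>i<3. mm \<kappa> n \<zeta> powr (-k) * Re (W * (of_real (p i) * (of_real ((1 + \<tau> * incr (s i / \<zeta>)) powr (-k)) * (1 + s i / \<zeta>) powr of_real \<beta>))))"
    proof (rule sum.cong[OF refl])
      fix i assume "i \<in> {..<3::nat}"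
      then have i: "i < 3" by simp
      have e: "(\<zeta> + s i) powr of_real \<beta> = W * (1 + s i / \<zeta>) powr of_real \<beta>"
        unfolding st(2)[OF i] W_def by (rule powr_mult_Re_pos[OF Re st(3)[OF i]])
      have "W * (of_real (p i) * (of_real ((1 + \<tau> * incr (s i / \<zeta>)) powr (-k)) * (1 + s i / \<zeta>) powr of_real \<beta>))
        = of_real (p i * (1 + \<tau> * incr (s i / \<zeta>)) powr (-k)) * (W * (1 + s i / \<zeta>) powr of_real \<beta>)"
        by simp
      then show "p i * (mm \<kappa> n (\<zeta> + s i) powr (-k) * Re ((\<zeta> + s i) powr of_real \<beta>)) =
        mm \<kappa> n \<zeta> powr (-k) * Re (W * (of_real (p i) * (of_real ((1 + \<tau> * incr (s i / \<zeta>)) powr (-k)) * (1 + s i / \<zeta>) powr of_real \<beta>)))"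
        unfolding st(1)[OF i] e by (simp only: Re_complex_of_real times_complex.sel Im_complex_of_real) (simp add: algebra_simps)
    qed
    also have "\<dots> = mm \<kappa> n \<zeta> powr (-k) * Re (W * X)" unfolding X_def sum_distrib_left Re_sum ..
    also have "W * X = W * of_real (1 + Q k \<tau> \<beta> / (cmod \<zeta>)^2) + W * E" unfolding E_def by (simp add: algebra_simps)
    also have "Re \<dots> = Re W * (1 + Q k \<tau> \<beta> / (cmod \<zeta>)^2) + cmod \<zeta> powr \<beta> * (Re (W * E) / cmod \<zeta> powr \<beta>)"
      using rp by (simp only: plus_complex.sel times_complex.sel[of W "of_real _"] Re_complex_of_real Im_complex_of_real) simp
    finally have S: "(\<Sum>i<3. p i * (mm \<kappa> n (\<zeta> + s i) powr (-k) * Re ((\<zeta> + s i) powr of_real \<beta>))) =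
      mm \<kappa> n \<zeta> powr (-k) * (Re W * (1 + Q k \<tau> \<beta> / (cmod \<zeta>)^2) + cmod \<zeta> powr \<beta> * (Re (W * E) / cmod \<zeta> powr \<beta>))" .
    have "cmod E \<le> C / (cmod \<zeta>) ^ 3"
      unfolding E_def X_def by (rule C(2)[OF z]) (use st(4,5)[of 0] in auto)
    moreover have "\<bar>Re (W * E)\<bar> \<le> cmod \<zeta> powr \<beta> * cmod E"
      using abs_Re_le_cmod[of "W * E"] norm_powr_of_real[OF z0] by (simp add: norm_mult W_def)
    moreover have "\<bar>v / c\<bar> \<le> d" if "\<bar>v\<bar> \<le> c * x" "x \<le> d" "c > 0" for v c x d :: real
    proof -
      have "\<bar>v / c\<bar> \<le> x" using that by (simp add: abs_divide divide_le_eq mult.commute)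
      then show ?thesis using that by linarith
    qed
    ultimately have "\<bar>Re (W * E) / cmod \<zeta> powr \<beta>\<bar> \<le> C / (cmod \<zeta>) ^ 3"
      using rp by blast
    then show "\<exists>e. \<bar>e\<bar> \<le> C / cmod \<zeta> ^ 3 \<and>
      (\<Sum>i<3. p i * (mm \<kappa> n (\<zeta> + s i) powr (-k) * Re ((\<zeta> + s i) powr of_real \<beta>))) =
      mm \<kappa> n \<zeta> powr (-k) * (Re (\<zeta> powr of_real \<beta>) *
      (1 + Q k (\<kappa> * (cmod \<zeta>)^2 / mm \<kappa> n \<zeta>) \<beta> / (cmod \<zeta>)^2) + cmod \<zeta> powr \<beta> * e)"
      unfolding S W_def[symmetric] \<tau>_def[symmetric] by blast
  qed
qed

end

text \<open>The relative growth in time of \<open>n powr (k - a) * mm powr (-k)\<close> minus the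
  term \<open>Q / (cmod \<zeta>)^2\<close> for degree \<beta>, with \<open>g = k * \<kappa>\<close>
  and \<open>v = \<kappa> * (cmod \<zeta>)^2\<close>. Its sign decides between super- and
  subsolution. For large \<open>k\<close> and fixed \<open>g\<close> the spatial profile tends to
  the Gaussian \<open>exp (- g * (cmod \<zeta>)^2 / n)\<close>, which is the heat kernel for
  \<open>g = 1/2\<close>; \<open>g\<close> is taken slightly smaller for the upper and slightly
  larger for the lower bound.\<close>

definition brk :: "real \<Rightarrow> real \<Rightarrow> real \<Rightarrow> real \<Rightarrow> real \<Rightarrow> real \<Rightarrow> real" where
  "brk k a g \<beta> n v = (k - a) / n - k / (n + v) + 2 * g * (1 + \<beta>) / (n + v) - 2 * g * (k + 1) * v / (n + v)^2"

text \<open>Over the common denominator \<open>brk\<close> is a quadratic form in \<open>n\<close>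
  and \<open>v\<close>, so its sign can be read off three coefficients.\<close>

lemma brk_eq:
  assumes "n > 0" "v \<ge> 0"
  shows "brk k a g \<beta> n v * ((n + v)^2 * n) =
    n^2 * (2 * g * (1 + \<beta>) - a) + n * v * (k * (1 - 2 * g) - 2 * a + 2 * g * \<beta>) + v^2 * (k - a)"
proof -
  define m where "m = n + v"
  have m: "m \<noteq> 0" "n \<noteq> 0" using assms unfolding m_def by auto
  have "brk k a g \<beta> n v * (m^2 * n) = (k - a) * m^2 - k * m * n + 2 * g * (1 + \<beta>) * m * n - 2 * g * (k + 1) * v * n"
    unfolding brk_def m_def[symmetric] using m by (simp add: field_simps power2_eq_square)
  then show ?thesis unfolding m_def by (simp add: algebra_simps power2_eq_square)
qed

lemma brk_lower:
  assumes n: "n > 0" "v \<ge> 0" and c: "c > 0" "2 * g * (1 + \<beta>) - a \<ge> c" "k * (1 - 2 * g) - 2 * a + 2 * g * \<beta> \<ge> c" "k - a \<ge> c"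
  shows "brk k a g \<beta> n v \<ge> c / (2 * n)"
proof -
  have pos: "(n + v)^2 * n > 0" using n by simp
  have "n^2 * c + n * v * c + v^2 * c \<le> brk k a g \<beta> n v * ((n + v)^2 * n)"
    unfolding brk_eq[OF n] using n c by (intro add_mono mult_left_mono) auto
  moreover have "c / (2 * n) * ((n + v)^2 * n) \<le> n^2 * c + n * v * c + v^2 * c"
    using n c by (simp add: power2_eq_square field_simps)
  ultimately have "c / (2 * n) * ((n + v)^2 * n) \<le> brk k a g \<beta> n v * ((n + v)^2 * n)" by linarith
  then show ?thesis using pos by (simp only: mult_le_cancel_right_pos)
qed

text \<open>The coefficient of \<open>v^2\<close> may be positive. In the region
  \<open>v * k \<le> n * w\<close> that term is dominated by the mixed one, which
  \<open>k * (2 * g - 1) \<ge> w\<close> makes sufficiently negative.\<close>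

lemma brk_nonpos:
  assumes n: "n > 0" "v \<ge> 0" and c: "a \<ge> 2 * g * (1 + \<beta>)" "0 \<le> g" "0 \<le> k" "v * k \<le> n * w" "k * (2 * g - 1) \<ge> w" "\<beta> \<ge> 0"
  shows "brk k a g \<beta> n v \<le> 0"
proof -
  have pos: "(n + v)^2 * n > 0" using n by simp
  have a: "a \<ge> g * \<beta>" "a \<ge> 0"
  proof -
    have "0 \<le> g * \<beta>" using c by simp
    then show "a \<ge> g * \<beta>" "a \<ge> 0" using c(1,2) by (simp_all add: algebra_simps)
  qed
  have 1: "n^2 * (2 * g * (1 + \<beta>) - a) \<le> 0" using c by (intro mult_nonneg_nonpos) auto
  have "v^2 * (k - a) \<le> v * (v * k)" using a n by (simp add: power2_eq_square mult_left_mono algebra_simps)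
  also have "\<dots> \<le> v * (n * w)" using c n by (intro mult_left_mono) auto
  finally have 2: "v^2 * (k - a) \<le> n * v * w" by (simp add: mult_ac)
  have "n * v * (k * (1 - 2 * g) - 2 * a + 2 * g * \<beta> + w) \<le> 0"
    using a c n by (intro mult_nonneg_nonpos) (auto simp: algebra_simps)
  then have "brk k a g \<beta> n v * ((n + v)^2 * n) \<le> 0 * ((n + v)^2 * n)"
    unfolding brk_eq[OF n] using 1 2 by (simp add: algebra_simps)
  then show ?thesis using pos by (simp only: mult_le_cancel_right_pos)
qed

text \<open>For the subsolution the factor in front of \<open>brk\<close> may be negative by a
  multiple of \<open>1 / n\<close>; a lower bound of order \<open>1 / n\<close> for
  \<open>brk\<close> makes this an error of order \<open>1 / n^2\<close>.\<close>

lemma brk_lower_crude: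
  assumes n: "n > 0" "v \<ge> 0" and c: "0 \<le> g" "0 \<le> k" "\<beta> \<ge> 0"
  shows "brk k a g \<beta> n v \<ge> - (\<bar>a\<bar> + k + 2 * g * (k + 1)) / n"
proof -
  have 1: "k / (n + v) \<le> k / n" using n c by (intro divide_left_mono) auto
  have 2: "0 \<le> 2 * g * (1 + \<beta>) / (n + v)" using n c by simp
  have X: "(n + v)^2 > 0" using n by simp
  have "v * n \<le> (n + v)^2" using n by (simp add: power2_eq_square algebra_simps)
  then have "v \<le> 1 / n * (n + v)^2" using n by (simp add: pos_le_divide_eq)
  then have "v / (n + v)^2 \<le> 1 / n" by (simp only: pos_divide_le_eq[OF X])
  then have "2 * g * (k + 1) * (v / (n + v)^2) \<le> 2 * g * (k + 1) * (1 / n)"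
    using c by (intro mult_left_mono) auto
  then have 3: "2 * g * (k + 1) * v / (n + v)^2 \<le> 2 * g * (k + 1) / n" by simp
  have 4: "(k - a) / n \<ge> - \<bar>a\<bar> / n" using n c by (intro divide_right_mono) auto
  have "- (\<bar>a\<bar> + k + 2 * g * (k + 1)) / n = - \<bar>a\<bar> / n - k / n - 2 * g * (k + 1) / n"
    by (simp add: add_divide_distrib diff_divide_distrib)
  then show ?thesis unfolding brk_def using 1 2 3 4 by linarith
qed

context iso_walk
begin

lemma Q_over:
  assumes "r > 0" "m > 0"
  shows "Q k (\<kappa> * r^2 / m) \<gamma> / r^2 = - 2 * (k * \<kappa>) * (1 + \<gamma>) / m + 2 * (k * \<kappa>) * (k + 1) * (\<kappa> * r^2) / m^2"
  unfolding Q_def using assms by (simp add: field_simps power2_eq_square)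

lemma time_powr:
  assumes "n > 0" "\<kappa> > 0"
  shows "(n + 1) powr q * mm \<kappa> (n + 1) \<zeta> powr (-k) =
    n powr q * mm \<kappa> n \<zeta> powr (-k) * ((1 + 1 / n) powr q * (1 + 1 / mm \<kappa> n \<zeta>) powr (-k))"
proof -
  have mp: "mm \<kappa> n \<zeta> > 0" unfolding mm_def using assms by (intro add_pos_nonneg) auto
  have "(n + 1) = n * (1 + 1 / n)" using assms by (simp add: field_simps)
  then have 1: "(n + 1) powr q = n powr q * (1 + 1 / n) powr q" using assms by (metis powr_mult add_pos_pos divide_pos_pos less_imp_le zero_less_one)
  have "mm \<kappa> (n + 1) \<zeta> = mm \<kappa> n \<zeta> + 1" by (simp add: mm_def)
  then have "mm \<kappa> (n + 1) \<zeta> = mm \<kappa> n \<zeta> * (1 + 1 / mm \<kappa> n \<zeta>)" using mp by (simp add: distrib_left)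
  then have 2: "mm \<kappa> (n + 1) \<zeta> powr (-k) = mm \<kappa> n \<zeta> powr (-k) * (1 + 1 / mm \<kappa> n \<zeta>) powr (-k)"
    using mp by (simp add: powr_mult)
  show ?thesis unfolding 1 2 by simp
qed

text \<open>
  A supersolution of the backward equation of the walk. The factor \<open>n\<^bsup>k-a\<^esup> (n + \<kappa>|\<zeta>|\<^sup>2)\<^bsup>-k\<^esup>\<close>
  imitates the heat kernel, and as \<open>|\<zeta>|\<^sup>\<beta>\<close> is subharmonic, subtracting \<open>\<eta> |\<zeta>|\<^sup>\<beta>\<close> leaves room for
  the discretisation errors.
\<close>

definition phi_upper :: "real \<Rightarrow> real \<Rightarrow> real \<Rightarrow> real \<Rightarrow> real \<Rightarrow> real \<Rightarrow> complex \<Rightarrow> real" where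
  "phi_upper k a \<kappa> \<beta> \<eta> n \<zeta> = n powr (k - a) * mm \<kappa> n \<zeta> powr (-k) * (Re (\<zeta> powr of_real \<beta>) - \<eta> * cmod \<zeta> powr \<beta>)"

text \<open>Two margins pay for the discretisation. The term with \<eta> gains
  \<open>\<eta> * (\<beta>^2 / 2)\<close> over the squared modulus, which beats the third-order
  errors in space once the modulus exceeds \<open>R0\<close>. The bound \<open>c / (2 * n)\<close>
  on \<open>brk\<close> beats the errors of order \<open>1 / n^2\<close> in time once
  \<open>n\<close> exceeds \<open>n0\<close>; this margin is multiplied by \<open>A\<close>,
  nonnegative where the function is.\<close>

lemma phi_upper_step:
  assumes \<eta>: "\<eta> > 0" and \<beta>: "\<beta> > 0" and \<kappa>: "\<kappa> > 0" and g: "g = k * \<kappa>" and c: "c > 0" "2 * g * (1 + \<beta>) - a \<ge> c"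
    "k * (1 - 2 * g) - 2 * a + 2 * g * \<beta> \<ge> c" "k - a \<ge> c"
  shows "\<exists>R0 n0. \<forall>\<zeta> n. cmod \<zeta> \<ge> R0 \<longrightarrow> n \<ge> n0 \<longrightarrow> Re \<zeta> > 0 \<longrightarrow> Re (\<zeta> powr of_real \<beta>) \<ge> \<eta> * cmod \<zeta> powr \<beta> \<longrightarrow>
    (\<Sum>i<3. p i * phi_upper k a \<kappa> \<beta> \<eta> n (\<zeta> + s i)) \<le> phi_upper k a \<kappa> \<beta> \<eta> (n + 1) \<zeta>"
proof -
  obtain C1 where C1: "C1 \<ge> 0" and H1: "\<And>\<zeta> n \<kappa>. cmod \<zeta> \<ge> 8 * L \<Longrightarrow> n > 0 \<Longrightarrow> \<kappa> > 0 \<Longrightarrow> Re \<zeta> > 0 \<Longrightarrow>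
    (\<exists>e. \<bar>e\<bar> \<le> C1 / cmod \<zeta> ^ 3 \<and>
    (\<Sum>i<3. p i * (mm \<kappa> n (\<zeta> + s i) powr (-k) * Re ((\<zeta> + s i) powr of_real \<beta>))) =
     mm \<kappa> n \<zeta> powr (-k) * (Re (\<zeta> powr of_real \<beta>) *
      (1 + Q k (\<kappa> * (cmod \<zeta>)^2 / mm \<kappa> n \<zeta>) \<beta> / (cmod \<zeta>)^2) + cmod \<zeta> powr \<beta> * e))"
    using step_harmonic[of k \<beta>] by blast
  obtain C2 where C2: "C2 \<ge> 0" and H2: "\<And>\<zeta> n \<kappa>. cmod \<zeta> \<ge> 8 * L \<Longrightarrow> n > 0 \<Longrightarrow> \<kappa> > 0 \<Longrightarrow>
    (\<exists>e. \<bar>e\<bar> \<le> C2 / cmod \<zeta> ^ 3 \<and>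
    (\<Sum>i<3. p i * (mm \<kappa> n (\<zeta> + s i) powr (-k) * cmod (\<zeta> + s i) powr \<beta>)) =
     mm \<kappa> n \<zeta> powr (-k) * cmod \<zeta> powr \<beta> *
      (1 + (\<beta>^2 / 2 + Q k (\<kappa> * (cmod \<zeta>)^2 / mm \<kappa> n \<zeta>) \<beta>) / (cmod \<zeta>)^2 + e))"
    using step_radial[of k \<beta>] by blast
  obtain C3 where C3: "C3 \<ge> 0" and H3: "\<And>n m. 2 \<le> n \<Longrightarrow> n \<le> m \<Longrightarrow>
    \<bar>(1 + 1 / n) powr (k - a) * (1 + 1 / m) powr (-k) - (1 + (k - a) / n - k / m)\<bar> \<le> C3 / n^2"
    using time_factor[of "k - a" k] by blast
  define R0 where "R0 = max (8 * L) (2 * (C1 + \<eta> * C2) / (\<eta> * \<beta>^2))"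
  define n0 where "n0 = max 2 (2 * C3 / c)"
  have "(\<Sum>i<3. p i * phi_upper k a \<kappa> \<beta> \<eta> n (\<zeta> + s i)) \<le> phi_upper k a \<kappa> \<beta> \<eta> (n + 1) \<zeta>"
    if z: "cmod \<zeta> \<ge> R0" and n: "n \<ge> n0" and Re: "Re \<zeta> > 0" and W: "Re (\<zeta> powr of_real \<beta>) \<ge> \<eta> * cmod \<zeta> powr \<beta>" for \<zeta> n
  proof -
    define r where "r = cmod \<zeta>"
    define \<rho> where "\<rho> = r powr \<beta>"
    define m where "m = mm \<kappa> n \<zeta>"
    have z8: "cmod \<zeta> \<ge> 8 * L" and zr: "r \<ge> 2 * (C1 + \<eta> * C2) / (\<eta> * \<beta>^2)" using z unfolding R0_def r_def by auto
    have n2: "n \<ge> 2" "n \<ge> 2 * C3 / c" using n unfolding n0_def by auto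
    have np: "n > 0" using n2 by simp
    have rp: "r > 0" using z8 L unfolding r_def by linarith
    have \<rho>p: "\<rho> > 0" unfolding \<rho>_def using rp by simp
    have shift_steps: "m = n + \<kappa> * r^2" unfolding m_def mm_def r_def ..
    have mp: "m > 0" "n \<le> m" unfolding shift_steps using np \<kappa> by (auto intro: add_pos_nonneg)
    define q' where "q' = Q k (\<kappa> * r^2 / m) \<beta> / r^2"
    obtain e1 where e1: "\<bar>e1\<bar> \<le> C1 / r ^ 3" and S1: "(\<Sum>i<3. p i * (mm \<kappa> n (\<zeta> + s i) powr (-k) * Re ((\<zeta> + s i) powr of_real \<beta>))) =
       m powr (-k) * (Re (\<zeta> powr of_real \<beta>) * (1 + q') + \<rho> * e1)"
      using H1[OF z8 np \<kappa> Re] unfolding r_def m_def \<rho>_def q'_def by blast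
    obtain e2 where e2: "\<bar>e2\<bar> \<le> C2 / r ^ 3" and S2: "(\<Sum>i<3. p i * (mm \<kappa> n (\<zeta> + s i) powr (-k) * cmod (\<zeta> + s i) powr \<beta>)) =
       m powr (-k) * \<rho> * (1 + (\<beta>^2 / 2) / r^2 + q' + e2)"
      using H2[OF z8 np \<kappa>] unfolding r_def m_def \<rho>_def q'_def add_divide_distrib by (auto simp: add.assoc)
    define T where "T = (1 + 1 / n) powr (k - a) * (1 + 1 / m) powr (-k)"
    define e3 where "e3 = T - (1 + (k - a) / n - k / m)"
    have e3: "\<bar>e3\<bar> \<le> C3 / n^2" unfolding e3_def T_def by (rule H3[OF n2(1) mp(2)])
    define A where "A = Re (\<zeta> powr of_real \<beta>) / \<rho> - \<eta>"
    have ReW: "Re (\<zeta> powr of_real \<beta>) = \<rho> * (A + \<eta>)" unfolding A_def using \<rho>p by simp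
    have A0: "A \<ge> 0" unfolding A_def using W \<rho>p unfolding \<rho>_def r_def by (simp add: field_simps)
    define b where "b = brk k a g \<beta> n (\<kappa> * r^2)"
    have b: "(k - a) / n - k / m = b + q'"
      unfolding b_def brk_def q'_def Q_over[OF rp mp(1)] shift_steps[symmetric] g by simp
    have bl: "b \<ge> c / (2 * n)" unfolding b_def using np \<kappa> c by (intro brk_lower) auto
    define G where "G = n powr (k - a) * m powr (-k) * \<rho>"
    have Gp: "G > 0" unfolding G_def using np mp \<rho>p by simp
    have "(\<Sum>i<3. p i * phi_upper k a \<kappa> \<beta> \<eta> n (\<zeta> + s i)) =
      n powr (k - a) * ((\<Sum>i<3. p i * (mm \<kappa> n (\<zeta> + s i) powr (-k) * Re ((\<zeta> + s i) powr of_real \<beta>)))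
       - \<eta> * (\<Sum>i<3. p i * (mm \<kappa> n (\<zeta> + s i) powr (-k) * cmod (\<zeta> + s i) powr \<beta>)))"
      unfolding phi_upper_def by (simp add: sum_distrib_left sum_subtractf algebra_simps)
    also have "\<dots> = G * ((A + \<eta>) * (1 + q') + e1 - \<eta> * (1 + (\<beta>^2 / 2) / r^2 + q' + e2))"
      unfolding S1 S2 ReW G_def by (simp add: algebra_simps)
    finally have LHS: "(\<Sum>i<3. p i * phi_upper k a \<kappa> \<beta> \<eta> n (\<zeta> + s i)) =
      G * ((A + \<eta>) * (1 + q') + e1 - \<eta> * (1 + (\<beta>^2 / 2) / r^2 + q' + e2))" .
    have RHS: "phi_upper k a \<kappa> \<beta> \<eta> (n + 1) \<zeta> = G * (A * T)"
      unfolding phi_upper_def time_powr[OF np \<kappa>] m_def[symmetric] T_def[symmetric] ReW r_def[symmetric] \<rho>_def[symmetric] G_def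
      by (simp add: algebra_simps)
    have Teq: "T = 1 + b + q' + e3" unfolding e3_def using b by simp
    have main: "A * T - ((A + \<eta>) * (1 + q') + e1 - \<eta> * (1 + (\<beta>^2 / 2) / r^2 + q' + e2)) = A * (b + e3) + (\<eta> * ((\<beta>^2 / 2) / r^2) - e1 + \<eta> * e2)"
      unfolding Teq by (simp add: algebra_simps)
    have "C3 / n^2 \<le> c / (2 * n)"
      using n2(2) np c(1) by (simp add: field_simps power2_eq_square)
    then have "b + e3 \<ge> 0" using bl e3 by linarith
    then have m1: "A * (b + e3) \<ge> 0" using A0 by simp
    have "(C1 + \<eta> * C2) / r ^ 3 \<le> \<eta> * ((\<beta>^2 / 2) / r^2)"
    proof -
      have "2 * (C1 + \<eta> * C2) \<le> r * (\<eta> * \<beta>^2)" using zr \<eta> \<beta> by (simp add: divide_le_eq)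
      then have "(C1 + \<eta> * C2) / r \<le> \<eta> * (\<beta>^2 / 2)" using rp by (simp add: field_simps)
      then have "(C1 + \<eta> * C2) / r / r^2 \<le> \<eta> * (\<beta>^2 / 2) / r^2" by (rule divide_right_mono) simp
      moreover have "(C1 + \<eta> * C2) / r / r^2 = (C1 + \<eta> * C2) / r ^ 3" by (simp add: eval_nat_numeral)
      ultimately show ?thesis by (simp only: times_divide_eq_right)
    qed
    moreover have "\<bar>\<eta> * e2\<bar> \<le> \<eta> * C2 / r ^ 3" using e2 \<eta> by (simp add: abs_mult mult_left_mono flip: times_divide_eq_right)
    ultimately have m2: "\<eta> * ((\<beta>^2 / 2) / r^2) - e1 + \<eta> * e2 \<ge> 0" using e1 by (simp add: add_divide_distrib)
    have "((A + \<eta>) * (1 + q') + e1 - \<eta> * (1 + (\<beta>^2 / 2) / r^2 + q' + e2)) \<le> A * T" using main m1 m2 by linarith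
    then show ?thesis unfolding LHS RHS using Gp by (intro mult_left_mono) auto
  qed
  then show ?thesis by blast
qed

end

context iso_walk
begin

text \<open>
  A subsolution where it is positive: the term with \<open>\<epsilon>\<close> makes it negative for \<open>|\<zeta>|\<^sup>2\<close> much larger
  than \<open>n\<close>, and the constant \<open>\<kappa>0\<close> makes it negative near the apex of the cone.
\<close>

definition phi_lower :: "real \<Rightarrow> real \<Rightarrow> real \<Rightarrow> real \<Rightarrow> real \<Rightarrow> real \<Rightarrow> real \<Rightarrow> real \<Rightarrow> complex \<Rightarrow> real" where
  "phi_lower k a \<kappa> \<beta> \<eta> \<epsilon> \<kappa>0 n \<zeta> = n powr (k - a) * mm \<kappa> n \<zeta> powr (-k) *
     (Re (\<zeta> powr of_real \<beta>) + \<eta> * cmod \<zeta> powr \<beta> - \<epsilon> / n * cmod \<zeta> powr (\<beta> + 2) - \<kappa>0 * cmod \<zeta> powr 0)"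

text \<open>In terms of \<open>u = (cmod \<zeta>)^2 / n\<close> the term with \<eta> gains when
  \<open>u\<close> is small and the term with \<epsilon> when \<open>u\<close> is large. That
  \<open>(t - u)^2\<close> is nonnegative shows that together they cover the constant cost for every
  \<open>u\<close>, if \<epsilon> is small against \<eta>.\<close>

lemma lower_margin:
  fixes u \<epsilon> \<eta> \<beta> :: real
  assumes "u > 0" "\<epsilon> > 0" and c: "\<epsilon> * ((\<beta> + 2)^2 / 2 + 1)^2 \<le> \<eta> * \<beta>^2 / 2"
  shows "\<eta> * \<beta>^2 / (4 * u) + \<epsilon> * u / 2 \<ge> \<epsilon> * ((\<beta> + 2)^2 / 2) + \<epsilon>"
proof -
  define t where "t = (\<beta> + 2)^2 / 2 + 1"
  have "0 \<le> \<epsilon> * (t - u)^2 / (2 * u)" using assms by simp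
  also have "\<epsilon> * (t - u)^2 / (2 * u) = \<epsilon> * t^2 / (2 * u) + \<epsilon> * u / 2 - \<epsilon> * t"
    using assms by (simp add: field_simps power2_eq_square)
  also have "\<epsilon> * t^2 / (2 * u) \<le> (\<eta> * \<beta>^2 / 2) / (2 * u)"
    using c assms unfolding t_def by (intro divide_right_mono) auto
  finally show ?thesis unfolding t_def by (simp add: algebra_simps)
qed

text \<open>Positivity at time \<open>n + 1\<close> confines the point to moduli of at least
  \<open>R1\<close> and at most of order \<open>sqrt n\<close>, where
  \<open>\<epsilon> * u \<le> 4\<close>. In this region the difference of the two sides, multiplied
  by \<open>n\<close>, consists of the gains of \<open>lower_margin\<close> and of costs that are
  small fractions of them.\<close>

lemma phi_lower_step:
  assumes \<eta>: "0 < \<eta>" "\<eta> \<le> 1" and \<beta>: "\<beta> > 0" and \<kappa>: "\<kappa> > 0" and g: "g = k * \<kappa>" "1/2 \<le> g" "g \<le> 1" and k: "k > 0"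
    and a: "a \<ge> 2 * g * (1 + \<beta>)" and \<epsilon>: "\<epsilon> > 0" "\<epsilon> * ((\<beta> + 2)^2 / 2 + 1)^2 \<le> \<eta> * \<beta>^2 / 2"
    and \<kappa>\<epsilon>: "4 * \<kappa> / \<epsilon> \<le> 1/3" and kg: "k * (2 * g - 1) \<ge> 4 * g / \<epsilon>" and Rm: "Rm > 0"
  shows "\<exists>\<kappa>0>0. \<exists>n0. \<kappa>0 \<ge> 2 * Rm powr \<beta> \<and> (\<forall>\<zeta> n. n \<ge> n0 \<longrightarrow> Re \<zeta> > 0 \<longrightarrow> phi_lower k a \<kappa> \<beta> \<eta> \<epsilon> \<kappa>0 (n + 1) \<zeta> > 0 \<longrightarrow>
    phi_lower k a \<kappa> \<beta> \<eta> \<epsilon> \<kappa>0 (n + 1) \<zeta> \<le> (\<Sum>i<3. p i * phi_lower k a \<kappa> \<beta> \<eta> \<epsilon> \<kappa>0 n (\<zeta> + s i)))"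
proof -
  obtain C1 where C1: "C1 \<ge> 0" and H1: "\<And>\<zeta> n \<kappa>. cmod \<zeta> \<ge> 8 * L \<Longrightarrow> n > 0 \<Longrightarrow> \<kappa> > 0 \<Longrightarrow> Re \<zeta> > 0 \<Longrightarrow>
    (\<exists>e. \<bar>e\<bar> \<le> C1 / cmod \<zeta> ^ 3 \<and>
    (\<Sum>i<3. p i * (mm \<kappa> n (\<zeta> + s i) powr (-k) * Re ((\<zeta> + s i) powr of_real \<beta>))) =
     mm \<kappa> n \<zeta> powr (-k) * (Re (\<zeta> powr of_real \<beta>) *
      (1 + Q k (\<kappa> * (cmod \<zeta>)^2 / mm \<kappa> n \<zeta>) \<beta> / (cmod \<zeta>)^2) + cmod \<zeta> powr \<beta> * e))"
    using step_harmonic[of k \<beta>] by blast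
  have rad: "\<exists>C\<ge>0. \<forall>\<zeta> n \<kappa>. cmod \<zeta> \<ge> 8 * L \<longrightarrow> n > 0 \<longrightarrow> \<kappa> > 0 \<longrightarrow>
    (\<exists>e. \<bar>e\<bar> \<le> C / cmod \<zeta> ^ 3 \<and>
    (\<Sum>i<3. p i * (mm \<kappa> n (\<zeta> + s i) powr (-k) * cmod (\<zeta> + s i) powr \<gamma>)) =
     mm \<kappa> n \<zeta> powr (-k) * cmod \<zeta> powr \<gamma> *
      (1 + (\<gamma>^2 / 2 + Q k (\<kappa> * (cmod \<zeta>)^2 / mm \<kappa> n \<zeta>) \<gamma>) / (cmod \<zeta>)^2 + e))" for \<gamma>
    by (rule step_radial)
  obtain C2 where C2: "C2 \<ge> 0" and H2: "\<And>\<zeta> n \<kappa>. cmod \<zeta> \<ge> 8 * L \<Longrightarrow> n > 0 \<Longrightarrow> \<kappa> > 0 \<Longrightarrow>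
    (\<exists>e. \<bar>e\<bar> \<le> C2 / cmod \<zeta> ^ 3 \<and>
    (\<Sum>i<3. p i * (mm \<kappa> n (\<zeta> + s i) powr (-k) * cmod (\<zeta> + s i) powr \<beta>)) =
     mm \<kappa> n \<zeta> powr (-k) * cmod \<zeta> powr \<beta> *
      (1 + (\<beta>^2 / 2 + Q k (\<kappa> * (cmod \<zeta>)^2 / mm \<kappa> n \<zeta>) \<beta>) / (cmod \<zeta>)^2 + e))"
    using rad[of \<beta>] by blast
  obtain C4 where C4: "C4 \<ge> 0" and H4: "\<And>\<zeta> n \<kappa>. cmod \<zeta> \<ge> 8 * L \<Longrightarrow> n > 0 \<Longrightarrow> \<kappa> > 0 \<Longrightarrow>
    (\<exists>e. \<bar>e\<bar> \<le> C4 / cmod \<zeta> ^ 3 \<and>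
    (\<Sum>i<3. p i * (mm \<kappa> n (\<zeta> + s i) powr (-k) * cmod (\<zeta> + s i) powr (\<beta> + 2))) =
     mm \<kappa> n \<zeta> powr (-k) * cmod \<zeta> powr (\<beta> + 2) *
      (1 + ((\<beta> + 2)^2 / 2 + Q k (\<kappa> * (cmod \<zeta>)^2 / mm \<kappa> n \<zeta>) (\<beta> + 2)) / (cmod \<zeta>)^2 + e))"
    using rad[of "\<beta> + 2"] by blast
  obtain C5 where C5: "C5 \<ge> 0" and H5: "\<And>\<zeta> n \<kappa>. cmod \<zeta> \<ge> 8 * L \<Longrightarrow> n > 0 \<Longrightarrow> \<kappa> > 0 \<Longrightarrow>
    (\<exists>e. \<bar>e\<bar> \<le> C5 / cmod \<zeta> ^ 3 \<and>
    (\<Sum>i<3. p i * (mm \<kappa> n (\<zeta> + s i) powr (-k) * cmod (\<zeta> + s i) powr 0)) =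
     mm \<kappa> n \<zeta> powr (-k) * cmod \<zeta> powr 0 *
      (1 + (0^2 / 2 + Q k (\<kappa> * (cmod \<zeta>)^2 / mm \<kappa> n \<zeta>) 0) / (cmod \<zeta>)^2 + e))"
    using rad[of 0] by blast
  obtain C3 where C3: "C3 \<ge> 0" and H3: "\<And>n m. 2 \<le> n \<Longrightarrow> n \<le> m \<Longrightarrow>
    \<bar>(1 + 1 / n) powr (k - a) * (1 + 1 / m) powr (-k) - (1 + (k - a) / n - k / m)\<bar> \<le> C3 / n^2"
    using time_factor[of "k - a" k] by blast
  obtain C6 where C6: "C6 \<ge> 0" and H6: "\<And>n m. 2 \<le> n \<Longrightarrow> n \<le> m \<Longrightarrow>
    \<bar>(1 + 1 / n) powr (k - a - 1) * (1 + 1 / m) powr (-k) - (1 + (k - a - 1) / n - k / m)\<bar> \<le> C6 / n^2"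
    using time_factor[of "k - a - 1" k] by blast
  define C7 where "C7 = \<bar>a\<bar> + k + 2 * g * (k + 1)"
  define Cr where "Cr = C1 + C2 + 4 * C4 + 2 * C5"
  define Cn where "Cn = 2 * C3 + 4 * C6 + 2 * C7"
  have C7: "C7 \<ge> 0" unfolding C7_def using k g by simp
  have Cr: "Cr \<ge> 0" unfolding Cr_def using C1 C2 C4 C5 by simp
  have Cn: "Cn \<ge> 0" unfolding Cn_def using C3 C6 C7 by simp
  have eb: "\<eta> * \<beta>^2 > 0" using \<eta> \<beta> by simp
  \<comment> \<open>From \<open>R1\<close> on the errors in space are at most an eighth of the gain
    from \<eta>. Below \<open>R1\<close> the choice of \<kappa>0 gives the bracket a constant term
    that exceeds its positive part, so the function is not positive there.\<close>
  define R1 where "R1 = max Rm (max (8 * L) (16 * Cr / (\<eta> * \<beta>^2)))"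
  define \<kappa>0 where "\<kappa>0 = 2 * R1 powr \<beta>"
  have R1: "R1 > 0" "R1 \<ge> Rm" "R1 \<ge> 8 * L" "R1 \<ge> 16 * Cr / (\<eta> * \<beta>^2)" unfolding R1_def using Rm by auto
  have \<kappa>0: "\<kappa>0 > 0" "\<kappa>0 \<ge> 2 * Rm powr \<beta>" unfolding \<kappa>0_def using R1 Rm \<beta> by (auto intro: powr_mono2)
  \<comment> \<open>Two ways to pay for the drift of the \<kappa>0 term: for \<open>u\<close> up to
    \<open>u0\<close> the gain from \<eta> suffices, as \<open>K \<le> 2\<close>; for larger
    \<open>u\<close> the modulus grows with \<open>n\<close> and \<open>K\<close> becomes small.
    \<open>Y\<close> and the last entry of \<open>n0\<close> say how large \<open>n\<close> must be
    for that.\<close>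
  define u0 where "u0 = \<eta> * \<beta> / 64"
  have u0: "u0 > 0" unfolding u0_def using \<eta> \<beta> by simp
  define Y where "Y = 8 * \<beta> * \<kappa>0 / \<epsilon>"
  have Y: "Y > 0" unfolding Y_def using \<beta> \<kappa>0 \<epsilon> by simp
  define n0 where "n0 = max 2 (max (4 * Cn / \<epsilon>) (Y powr (2 / \<beta>) / u0))"
  have "phi_lower k a \<kappa> \<beta> \<eta> \<epsilon> \<kappa>0 (n + 1) \<zeta> \<le> (\<Sum>i<3. p i * phi_lower k a \<kappa> \<beta> \<eta> \<epsilon> \<kappa>0 n (\<zeta> + s i))"
    if n: "n \<ge> n0" and Re: "Re \<zeta> > 0" and pos: "phi_lower k a \<kappa> \<beta> \<eta> \<epsilon> \<kappa>0 (n + 1) \<zeta> > 0" for \<zeta> n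
  proof -
    define r where "r = cmod \<zeta>"
    define \<rho> where "\<rho> = r powr \<beta>"
    define m where "m = mm \<kappa> n \<zeta>"
    define u where "u = r^2 / n"
    have n2: "n \<ge> 2" "n \<ge> 4 * Cn / \<epsilon>" "n \<ge> Y powr (2 / \<beta>) / u0" using n unfolding n0_def by auto
    have np: "n > 0" using n2 by simp
    have z0: "\<zeta> \<noteq> 0" using Re by auto
    have rp: "r > 0" unfolding r_def using z0 by simp
    have \<rho>p: "\<rho> > 0" unfolding \<rho>_def using rp by simp
    have up: "u > 0" unfolding u_def using rp np by simp
    have \<rho>2: "r powr (\<beta> + 2) = \<rho> * r^2" unfolding \<rho>_def powr_add using rp by simp
    have shift_steps: "m = n + \<kappa> * r^2" unfolding m_def mm_def r_def ..
    have mp: "m > 0" "n \<le> m" unfolding shift_steps using np \<kappa> by (auto intro: add_pos_nonneg)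
    define A where "A = Re (\<zeta> powr of_real \<beta>) / \<rho> + \<eta>"
    have ReW: "Re (\<zeta> powr of_real \<beta>) = \<rho> * (A - \<eta>)" unfolding A_def using \<rho>p by simp
    have "Re (\<zeta> powr of_real \<beta>) \<le> \<rho>" using complex_Re_le_cmod[of "\<zeta> powr of_real \<beta>"] norm_powr_of_real[OF z0, of \<beta>] unfolding \<rho>_def r_def by simp
    then have "Re (\<zeta> powr of_real \<beta>) / \<rho> \<le> 1" using \<rho>p by simp
    then have A2: "A \<le> 2" unfolding A_def using \<eta> by linarith
    define K where "K = \<kappa>0 / \<rho>"
    have Kp: "K > 0" unfolding K_def using \<kappa>0 \<rho>p by simp
    have k0: "\<kappa>0 * r powr 0 = \<rho> * K" unfolding K_def using rp \<rho>p by simp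
    define Pn where "Pn = \<epsilon> * r^2 / (n + 1)"
    have Pn0: "Pn \<ge> 0" unfolding Pn_def using \<epsilon> np by simp
    have eu: "\<epsilon> * u = Pn * (1 + 1 / n)"
    proof -
      have "1 + 1 / n = (n + 1) / n" using np by (simp add: add_divide_distrib)
      moreover have "n + 1 \<noteq> 0" using np by simp
      ultimately show ?thesis unfolding Pn_def u_def by simp
    qed
    have posfac: "phi_lower k a \<kappa> \<beta> \<eta> \<epsilon> \<kappa>0 (n + 1) \<zeta> = (n + 1) powr (k - a) * mm \<kappa> (n + 1) \<zeta> powr (-k) * (\<rho> * (A - Pn - K))"
      unfolding phi_lower_def r_def[symmetric] k0 ReW \<rho>2 \<rho>_def[symmetric] Pn_def by (simp add: algebra_simps)
    have "\<rho> * (A - Pn - K) > 0"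
      using pos unfolding posfac by (metis mult_le_0_iff mult_nonneg_nonneg not_le powr_ge_zero)
    then have X0: "A - Pn - K > 0" using \<rho>p by (simp add: zero_less_mult_iff)
    have K2: "K \<le> 2" "A - K \<le> 2" "A - K \<ge> 0" "Pn \<le> 2" using X0 A2 Pn0 Kp by linarith+
    have eu4: "\<epsilon> * u \<le> 4"
    proof -
      have "Pn * (1 + 1 / n) \<le> 2 * 2" using K2 Pn0 n2 by (intro mult_mono) (auto simp: field_simps)
      then show ?thesis unfolding eu by simp
    qed
    \<comment> \<open>Positivity is known at time \<open>n + 1\<close>, where the \<epsilon> term is
      \<open>Pn\<close>. At time \<open>n\<close> that term is larger by the factor
      \<open>1 + 1 / n\<close>, so the bracket may be negative, by at most
      \<open>2 / n\<close>.\<close>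
    have Xl: "A - \<epsilon> * u - K \<ge> - 2 / n"
    proof -
      have "Pn / n \<le> 2 / n" using K2 np by (intro divide_right_mono) auto
      then show ?thesis unfolding eu using X0 by (simp add: distrib_left)
    qed
    have rR: "r \<ge> R1"
    proof (rule ccontr)
      assume "\<not> r \<ge> R1"
      then have "\<rho> < R1 powr \<beta>" unfolding \<rho>_def using rp \<beta> by (intro powr_less_mono2) auto
      then have "K > 2" unfolding K_def \<kappa>0_def using \<rho>p by (simp add: less_divide_eq)
      then show False using K2 by simp
    qed
    then have z8: "cmod \<zeta> \<ge> 8 * L" using R1 unfolding r_def by linarith
    define q' where "q' = Q k (\<kappa> * r^2 / m) \<beta> / r^2"
    have Qo: "Q k (\<kappa> * r^2 / m) \<gamma> / r^2 = q' - 2 * g * (\<gamma> - \<beta>) / m" for \<gamma>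
      unfolding q'_def Q_over[OF rp mp(1)] g(1) using mp by (simp add: field_simps)
    obtain e1 where e1: "\<bar>e1\<bar> \<le> C1 / r ^ 3" and S1: "(\<Sum>i<3. p i * (mm \<kappa> n (\<zeta> + s i) powr (-k) * Re ((\<zeta> + s i) powr of_real \<beta>))) =
       m powr (-k) * (Re (\<zeta> powr of_real \<beta>) * (1 + q') + \<rho> * e1)"
      using H1[OF z8 np \<kappa> Re] unfolding r_def m_def \<rho>_def q'_def by blast
    obtain e2 where e2: "\<bar>e2\<bar> \<le> C2 / r ^ 3" and S2: "(\<Sum>i<3. p i * (mm \<kappa> n (\<zeta> + s i) powr (-k) * cmod (\<zeta> + s i) powr \<beta>)) =
       m powr (-k) * \<rho> * (1 + (\<beta>^2 / 2) / r^2 + q' + e2)"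
      using H2[OF z8 np \<kappa>] unfolding r_def m_def \<rho>_def q'_def add_divide_distrib by (auto simp: add.assoc)
    obtain e4 where e4: "\<bar>e4\<bar> \<le> C4 / r ^ 3" and S4': "(\<Sum>i<3. p i * (mm \<kappa> n (\<zeta> + s i) powr (-k) * cmod (\<zeta> + s i) powr (\<beta> + 2))) =
       m powr (-k) * r powr (\<beta> + 2) * (1 + ((\<beta> + 2)^2 / 2 + Q k (\<kappa> * r^2 / m) (\<beta> + 2)) / r^2 + e4)"
      using H4[OF z8 np \<kappa>] unfolding r_def m_def by blast
    have S4: "(\<Sum>i<3. p i * (mm \<kappa> n (\<zeta> + s i) powr (-k) * cmod (\<zeta> + s i) powr (\<beta> + 2))) =
       m powr (-k) * (\<rho> * r^2) * (1 + (\<beta> + 2)^2 / 2 / r^2 + (q' - 4 * g / m) + e4)"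
      unfolding S4' \<rho>2 add_divide_distrib Qo by (simp add: algebra_simps)
    obtain e5 where e5: "\<bar>e5\<bar> \<le> C5 / r ^ 3" and S5': "(\<Sum>i<3. p i * (mm \<kappa> n (\<zeta> + s i) powr (-k) * cmod (\<zeta> + s i) powr 0)) =
       m powr (-k) * r powr 0 * (1 + (0^2 / 2 + Q k (\<kappa> * r^2 / m) 0) / r^2 + e5)"
      using H5[OF z8 np \<kappa>] unfolding r_def m_def by blast
    have S5: "\<kappa>0 * (\<Sum>i<3. p i * (mm \<kappa> n (\<zeta> + s i) powr (-k) * cmod (\<zeta> + s i) powr 0)) =
       m powr (-k) * (\<rho> * K) * (1 + (q' + 2 * g * \<beta> / m) + e5)"
      unfolding S5' k0[symmetric] add_divide_distrib Qo by (simp add: algebra_simps)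
    define T1 where "T1 = (1 + 1 / n) powr (k - a) * (1 + 1 / m) powr (-k)"
    define e3 where "e3 = T1 - (1 + (k - a) / n - k / m)"
    have e3: "\<bar>e3\<bar> \<le> C3 / n^2" unfolding e3_def T1_def by (rule H3[OF n2(1) mp(2)])
    define T2 where "T2 = (1 + 1 / n) powr (k - a - 1) * (1 + 1 / m) powr (-k)"
    define e6 where "e6 = T2 - (1 + (k - a - 1) / n - k / m)"
    have e6: "\<bar>e6\<bar> \<le> C6 / n^2" unfolding e6_def T2_def by (rule H6[OF n2(1) mp(2)])
    have T12: "T1 = T2 * (1 + 1 / n)" unfolding T1_def T2_def using np by (simp add: powr_diff)
    define b where "b = brk k a g \<beta> n (\<kappa> * r^2)"
    have b: "(k - a) / n - k / m = b + q'"
      unfolding b_def brk_def q'_def Q_over[OF rp mp(1)] shift_steps[symmetric] g(1) by simp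
    define G where "G = n powr (k - a) * m powr (-k) * \<rho>"
    have Gp: "G > 0" unfolding G_def using np mp \<rho>p by simp
    have un: "r^2 = u * n" unfolding u_def using np by simp
    have "(\<Sum>i<3. p i * phi_lower k a \<kappa> \<beta> \<eta> \<epsilon> \<kappa>0 n (\<zeta> + s i)) =
      n powr (k - a) * ((\<Sum>i<3. p i * (mm \<kappa> n (\<zeta> + s i) powr (-k) * Re ((\<zeta> + s i) powr of_real \<beta>)))
       + \<eta> * (\<Sum>i<3. p i * (mm \<kappa> n (\<zeta> + s i) powr (-k) * cmod (\<zeta> + s i) powr \<beta>))
       - \<epsilon> / n * (\<Sum>i<3. p i * (mm \<kappa> n (\<zeta> + s i) powr (-k) * cmod (\<zeta> + s i) powr (\<beta> + 2)))
       - \<kappa>0 * (\<Sum>i<3. p i * (mm \<kappa> n (\<zeta> + s i) powr (-k) * cmod (\<zeta> + s i) powr 0)))"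
      unfolding phi_lower_def by (simp add: eval_nat_numeral algebra_simps)
    also have "\<dots> = G * ((A - \<eta>) * (1 + q') + e1 + \<eta> * (1 + (\<beta>^2 / 2) / r^2 + q' + e2)
      - \<epsilon> / n * r^2 * (1 + (\<beta> + 2)^2 / 2 / r^2 + (q' - 4 * g / m) + e4) - K * (1 + (q' + 2 * g * \<beta> / m) + e5))"
      unfolding S1 S2 S4 S5 ReW G_def by (simp add: algebra_simps)
    also have "\<epsilon> / n * r^2 = \<epsilon> * u" unfolding u_def by simp
    finally have RHS: "(\<Sum>i<3. p i * phi_lower k a \<kappa> \<beta> \<eta> \<epsilon> \<kappa>0 n (\<zeta> + s i)) =
      G * ((A - \<eta>) * (1 + q') + e1 + \<eta> * (1 + (\<beta>^2 / 2) / r^2 + q' + e2)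
      - \<epsilon> * u * (1 + (\<beta> + 2)^2 / 2 / r^2 + (q' - 4 * g / m) + e4) - K * (1 + (q' + 2 * g * \<beta> / m) + e5))" .
    have LHS: "phi_lower k a \<kappa> \<beta> \<eta> \<epsilon> \<kappa>0 (n + 1) \<zeta> = G * (T1 * (A - K) - T2 * (\<epsilon> * u))"
    proof -
      have "phi_lower k a \<kappa> \<beta> \<eta> \<epsilon> \<kappa>0 (n + 1) \<zeta> = G * (T1 * (A - Pn - K))"
        unfolding posfac time_powr[OF np \<kappa>] m_def[symmetric] T1_def[symmetric] G_def by simp
      also have "T1 * (A - Pn - K) = T1 * (A - K) - T2 * (\<epsilon> * u)" unfolding eu T12 by (simp add: algebra_simps add_divide_distrib diff_divide_distrib)
      finally show ?thesis .
    qed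
    have T1eq: "T1 = 1 + b + q' + e3" unfolding e3_def using b by simp
    have T2eq: "T2 = 1 + b + q' - 1 / n + e6" unfolding e6_def using b by (simp add: diff_divide_distrib)
    define Err where "Err = e1 + \<eta> * e2 - \<epsilon> * u * e4 - K * e5 - e3 * (A - K) + e6 * (\<epsilon> * u)"
    have ru: "\<epsilon> * u * ((\<beta> + 2)^2 / 2 / r^2) = \<epsilon> * ((\<beta> + 2)^2 / 2) / n" unfolding u_def using rp by (simp add: field_simps)
    have main: "((A - \<eta>) * (1 + q') + e1 + \<eta> * (1 + (\<beta>^2 / 2) / r^2 + q' + e2)
      - \<epsilon> * u * (1 + (\<beta> + 2)^2 / 2 / r^2 + (q' - 4 * g / m) + e4) - K * (1 + (q' + 2 * g * \<beta> / m) + e5))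
      - (T1 * (A - K) - T2 * (\<epsilon> * u))
      = - ((A - \<epsilon> * u - K) * b) + \<eta> * ((\<beta>^2 / 2) / r^2) + \<epsilon> * u * (4 * g / m) - \<epsilon> * u / n
        - \<epsilon> * u * ((\<beta> + 2)^2 / 2 / r^2) - K * (2 * g * \<beta> / m) + Err"
      unfolding T1eq T2eq Err_def by (simp add: algebra_simps)
    \<comment> \<open>As \<kappa> is small against \<epsilon>, \<open>m\<close> stays below
      \<open>4/3 * n\<close> here. Then the drift \<open>4 * g / m\<close> of the \<epsilon> term
      exceeds \<open>1 / n\<close>, the loss caused by its coefficient
      \<open>\<epsilon> / n\<close>, by at least \<open>1 / (2 * n)\<close>.\<close>
    have \<kappa>u: "\<kappa> * u \<le> 1/3"
    proof -
      have "\<kappa> * u = \<kappa> / \<epsilon> * (\<epsilon> * u)" using \<epsilon> by simp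
      also have "\<dots> \<le> \<kappa> / \<epsilon> * 4" using eu4 \<kappa> \<epsilon> by (intro mult_left_mono) auto
      finally show ?thesis using \<kappa>\<epsilon> by simp
    qed
    have m43: "m \<le> 4/3 * n"
    proof -
      have "m = n * (1 + \<kappa> * u)" unfolding shift_steps un by (simp add: algebra_simps)
      also have "\<dots> \<le> n * (4/3)" using \<kappa>u np by (intro mult_left_mono) auto
      finally show ?thesis by simp
    qed
    have bn: "b \<le> 0" unfolding b_def
    proof (rule brk_nonpos[where w = "4 * g / \<epsilon>"])
      have "\<kappa> * r^2 * k = n * (g * u)" unfolding un g(1) by (simp add: algebra_simps)
      also have "\<dots> \<le> n * (4 * g / \<epsilon>)"
      proof (rule mult_left_mono)
        have "g * u = g / \<epsilon> * (\<epsilon> * u)" using \<epsilon> by simp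
        also have "\<dots> \<le> g / \<epsilon> * 4" using eu4 g(2) \<epsilon> by (intro mult_left_mono) auto
        also have "g / \<epsilon> * 4 = 4 * g / \<epsilon>" by simp
        finally show "g * u \<le> 4 * g / \<epsilon>" .
      qed (use np in simp)
      finally show "\<kappa> * r^2 * k \<le> n * (4 * g / \<epsilon>)" .
    qed (use np \<kappa> a g(2,3) k kg \<beta> in auto)
    have bl: "b \<ge> - C7 / n" unfolding b_def C7_def using np \<kappa> g(2,3) k \<beta> by (intro brk_lower_crude) auto
    have I1: "- ((A - \<epsilon> * u - K) * b) \<ge> - (2 * C7 / n^2)"
    proof -
      have "(A - \<epsilon> * u - K) * b \<le> (- 2 / n) * b" by (rule mult_right_mono_neg[OF Xl bn])
      also have "\<dots> = (2 / n) * (- b)" by simp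
      also have "\<dots> \<le> (2 / n) * (C7 / n)" using bl np by (intro mult_left_mono) auto
      finally show ?thesis by (simp add: power2_eq_square)
    qed
    have I2: "\<epsilon> * u * (4 * g / m) \<ge> \<epsilon> * u * ((3/2) / n)"
    proof (rule mult_left_mono)
      have "(3/2) * m \<le> 4 * g * n"
      proof -
        have "(3/2) * m \<le> 2 * n" using m43 by simp
        also have "\<dots> \<le> 4 * g * n" using g(2) np by simp
        finally show ?thesis .
      qed
      then show "(3/2) / n \<le> 4 * g / m" using np mp by (simp add: field_simps)
    qed (use \<epsilon> up in simp)
    have I3: "K * (2 * g * \<beta> / m) \<le> 2 * \<beta> * K / n"
    proof -
      have "2 * g * \<beta> / m \<le> 2 * \<beta> / n" using g(2,3) \<beta> np mp by (intro frac_le) auto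
      then have "K * (2 * g * \<beta> / m) \<le> K * (2 * \<beta> / n)" using Kp by (intro mult_left_mono) auto
      then show ?thesis by (simp add: mult_ac)
    qed
    have I4: "\<bar>Err\<bar> \<le> Cr / r ^ 3 + (2 * C3 + 4 * C6) / n^2"
    proof -
      have r3: "r ^ 3 > 0" using rp by simp
      have "\<bar>\<eta> * e2\<bar> \<le> 1 * (C2 / r ^ 3)" unfolding abs_mult using e2 \<eta> by (intro mult_mono) auto
      moreover have "\<bar>\<epsilon> * u * e4\<bar> \<le> 4 * (C4 / r ^ 3)" unfolding abs_mult[of "\<epsilon> * u"] using e4 eu4 \<epsilon> up by (intro mult_mono) auto
      moreover have "\<bar>K * e5\<bar> \<le> 2 * (C5 / r ^ 3)" unfolding abs_mult using e5 K2 Kp by (intro mult_mono) auto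
      moreover have "\<bar>e3 * (A - K)\<bar> \<le> (C3 / n^2) * 2" unfolding abs_mult using e3 K2 by (intro mult_mono) auto
      moreover have "\<bar>e6 * (\<epsilon> * u)\<bar> \<le> (C6 / n^2) * 4" unfolding abs_mult[of e6] using e6 eu4 \<epsilon> up by (intro mult_mono) auto
      ultimately have "\<bar>Err\<bar> \<le> C1 / r ^ 3 + 1 * (C2 / r ^ 3) + 4 * (C4 / r ^ 3) + 2 * (C5 / r ^ 3) + (C3 / n^2) * 2 + (C6 / n^2) * 4"
        unfolding Err_def using e1 by linarith
      also have "\<dots> = Cr / r ^ 3 + (2 * C3 + 4 * C6) / n^2" unfolding Cr_def by (simp add: add_divide_distrib mult.commute)
      finally show ?thesis .
    qed
    have J1: "\<eta> * \<beta>^2 / (4 * u) + \<epsilon> * u / 2 \<ge> \<epsilon> * ((\<beta> + 2)^2 / 2) + \<epsilon>" by (rule lower_margin[OF up \<epsilon>])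
    have J2: "n * (Cr / r ^ 3) \<le> \<eta> * \<beta>^2 / (16 * u)"
    proof -
      have "16 * Cr \<le> r * (\<eta> * \<beta>^2)"
      proof -
        have "16 * Cr / (\<eta> * \<beta>^2) \<le> r" using rR R1(4) by linarith
        then show ?thesis using eb by (simp only: pos_divide_le_eq)
      qed
      then have "Cr / r \<le> \<eta> * \<beta>^2 / 16" using rp by (simp add: field_simps)
      then have "Cr / r / u \<le> \<eta> * \<beta>^2 / 16 / u" using up by (intro divide_right_mono) auto
      moreover have "n * (Cr / r ^ 3) = Cr / r / u" unfolding u_def using rp np by (simp add: field_simps eval_nat_numeral)
      ultimately show ?thesis by (simp add: mult.commute)
    qed
    have J3: "2 * \<beta> * K \<le> \<eta> * \<beta>^2 / (16 * u) + \<epsilon> / 4"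
    proof (cases "u \<le> u0")
      case True
      have "2 * \<beta> * K \<le> 4 * \<beta>" using K2 \<beta> by simp
      also have "\<dots> \<le> \<eta> * \<beta>^2 / (16 * u)" using True up \<beta> unfolding u0_def by (simp add: field_simps power2_eq_square)
      finally show ?thesis using \<epsilon> by simp
    next
      case False
      have "Y powr (2 / \<beta>) \<le> u0 * n" using n2(3) u0 by (simp add: divide_le_eq mult.commute)
      also have "\<dots> \<le> r^2" unfolding un using False np by (intro mult_right_mono) auto
      finally have "Y powr (2 / \<beta>) \<le> r^2" .
      then have "(Y powr (2 / \<beta>)) powr (\<beta> / 2) \<le> (r^2) powr (\<beta> / 2)" using \<beta> by (intro powr_mono2) auto
      moreover have "(Y powr (2 / \<beta>)) powr (\<beta> / 2) = Y" using Y \<beta> by (simp add: powr_powr)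
      moreover have "(r^2) powr (\<beta> / 2) = \<rho>" unfolding \<rho>_def using rp by (simp add: powr_powr flip: powr_numeral)
      ultimately have "Y \<le> \<rho>" by simp
      then have "8 * \<beta> * K \<le> \<epsilon>" unfolding Y_def K_def using \<epsilon> \<rho>p by (simp add: field_simps)
      moreover have "0 \<le> \<eta> * \<beta>^2 / (16 * u)" using eb up by simp
      ultimately show ?thesis by linarith
    qed
    have J4: "Cn / n \<le> \<epsilon> / 4" using n2(2) np \<epsilon> by (simp add: field_simps)
    have nn: "n * (x / n^2) = x / n" for x using np by (simp add: power2_eq_square)
    have J5: "n * (\<eta> * ((\<beta>^2 / 2) / r^2)) = \<eta> * \<beta>^2 / (2 * u)" unfolding u_def using np rp by (simp add: field_simps)
    define D where "D = - ((A - \<epsilon> * u - K) * b) + \<eta> * ((\<beta>^2 / 2) / r^2) + \<epsilon> * u * (4 * g / m) - \<epsilon> * u / n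
        - \<epsilon> * u * ((\<beta> + 2)^2 / 2 / r^2) - K * (2 * g * \<beta> / m) + Err"
    have "D \<ge> - (2 * C7 / n^2) + \<eta> * ((\<beta>^2 / 2) / r^2) + \<epsilon> * u * ((3/2) / n) - \<epsilon> * u / n
        - \<epsilon> * ((\<beta> + 2)^2 / 2) / n - 2 * \<beta> * K / n - (Cr / r ^ 3 + (2 * C3 + 4 * C6) / n^2)"
      unfolding D_def ru using I1 I2 I3 I4 by linarith
    then have "n * D \<ge> n * (- (2 * C7 / n^2) + \<eta> * ((\<beta>^2 / 2) / r^2) + \<epsilon> * u * ((3/2) / n) - \<epsilon> * u / n
        - \<epsilon> * ((\<beta> + 2)^2 / 2) / n - 2 * \<beta> * K / n - (Cr / r ^ 3 + (2 * C3 + 4 * C6) / n^2))"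
      using np by (intro mult_left_mono) auto
    also have "n * (- (2 * C7 / n^2) + \<eta> * ((\<beta>^2 / 2) / r^2) + \<epsilon> * u * ((3/2) / n) - \<epsilon> * u / n
        - \<epsilon> * ((\<beta> + 2)^2 / 2) / n - 2 * \<beta> * K / n - (Cr / r ^ 3 + (2 * C3 + 4 * C6) / n^2))
      = - (n * (2 * C7 / n^2)) + n * (\<eta> * ((\<beta>^2 / 2) / r^2)) + n * (\<epsilon> * u * ((3/2) / n)) - n * (\<epsilon> * u / n)
        - n * (\<epsilon> * ((\<beta> + 2)^2 / 2) / n) - n * (2 * \<beta> * K / n) - (n * (Cr / r ^ 3) + n * ((2 * C3 + 4 * C6) / n^2))"
      by (simp only: distrib_left right_diff_distrib mult_minus_right)
    also have "\<dots> = - (2 * C7 / n) + \<eta> * \<beta>^2 / (2 * u) + \<epsilon> * u * (3/2) - \<epsilon> * u - \<epsilon> * ((\<beta> + 2)^2 / 2) - 2 * \<beta> * K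
        - (n * (Cr / r ^ 3) + (2 * C3 + 4 * C6) / n)"
      unfolding nn J5 using np by simp
    finally have fin: "n * D \<ge> - (2 * C7 / n) + \<eta> * \<beta>^2 / (2 * u) + \<epsilon> * u * (3/2) - \<epsilon> * u - \<epsilon> * ((\<beta> + 2)^2 / 2) - 2 * \<beta> * K
        - (n * (Cr / r ^ 3) + (2 * C3 + 4 * C6) / n)" .
    have "Cn / n = 2 * C7 / n + (2 * C3 + 4 * C6) / n" unfolding Cn_def by (simp add: add_divide_distrib)
    moreover define v where "v = \<eta> * \<beta>^2 / u"
    moreover have "v \<ge> 0" unfolding v_def using eb up by simp
    moreover have "\<eta> * \<beta>^2 / (2 * u) = v / 2" "\<eta> * \<beta>^2 / (4 * u) = v / 4" "\<eta> * \<beta>^2 / (16 * u) = v / 16"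
      unfolding v_def by simp_all
    ultimately have "n * D \<ge> 0" using fin J1 J2 J3 J4 \<epsilon>(1) by linarith
    then have "D \<ge> 0" using np by (simp add: zero_le_mult_iff)
    then show ?thesis unfolding LHS RHS using main Gp unfolding D_def[symmetric] by (intro mult_left_mono) linarith+
  qed
  then show ?thesis using \<kappa>0 by blast
qed

end

section \<open>Tandem walks\<close>

definition quad :: "int \<times> int \<Rightarrow> bool" where "quad z \<longleftrightarrow> 0 \<le> fst z \<and> 0 \<le> snd z"

lemma tandem_walks_quad: "w \<in> tandem_walks A B C n e \<Longrightarrow> quad e"
  by (auto simp: tandem_walks_def quad_def)

lemma tandem_walks_0: "tandem_walks A B C 0 e = (if e = (0, 0) then {[(0, 0)]} else {})"
  by (auto simp: tandem_walks_def length_Suc_conv)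

lemma tandem_walks_Suc:
  "tandem_walks A B C (Suc n) e =
     (if quad e then (\<Union>d\<in>tandem_steps A B C. (\<lambda>w. w @ [e]) ` tandem_walks A B C n (e - d)) else {})"
proof (intro Set.set_eqI iffI)
  fix w assume w: "w \<in> tandem_walks A B C (Suc n) e"
  then have q: "quad e" by (rule tandem_walks_quad)
  have len: "length w = Suc (Suc n)" using w by (simp add: tandem_walks_def)
  define v where "v = butlast w"
  have lv: "length v = Suc n" unfolding v_def using len by simp
  have vn: "v ! k = w ! k" if "k \<le> n" for k unfolding v_def using that len by (simp add: nth_butlast)
  have "w \<noteq> []" using len by auto
  moreover have "last w = w ! Suc n" using len calculation by (simp add: last_conv_nth)
  moreover have "w ! Suc n = e" using w by (simp add: tandem_walks_def)
  ultimately have wv: "w = v @ [e]" unfolding v_def using append_butlast_last_id[of w] by simp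
  define d where "d = w ! Suc n - w ! n"
  have d: "d \<in> tandem_steps A B C" using w unfolding d_def tandem_walks_def by blast
  have e: "w ! Suc n = e" using w by (simp add: tandem_walks_def)
  have "v \<in> tandem_walks A B C n (e - d)"
    using w lv vn e unfolding tandem_walks_def d_def by (auto simp: le_Suc_eq)
  then show "w \<in> (if quad e then (\<Union>d\<in>tandem_steps A B C. (\<lambda>w. w @ [e]) ` tandem_walks A B C n (e - d)) else {})"
    using q d wv by auto
next
  fix w assume w: "w \<in> (if quad e then (\<Union>d\<in>tandem_steps A B C. (\<lambda>w. w @ [e]) ` tandem_walks A B C n (e - d)) else {})"
  then have q: "quad e" by (auto split: if_splits)
  then obtain d v where d: "d \<in> tandem_steps A B C" and v: "v \<in> tandem_walks A B C n (e - d)" and wv: "w = v @ [e]"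
    using w by auto
  have lv: "length v = Suc n" using v by (simp add: tandem_walks_def)
  have wn: "w ! k = v ! k" if "k \<le> n" for k unfolding wv using that lv by (simp add: nth_append)
  have we: "w ! Suc n = e" unfolding wv using lv by (simp add: nth_append)
  show "w \<in> tandem_walks A B C (Suc n) e"
    using v q d wn we lv unfolding tandem_walks_def quad_def
    by (auto simp: wv le_Suc_eq less_Suc_eq)
qed

definition tandem_count :: "nat \<Rightarrow> nat \<Rightarrow> nat \<Rightarrow> nat \<Rightarrow> int \<times> int \<Rightarrow> nat" where
  "tandem_count A B C n e = card (tandem_walks A B C n e)"

locale tandem =
  fixes A B C :: nat
  assumes ABC: "A > 0" "B > 0" "C > 0"
begin

definition st :: "nat \<Rightarrow> int \<times> int" where
  "st i = (if i = 0 then (int A, 0) else if i = 1 then (- int B, int B) else (0, - int C))"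

lemma count_0: "tandem_count A B C 0 z = (if z = (0, 0) then 1 else 0)"
  unfolding tandem_count_def tandem_walks_0 by simp

lemma count_Suc: "tandem_count A B C (Suc n) z = (if quad z then \<Sum>i<3. tandem_count A B C n (z - st i) else 0)"
proof (cases "quad z")
  case True
  have inj: "inj_on st {..<3}" unfolding inj_on_def st_def using ABC by (auto simp: eval_nat_numeral less_Suc_eq)
  have steps: "tandem_steps A B C = st ` {..<3}" unfolding tandem_steps_def st_def by (auto simp: eval_nat_numeral lessThan_Suc)
  let ?W = "\<lambda>d. (\<lambda>w. w @ [z]) ` tandem_walks A B C n (z - d)"
  have "card (\<Union>d\<in>tandem_steps A B C. ?W d) = (\<Sum>d\<in>tandem_steps A B C. card (?W d))"
  proof (rule card_UN_disjoint)
    show "finite (tandem_steps A B C)" unfolding steps by simp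
    show "\<forall>d\<in>tandem_steps A B C. finite (?W d)" by (simp add: finite_tandem_walks)
    show "\<forall>d\<in>tandem_steps A B C. \<forall>d'\<in>tandem_steps A B C. d \<noteq> d' \<longrightarrow> ?W d \<inter> ?W d' = {}"
      by (auto simp: tandem_walks_def)
  qed
  also have "\<dots> = (\<Sum>d\<in>tandem_steps A B C. tandem_count A B C n (z - d))"
    unfolding tandem_count_def by (intro sum.cong refl card_image) (auto simp: inj_on_def)
  also have "\<dots> = (\<Sum>i<3. tandem_count A B C n (z - st i))"
    unfolding steps by (simp add: sum.reindex[OF inj])
  finally show ?thesis unfolding tandem_count_def tandem_walks_Suc using True by simp
qed (simp add: tandem_count_def tandem_walks_Suc)

definition S0 :: real where "S0 = 1 / A + 1 / B + 1 / C"
text \<open>Weights inversely proportional to \<open>A\<close>, \<open>B\<close>, \<open>C\<close>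
  are the only probabilities on the three steps with mean zero.\<close>

definition pr :: "nat \<Rightarrow> real" where
  "pr i = (if i = 0 then 1 / (A * S0) else if i = 1 then 1 / (B * S0) else 1 / (C * S0))"
text \<open>Minus the correlation of the coordinates of the centred walk: its covariance matrix is
  \<open>1 / S0\<close> times the matrix with diagonal \<open>A + B\<close>, \<open>B + C\<close>
  and off-diagonal entry \<open>- B\<close>.\<close>

definition cth :: real where "cth = B / sqrt ((real A + B) * (real B + C))"
definition theta :: real where "theta = arccos cth"
definition tt :: real where "tt = sqrt S0 / sin theta"
definition c1 :: real where "c1 = tt / sqrt (real A + B)"
definition c2 :: real where "c2 = tt / sqrt (real B + C)"
text \<open>\<open>e1\<close> and \<open>e2\<close> are the images of the unit vectors under the map
  that makes the covariance the identity. The cone is placed symmetrically about the positive real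
  axis, inside the right half-plane, where principal powers are multiplicative.\<close>

definition e1 :: complex where "e1 = of_real c1 * cis (- theta / 2)"
definition e2 :: complex where "e2 = of_real c2 * cis (theta / 2)"
definition TT :: "int \<times> int \<Rightarrow> complex" where "TT z = of_int (fst z) * e1 + of_int (snd z) * e2"
text \<open>The sign is reversed because the recursion for the counts goes one step back, from
  \<open>z\<close> to \<open>z - st i\<close>.\<close>

definition ss :: "nat \<Rightarrow> complex" where "ss i = - TT (st i)"
definition LL :: real where "LL = 1 + (\<Sum>i<3. cmod (ss i))"

lemma S0_pos: "S0 > 0" unfolding S0_def using ABC by (intro add_pos_pos) auto

lemma cth: "0 < cth" "cth < 1"
proof -
  have p: "(real A + B) * (real B + C) > 0" using ABC by simp
  show "0 < cth" unfolding cth_def using ABC p by (intro divide_pos_pos) auto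
  have "(real B)^2 < (real A + B) * (real B + C)" using ABC by (simp add: power2_eq_square algebra_simps add_pos_pos)
  then have "sqrt ((real B)^2) < sqrt ((real A + B) * (real B + C))" by (rule real_sqrt_less_mono)
  then show "cth < 1" unfolding cth_def using p by simp
qed

lemma theta: "0 < theta" "theta < pi / 2" "cos theta = cth" "sin theta > 0"
proof -
  show t: "0 < theta" "theta < pi / 2" "cos theta = cth" unfolding theta_def
    using cth arccos_less_arccos[of 0 cth] arccos_lt_bounded[of cth] by (auto simp: cos_arccos)
  then show "sin theta > 0" by (intro sin_gt_zero) auto
qed

lemma c_pos: "tt > 0" "c1 > 0" "c2 > 0"
  unfolding c1_def c2_def tt_def using S0_pos theta ABC by auto

lemma pr_pos: "pr i > 0" unfolding pr_def using ABC S0_pos by auto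

lemma c_squares: "(real A + B) * c1^2 = tt^2" "(real B + C) * c2^2 = tt^2" "B * (c1 * c2) = tt^2 * cth"
proof -
  show "(real A + B) * c1^2 = tt^2" "(real B + C) * c2^2 = tt^2"
    unfolding c1_def c2_def using ABC by (auto simp: power_divide)
  show "B * (c1 * c2) = tt^2 * cth" unfolding c1_def c2_def cth_def using ABC
    by (simp add: real_sqrt_mult power2_eq_square)
qed

lemma tt2: "tt^2 * (sin theta)^2 = S0"
  unfolding tt_def using theta S0_pos by (simp add: power_divide)

sublocale iso_walk pr ss LL
proof
  have s: "(\<Sum>i<3. f i) = f 0 + f 1 + f 2" for f :: "nat \<Rightarrow> 'a::comm_monoid_add" by (simp add: eval_nat_numeral add.assoc)
  have p: "pr 0 = 1 / (A * S0)" "pr 1 = 1 / (B * S0)" "pr 2 = 1 / (C * S0)" unfolding pr_def by auto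
  have x: "ss 0 = - (of_nat A * e1)" "ss 1 = of_nat B * (e1 - e2)" "ss 2 = of_nat C * e2"
    unfolding ss_def TT_def st_def by (auto simp: algebra_simps)
  have nz: "S0 \<noteq> 0" "real A \<noteq> 0" "real B \<noteq> 0" "real C \<noteq> 0" using S0_pos ABC by auto
  have nzc: "complex_of_real S0 \<noteq> 0" "complex_of_nat A \<noteq> 0" "complex_of_nat B \<noteq> 0" "complex_of_nat C \<noteq> 0" using nz by auto
  show "pr i \<ge> 0" for i using pr_pos[of i] by simp
  show "(\<Sum>i<3. pr i) = 1"
  proof -
    have "(\<Sum>i<3. pr i) = (1 / A + 1 / B + 1 / C) / S0" unfolding s p by (simp add: add_divide_distrib)
    then show ?thesis unfolding S0_def[symmetric] using nz by simp
  qed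
  show "(\<Sum>i<3. of_real (pr i) * ss i) = 0"
    unfolding s p x using nzc by (simp add: field_simps)
  have cs: "cis (- theta / 2) ^ 2 = cis (- theta)" "cis (theta / 2) ^ 2 = cis theta" "cis (- theta / 2) * cis (theta / 2) = 1"
    by (simp_all add: power2_eq_square cis_mult)
  have e11: "e1^2 = of_real (c1^2) * cis (- theta)" and e22: "e2^2 = of_real (c2^2) * cis theta" and e12: "e1 * e2 = of_real (c1 * c2)"
    unfolding e1_def e2_def power_mult_distrib cs using cs(3) by (auto simp: algebra_simps)
  show "(\<Sum>i<3. of_real (pr i) * (ss i)^2) = 0"
  proof -
    have "of_real S0 * (\<Sum>i<3. of_real (pr i) * (ss i)^2) = of_nat A * e1^2 + of_nat B * (e1 - e2)^2 + of_nat C * e2^2"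
      unfolding s p x using nzc by (simp add: field_simps power2_eq_square)
    also have "\<dots> = (of_nat A + of_nat B) * e1^2 - 2 * of_nat B * (e1 * e2) + (of_nat B + of_nat C) * e2^2"
      by (simp add: algebra_simps power2_eq_square)
    also have "\<dots> = of_real ((real A + B) * c1^2) * cis (- theta) - of_real (2 * (B * (c1 * c2))) + of_real ((real B + C) * c2^2) * cis theta"
      unfolding e11 e22 e12 by (simp add: mult.assoc)
    also have "\<dots> = of_real (tt^2) * (cis (- theta) + cis theta - of_real (2 * cth))"
      unfolding c_squares by (simp add: algebra_simps)
    also have "cis (- theta) + cis theta - of_real (2 * cth) = 0"
      using theta(3) by (simp add: complex_eq_iff)
    finally show ?thesis using nzc by simp
  qed
  show "(\<Sum>i<3. pr i * (cmod (ss i))^2) = 2"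
  proof -
    have n1: "(cmod e1)^2 = c1^2" "(cmod e2)^2 = c2^2" unfolding e1_def e2_def by (simp_all add: norm_mult)
    have n2: "(cmod (e1 - e2))^2 = c1^2 + c2^2 - 2 * (c1 * c2 * cth)"
    proof -
      have alg: "(a * u - b * u)^2 + (a * v + b * v)^2 = (a^2 + b^2) * (u^2 + v^2) - 2 * (a * b * (u^2 - v^2))"
        for a b u v :: real by (simp add: power2_eq_square algebra_simps)
      have "(cmod (e1 - e2))^2 = (c1 * cos (theta/2) - c2 * cos (theta/2))^2 + (c1 * sin (theta/2) + c2 * sin (theta/2))^2"
        unfolding cmod_power2 e1_def e2_def by (simp add: power2_eq_square algebra_simps)
      also have "\<dots> = (c1^2 + c2^2) * ((cos (theta/2))^2 + (sin (theta/2))^2) - 2 * (c1 * c2 * ((cos (theta/2))^2 - (sin (theta/2))^2))"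
        by (rule alg)
      also have "(cos (theta/2))^2 - (sin (theta/2))^2 = cth" using cos_double[of "theta/2"] theta(3) by simp
      finally show ?thesis by simp
    qed
    have "S0 * (\<Sum>i<3. pr i * (cmod (ss i))^2) = A * (cmod e1)^2 + B * (cmod (e1 - e2))^2 + C * (cmod e2)^2"
      unfolding s p x norm_minus_cancel norm_mult norm_of_nat using nz by (simp add: field_simps power2_eq_square)
    also have "\<dots> = (real A + B) * c1^2 + (real B + C) * c2^2 - 2 * (B * (c1 * c2)) * cth"
      unfolding n1 n2 by (simp add: algebra_simps)
    also have "\<dots> = 2 * tt^2 * (1 - cth^2)" unfolding c_squares by (simp add: algebra_simps power2_eq_square)
    also have "1 - cth^2 = (sin theta)^2" using sin_cos_squared_add[of theta] theta(3) by simp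
    also have "2 * tt^2 * (sin theta)^2 = 2 * S0" using tt2 by simp
    finally show ?thesis using nz by simp
  qed
  show "cmod (ss i) \<le> LL" if "i < 3" for i
  proof -
    have "cmod (ss i) \<le> (\<Sum>i<3. cmod (ss i))" using that by (intro member_le_sum) auto
    then show ?thesis unfolding LL_def by simp
  qed
  show "LL > 0" unfolding LL_def by (intro add_pos_nonneg sum_nonneg) auto
qed

text \<open>The numbers \<open>x1\<close>, \<open>x2\<close>, \<open>lam\<close> solve three linear
  equations saying that the tilted weight of step \<open>i\<close> is \<open>pr i\<close>. Dividing
  the equations by \<open>A\<close>, \<open>B\<close>, \<open>C\<close> and adding them eliminates
  \<open>x1\<close> and \<open>x2\<close>, which gives this value.\<close>

definition lam :: real where "lam = - (ln (pr 0) / A + ln (pr 1) / B + ln (pr 2) / C) / S0"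
definition x1 :: real where "x1 = (ln (pr 0) + lam) / A"
definition x2 :: real where "x2 = - (ln (pr 2) + lam) / C"
definition weighted_count :: "nat \<Rightarrow> int \<times> int \<Rightarrow> real" where
  "weighted_count n z = tandem_count A B C n z * exp (x1 * of_int (fst z) + x2 * of_int (snd z) - n * lam)"

lemma step_weight:
  assumes "i < 3" shows "exp (x1 * of_int (fst (st i)) + x2 * of_int (snd (st i)) - lam) = pr i"
proof -
  have l1: "x1 * A = ln (pr 0) + lam" and l2: "x2 * C = - (ln (pr 2) + lam)" unfolding x1_def x2_def using ABC by auto
  have "lam * S0 = - (ln (pr 0) / A + ln (pr 1) / B + ln (pr 2) / C)" unfolding lam_def using S0_pos by simp
  then have "(ln (pr 0) + lam) / A + (ln (pr 1) + lam) / B + (ln (pr 2) + lam) / C = 0"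
    unfolding S0_def by (simp add: add_divide_distrib algebra_simps)
  moreover have "x2 = - ((ln (pr 2) + lam) / C)" unfolding x2_def by (simp only: minus_divide_left)
  ultimately have "x2 - x1 = (ln (pr 1) + lam) / B" unfolding x1_def by linarith
  then have l3: "x2 * B - x1 * B = ln (pr 1) + lam" using ABC by (simp add: left_diff_distrib[symmetric])
  consider "i = 0" | "i = 1" | "i = 2" using assms by linarith
  then have "x1 * of_int (fst (st i)) + x2 * of_int (snd (st i)) - lam = ln (pr i)"
    by cases (use l1 l2 l3 in \<open>simp_all add: st_def\<close>)
  then show ?thesis using pr_pos[of i] by simp
qed

lemma weighted_count_0: "weighted_count 0 z = (if z = (0, 0) then 1 else 0)"
  unfolding weighted_count_def count_0 by simp

text \<open>The tilt makes the counts into probabilities of the centred walk that is killed when it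
  leaves the quadrant.\<close>

lemma weighted_count_Suc: "weighted_count (Suc n) z = (if quad z then \<Sum>i<3. pr i * weighted_count n (z - st i) else 0)"
proof (cases "quad z")
  case True
  have "pr i * weighted_count n (z - st i) = tandem_count A B C n (z - st i) * exp (x1 * of_int (fst z) + x2 * of_int (snd z) - Suc n * lam)" if "i < 3" for i
    unfolding weighted_count_def step_weight[OF that, symmetric] by (simp add: exp_add[symmetric] algebra_simps)
  then have "(\<Sum>i<3. pr i * weighted_count n (z - st i)) = (\<Sum>i<3. tandem_count A B C n (z - st i) * exp (x1 * of_int (fst z) + x2 * of_int (snd z) - Suc n * lam))"
    by (intro sum.cong) auto
  then show ?thesis using True unfolding weighted_count_def count_Suc by (simp add: sum_distrib_right)
qed (simp add: weighted_count_def count_Suc)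

lemma weighted_count_nonneg: "weighted_count n z \<ge> 0" unfolding weighted_count_def by simp

lemma weighted_count_not_quad: "\<not> quad z \<Longrightarrow> weighted_count n z = 0"
  by (cases n) (auto simp: weighted_count_0 weighted_count_Suc quad_def)

lemma TT_diff: "TT (z - st i) = TT z + ss i"
  unfolding ss_def TT_def by (simp add: algebra_simps)

end

section \<open>Arguments in the cone and the upper bound\<close>

lemma Re_powr_polar:
  assumes "z \<noteq> 0"
  shows "Re (z powr of_real b) = cmod z powr b * cos (b * Im (Ln z))"
  using assms by (simp add: powr_def Re_exp)

text \<open>\<open>z + s\<close> is \<open>z\<close> times \<open>1 + s / z\<close>. Both factors
  have positive real part, so the principal logarithms add, and the argument changes by at most the
  modulus of \<open>Ln (1 + s / z)\<close>.\<close>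

lemma Im_Ln_perturb:
  assumes z: "Re z > 0" and s: "cmod s \<le> d * cmod z" and d: "0 \<le> d" "d < 1/2"
  shows "\<bar>Im (Ln (z + s)) - Im (Ln z)\<bar> \<le> 2 * d" "Re (1 + s / z) > 0" "z + s \<noteq> 0"
proof -
  have z0: "z \<noteq> 0" using z by auto
  define x where "x = s / z"
  have x: "cmod x \<le> d" unfolding x_def norm_divide using s z0 by (simp add: divide_le_eq)
  have e: "z + s = z * (1 + x)" unfolding x_def using z0 by (simp add: distrib_left)
  have R: "Re (1 + x) > 0" using abs_Re_le_cmod[of x] x d by simp
  then show "Re (1 + s / z) > 0" unfolding x_def .
  have nz: "1 + x \<noteq> 0"
  proof
    assume "1 + x = 0"
    then have "Re (1 + x) = 0" by (simp only: zero_complex.simps)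
    then show False using R by linarith
  qed
  show "z + s \<noteq> 0" unfolding e using z0 nz by simp
  have "\<bar>Im (Ln z)\<bar> < pi / 2" "\<bar>Im (Ln (1 + x))\<bar> < pi / 2"
    using z R z0 nz Re_Ln_pos_lt by blast+
  then have "Ln (z * (1 + x)) = Ln z + Ln (1 + x)" using z0 nz by (intro Ln_times_simple) auto
  then have "\<bar>Im (Ln (z + s)) - Im (Ln z)\<bar> = \<bar>Im (Ln (1 + x))\<bar>" unfolding e by simp
  also have "\<dots> \<le> cmod (Ln (1 + x))" by (rule abs_Im_le_cmod)
  also have "\<dots> \<le> 2 * cmod x" by (rule norm_Ln_le) (use x d in linarith)
  finally show "\<bar>Im (Ln (z + s)) - Im (Ln z)\<bar> \<le> 2 * d" using x by linarith
qed

context tandem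
begin

definition alpha :: real where "alpha = pi / theta"

lemma alpha_gt: "alpha > 2" unfolding alpha_def using theta by (simp add: less_divide_eq)

text \<open>\<open>R\<close> translates the image of the quadrant along the axis of the cone; a
  large \<open>R\<close> keeps all points away from the apex, near which the expansions are
  useless.\<close>

definition cone :: "real \<Rightarrow> real \<Rightarrow> real \<Rightarrow> complex" where
  "cone x y R = of_real x * e1 + of_real y * e2 + of_real R"

text \<open>A rotation by half the opening angle lays an edge of the cone on the real axis, so the
  imaginary part measures the signed distance from that edge.\<close>

lemma cone_components:
  "Re (cone x y R) = (x * c1 + y * c2) * cos (theta / 2) + R"
  "Im (cone x y R * cis (theta / 2)) = y * c2 * sin theta + R * sin (theta / 2)"
  "Im (cone x y R * cis (- theta / 2)) = - (x * c1 * sin theta) - R * sin (theta / 2)"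
proof -
  have s2: "sin theta = 2 * sin (theta/2) * cos (theta/2)" using sin_double[of "theta/2"] by simp
  show "Re (cone x y R) = (x * c1 + y * c2) * cos (theta / 2) + R"
    unfolding cone_def e1_def e2_def by (simp add: algebra_simps)
  show "Im (cone x y R * cis (theta / 2)) = y * c2 * sin theta + R * sin (theta / 2)"
    unfolding cone_def e1_def e2_def s2 by (simp add: algebra_simps)
  show "Im (cone x y R * cis (- theta / 2)) = - (x * c1 * sin theta) - R * sin (theta / 2)"
    unfolding cone_def e1_def e2_def s2 by (simp add: algebra_simps)
qed

lemma Im_cis_polar: "z \<noteq> 0 \<Longrightarrow> Im (z * cis t) = cmod z * sin (Im (Ln z) + t)"
proof -
  assume z: "z \<noteq> 0"
  have "z = of_real (cmod z) * cis (Im (Ln z))"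
  proof -
    have "z = exp (Ln z)" using z by simp
    also have "\<dots> = of_real (exp (Re (Ln z))) * cis (Im (Ln z))" by (simp add: exp_eq_polar)
    also have "exp (Re (Ln z)) = cmod z" using z by simp
    finally show ?thesis .
  qed
  then have "z * cis t = of_real (cmod z) * cis (Im (Ln z) + t)" by (metis cis_mult mult.assoc)
  then show ?thesis by simp
qed

lemma cos_half: "cos (theta / 2) > 0" "sin (theta / 2) > 0"
  using theta by (auto intro!: cos_gt_zero sin_gt_zero)

lemma cone_arg:
  assumes "x \<ge> 0" "y \<ge> 0" "R \<ge> 0" "cone x y R \<noteq> 0"
  shows "\<bar>Im (Ln (cone x y R))\<bar> \<le> theta / 2" "Re (cone x y R) > 0"
proof -
  let ?z = "cone x y R" and ?f = "Im (Ln (cone x y R))"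
  have rp: "cmod ?z > 0" using assms by simp
  have "Re ?z \<ge> 0" unfolding cone_components using assms cos_half c_pos by auto
  moreover have "Re ?z \<noteq> 0"
  proof
    assume "Re ?z = 0"
    moreover have "0 \<le> x * c1 + y * c2" "0 \<le> x * c1" "0 \<le> y * c2" using assms c_pos by auto
    ultimately have "R = 0" "x * c1 + y * c2 = 0" using cos_half assms(3)
      unfolding cone_components by (smt (verit) mult_eq_0_iff mult_nonneg_nonneg)+
    then have "x = 0 \<and> y = 0 \<and> R = 0" using \<open>0 \<le> x * c1\<close> \<open>0 \<le> y * c2\<close> c_pos
      by (smt (verit) mult_eq_0_iff)
    then show False using assms(4) unfolding cone_def by simp
  qed
  ultimately show R: "Re ?z > 0" by simp
  then have b: "\<bar>?f\<bar> < pi / 2" using Re_Ln_pos_lt assms(4) by blast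
  have "0 \<le> cmod ?z * sin (?f + theta / 2)"
    unfolding Im_cis_polar[OF assms(4), symmetric] cone_components using assms c_pos theta cos_half by auto
  then have s1: "0 \<le> sin (?f + theta / 2)" using rp by (simp add: zero_le_mult_iff)
  have "0 \<ge> cmod ?z * sin (?f + - theta / 2)"
  proof -
    have "0 \<le> x * c1 * sin theta" "0 \<le> R * sin (theta / 2)" using assms c_pos theta cos_half by auto
    then show ?thesis unfolding Im_cis_polar[OF assms(4), symmetric] cone_components by linarith
  qed
  then have s2: "0 \<ge> sin (?f + - theta / 2)" using rp by (simp add: mult_le_0_iff)
  have "?f \<ge> - theta / 2"
  proof (rule ccontr)
    assume "\<not> ?f \<ge> - theta / 2"
    then have "sin (?f + theta / 2) < 0" using b theta by (intro sin_less_zero) auto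
    then show False using s1 by simp
  qed
  moreover have "?f \<le> theta / 2"
  proof (rule ccontr)
    assume "\<not> ?f \<le> theta / 2"
    then have "sin (?f + - theta / 2) > 0" using b theta by (intro sin_gt_zero) auto
    then show False using s2 by simp
  qed
  ultimately show "\<bar>?f\<bar> \<le> theta / 2" by linarith
qed

lemma TT_cone: "TT z = cone (of_int (fst z)) (of_int (snd z)) 0"
  unfolding TT_def cone_def by simp

lemma TT_cone_shift: "TT z + of_real R = cone (of_int (fst z)) (of_int (snd z)) R"
  unfolding TT_def cone_def by simp

lemma outside_arg:
  assumes "\<not> quad z" "TT z \<noteq> 0" "\<bar>Im (Ln (TT z))\<bar> \<le> theta"
  shows "theta / 2 \<le> \<bar>Im (Ln (TT z))\<bar>"
proof -
  let ?f = "Im (Ln (TT z))"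
  have rp: "cmod (TT z) > 0" using assms by simp
  have "fst z < 0 \<or> snd z < 0" using assms(1) unfolding quad_def by auto
  then show ?thesis
  proof
    assume f: "fst z < 0"
    then have "0 < - (of_int (fst z) * c1 * sin theta)" using c_pos theta by (simp add: mult_less_0_iff)
    then have "0 < Im (TT z * cis (- theta / 2))" unfolding TT_cone cone_components by simp
    then have s: "0 < sin (?f + - theta / 2)" unfolding Im_cis_polar[OF assms(2)] using rp by (simp add: zero_less_mult_iff)
    show ?thesis
    proof (rule ccontr)
      assume "\<not> ?thesis"
      then have "sin (theta / 2 - ?f) \<ge> 0" using theta by (intro sin_ge_zero) auto
      moreover have "?f + - theta / 2 = - (theta / 2 - ?f)" by simp
      ultimately have "sin (?f + - theta / 2) \<le> 0" by (simp only: sin_minus)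
      then show False using s by simp
    qed
  next
    assume f: "snd z < 0"
    then have "of_int (snd z) * c2 * sin theta < 0" using c_pos theta by (simp add: mult_less_0_iff)
    then have "Im (TT z * cis (theta / 2)) < 0" unfolding TT_cone cone_components by simp
    then have s: "sin (?f + theta / 2) < 0" unfolding Im_cis_polar[OF assms(2)] using rp by (simp add: mult_less_0_iff)
    show ?thesis
    proof (rule ccontr)
      assume "\<not> ?thesis"
      then have "sin (?f + theta / 2) \<ge> 0" using theta by (intro sin_ge_zero) auto
      then show False using s by simp
    qed
  qed
qed

text \<open>Comparison by induction on \<open>n\<close>, on the translated cone. The one-step
  inequality propagates the bound at points of the quadrant. A neighbour outside the quadrant has
  count zero, and there the supersolution only has to be nonnegative: \<open>\<beta> < alpha\<close>
  allows a cone widened enough to contain all neighbours.\<close>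

lemma weighted_count_upper_param:
  assumes \<beta>: "0 < \<beta>" "\<beta> < alpha" and \<kappa>: "\<kappa> > 0" and k: "k > 0" and g: "g = k * \<kappa>" and c: "c > 0" "2 * g * (1 + \<beta>) - a \<ge> c"
    "k * (1 - 2 * g) - 2 * a + 2 * g * \<beta> \<ge> c" "k - a \<ge> c" and a: "a \<ge> 0"
  shows "\<exists>D. \<forall>n\<ge>1. weighted_count n (0, 0) \<le> D * real n powr (- a)"
proof -
  \<comment> \<open>Midway between the opening angle and \<open>pi / \<beta>\<close>, the opening at
    which the real part of the power vanishes on the edges. So \<eta>, the cosine on the edges of
    the widened cone, is positive.\<close>
  define th' where "th' = (theta + pi / \<beta>) / 2"
  have bt: "\<beta> * theta < pi" using \<beta> theta unfolding alpha_def by (simp add: less_divide_eq)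
  then have tb: "theta < pi / \<beta>" using \<beta> by (simp add: less_divide_eq mult.commute)
  have th': "theta < th'" "\<beta> * (th' / 2) < pi / 2" "0 < \<beta> * (th' / 2)"
  proof -
    show "theta < th'" unfolding th'_def using tb by simp
    have "\<beta> * (th' / 2) = (\<beta> * theta + pi) / 4" unfolding th'_def using \<beta> by (simp add: field_simps)
    then show "\<beta> * (th' / 2) < pi / 2" using bt by simp
    show "0 < \<beta> * (th' / 2)" using \<beta> theta \<open>theta < th'\<close> by simp
  qed
  define \<eta> where "\<eta> = cos (\<beta> * (th' / 2))"
  have \<eta>: "\<eta> > 0" unfolding \<eta>_def using th' by (intro cos_gt_zero) auto
  have \<eta>1: "\<eta> < 1" unfolding \<eta>_def using cos_monotone_0_pi[of 0 "\<beta> * (th' / 2)"] th' by simp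
  define \<delta> where "\<delta> = th' - theta"
  have \<delta>: "\<delta> > 0" unfolding \<delta>_def using th' by simp
  obtain R0 n0 where step: "\<And>\<zeta> n. cmod \<zeta> \<ge> R0 \<Longrightarrow> n \<ge> n0 \<Longrightarrow> Re \<zeta> > 0 \<Longrightarrow> Re (\<zeta> powr of_real \<beta>) \<ge> \<eta> * cmod \<zeta> powr \<beta> \<Longrightarrow>
    (\<Sum>i<3. pr i * phi_upper k a \<kappa> \<beta> \<eta> n (\<zeta> + ss i)) \<le> phi_upper k a \<kappa> \<beta> \<eta> (n + 1) \<zeta>"
    using phi_upper_step[OF \<eta> \<beta>(1) \<kappa> g c] by blast
  \<comment> \<open>Beyond the reach of \<open>phi_upper_step\<close>, and so far out that one step
    changes the argument by at most \<open>\<delta> / 2\<close>, half of the difference between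
    \<open>th'\<close> and \<open>theta\<close>.\<close>
  define R where "R = max R0 (max (4 * LL) (4 * LL / \<delta>))"
  have R: "R \<ge> R0" "R \<ge> 4 * LL" "R \<ge> 4 * LL / \<delta>" unfolding R_def by auto
  have Rp: "R > 0" using R L by linarith
  define m0 where "m0 = max n0 1"
  have m0: "m0 \<ge> n0" "m0 \<ge> 1" unfolding m0_def by auto
  have m0p: "m0 > 0" using m0 by linarith
  let ?phi = "phi_upper k a \<kappa> \<beta> \<eta>"
  have cosge: "Re (\<zeta> powr of_real \<beta>) \<ge> \<eta> * cmod \<zeta> powr \<beta>" if "\<zeta> \<noteq> 0" "\<bar>Im (Ln \<zeta>)\<bar> \<le> th' / 2" for \<zeta>
  proof -
    have "\<eta> \<le> cos \<bar>\<beta> * Im (Ln \<zeta>)\<bar>"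
      unfolding \<eta>_def using that(2) th' \<beta> by (intro cos_monotone_0_pi_le) (auto simp: abs_mult)
    then have "\<eta> \<le> cos (\<beta> * Im (Ln \<zeta>))" by simp
    then have "cmod \<zeta> powr \<beta> * \<eta> \<le> cmod \<zeta> powr \<beta> * cos (\<beta> * Im (Ln \<zeta>))" by (rule mult_left_mono) simp
    then show ?thesis unfolding Re_powr_polar[OF that(1)] by (simp only: mult.commute[of \<eta>])
  qed
  have phi_nonneg: "?phi n \<zeta> \<ge> 0" if "\<zeta> \<noteq> 0" "\<bar>Im (Ln \<zeta>)\<bar> \<le> th' / 2" for n \<zeta>
    unfolding phi_upper_def using cosge[OF that] by simp
  define D where "D = 1 / ?phi m0 (of_real R)"
  have phi0: "?phi n (of_real R) = n powr (k - a) * (n + \<kappa> * R^2) powr (-k) * (R powr \<beta> * (1 - \<eta>))" if "n > 0" for n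
  proof -
    have "(of_real R :: complex) powr of_real \<beta> = of_real (R powr \<beta>)" using Rp by (simp add: powr_of_real)
    then show ?thesis unfolding phi_upper_def mm_def using Rp by (simp add: algebra_simps)
  qed
  have "?phi m0 (of_real R) > 0" unfolding phi0[OF m0p]
    using m0 \<kappa> Rp \<eta>1 by (intro mult_pos_pos) (auto intro: add_pos_pos simp: powr_gt_zero add_nonneg_eq_0_iff)
  then have D: "D > 0" "D * ?phi m0 (of_real R) = 1" unfolding D_def by auto
  have main: "weighted_count n z \<le> D * ?phi (m0 + n) (TT z + of_real R)" if "quad z" for n z
    using that
  proof (induction n arbitrary: z)
    case 0
    have zn: "TT z + of_real R \<noteq> 0"
    proof
      assume "TT z + of_real R = 0"
      then have "Re (TT z + of_real R) = 0" by simp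
      moreover have "Re (TT z + of_real R) \<ge> R" unfolding TT_cone_shift cone_components
        using 0 c_pos cos_half unfolding quad_def by (simp add: mult_nonneg_nonneg add_nonneg_nonneg)
      ultimately show False using Rp by simp
    qed
    show ?case
    proof (cases "z = (0, 0)")
      case True
      then show ?thesis using D by (simp add: weighted_count_0 TT_def)
    next
      case False
      have "\<bar>Im (Ln (TT z + of_real R))\<bar> \<le> theta / 2" unfolding TT_cone_shift
        using zn 0 Rp unfolding quad_def TT_cone_shift by (intro cone_arg) auto
      then have "?phi (m0 + real 0) (TT z + of_real R) \<ge> 0" using th' by (intro phi_nonneg zn) auto
      then show ?thesis using False D by (simp add: weighted_count_0)
    qed
  next
    case (Suc n)
    define \<zeta> where "\<zeta> = TT z + of_real R"
    have xy: "of_int (fst z) \<ge> (0::real)" "of_int (snd z) \<ge> (0::real)" using Suc.prems unfolding quad_def by auto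
    have "Re \<zeta> \<ge> R" unfolding \<zeta>_def TT_cone_shift cone_components using xy c_pos cos_half by (simp add: mult_nonneg_nonneg add_nonneg_nonneg)
    then have Re: "Re \<zeta> > 0" "cmod \<zeta> \<ge> R" using Rp complex_Re_le_cmod[of \<zeta>] by linarith+
    have z0: "\<zeta> \<noteq> 0" using Re by auto
    have arg: "\<bar>Im (Ln \<zeta>)\<bar> \<le> theta / 2" unfolding \<zeta>_def TT_cone_shift
      by (rule cone_arg) (use z0 xy Rp in \<open>auto simp: \<zeta>_def TT_cone_shift\<close>)
    have nb: "\<zeta> + ss i \<noteq> 0 \<and> \<bar>Im (Ln (\<zeta> + ss i))\<bar> \<le> th' / 2" if i: "i < 3" for i
    proof -
      define d where "d = min (1/4) (\<delta> / 4)"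
      have "d * cmod \<zeta> \<ge> LL"
      proof -
        have "LL \<le> (1/4) * R" "LL \<le> \<delta> / 4 * R" using R \<delta> by (simp_all add: field_simps)
        then have "LL \<le> d * R" unfolding d_def min_def by auto
        also have "\<dots> \<le> d * cmod \<zeta>" using Re \<delta> unfolding d_def by (intro mult_left_mono) auto
        finally show ?thesis .
      qed
      then have s: "cmod (ss i) \<le> d * cmod \<zeta>" using sL[OF i] by linarith
      have d: "0 \<le> d" "d < 1/2" "2 * d \<le> \<delta> / 2" unfolding d_def using \<delta> by auto
      note P = Im_Ln_perturb[OF Re(1) s d(1,2)]
      have "\<bar>Im (Ln (\<zeta> + ss i))\<bar> \<le> theta / 2 + \<delta> / 2" using P(1) arg d(3) by linarith
      then show ?thesis using P(3) unfolding \<delta>_def by (simp add: field_simps)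
    qed
    have "weighted_count (Suc n) z = (\<Sum>i<3. pr i * weighted_count n (z - st i))" using Suc.prems by (simp add: weighted_count_Suc)
    also have "\<dots> \<le> (\<Sum>i<3. pr i * (D * ?phi (m0 + n) (\<zeta> + ss i)))"
    proof (intro sum_mono mult_left_mono)
      fix i assume "i \<in> {..<3::nat}"
      then have i: "i < 3" by simp
      have e: "TT (z - st i) + of_real R = \<zeta> + ss i" unfolding TT_diff \<zeta>_def by simp
      show "weighted_count n (z - st i) \<le> D * ?phi (m0 + n) (\<zeta> + ss i)"
      proof (cases "quad (z - st i)")
        case True
        from Suc.IH[OF True] show ?thesis unfolding e .
      next
        case False
        then show ?thesis using weighted_count_not_quad phi_nonneg[of "\<zeta> + ss i"] nb[OF i] D by simp
      qed
    qed (use pr_pos in \<open>simp add: less_imp_le\<close>)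
    also have "\<dots> = D * (\<Sum>i<3. pr i * ?phi (m0 + n) (\<zeta> + ss i))" by (simp add: sum_distrib_left mult_ac)
    also have "\<dots> \<le> D * ?phi (m0 + n + 1) \<zeta>"
    proof (rule mult_left_mono[OF step])
      show "R0 \<le> cmod \<zeta>" using Re R by linarith
      show "n0 \<le> m0 + real n" using m0 by linarith
      show "Re (\<zeta> powr of_real \<beta>) \<ge> \<eta> * cmod \<zeta> powr \<beta>" using z0 arg th' by (intro cosge) auto
    qed (use Re D in auto)
    finally show ?case unfolding \<zeta>_def by (simp add: add_ac)
  qed
  define D' where "D' = D * (R powr \<beta> * (1 - \<eta>))"
  have D'0: "D' \<ge> 0" unfolding D'_def using D \<eta>1 by simp
  have "weighted_count n (0, 0) \<le> D' * real n powr (- a)" if n: "n \<ge> 1" for n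
  proof -
    define N where "N = m0 + real n"
    have N: "N > 0" "N \<ge> real n" unfolding N_def using m0 n by auto
    have "weighted_count n (0, 0) \<le> D * ?phi N (of_real R)" using main[of "(0, 0)" n] unfolding N_def by (simp add: quad_def TT_def)
    also have "\<dots> = D' * (N powr (k - a) * (N + \<kappa> * R^2) powr (-k))" unfolding phi0[OF N(1)] D'_def by simp
    also have "\<dots> \<le> D' * (N powr (k - a) * N powr (-k))"
      using D'0 N \<kappa> k by (intro mult_left_mono powr_mono2') auto
    also have "N powr (k - a) * N powr (-k) = N powr (- a)" by (simp flip: powr_add)
    also have "D' * N powr (- a) \<le> D' * real n powr (- a)" using D'0 N n a by (intro mult_left_mono powr_mono2') auto
    finally show ?thesis .
  qed
  then show ?thesis by blast
qed

text \<open>The attainable exponent is \<open>2 * g * (1 + \<beta>)\<close>. With \<open>g\<close>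
  and \<beta> each lowered by \<open>t\<close> it falls short of \<open>1 + alpha\<close> by at most
  \<open>t * (3 + 2 * alpha)\<close>, which is half of \<open>e\<close>; the other half of
  \<open>e\<close> is the margin \<open>c\<close>.\<close>

lemma weighted_count_upper:
  assumes "\<epsilon> > 0"
  shows "\<exists>D. \<forall>n\<ge>1. weighted_count n (0, 0) \<le> D * real n powr (- (1 + alpha) + \<epsilon>)"
proof -
  define e where "e = min \<epsilon> 1"
  have e: "e > 0" "e \<le> \<epsilon>" "e \<le> 1" unfolding e_def using assms by auto
  define t where "t = e / (2 * (3 + 2 * alpha))"
  have t: "t > 0" "t < 1/4" "t * (3 + 2 * alpha) = e / 2" unfolding t_def using e alpha_gt by (simp_all add: field_simps)
  define a where "a = 1 + alpha - e"
  define \<beta> where "\<beta> = alpha - t"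
  define g where "g = 1 / 2 - t"
  define c where "c = e / 2"
  \<comment> \<open>Since \<open>1 - 2 * g = 2 * t\<close>, the first summand makes the mixed
    coefficient of the quadratic form at least \<open>c\<close>; the others give
    \<open>k - a \<ge> c\<close>.\<close>
  define k where "k = (2 * a + c) / (2 * t) + a + c"
  define \<kappa> where "\<kappa> = g / k"
  have a0: "a > 0" unfolding a_def using e alpha_gt by simp
  have c0: "c > 0" unfolding c_def using e by simp
  have g0: "g > 0" unfolding g_def using t by simp
  have b0: "0 < \<beta>" "\<beta> < alpha" unfolding \<beta>_def using t alpha_gt by auto
  have k0: "k > 0" unfolding k_def using a0 c0 t by (simp add: add_pos_pos)
  have "\<exists>D. \<forall>n\<ge>1. weighted_count n (0, 0) \<le> D * real n powr (- a)"
  proof (rule weighted_count_upper_param[OF b0 _ k0 _ c0])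
    show "\<kappa> > 0" unfolding \<kappa>_def using g0 k0 by simp
    show "g = k * \<kappa>" unfolding \<kappa>_def using k0 by simp
    have "2 * g * (1 + \<beta>) = 1 + alpha - t * (3 + 2 * alpha) + 2 * t^2" unfolding g_def \<beta>_def by (simp add: algebra_simps power2_eq_square)
    then have "2 * g * (1 + \<beta>) \<ge> 1 + alpha - e / 2" using t(3) by simp
    then show "c \<le> 2 * g * (1 + \<beta>) - a" unfolding c_def a_def by (simp add: field_simps)
    have "k * (1 - 2 * g) = 2 * t * k" unfolding g_def by (simp add: algebra_simps)
    also have "2 * t * k \<ge> 2 * t * ((2 * a + c) / (2 * t))" using t a0 c0 unfolding k_def by (intro mult_left_mono) auto
    finally have "k * (1 - 2 * g) \<ge> 2 * a + c" using t by simp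
    moreover have "2 * g * \<beta> \<ge> 0" using g0 b0 by simp
    ultimately show "c \<le> k * (1 - 2 * g) - 2 * a + 2 * g * \<beta>" by linarith
    have "(2 * a + c) / (2 * t) \<ge> 0" using a0 c0 t by simp
    then show "c \<le> k - a" unfolding k_def by linarith
  qed (use a0 in simp)
  then obtain D where D: "\<And>n. n \<ge> 1 \<Longrightarrow> weighted_count n (0, 0) \<le> D * real n powr (- a)" by blast
  have D0: "D \<ge> 0" using order_trans[OF weighted_count_nonneg D[of 1]] by simp
  have "weighted_count n (0, 0) \<le> D * real n powr (- (1 + alpha) + \<epsilon>)" if "n \<ge> 1" for n
  proof -
    have "real n powr (- a) \<le> real n powr (- (1 + alpha) + \<epsilon>)" using that e unfolding a_def by (intro powr_mono) auto
    then show ?thesis using D[OF that] D0 mult_left_mono by (meson order_trans)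
  qed
  then show ?thesis by blast
qed

end

section \<open>The lattice of reachable points, the period, and positivity of the counts\<close>

context tandem
begin

text \<open>
  The lattice condition that a point reached in \<open>n\<close> steps has to satisfy.
\<close>

definition admissible :: "nat \<Rightarrow> int \<times> int \<Rightarrow> bool" where
  "admissible n z \<longleftrightarrow> (\<exists>i j k. i + j + k = int n \<and> fst z = int A * i - int B * j \<and> snd z = int B * j - int C * k)"

definition shift_steps :: "int \<times> int \<Rightarrow> nat \<Rightarrow> nat \<Rightarrow> int \<times> int" where
  "shift_steps z m i = (fst z + int m * fst (st i), snd z + int m * snd (st i))"

lemma admissible_add: "admissible n z \<Longrightarrow> i < 3 \<Longrightarrow> admissible (n + m) (shift_steps z m i)"
proof -
  assume "admissible n z" and i: "i < 3"
  then obtain a b c where *: "a + b + c = int n" "fst z = int A * a - int B * b" "snd z = int B * b - int C * c"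
    unfolding admissible_def by blast
  consider "i = 0" | "i = 1" | "i = 2" using i by linarith
  then show ?thesis
  proof cases
    case 1 then show ?thesis unfolding admissible_def shift_steps_def st_def
      by (intro exI[of _ "a + int m"] exI[of _ b] exI[of _ c]) (use * in \<open>simp add: algebra_simps\<close>)
  next
    case 2 then show ?thesis unfolding admissible_def shift_steps_def st_def
      by (intro exI[of _ a] exI[of _ "b + int m"] exI[of _ c]) (use * in \<open>simp add: algebra_simps\<close>)
  next
    case 3 then show ?thesis unfolding admissible_def shift_steps_def st_def
      by (intro exI[of _ a] exI[of _ b] exI[of _ "c + int m"]) (use * in \<open>simp add: algebra_simps\<close>)
  qed
qed

lemma admissible_sub: "admissible (n + m) (shift_steps z m i) \<Longrightarrow> i < 3 \<Longrightarrow> admissible n z"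
proof -
  assume "admissible (n + m) (shift_steps z m i)" and i: "i < 3"
  then obtain a b c where *: "a + b + c = int n + int m"
    "fst z + int m * fst (st i) = int A * a - int B * b" "snd z + int m * snd (st i) = int B * b - int C * c"
    unfolding admissible_def shift_steps_def by auto
  consider "i = 0" | "i = 1" | "i = 2" using i by linarith
  then show ?thesis
  proof cases
    case 1 then show ?thesis unfolding admissible_def
      by (intro exI[of _ "a - int m"] exI[of _ b] exI[of _ c]) (use * in \<open>simp add: st_def algebra_simps\<close>)
  next
    case 2 then show ?thesis unfolding admissible_def
      by (intro exI[of _ a] exI[of _ "b - int m"] exI[of _ c]) (use * in \<open>simp add: st_def algebra_simps\<close>)
  next
    case 3 then show ?thesis unfolding admissible_def
      by (intro exI[of _ a] exI[of _ b] exI[of _ "c - int m"]) (use * in \<open>simp add: st_def algebra_simps\<close>)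
  qed
qed

lemma shift_steps_Suc0: "shift_steps (z - st i) (Suc 0) i = z" unfolding shift_steps_def by (simp add: prod_eq_iff)

lemma admissible_step: "admissible (Suc n) z \<Longrightarrow> i < 3 \<Longrightarrow> admissible n (z - st i)"
  using admissible_sub[of n "Suc 0" "z - st i" i] by (simp add: shift_steps_Suc0)

lemma admissible_unstep: "admissible n (z - st i) \<Longrightarrow> i < 3 \<Longrightarrow> admissible (Suc n) z"
  using admissible_add[of n "z - st i" i "Suc 0"] by (simp add: shift_steps_Suc0)

lemma admissible_count: "tandem_count A B C n z \<noteq> 0 \<Longrightarrow> admissible n z"
proof (induction n arbitrary: z)
  case 0
  then have "z = (0, 0)" by (simp add: count_0 split: if_splits)
  then show ?case unfolding admissible_def by (intro exI[of _ 0]) simp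
next
  case (Suc n)
  have "(\<Sum>i<3. tandem_count A B C n (z - st i)) \<noteq> 0"
  proof
    assume "(\<Sum>i<3. tandem_count A B C n (z - st i)) = 0"
    then have "tandem_count A B C (Suc n) z = 0" unfolding count_Suc by (cases "quad z") (simp_all only: if_True if_False)
    then show False using Suc.prems by contradiction
  qed
  then obtain i where "i \<in> {..<3}" "tandem_count A B C n (z - st i) \<noteq> 0" by (rule sum.not_neutral_contains_not_neutral)
  then have i: "i < 3" "tandem_count A B C n (z - st i) \<noteq> 0" by auto
  then show ?case using Suc.IH admissible_unstep by blast
qed

text \<open>A closed sequence with \<open>i\<close>, \<open>j\<close>, \<open>k\<close> steps of the
  three kinds has \<open>A * i = B * j = C * k\<close>. The shortest nonempty one uses
  \<open>LA\<close>, \<open>LB\<close>, \<open>LC\<close> steps; its length \<open>ell\<close> is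
  the period of the excursions.\<close>

definition LA :: nat where "LA = lcm A (lcm B C) div A"
definition LB :: nat where "LB = lcm A (lcm B C) div B"
definition LC :: nat where "LC = lcm A (lcm B C) div C"
definition ell :: nat where "ell = LA + LB + LC"

lemma LABC: "A * LA = lcm A (lcm B C)" "B * LB = lcm A (lcm B C)" "C * LC = lcm A (lcm B C)"
  unfolding LA_def LB_def LC_def by (auto intro!: dvd_mult_div_cancel intro: dvd_lcmI2)

lemma L_pos: "lcm A (lcm B C) > 0" using ABC by (simp add: lcm_pos_nat)

lemma LABC_pos: "LA > 0" "LB > 0" "LC > 0" "ell > 0"
proof -
  show "LA > 0" using LABC(1) L_pos by (intro gr0I) auto
  show "LB > 0" using LABC(2) L_pos by (intro gr0I) auto
  show "LC > 0" using LABC(3) L_pos by (intro gr0I) auto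
  show "ell > 0" unfolding ell_def using \<open>LA > 0\<close> by simp
qed

lemma admissible_ell: "admissible (ell * N) (0, 0)"
proof -
  have "A * (LA * N) = B * (LB * N)" "B * (LB * N) = C * (LC * N)" using LABC by (metis mult.assoc)+
  then have "int A * int (LA * N) = int B * int (LB * N)" "int B * int (LB * N) = int C * int (LC * N)"
    by (metis of_nat_mult)+
  then have "int A * int (LA * N) - int B * int (LB * N) = 0" "int B * int (LB * N) - int C * int (LC * N) = 0" by linarith+
  moreover have "int (LA * N) + int (LB * N) + int (LC * N) = int (ell * N)" unfolding ell_def by (simp add: algebra_simps)
  ultimately show ?thesis unfolding admissible_def
    by (rule_tac exI[of _ "int (LA * N)"], rule_tac exI[of _ "int (LB * N)"], rule_tac exI[of _ "int (LC * N)"]) (simp only: fst_conv snd_conv)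
qed

lemma admissible_origin: assumes "admissible n (0, 0)" shows "ell dvd n"
proof -
  let ?L = "lcm A (lcm B C)"
  obtain i j k where *: "i + j + k = int n" "int A * i = int B * j" "int B * j = int C * k"
    using assms unfolding admissible_def by auto
  have "int A dvd int A * i" "int B dvd int A * i" "int C dvd int A * i" using * by (auto intro: dvd_triv_left) (metis dvd_triv_left)+
  then have "lcm (int A) (lcm (int B) (int C)) dvd int A * i" by (intro lcm_least)
  then have "int ?L dvd int A * i" by (simp add: lcm_int_int_eq)
  then obtain w where w: "int A * i = int ?L * w" by (auto elim: dvdE)
  have "int A * i = int A * (int LA * w)" using w LABC(1) by (metis mult.assoc of_nat_mult)
  then have i: "i = int LA * w" using ABC by simp
  have "int B * j = int B * (int LB * w)" using w * LABC(2) by (metis mult.assoc of_nat_mult)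
  then have j: "j = int LB * w" using ABC by simp
  have "int C * k = int C * (int LC * w)" using w * LABC(3) by (metis mult.assoc of_nat_mult)
  then have k: "k = int LC * w" using ABC by simp
  have "int n = int ell * w" using *(1) unfolding i j k ell_def by (simp add: algebra_simps)
  then have "int ell dvd int n" by simp
  then show ?thesis by simp
qed

text \<open>Equal steps move along a segment and the quadrant is convex, so it is enough that both
  ends lie in it. The weight of this single path is a lower bound for the sum over all
  paths.\<close>

lemma weighted_count_path:
  assumes "i < 3" "quad z" "quad (shift_steps z m i)"
  shows "pr i ^ m * weighted_count n z \<le> weighted_count (n + m) (shift_steps z m i)"
  using assms(3)
proof (induction m)
  case 0 then show ?case by (simp add: shift_steps_def)
next
  case (Suc m)
  have mid: "0 \<le> f + int m * s" if "0 \<le> f" "0 \<le> f + int (Suc m) * s" for f s :: int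
  proof (cases "s \<ge> 0")
    case False
    then have "f + int (Suc m) * s \<le> f + int m * s" by (simp add: algebra_simps)
    then show ?thesis using that by linarith
  qed (use that in simp)
  have q: "quad (shift_steps z m i)" using assms(2) Suc.prems mid unfolding quad_def shift_steps_def by (simp del: of_nat_Suc)
  define y where "y = shift_steps z (Suc m) i"
  have e: "y - st i = shift_steps z m i" unfolding shift_steps_def y_def by (simp add: prod_eq_iff algebra_simps)
  have "pr i ^ Suc m * weighted_count n z = pr i * (pr i ^ m * weighted_count n z)" by simp
  also have "\<dots> \<le> pr i * weighted_count (n + m) (y - st i)" unfolding e using Suc.IH[OF q] pr_pos[of i] by (intro mult_left_mono) auto
  also have "\<dots> \<le> (\<Sum>j<3. pr j * weighted_count (n + m) (y - st j))"
    using assms(1) pr_pos weighted_count_nonneg by (intro member_le_sum[of i]) (auto simp: less_imp_le)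
  also have "\<dots> = weighted_count (Suc (n + m)) y" using Suc.prems unfolding y_def[symmetric] by (simp add: weighted_count_Suc)
  finally show ?case unfolding y_def by simp
qed

lemma weighted_count_pos_path:
  assumes "i < 3" "quad z" "quad (shift_steps z m i)" "weighted_count n z > 0"
  shows "weighted_count (n + m) (shift_steps z m i) > 0"
  using weighted_count_path[OF assms(1-3), of n] pr_pos[of i] assms(4) by (smt (verit) mult_pos_pos zero_less_power)

text \<open>Admissibility provides integers \<open>a\<close>, \<open>b\<close>, \<open>c\<close> as
  numbers of steps. The bound on \<open>n\<close> forces \<open>c\<close> to be nonnegative, and
  then the signs of the coordinates do the same for \<open>b\<close> and \<open>a\<close>. Taken in
  this order, all steps to the right, then all diagonal ones, then all downward ones, the path stays
  in the quadrant.\<close>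

lemma weighted_count_pos:
  assumes q: "quad z" and k: "admissible n z" and n: "real n \<ge> S0 * (of_int (fst z) + of_int (snd z))"
  shows "weighted_count n z > 0"
proof -
  obtain a b c where *: "a + b + c = int n" "fst z = int A * a - int B * b" "snd z = int B * b - int C * c"
    using k unfolding admissible_def by blast
  have xy: "fst z \<ge> 0" "snd z \<ge> 0" using q unfolding quad_def by auto
  have c: "c \<ge> 0"
  proof (rule ccontr)
    assume "\<not> c \<ge> 0"
    then have c: "real_of_int c < 0" by simp
    let ?x = "real_of_int (fst z)" and ?y = "real_of_int (snd z)"
    have r: "?x = A * real_of_int a - B * real_of_int b" "?y = B * real_of_int b - C * real_of_int c"
      using arg_cong[OF *(2), of real_of_int] arg_cong[OF *(3), of real_of_int] by simp_all
    have b: "real_of_int b = (?y + C * c) / B" unfolding r using ABC by simp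
    have a: "real_of_int a = (?x + ?y + C * c) / A" unfolding r using ABC by simp
    have "real n = real_of_int (a + b + c)" using *(1) by simp
    also have "\<dots> = (?x + ?y) / A + ?y / B + C * c * S0"
      unfolding of_int_add a b S0_def using ABC by (simp add: field_simps)
    also have "\<dots> < (?x + ?y) / A + ?y / B" using c S0_pos ABC by (simp add: mult_pos_neg mult_neg_pos mult_less_0_iff)
    also have "\<dots> \<le> (?x + ?y) / A + (?x + ?y) / B + (?x + ?y) / C" using xy ABC by (simp add: add_divide_distrib)
    also have "\<dots> = S0 * (?x + ?y)" unfolding S0_def by (simp add: algebra_simps add_divide_distrib)
    finally show False using n by simp
  qed
  then have "int B * b \<ge> 0" using *(3) xy by (smt (verit) mult_nonneg_nonneg of_nat_0_le_iff)
  then have b: "b \<ge> 0" using ABC by (simp add: zero_le_mult_iff)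
  then have "int A * a \<ge> 0" using *(2) xy by (smt (verit) mult_nonneg_nonneg of_nat_0_le_iff)
  then have a: "a \<ge> 0" using ABC by (simp add: zero_le_mult_iff)
  define i j k where "i = nat a" "j = nat b" "k = nat c"
  have ijk: "a = int i" "b = int j" "c = int k" unfolding i_j_k_def using a b c by auto
  have nn: "n = i + j + k" using *(1) unfolding ijk by linarith
  define z1 where "z1 = shift_steps (0, 0) i 0"
  define z2 where "z2 = shift_steps z1 j 1"
  have e1: "z1 = (int A * int i, 0)" unfolding z1_def shift_steps_def st_def by simp
  have e2: "z2 = (int A * int i - int B * int j, int B * int j)" unfolding z2_def shift_steps_def e1 st_def by simp
  have e3: "shift_steps z2 k 2 = z" using *(2,3) unfolding shift_steps_def e2 st_def ijk by (simp add: prod_eq_iff)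
  have q1: "quad z1" unfolding e1 quad_def by simp
  have q2: "quad z2" using xy *(2) unfolding e2 quad_def ijk by simp
  have "weighted_count (0 + i) z1 > 0" unfolding z1_def
    by (rule weighted_count_pos_path) (use q1 in \<open>auto simp: weighted_count_0 quad_def z1_def\<close>)
  then have "weighted_count (0 + i + j) z2 > 0" unfolding z2_def by (intro weighted_count_pos_path) (use q1 q2 in \<open>auto simp: z2_def\<close>)
  then have "weighted_count (0 + i + j + k) (shift_steps z2 k 2) > 0" by (intro weighted_count_pos_path) (use q2 q e3 in auto)
  then show ?thesis unfolding e3 nn by simp
qed

lemma TT_Re_bound:
  assumes "quad z"
  defines "\<delta> \<equiv> min c1 c2 * cos (theta / 2)"
  shows "\<delta> > 0" "\<delta> * of_int (fst z) \<le> cmod (TT z)" "\<delta> * of_int (snd z) \<le> cmod (TT z)"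
proof -
  have xy: "of_int (fst z) \<ge> (0::real)" "of_int (snd z) \<ge> (0::real)" using assms(1) unfolding quad_def by auto
  show d: "\<delta> > 0" unfolding \<delta>_def using c_pos cos_half by simp
  have "\<delta> * of_int (fst z) \<le> c1 * cos (theta / 2) * of_int (fst z)" "\<delta> * of_int (snd z) \<le> c2 * cos (theta / 2) * of_int (snd z)"
    unfolding \<delta>_def using xy cos_half by (intro mult_right_mono; simp)+
  moreover have "0 \<le> c1 * cos (theta / 2) * of_int (fst z)" "0 \<le> c2 * cos (theta / 2) * of_int (snd z)"
    using xy c_pos cos_half by auto
  moreover have "Re (TT z) = c1 * cos (theta / 2) * of_int (fst z) + c2 * cos (theta / 2) * of_int (snd z)"
    unfolding TT_cone cone_components by (simp add: algebra_simps)
  ultimately show "\<delta> * of_int (fst z) \<le> cmod (TT z)" "\<delta> * of_int (snd z) \<le> cmod (TT z)"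
    using complex_Re_le_cmod[of "TT z"] by linarith+
qed

lemma finite_TT_ball: "finite {z. quad z \<and> cmod (TT z) \<le> R}"
  and TT_ball_bounded: "\<exists>X. \<forall>z. quad z \<longrightarrow> cmod (TT z) \<le> R \<longrightarrow> of_int (fst z) + of_int (snd z) \<le> real X"
proof -
  define \<delta> where "\<delta> = min c1 c2 * cos (theta / 2)"
  define Y where "Y = nat \<lceil>R / \<delta>\<rceil>"
  have b: "fst z \<in> {0..int Y} \<and> snd z \<in> {0..int Y}" if z: "quad z" "cmod (TT z) \<le> R" for z
  proof -
    note T = TT_Re_bound[OF z(1), folded \<delta>_def]
    have "of_int (fst z) \<le> R / \<delta>" "of_int (snd z) \<le> R / \<delta>" using T z(2) by (simp_all add: pos_le_divide_eq mult.commute)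
    then have "fst z \<le> \<lceil>R / \<delta>\<rceil>" "snd z \<le> \<lceil>R / \<delta>\<rceil>" by linarith+
    moreover have "\<lceil>R / \<delta>\<rceil> \<le> int Y" unfolding Y_def by linarith
    ultimately have "fst z \<le> int Y" "snd z \<le> int Y" by linarith+
    then show ?thesis using z(1) unfolding quad_def by auto
  qed
  then have "{z. quad z \<and> cmod (TT z) \<le> R} \<subseteq> {0..int Y} \<times> {0..int Y}" by (auto simp: mem_Times_iff)
  then show "finite {z. quad z \<and> cmod (TT z) \<le> R}" by (rule finite_subset) simp
  have "of_int (fst z) + of_int (snd z) \<le> real (2 * Y)" if "quad z" "cmod (TT z) \<le> R" for z
  proof -
    have "fst z + snd z \<le> int (2 * Y)" using b[OF that] by simp
    then have "real_of_int (fst z + snd z) \<le> real_of_int (int (2 * Y))" by (simp only: of_int_le_iff)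
    then show ?thesis by simp
  qed
  then show "\<exists>X. \<forall>z. quad z \<longrightarrow> cmod (TT z) \<le> R \<longrightarrow> of_int (fst z) + of_int (snd z) \<le> real X" by blast
qed

section \<open>The lower bound\<close>

lemma Re_powr_le: "Re (\<zeta> powr of_real \<beta>) \<le> cmod \<zeta> powr \<beta>"
proof (cases "\<zeta> = 0")
  case False
  have "cmod \<zeta> powr \<beta> * cos (\<beta> * Im (Ln \<zeta>)) \<le> cmod \<zeta> powr \<beta> * 1" by (intro mult_left_mono) auto
  then show ?thesis unfolding Re_powr_polar[OF False] by simp
qed simp

text \<open>The positive part of the bracket is at most
  \<open>2 * cmod \<zeta> powr \<beta>\<close>. Comparison with the \<kappa>0 term bounds the
  modulus from below, comparison with the \<epsilon> term from above.\<close>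

lemma phi_lower_posD:
  assumes "phi_lower k a \<kappa> \<beta> \<eta> \<epsilon> \<kappa>0 n \<zeta> > 0" and n: "n > 0" and \<eta>: "\<eta> \<le> 1" and \<beta>: "\<beta> > 0" and \<epsilon>: "\<epsilon> > 0"
    and \<kappa>0: "\<kappa>0 \<ge> 2 * Rm powr \<beta>" "\<kappa>0 > 0" and Rm: "Rm > 0"
  shows "\<zeta> \<noteq> 0" "cmod \<zeta> \<ge> Rm" "(cmod \<zeta>)^2 \<le> 2 * n / \<epsilon>"
proof -
  let ?r = "cmod \<zeta>"
  let ?B = "Re (\<zeta> powr of_real \<beta>) + \<eta> * ?r powr \<beta> - \<epsilon> / n * ?r powr (\<beta> + 2) - \<kappa>0 * ?r powr 0"
  have B: "?B > 0"
  proof (rule ccontr)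
    assume "\<not> ?B > 0"
    then have "phi_lower k a \<kappa> \<beta> \<eta> \<epsilon> \<kappa>0 n \<zeta> \<le> 0" unfolding phi_lower_def by (intro mult_nonneg_nonpos) auto
    then show False using assms(1) by simp
  qed
  show z: "\<zeta> \<noteq> 0" using B by auto
  then have r: "?r > 0" by simp
  have "?r powr 0 = 1" using r by simp
  moreover have "?r powr (\<beta> + 2) = ?r powr \<beta> * ?r^2" using r by (simp add: powr_add)
  moreover have "\<eta> * ?r powr \<beta> \<le> 1 * ?r powr \<beta>" using \<eta> by (intro mult_right_mono) auto
  ultimately have B2: "2 * ?r powr \<beta> - \<epsilon> / n * (?r powr \<beta> * ?r^2) - \<kappa>0 > 0"
    using B Re_powr_le[of \<zeta> \<beta>] by simp
  have rp: "?r powr \<beta> > 0" using r by simp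
  have "0 \<le> \<epsilon> / n * (?r powr \<beta> * ?r^2)" using \<epsilon> n by simp
  then have "Rm powr \<beta> < ?r powr \<beta>" using B2 \<kappa>0 by linarith
  then show "?r \<ge> Rm" using \<beta> Rm r by (meson powr_mono2 less_imp_le not_le)
  have "?r powr \<beta> * (2 - \<epsilon> / n * ?r^2) > 0" using B2 \<kappa>0 by (simp add: algebra_simps)
  then have "\<epsilon> / n * ?r^2 < 2" using rp by (simp add: zero_less_mult_iff)
  then show "?r^2 \<le> 2 * n / \<epsilon>" using n \<epsilon> by (simp add: field_simps)
qed

lemma phi_lower_nonpos:
  assumes "\<zeta> \<noteq> 0" "cos (\<beta> * Im (Ln \<zeta>)) \<le> - \<eta>" "n > 0" "\<epsilon> > 0" "\<kappa>0 > 0"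
  shows "phi_lower k a \<kappa> \<beta> \<eta> \<epsilon> \<kappa>0 n \<zeta> \<le> 0"
proof -
  have "cmod \<zeta> powr \<beta> * cos (\<beta> * Im (Ln \<zeta>)) \<le> cmod \<zeta> powr \<beta> * (- \<eta>)" using assms(2) by (intro mult_left_mono) auto
  then have "Re (\<zeta> powr of_real \<beta>) + \<eta> * cmod \<zeta> powr \<beta> \<le> 0" unfolding Re_powr_polar[OF assms(1)] by (simp add: mult.commute)
  moreover have "0 \<le> \<epsilon> / n * cmod \<zeta> powr (\<beta> + 2)" "0 \<le> \<kappa>0 * cmod \<zeta> powr 0" using assms by auto
  ultimately show ?thesis unfolding phi_lower_def by (intro mult_nonneg_nonpos) auto
qed

text \<open>Where the subsolution is not positive there is nothing to prove; elsewhere its one-step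
  inequality applies. A neighbour outside the quadrant has argument between \<open>theta / 2\<close>
  and \<open>theta\<close> in modulus, where \<open>cosb\<close> makes the subsolution nonpositive
  and hence no larger than the count. The induction runs over admissible points only, since the
  counts vanish at all others.\<close>

lemma weighted_count_lower_main:
  assumes \<eta>: "0 < \<eta>" "\<eta> \<le> 1" and \<beta>: "\<beta> > 0" and \<kappa>: "\<kappa> > 0" and g: "g = k * \<kappa>" "1/2 \<le> g" "g \<le> 1" and k: "k > 0"
    and a: "a \<ge> 2 * g * (1 + \<beta>)" and \<epsilon>: "\<epsilon> > 0" "\<epsilon> * ((\<beta> + 2)^2 / 2 + 1)^2 \<le> \<eta> * \<beta>^2 / 2"
    and \<kappa>\<epsilon>: "4 * \<kappa> / \<epsilon> \<le> 1/3" and kg: "k * (2 * g - 1) \<ge> 4 * g / \<epsilon>"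
    and cosb: "\<And>\<phi>. theta / 2 \<le> \<bar>\<phi>\<bar> \<Longrightarrow> \<bar>\<phi>\<bar> \<le> theta \<Longrightarrow> cos (\<beta> * \<phi>) \<le> - \<eta>"
  shows "\<exists>\<kappa>0 c n1 m. c > 0 \<and> \<kappa>0 > 0 \<and> n1 \<ge> (1::nat) \<and> (\<forall>j z. quad z \<longrightarrow> admissible (n1 + m + j) z \<longrightarrow>
     c * phi_lower k a \<kappa> \<beta> \<eta> \<epsilon> \<kappa>0 (real (n1 + j)) (TT z) \<le> weighted_count (n1 + m + j) z)"
proof -
  define d where "d = min (1/4) (theta / 4)"
  have d: "d > 0" "0 \<le> d" "d < 1/2" "2 * d \<le> theta / 2" unfolding d_def using theta by auto
  \<comment> \<open>From modulus \<open>Rm\<close> on a step changes the argument by at most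
    \<open>theta / 2\<close>.\<close>
  define Rm where "Rm = LL / d"
  have Rm: "Rm > 0" "LL = d * Rm" unfolding Rm_def using L d by auto
  obtain \<kappa>0 n0 where \<kappa>0: "\<kappa>0 > 0" "\<kappa>0 \<ge> 2 * Rm powr \<beta>" and step: "\<And>\<zeta> n. n \<ge> n0 \<Longrightarrow> Re \<zeta> > 0 \<Longrightarrow>
    phi_lower k a \<kappa> \<beta> \<eta> \<epsilon> \<kappa>0 (n + 1) \<zeta> > 0 \<Longrightarrow>
    phi_lower k a \<kappa> \<beta> \<eta> \<epsilon> \<kappa>0 (n + 1) \<zeta> \<le> (\<Sum>i<3. pr i * phi_lower k a \<kappa> \<beta> \<eta> \<epsilon> \<kappa>0 n (\<zeta> + ss i))"
    using phi_lower_step[OF \<eta> \<beta> \<kappa> g k a \<epsilon> \<kappa>\<epsilon> kg Rm(1)] by blast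
  let ?phi = "phi_lower k a \<kappa> \<beta> \<eta> \<epsilon> \<kappa>0"
  define n1 where "n1 = nat \<lceil>n0\<rceil> + 1"
  have n1: "real n1 \<ge> n0" "n1 \<ge> 1" unfolding n1_def by linarith+
  have n1p: "real n1 > 0" using n1 by simp
  define F where "F = {z. quad z \<and> cmod (TT z) \<le> sqrt (2 * real n1 / \<epsilon>)}"
  have F: "finite F" unfolding F_def by (rule finite_TT_ball)
  obtain X where X: "\<And>z. z \<in> F \<Longrightarrow> of_int (fst z) + of_int (snd z) \<le> real X"
    using TT_ball_bounded[of "sqrt (2 * real n1 / \<epsilon>)"] unfolding F_def by blast
  \<comment> \<open>A head start for the walk: at time \<open>n1\<close> the subsolution is positive
    only on a finite part of the quadrant, and after \<open>n1 + m\<close> steps all admissible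
    points of that part have positive weight.\<close>
  define m where "m = nat \<lceil>S0 * real X\<rceil>"
  have m: "real m \<ge> S0 * real X" unfolding m_def by linarith
  define F' where "F' = {z\<in>F. admissible (n1 + m) z \<and> ?phi n1 (TT z) > 0}"
  have F': "finite F'" unfolding F'_def using F by simp
  \<comment> \<open>The entry 1 keeps the minimum meaningful when \<open>F'\<close> is
    empty.\<close>
  define c where "c = Min (insert 1 ((\<lambda>z. weighted_count (n1 + m) z / ?phi n1 (TT z)) ` F'))"
  have pos: "weighted_count (n1 + m) z / ?phi n1 (TT z) > 0" if z: "z \<in> F'" for z
  proof -
    have zz: "z \<in> F" "quad z" "admissible (n1 + m) z" "?phi n1 (TT z) > 0" using z unfolding F'_def F_def by auto
    have "S0 * (of_int (fst z) + of_int (snd z)) \<le> S0 * real X" using X[OF zz(1)] S0_pos by (intro mult_left_mono) auto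
    then have "weighted_count (n1 + m) z > 0" using m by (intro weighted_count_pos zz) simp
    then show ?thesis using zz by simp
  qed
  have c: "c > 0" unfolding c_def using F' pos by (subst Min_gr_iff) auto
  have cle: "c \<le> weighted_count (n1 + m) z / ?phi n1 (TT z)" if "z \<in> F'" for z
    unfolding c_def using F' that by (intro Min_le) auto
  have main: "\<forall>z. quad z \<longrightarrow> admissible (n1 + m + j) z \<longrightarrow> c * ?phi (real (n1 + j)) (TT z) \<le> weighted_count (n1 + m + j) z" for j
  proof (induction j)
    case 0
    show ?case
    proof (intro allI impI)
      fix z assume z: "quad z" "admissible (n1 + m + 0) z"
      show "c * ?phi (real (n1 + 0)) (TT z) \<le> weighted_count (n1 + m + 0) z"
      proof (cases "?phi (real n1) (TT z) > 0")
        case True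
        have "(cmod (TT z))^2 \<le> 2 * real n1 / \<epsilon>"
          by (rule phi_lower_posD(3)[OF True n1p \<eta>(2) \<beta> \<epsilon>(1) \<kappa>0(2,1) Rm(1)])
        then have "cmod (TT z) \<le> sqrt (2 * real n1 / \<epsilon>)" by (rule real_le_rsqrt)
        then have "z \<in> F'" unfolding F'_def F_def using z True by simp
        from cle[OF this] show ?thesis using True by (simp add: pos_le_divide_eq)
      next
        case False
        then have "c * ?phi (real n1) (TT z) \<le> 0" using c by (intro mult_nonneg_nonpos) auto
        then show ?thesis using weighted_count_nonneg[of "n1 + m" z] by simp
      qed
    qed
  next
    case (Suc j)
    show ?case
    proof (intro allI impI)
      fix z assume z: "quad z" "admissible (n1 + m + Suc j) z"
      define n where "n = real (n1 + j)"
      have n: "n > 0" "n \<ge> n0" "real (n1 + Suc j) = n + 1" unfolding n_def using n1 by auto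
      define \<zeta> where "\<zeta> = TT z"
      show "c * ?phi (real (n1 + Suc j)) (TT z) \<le> weighted_count (n1 + m + Suc j) z"
      proof (cases "?phi (n + 1) \<zeta> > 0")
        case True
        have n1': "n + 1 > 0" using n by simp
        note D = phi_lower_posD[OF True n1' \<eta>(2) \<beta> \<epsilon>(1) \<kappa>0(2,1) Rm(1)]
        have arg: "\<bar>Im (Ln \<zeta>)\<bar> \<le> theta / 2" "Re \<zeta> > 0"
          unfolding \<zeta>_def TT_cone by (rule cone_arg; use D(1) z(1) in \<open>simp add: \<zeta>_def TT_cone quad_def\<close>)+
        have "?phi (n + 1) \<zeta> \<le> (\<Sum>i<3. pr i * ?phi n (\<zeta> + ss i))" by (rule step[OF n(2) arg(2) True])
        then have "c * ?phi (n + 1) \<zeta> \<le> c * (\<Sum>i<3. pr i * ?phi n (\<zeta> + ss i))" using c by (intro mult_left_mono) auto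
        also have "\<dots> = (\<Sum>i<3. pr i * (c * ?phi n (\<zeta> + ss i)))" by (simp add: sum_distrib_left mult_ac)
        also have "\<dots> \<le> (\<Sum>i<3. pr i * weighted_count (n1 + m + j) (z - st i))"
        proof (intro sum_mono mult_left_mono)
          fix i assume "i \<in> {..<3::nat}"
          then have i: "i < 3" by simp
          have e: "TT (z - st i) = \<zeta> + ss i" unfolding TT_diff \<zeta>_def by simp
          show "c * ?phi n (\<zeta> + ss i) \<le> weighted_count (n1 + m + j) (z - st i)"
          proof (cases "quad (z - st i)")
            case True
            have "admissible (n1 + m + j) (z - st i)" using admissible_step[of "n1 + m + j" z i] z(2) i by simp
            then show ?thesis using Suc.IH True unfolding e[symmetric] n_def by blast
          next
            case False
            have "cmod (ss i) \<le> d * cmod \<zeta>"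
              using sL[OF i] mult_left_mono[OF D(2) d(2)] Rm(2) by linarith
            note P = Im_Ln_perturb[OF arg(2) this d(2,3)]
            have a1: "\<bar>Im (Ln (TT (z - st i)))\<bar> \<le> theta" unfolding e using P(1) arg(1) d(4) by linarith
            have "theta / 2 \<le> \<bar>Im (Ln (TT (z - st i)))\<bar>"
              by (rule outside_arg[OF False _ a1]) (use P(3) e in simp)
            then have "cos (\<beta> * Im (Ln (\<zeta> + ss i))) \<le> - \<eta>" using a1 unfolding e by (intro cosb)
            then have "?phi n (\<zeta> + ss i) \<le> 0" by (intro phi_lower_nonpos P(3) n \<epsilon> \<kappa>0)
            then have "c * ?phi n (\<zeta> + ss i) \<le> 0" using c by (intro mult_nonneg_nonpos) auto
            then show ?thesis using weighted_count_nonneg[of "n1 + m + j" "z - st i"] by linarith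
          qed
        qed (use pr_pos in \<open>simp add: less_imp_le\<close>)
        also have "\<dots> = weighted_count (n1 + m + Suc j) z" using z by (simp add: weighted_count_Suc)
        finally show ?thesis unfolding n(3) \<zeta>_def .
      next
        case False
        then have "c * ?phi (n + 1) \<zeta> \<le> 0" using c by (intro mult_nonneg_nonpos) auto
        then show ?thesis unfolding n(3) \<zeta>_def using weighted_count_nonneg[of "n1 + m + Suc j" z] by linarith
      qed
    qed
  qed
  show ?thesis
    by (rule exI[of _ \<kappa>0], rule exI[of _ c], rule exI[of _ n1], rule exI[of _ m]) (use c \<kappa>0 n1 main in auto)
qed

text \<open>A ray strictly inside the cone has \<open>cos (\<beta> * \<phi>) + \<eta> > 0\<close>,
  so far out on it the leading term beats \<kappa>0; for large \<open>n\<close> the \<epsilon> term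
  is at most 1 and \<open>mm\<close> at most \<open>2 * n\<close>. The coordinates are multiples of
  \<open>B * C\<close> so that the origin can be reached from there by whole numbers of diagonal and
  downward steps.\<close>

lemma phi_lower_star:
  assumes \<beta>: "\<beta> > 0" "\<beta> * (theta / 2) \<le> pi" and \<eta>: "\<eta> = - cos (\<beta> * (theta / 2))"
    and \<kappa>0: "\<kappa>0 > 0" and \<epsilon>: "\<epsilon> > 0" and k: "k > 0" and \<kappa>: "\<kappa> > 0"
  shows "\<exists>w c n2. c > 0 \<and> (\<forall>n\<ge>n2. c * n powr (- a) \<le> phi_lower k a \<kappa> \<beta> \<eta> \<epsilon> \<kappa>0 n (TT (int (B * C * w), int (B * C * w))))"
proof -
  define \<xi> where "\<xi> = cone (real (B * C)) (real (B * C)) 0"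
  have BC: "real (B * C) > 0" using ABC by simp
  have re: "Re \<xi> > 0" unfolding \<xi>_def cone_components using BC c_pos cos_half by (simp add: add_pos_pos)
  then have nz: "\<xi> \<noteq> 0" by auto
  define \<phi> where "\<phi> = Im (Ln \<xi>)"
  have le: "\<bar>\<phi>\<bar> \<le> theta / 2" unfolding \<phi>_def \<xi>_def using nz BC unfolding \<xi>_def by (intro cone_arg) auto
  have "\<phi> \<noteq> theta / 2"
  proof
    assume "\<phi> = theta / 2"
    then have "Im (Ln \<xi>) + - theta / 2 = 0" unfolding \<phi>_def by simp
    then have "Im (\<xi> * cis (- theta / 2)) = 0" unfolding Im_cis_polar[OF nz] by (simp only: sin_zero mult_zero_right)
    then have "real (B * C) * c1 * sin theta = 0" unfolding \<xi>_def cone_components by simp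
    then show False using BC c_pos theta by (simp only: mult_eq_0_iff) auto
  qed
  moreover have "\<phi> \<noteq> - (theta / 2)"
  proof
    assume "\<phi> = - (theta / 2)"
    then have "Im (\<xi> * cis (theta / 2)) = 0" unfolding Im_cis_polar[OF nz] \<phi>_def by simp
    then have "real (B * C) * c2 * sin theta = 0" unfolding \<xi>_def cone_components by simp
    then show False using BC c_pos theta by (simp only: mult_eq_0_iff) auto
  qed
  ultimately have lt: "\<bar>\<phi>\<bar> < theta / 2" using le by linarith
  have "cos (\<beta> * (theta / 2)) < cos (\<beta> * \<bar>\<phi>\<bar>)"
    using \<beta> lt by (intro cos_monotone_0_pi mult_strict_left_mono) auto
  moreover have "cos (\<beta> * \<bar>\<phi>\<bar>) = cos (\<beta> * \<phi>)" by (cases "\<phi> \<ge> 0") auto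
  ultimately have \<delta>: "cos (\<beta> * \<phi>) + \<eta> > 0" unfolding \<eta> by simp
  define \<delta> where "\<delta> = cos (\<beta> * \<phi>) + \<eta>"
  \<comment> \<open>Of the value \<open>\<kappa>0 + 2\<close>, the \<kappa>0 term takes \<kappa>0,
    the \<epsilon> term at most 1, and 1 is left as lower bound for the bracket.\<close>
  define X where "X = (\<kappa>0 + 2) / (\<delta> * cmod \<xi> powr \<beta>)"
  have dx: "\<delta> * cmod \<xi> powr \<beta> > 0" unfolding \<delta>_def using \<delta> nz by simp
  then have X: "X > 0" unfolding X_def using \<kappa>0 by (intro divide_pos_pos) auto
  have gen: "x / y * y = x" if "0 < y" for x y :: real using that by simp
  define w where "w = nat \<lceil>X powr (1 / \<beta>)\<rceil> + 1"
  have w: "real w \<ge> X powr (1 / \<beta>)" "real w > 0" unfolding w_def by linarith+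
  have "X = (X powr (1 / \<beta>)) powr \<beta>" using X \<beta> by (simp add: powr_powr)
  also have "\<dots> \<le> real w powr \<beta>" using w \<beta> by (intro powr_mono2) auto
  finally have wX: "X \<le> real w powr \<beta>" .
  define \<zeta> where "\<zeta> = TT (int (B * C * w), int (B * C * w))"
  have z: "\<zeta> = of_real (real w) * \<xi>" unfolding \<zeta>_def \<xi>_def TT_cone cone_def by (simp add: algebra_simps)
  have z0: "\<zeta> \<noteq> 0" unfolding z using nz w by simp
  have ph: "Im (Ln \<zeta>) = \<phi>"
  proof -
    have "Im (Ln (of_real (real w) * \<xi>)) = Im (complex_of_real (ln (real w)) + Ln \<xi>)"
      by (simp only: Ln_times_of_real[OF w(2) nz] Ln_of_real[OF w(2)])
    then show ?thesis unfolding z \<phi>_def by (simp only: plus_complex.simps Im_complex_of_real add_0)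
  qed
  define r where "r = cmod \<zeta>"
  have r: "r > 0" unfolding r_def using z0 by simp
  have "r powr \<beta> = real w powr \<beta> * cmod \<xi> powr \<beta>" unfolding r_def z norm_mult using w by (simp add: powr_mult)
  then have "r powr \<beta> * \<delta> = real w powr \<beta> * (\<delta> * cmod \<xi> powr \<beta>)" by simp
  also have "\<dots> \<ge> X * (\<delta> * cmod \<xi> powr \<beta>)" using wX dx by (intro mult_right_mono) auto
  also have "X * (\<delta> * cmod \<xi> powr \<beta>) = \<kappa>0 + 2" unfolding X_def by (rule gen[OF dx])
  finally have big: "\<kappa>0 + 2 \<le> r powr \<beta> * \<delta>" .
  define n2 where "n2 = max 1 (max (\<epsilon> * r powr (\<beta> + 2)) (\<kappa> * r^2))"
  have "2 powr (-k) * n powr (- a) \<le> phi_lower k a \<kappa> \<beta> \<eta> \<epsilon> \<kappa>0 n \<zeta>" if n: "n \<ge> n2" for n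
  proof -
    have n': "n \<ge> 1" "\<epsilon> * r powr (\<beta> + 2) \<le> n" "\<kappa> * r^2 \<le> n" using n unfolding n2_def by auto
    let ?B = "Re (\<zeta> powr of_real \<beta>) + \<eta> * cmod \<zeta> powr \<beta> - \<epsilon> / n * cmod \<zeta> powr (\<beta> + 2) - \<kappa>0 * cmod \<zeta> powr 0"
    have "\<epsilon> / n * r powr (\<beta> + 2) \<le> 1" using n' by (simp add: divide_le_eq)
    moreover have "Re (\<zeta> powr of_real \<beta>) + \<eta> * cmod \<zeta> powr \<beta> = r powr \<beta> * \<delta>"
      unfolding Re_powr_polar[OF z0] ph r_def \<delta>_def by (simp add: algebra_simps)
    ultimately have B: "?B \<ge> 1" using big r unfolding r_def[symmetric] by simp
    have "2 powr (-k) * n powr (- a) = n powr (k - a) * (2 * n) powr (- k)"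
    proof -
      have "n powr (k - a) * (2 * n) powr (- k) = 2 powr (- k) * (n powr (k - a) * n powr (- k))" using n' by (simp add: powr_mult)
      also have "n powr (k - a) * n powr (- k) = n powr (- a)" by (simp flip: powr_add)
      finally show ?thesis by simp
    qed
    also have "\<dots> \<le> n powr (k - a) * mm \<kappa> n \<zeta> powr (- k)"
    proof (rule mult_left_mono)
      have "0 \<le> \<kappa> * r^2" using \<kappa> by simp
      then show "(2 * n) powr (- k) \<le> mm \<kappa> n \<zeta> powr (- k)"
        using n' k unfolding mm_def r_def[symmetric] by (intro powr_mono2') auto
    qed simp
    also have "\<dots> \<le> n powr (k - a) * mm \<kappa> n \<zeta> powr (- k) * ?B"
      using mult_left_mono[OF B, of "n powr (k - a) * mm \<kappa> n \<zeta> powr (- k)"] by simp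
    finally show ?thesis unfolding phi_lower_def .
  qed
  then have "(2::real) powr (-k) > 0 \<and> (\<forall>n\<ge>n2. 2 powr (-k) * n powr (- a) \<le> phi_lower k a \<kappa> \<beta> \<eta> \<epsilon> \<kappa>0 n \<zeta>)" by simp
  then show ?thesis unfolding \<zeta>_def by blast
qed

text \<open>The diagonal point \<open>z\<close> is joined to the origin by \<open>C * w\<close>
  diagonal and then \<open>2 * B * w\<close> downward steps, at the cost of the constant factor
  \<open>P\<close>. Admissibility of \<open>z\<close> is obtained by following these steps backwards
  from the origin at time \<open>ell * N\<close>.\<close>

lemma weighted_count_lower_param:
  assumes \<eta>: "0 < \<eta>" "\<eta> \<le> 1" and \<beta>: "\<beta> > 0" and \<kappa>: "\<kappa> > 0" and g: "g = k * \<kappa>" "1/2 \<le> g" "g \<le> 1" and k: "k > 0"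
    and a: "a \<ge> 2 * g * (1 + \<beta>)" "a \<ge> 0" and \<epsilon>: "\<epsilon> > 0" "\<epsilon> * ((\<beta> + 2)^2 / 2 + 1)^2 \<le> \<eta> * \<beta>^2 / 2"
    and \<kappa>\<epsilon>: "4 * \<kappa> / \<epsilon> \<le> 1/3" and kg: "k * (2 * g - 1) \<ge> 4 * g / \<epsilon>"
    and cosb: "\<And>\<phi>. theta / 2 \<le> \<bar>\<phi>\<bar> \<Longrightarrow> \<bar>\<phi>\<bar> \<le> theta \<Longrightarrow> cos (\<beta> * \<phi>) \<le> - \<eta>"
    and \<beta>\<eta>: "\<beta> * (theta / 2) \<le> pi" "\<eta> = - cos (\<beta> * (theta / 2))"
  shows "\<exists>c>0. \<exists>N0. \<forall>N\<ge>N0. c * real N powr (- a) \<le> weighted_count (ell * N) (0, 0)"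
proof -
  obtain \<kappa>0 c n1 m where c: "c > 0" "\<kappa>0 > 0" "n1 \<ge> (1::nat)" and main: "\<And>j z. quad z \<Longrightarrow> admissible (n1 + m + j) z \<Longrightarrow>
     c * phi_lower k a \<kappa> \<beta> \<eta> \<epsilon> \<kappa>0 (real (n1 + j)) (TT z) \<le> weighted_count (n1 + m + j) z"
    using weighted_count_lower_main[OF \<eta> \<beta> \<kappa> g k a(1) \<epsilon> \<kappa>\<epsilon> kg cosb] by blast
  obtain w c' n2 where c': "c' > 0" and star: "\<And>n. n \<ge> n2 \<Longrightarrow>
      c' * n powr (- a) \<le> phi_lower k a \<kappa> \<beta> \<eta> \<epsilon> \<kappa>0 n (TT (int (B * C * w), int (B * C * w)))"
    using phi_lower_star[OF \<beta> \<beta>\<eta> c(2) \<epsilon>(1) k \<kappa>, of a] by blast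
  define z where "z = (int (B * C * w), int (B * C * w))"
  define z2 where "z2 = shift_steps z (C * w) 1"
  have z2: "z2 = (0, 2 * int (B * C * w))" unfolding z2_def shift_steps_def z_def st_def by simp
  have z3: "shift_steps z2 (2 * B * w) 2 = (0, 0)" unfolding shift_steps_def z2 st_def by simp
  have q: "quad z" "quad z2" unfolding z2 z_def quad_def by auto
  define s where "s = C * w + 2 * B * w"
  define P where "P = pr 1 ^ (C * w) * pr 2 ^ (2 * B * w)"
  have P: "P > 0" unfolding P_def using pr_pos[of 1] pr_pos[of 2] by simp
  define c3 where "c3 = P * (c * (c' * real ell powr (- a)))"
  have c3: "c3 > 0" unfolding c3_def using P c c' LABC_pos by simp
  have "c3 * real N powr (- a) \<le> weighted_count (ell * N) (0, 0)" if N: "N \<ge> n1 + m + s + nat \<lceil>n2\<rceil>" for N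
  proof -
    have eN: "ell * N \<ge> N" using LABC_pos by simp
    define n where "n = ell * N - s"
    define j where "j = n - n1 - m"
    have n: "n = n1 + m + j" "ell * N = n + C * w + 2 * B * w" unfolding j_def n_def s_def using N eN unfolding s_def by linarith+
    have j: "real (n1 + j) \<ge> n2" "n1 + j \<le> ell * N"
    proof -
      have "n1 + j \<ge> nat \<lceil>n2\<rceil>" using n N eN unfolding s_def by linarith
      then show "real (n1 + j) \<ge> n2" by linarith
      show "n1 + j \<le> ell * N" using n by linarith
    qed
    have "admissible (n + C * w + 2 * B * w) (shift_steps z2 (2 * B * w) 2)" unfolding z3 n(2)[symmetric] by (rule admissible_ell)
    then have "admissible (n + C * w) (shift_steps z (C * w) 1)" unfolding z2_def[symmetric] by (rule admissible_sub) simp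
    then have kl: "admissible n z" by (rule admissible_sub) simp
    have p1: "pr 1 ^ (C * w) * weighted_count n z \<le> weighted_count (n + C * w) z2" unfolding z2_def by (rule weighted_count_path) (use q in \<open>auto simp: z2_def\<close>)
    have p2: "pr 2 ^ (2 * B * w) * weighted_count (n + C * w) z2 \<le> weighted_count (n + C * w + 2 * B * w) (0, 0)"
      unfolding z3[symmetric] by (rule weighted_count_path) (use q z3 in \<open>auto simp: quad_def\<close>)
    have "real ell powr (- a) * real N powr (- a) = real (ell * N) powr (- a)" by (simp add: powr_mult)
    also have "\<dots> \<le> real (n1 + j) powr (- a)"
    proof (rule powr_mono2')
      show "real (n1 + j) \<le> real (ell * N)" using j(2) by (simp only: of_nat_le_iff)
    qed (use a c in auto)
    finally have "c' * (real ell powr (- a) * real N powr (- a)) \<le> c' * real (n1 + j) powr (- a)" using c' by (intro mult_left_mono) auto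
    also have "\<dots> \<le> phi_lower k a \<kappa> \<beta> \<eta> \<epsilon> \<kappa>0 (real (n1 + j)) (TT z)" unfolding z_def by (rule star[OF j(1)])
    finally have "c * (c' * (real ell powr (- a) * real N powr (- a))) \<le> c * phi_lower k a \<kappa> \<beta> \<eta> \<epsilon> \<kappa>0 (real (n1 + j)) (TT z)"
      using c by (intro mult_left_mono) auto
    also have "\<dots> \<le> weighted_count n z" using main[OF q(1), of j] kl unfolding n(1) by simp
    finally have "P * (c * (c' * (real ell powr (- a) * real N powr (- a)))) \<le> P * weighted_count n z" using P by (intro mult_left_mono) auto
    also have "P * weighted_count n z = pr 2 ^ (2 * B * w) * (pr 1 ^ (C * w) * weighted_count n z)" unfolding P_def by (simp add: mult_ac)
    also have "\<dots> \<le> pr 2 ^ (2 * B * w) * weighted_count (n + C * w) z2" using p1 pr_pos[of 2] by (intro mult_left_mono) auto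
    also have "\<dots> \<le> weighted_count (ell * N) (0, 0)" unfolding n(2) by (rule p2)
    finally show ?thesis unfolding c3_def by (simp add: mult_ac)
  qed
  then show ?thesis using c3 by blast
qed

text \<open>Here \<open>g\<close> and \<beta> are raised by \<open>t\<close>. The required exponent
  \<open>2 * g * (1 + \<beta>)\<close> then exceeds \<open>1 + alpha\<close> by at most
  \<open>t * (4 + 2 * alpha)\<close>, which is at most half of \<open>e\<close>.\<close>

lemma weighted_count_lower:
  assumes "e > 0"
  shows "\<exists>c>0. \<exists>N0. \<forall>N\<ge>N0. c * real N powr (- (1 + alpha) - e) \<le> weighted_count (ell * N) (0, 0)"
proof -
  define t where "t = min e 1 / (2 * (4 + 2 * alpha))"
  have e: "min e 1 > 0" "min e 1 \<le> e" "min e 1 \<le> 1" using assms by auto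
  have al: "4 + 2 * alpha > 8" using alpha_gt by simp
  have t: "t > 0" unfolding t_def using e al by simp
  have gen: "x / (2 * y) * y = x / 2" if "y \<noteq> 0" for x y :: real using that by simp
  have tt: "t * (4 + 2 * alpha) = min e 1 / 2" unfolding t_def by (rule gen) (use al in linarith)
  have "t * 8 \<le> t * (4 + 2 * alpha)" using t al by (intro mult_left_mono) auto
  then have t8: "t \<le> 1 / 16" using tt e by linarith
  define \<beta> where "\<beta> = alpha + t"
  define g where "g = 1 / 2 + t"
  define \<eta> where "\<eta> = - cos (\<beta> * (theta / 2))"
  have at: "alpha * theta = pi" unfolding alpha_def using theta by simp
  have tth: "0 < t * theta" "t * theta \<le> theta / 16" using t t8 theta mult_right_mono[OF t8, of theta] by auto
  have bt: "\<beta> * (theta / 2) = pi / 2 + t * theta / 2" unfolding \<beta>_def using at by (simp add: algebra_simps)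
  have btp: "\<beta> * (theta / 2) \<le> pi" "pi / 2 < \<beta> * (theta / 2)" unfolding bt using tth theta by linarith+
  have "cos (\<beta> * (theta / 2)) < cos (pi / 2)" using btp by (intro cos_monotone_0_pi) auto
  then have \<eta>: "0 < \<eta>" "\<eta> \<le> 1" unfolding \<eta>_def using cos_ge_minus_one[of "\<beta> * (theta / 2)"] by simp_all
  have \<beta>: "\<beta> > 0" unfolding \<beta>_def using alpha_gt t by simp
  \<comment> \<open>\<open>\<beta> * \<bar>\<phi>\<bar>\<close> runs from slightly above
    \<open>pi / 2\<close> to slightly above \<open>pi\<close>. The cosine decreases up to
    \<open>pi\<close>; beyond it, reflection at \<open>pi\<close> leads back into the range already
    treated.\<close>
  have cosb: "cos (\<beta> * \<phi>) \<le> - \<eta>" if \<phi>: "theta / 2 \<le> \<bar>\<phi>\<bar>" "\<bar>\<phi>\<bar> \<le> theta" for \<phi>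
  proof -
    have e1: "cos (\<beta> * \<phi>) = cos (\<beta> * \<bar>\<phi>\<bar>)" by (cases "\<phi> \<ge> 0") auto
    have lo: "\<beta> * (theta / 2) \<le> \<beta> * \<bar>\<phi>\<bar>" using \<phi> \<beta> by (intro mult_left_mono) auto
    have hi: "\<beta> * \<bar>\<phi>\<bar> \<le> \<beta> * theta" using \<phi> \<beta> by (intro mult_left_mono) auto
    have "cos (\<beta> * \<bar>\<phi>\<bar>) \<le> cos (\<beta> * (theta / 2))"
    proof (cases "\<beta> * \<bar>\<phi>\<bar> \<le> pi")
      case True
      then show ?thesis using lo btp by (intro cos_monotone_0_pi_le) auto
    next
      case False
      have "cos (2 * pi - \<beta> * \<bar>\<phi>\<bar>) \<le> cos (\<beta> * (theta / 2))"
        using False hi bt btp theta tth by (intro cos_monotone_0_pi_le) auto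
      then show ?thesis by (simp add: cos_diff)
    qed
    then show ?thesis unfolding e1 \<eta>_def by simp
  qed
  define G where "G = (\<beta> + 2)^2 / 2 + 1"
  have G: "G > 0" unfolding G_def by (simp add: add_nonneg_pos)
  define \<epsilon> where "\<epsilon> = \<eta> * \<beta>^2 / 2 / G^2"
  have \<epsilon>: "\<epsilon> > 0" "\<epsilon> * G^2 \<le> \<eta> * \<beta>^2 / 2" unfolding \<epsilon>_def using \<eta> \<beta> G by simp_all
  \<comment> \<open>As \<open>2 * g - 1 = 2 * t\<close>, the first summand meets the condition on
    \<open>k * (2 * g - 1)\<close>; the second makes \<open>\<kappa> = g / k\<close> small against
    \<epsilon>.\<close>
  define k where "k = 4 * g / (2 * t * \<epsilon>) + 12 * g / \<epsilon>"
  have g: "1/2 \<le> g" "g \<le> 1" "g > 0" unfolding g_def using t t8 by auto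
  have k1: "4 * g / (2 * t * \<epsilon>) > 0" "12 * g / \<epsilon> > 0" using g t \<epsilon> by auto
  have k: "k > 0" unfolding k_def using k1 by linarith
  define \<kappa> where "\<kappa> = g / k"
  have \<kappa>: "\<kappa> > 0" unfolding \<kappa>_def using g k by simp
  have g\<kappa>: "g = k * \<kappa>" unfolding \<kappa>_def using k by simp
  have "k \<ge> 12 * g / \<epsilon>" unfolding k_def using k1 by linarith
  then have "k * \<epsilon> \<ge> 12 * g" using \<epsilon> by (simp add: pos_divide_le_eq)
  then have \<kappa>\<epsilon>: "4 * \<kappa> / \<epsilon> \<le> 1/3" unfolding \<kappa>_def using k \<epsilon> by (simp add: field_simps)
  have "2 * t * k \<ge> 2 * t * (4 * g / (2 * t * \<epsilon>))" using t k1 unfolding k_def by (intro mult_left_mono) auto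
  moreover have "2 * t * (4 * g / (2 * t * \<epsilon>)) = 4 * g / \<epsilon>" using t by simp
  ultimately have kg: "k * (2 * g - 1) \<ge> 4 * g / \<epsilon>" unfolding g_def by (simp add: algebra_simps)
  define a where "a = 1 + alpha + e"
  have "2 * g * (1 + \<beta>) = 1 + alpha + t * (3 + 2 * alpha) + 2 * (t * t)" unfolding g_def \<beta>_def by (simp add: algebra_simps)
  moreover have "2 * (t * t) \<le> t" using t t8 by simp
  moreover have "t * (3 + 2 * alpha) + t = t * (4 + 2 * alpha)" by (simp add: algebra_simps)
  ultimately have a: "a \<ge> 2 * g * (1 + \<beta>)" unfolding a_def using tt e by linarith
  have a0: "a \<ge> 0" unfolding a_def using alpha_gt assms by simp
  have "\<exists>c>0. \<exists>N0. \<forall>N\<ge>N0. c * real N powr (- a) \<le> weighted_count (ell * N) (0, 0)"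
    by (rule weighted_count_lower_param[OF \<eta> \<beta> \<kappa> g\<kappa> g(1,2) k a a0 \<epsilon>(1) \<epsilon>(2)[unfolded G_def] \<kappa>\<epsilon> kg cosb btp(1) \<eta>_def])
  moreover have "- a = - (1 + alpha) - e" unfolding a_def by simp
  ultimately show ?thesis by simp
qed

end

section \<open>Conclusion\<close>

lemma ev_pcompose: "ev (p \<circ>\<^sub>p q) s = ev p (ev q s)"
  by (induction p) (simp_all add: pcompose_pCons)

lemma algebraic_ev:
  assumes "algebraic (s :: complex)"
  obtains p where "p \<noteq> 0" "ev p s = 0"
proof -
  obtain q :: "complex poly" where q: "\<forall>i. coeff q i \<in> \<rat>" "q \<noteq> 0" "poly q s = 0"
    using assms unfolding algebraic_altdef by blast
  then have "\<forall>i. \<exists>r. coeff q i = of_rat r" by (auto simp: Rats_def)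
  then obtain r where r: "\<And>i. coeff q i = of_rat (r i)" by metis
  define p where "p = Abs_poly r"
  have r0: "r i = 0" if "coeff q i = 0" for i using r[of i] that by simp
  have c: "coeff p i = r i" for i unfolding p_def
    by (subst coeff_Abs_poly[of "degree q"]) (auto intro!: r0 coeff_eq_0)
  have m: "map_poly of_rat p = q" by (intro poly_eqI) (simp add: coeff_map_poly c r)
  show thesis by (rule that[of p]) (use q m in \<open>auto simp: ev_def\<close>)
qed

lemma of_real_of_rat: "complex_of_real (of_rat r) = of_rat r"
  by (cases r) (simp add: of_rat_rat)

lemma algebraic_diffD:
  assumes "algebraic (of_rat m - s :: complex)" shows "algebraic s"
proof -
  obtain p where p: "p \<noteq> 0" "ev p (of_rat m - s) = 0" using algebraic_ev[OF assms] .
  show ?thesis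
  proof (rule ev_root_algebraic)
    show "p \<circ>\<^sub>p [:m, -1:] \<noteq> 0" using p by (simp add: pcompose_eq_0_iff)
    show "ev (p \<circ>\<^sub>p [:m, -1:]) s = 0" using p by (simp add: ev_pcompose of_rat_minus)
  qed
qed

lemma algebraic_inverse_complex:
  fixes s :: complex
  assumes "algebraic s" "s \<noteq> 0" shows "algebraic (inverse s)"
proof -
  obtain q :: "complex poly" where q: "\<forall>i. coeff q i \<in> \<int>" "q \<noteq> 0" "poly q s = 0"
    using assms unfolding algebraic_def by blast
  have "poly (reflect_poly q) (inverse s) = 0" using q assms(2) by (simp add: poly_reflect_poly_nz)
  moreover have "reflect_poly q \<noteq> 0" using q by simp
  moreover have "coeff (reflect_poly q) i \<in> \<int>" for i using q by (simp add: coeff_reflect_poly)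
  ultimately show ?thesis unfolding algebraic_def by blast
qed

text \<open>Chebyshev polynomials scaled to send \<open>2 * cos t\<close> to
  \<open>2 * cos (n * t)\<close>; in this scaling they have integer coefficients and are monic for
  positive \<open>n\<close>.\<close>

fun cheb :: "nat \<Rightarrow> int poly" where
  "cheb 0 = [:2:]"
| "cheb (Suc 0) = [:0, 1:]"
| "cheb (Suc (Suc n)) = pCons 0 (cheb (Suc n)) - cheb n"

lemma cheb_coeff: "(\<forall>k>n. coeff (cheb n) k = 0) \<and> (n > 0 \<longrightarrow> coeff (cheb n) n = 1)"
proof (induction n rule: cheb.induct)
  case (3 n)
  then show ?case by (auto simp: coeff_pCons split: nat.splits)
qed (auto simp: coeff_pCons split: nat.splits)

lemma cheb_eval: "poly (map_poly of_int (cheb n)) (2 * cos t) = 2 * cos (real n * t)"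
proof (induction n rule: cheb.induct)
  case (3 n)
  have m: "map_poly real_of_int (pCons 0 (cheb (Suc n)) - cheb n) = pCons 0 (map_poly of_int (cheb (Suc n))) - map_poly of_int (cheb n)"
    by (intro poly_eqI) (simp add: coeff_map_poly coeff_pCons split: nat.splits)
  have "2 * cos t * cos (real (Suc n) * t) = cos (real (Suc n) * t + t) + cos (real (Suc n) * t - t)"
    by (simp add: cos_add cos_diff)
  also have "real (Suc n) * t + t = real (Suc (Suc n)) * t" by (simp add: algebra_simps)
  also have "real (Suc n) * t - t = real n * t" by (simp add: algebra_simps)
  finally show ?case using 3 by (simp add: m)
qed (simp_all add: map_poly_pCons)

text \<open>\<open>2 * cos t\<close> is a root of the monic integer polynomial
  \<open>cheb n - [:2:]\<close>, hence an algebraic integer, and rational algebraic integers are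
  integers.\<close>

lemma two_cos_rational:
  assumes n: "n > 0" and c: "cos (real n * t) = 1" and r: "2 * cos t \<in> \<rat>"
  shows "2 * cos t \<in> \<int>"
proof -
  define q where "q = cheb n - [:2:]"
  have d: "coeff q k = (if k = n then 1 else 0)" if "k \<ge> n" for k
    using cheb_coeff[of n] that n unfolding q_def by (auto simp: coeff_pCons split: nat.splits)
  have "degree q = n"
    by (intro antisym degree_le le_degree) (use d in auto)
  then have l: "lead_coeff q = 1" using d by simp
  have m: "map_poly real_of_int q = map_poly of_int (cheb n) - [:2:]" unfolding q_def
    by (intro poly_eqI) (simp add: coeff_map_poly coeff_pCons split: nat.splits)
  have "poly (map_poly of_int q) (2 * cos t) = 0" unfolding m using c by (simp add: cheb_eval)
  then have "algebraic_int (2 * cos t)" using l unfolding algebraic_int_altdef_ipoly by blast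
  then show ?thesis using r by (rule rational_algebraic_int_is_int)
qed

context tandem
begin

lemma cth_squared: "cth ^ 2 = real B ^ 2 / ((real A + real B) * (real B + real C))"
  unfolding cth_def using ABC by (simp add: power_divide)

text \<open>If \<open>theta / pi\<close> were rational,
  \<open>2 * cos (2 * theta) = 4 * cth^2 - 2\<close> would be an integer. As \<open>cth\<close> lies
  strictly between 0 and 1, it would be -1, 0 or 1, which are the three excluded cases. On the other
  side, \<open>cis (2 * theta)\<close> is a root of the quadratic polynomial with constant and
  leading coefficient 1 and middle coefficient \<open>- 2 * cos (2 * theta)\<close>, a rational
  number.\<close>

lemma angle_transcendental:
  assumes h: "real B ^ 2 / ((real A + real B) * (real B + real C)) \<notin> {1/4, 1/2, 3/4}"
    and alg: "algebraic (complex_of_real (theta / pi))"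
  shows False
proof (rule gelfond_schneider_exp[OF alg])
  define q :: rat where "q = 2 * (of_nat B ^ 2 / ((of_nat A + of_nat B) * (of_nat B + of_nat C))) - 1"
  have q: "of_rat q = cos (2 * theta)"
    unfolding q_def cos_double_cos theta(3) cth_squared
    by (simp add: of_rat_diff of_rat_mult of_rat_divide of_rat_add of_rat_power)
  show "complex_of_real (theta / pi) \<notin> \<rat>"
  proof
    assume "complex_of_real (theta / pi) \<in> \<rat>"
    then obtain r where "complex_of_real (theta / pi) = of_rat r" by (auto simp: Rats_def)
    then have "complex_of_real (theta / pi) = complex_of_real (of_rat r)" by (simp only: of_real_of_rat)
    then have "theta / pi = of_rat r" by (simp only: of_real_eq_iff)
    then have "theta / pi \<in> \<rat>" by simp
    then obtain a b where ab: "b \<noteq> (0::nat)" "\<bar>theta / pi\<bar> = real a / real b"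
      by (rule Rats_abs_nat_div_natE)
    then have "theta * b = pi * a" using theta by (simp add: field_simps)
    then have "real b * (2 * theta) = 2 * pi * real a" by (simp add: algebra_simps)
    then have "cos (real b * (2 * theta)) = 1" by (simp add: cos_one_2pi)
    moreover have "2 * cos (2 * theta) \<in> \<rat>" unfolding q[symmetric] by simp
    ultimately have "2 * cos (2 * theta) \<in> \<int>" using ab by (intro two_cos_rational) auto
    then obtain m where "2 * cos (2 * theta) = of_int m" by (auto simp: Ints_def)
    then have m: "4 * cth ^ 2 - 2 = of_int m" unfolding cos_double_cos theta(3) by simp
    have "0 < cth ^ 2" "cth ^ 2 < 1" using cth by (auto simp: power_less_one_iff)
    then have "- 2 < real_of_int m" "real_of_int m < 2" unfolding m[symmetric] by auto
    then have "m = -1 \<or> m = 0 \<or> m = 1" by linarith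
    then have "cth ^ 2 \<in> {1/4, 1/2, 3/4}" using m by auto
    then show False using h unfolding cth_squared by simp
  qed
  have e: "2 * of_real pi * \<i> * complex_of_real (theta / pi) = \<i> * of_real (2 * theta)" by simp
  show "algebraic (exp (2 * of_real pi * \<i> * complex_of_real (theta / pi)))"
  proof (rule ev_root_algebraic[of "[:1, - 2 * q, 1:]"])
    have "complex_of_rat q = complex_of_real (of_rat q)" by (simp only: of_real_of_rat)
    then have qc: "complex_of_rat q = of_real (cos (2 * theta))" unfolding q .
    have "ev [:1, - 2 * q, 1:] (exp (2 * of_real pi * \<i> * complex_of_real (theta / pi)))
      = 1 - 2 * of_real (cos (2 * theta)) * cis (2 * theta) + (cis (2 * theta))^2"
      unfolding e cis_conv_exp[symmetric]
      by (simp add: of_rat_mult of_rat_minus qc algebra_simps power2_eq_square)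
    also have "\<dots> = 0"
      using sin_cos_squared_add[of "2 * theta"]
      by (simp add: complex_eq_iff power2_eq_square algebra_simps)
    finally show "ev [:1, - 2 * q, 1:] (exp (2 * of_real pi * \<i> * complex_of_real (theta / pi))) = 0" .
  qed simp
qed

end

section \<open>From differential equations to recurrences over the rationals\<close>

definition const_part :: "complex fps fps fps \<Rightarrow> complex fps" where
  "const_part f = Abs_fps (\<lambda>n. fps_nth (fps_nth (fps_nth f n) 0) 0)"

lemma const_part_deriv: "const_part ((deriv_t ^^ k) f) = (fps_deriv ^^ k) (const_part f)"
proof (induction k arbitrary: f)
  case (Suc k)
  have of_nat_nth: "fps_nth (fps_nth (of_nat c * g) 0) 0 = of_nat c * fps_nth (fps_nth g 0) 0" for c and g :: "complex fps fps"
    by (induction c) (simp_all add: distrib_right)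
  have "const_part (deriv_t f) = fps_deriv (const_part f)" for f
    unfolding const_part_def deriv_t_def by (rule fps_ext) (simp add: of_nat_nth del: of_nat_Suc of_nat_add)
  then show ?case using Suc[of "deriv_t f"] by (simp add: funpow_swap1)
qed simp

text \<open>
  Only the lowest power of \<open>y\<close>, and then of \<open>x\<close>, in the equation survives \<open>x = y = 0\<close>.
\<close>

lemma D_finite_excursion:
  assumes "D_finite3 (tandem_gf A B C :: complex fps fps fps)"
  shows "D_finite (excursion_gf A B C :: complex fps)"
proof -
  let ?Q = "tandem_gf A B C :: complex fps fps fps"
  obtain r p where nz: "\<exists>k\<le>r. p k \<noteq> 0" and eq: "(\<Sum>k\<le>r. fps_of_poly3 (p k) * (deriv_t ^^ k) ?Q) = 0"
    using assms unfolding D_finite3_def satisfies_lde_def by blast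
  \<comment> \<open>The least exponent is taken over all coefficients of the equation together, so
    that the same monomial is extracted from every summand and at least one coefficient stays
    nonzero.\<close>
  let ?Y = "\<lambda>j. \<exists>k\<le>r. \<exists>n. coeff (coeff (p k) n) j \<noteq> 0"
  have "\<exists>j. ?Y j" using nz by (metis leading_coeff_0_iff)
  define j0 where "j0 = (LEAST j. ?Y j)"
  have j0: "?Y j0" unfolding j0_def by (rule LeastI_ex) fact
  have jl: "coeff (coeff (p k) n) j = 0" if "k \<le> r" "j < j0" for k n j
    using not_less_Least[of j ?Y] that unfolding j0_def by blast
  let ?X = "\<lambda>i. \<exists>k\<le>r. \<exists>n. coeff (coeff (coeff (p k) n) j0) i \<noteq> 0"
  have "\<exists>i. ?X i" using j0 by (metis leading_coeff_0_iff)
  define i0 where "i0 = (LEAST i. ?X i)"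
  have i0: "?X i0" unfolding i0_def by (rule LeastI_ex) fact
  have il: "coeff (coeff (coeff (p k) n) j0) i = 0" if "k \<le> r" "i < i0" for k n i
    using not_less_Least[of i ?X] that unfolding i0_def by blast
  define P where "P k = map_poly (\<lambda>c. coeff (coeff c j0) i0) (p k)" for k
  have cP: "coeff (P k) n = coeff (coeff (coeff (p k) n) j0) i0" for k n
    unfolding P_def by (simp add: coeff_map_poly)
  have Pnz: "\<exists>k\<le>r. P k \<noteq> 0" using i0 cP by (metis coeff_0)
  have low: "fps_nth (f * g) m = fps_nth f m * fps_nth g 0" if "\<And>j. j < m \<Longrightarrow> fps_nth f j = 0" for f g :: "'b::comm_ring_1 fps" and m
  proof -
    have "fps_nth (f * g) m = (\<Sum>j=0..m. fps_nth f j * fps_nth g (m - j))" by (rule fps_mult_nth)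
    also have "\<dots> = (\<Sum>j\<in>{m}. fps_nth f j * fps_nth g (m - j))"
      using that by (intro sum.mono_neutral_right) auto
    finally show ?thesis by simp
  qed
  have summand: "fps_nth (fps_nth (fps_nth (fps_of_poly3 (p k) * F) n) j0) i0 = fps_nth (fps_of_poly (P k) * const_part F) n"
    if "k \<le> r" for k n and F :: "complex fps fps fps"
  proof -
    have "fps_nth (fps_nth (fps_nth (fps_of_poly3 (p k)) m * fps_nth F l) j0) i0
      = coeff (P k) m * fps_nth (const_part F) l" for m l
      by (subst low, simp add: fps_of_poly3_def jl[OF that], rule fps_ext, simp add: jl[OF that])
        (subst low, auto simp: fps_of_poly3_def il[OF that] cP const_part_def)
    then show ?thesis by (simp add: fps_mult_nth fps_sum_nth)
  qed
  have E: "const_part ?Q = excursion_gf A B C" unfolding const_part_def excursion_gf_def by simp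
  have "(\<Sum>k\<le>r. fps_of_poly (P k) * (fps_deriv ^^ k) (excursion_gf A B C)) = 0"
  proof (rule fps_ext)
    fix n
    have "fps_nth (\<Sum>k\<le>r. fps_of_poly (P k) * (fps_deriv ^^ k) (excursion_gf A B C)) n
      = (\<Sum>k\<le>r. fps_nth (fps_nth (fps_nth (fps_of_poly3 (p k) * (deriv_t ^^ k) ?Q) n) j0) i0)"
      unfolding fps_sum_nth by (intro sum.cong refl) (simp add: summand const_part_deriv E)
    also have "\<dots> = fps_nth (fps_nth (fps_nth (\<Sum>k\<le>r. fps_of_poly3 (p k) * (deriv_t ^^ k) ?Q) n) j0) i0"
      by (simp add: fps_sum_nth)
    finally show "fps_nth (\<Sum>k\<le>r. fps_of_poly (P k) * (fps_deriv ^^ k) (excursion_gf A B C)) n = fps_nth 0 n"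
      unfolding eq by simp
  qed
  then show ?thesis unfolding D_finite_def satisfies_lde_def using Pnz by blast
qed

text \<open>With backward shifts and only for \<open>s \<ge> D\<close>, so that \<open>s - d\<close>
  never truncates.\<close>

definition P_recursive :: "(nat \<Rightarrow> rat) \<Rightarrow> bool" where
  "P_recursive a \<longleftrightarrow> (\<exists>D P. (\<exists>d\<le>D. P d \<noteq> 0) \<and> (\<forall>s\<ge>D. (\<Sum>d\<le>D. poly (P d) (of_nat s) * a (s - d)) = 0))"

lemma P_recursiveI:
  assumes "\<exists>d\<le>D. P d \<noteq> 0" "\<forall>s\<ge>D. (\<Sum>d\<le>D. poly (P d) (of_nat s) * a (s - d)) = 0"
  shows "P_recursive a"
  unfolding P_recursive_def by (rule exI[of _ D], rule exI[of _ P], rule conjI[OF assms])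

text \<open>
  Applied to the coefficients of a differential equation over the complex numbers, such a functional
  leaves a recurrence over the rationals, because the excursion numbers are rational.
\<close>

lemma rat_functional:
  assumes "c \<noteq> (0::complex)"
  obtains h :: "complex \<Rightarrow> rat" where "h c \<noteq> 0" "\<And>(f :: 'a \<Rightarrow> rat) g S. finite S \<Longrightarrow> h (\<Sum>i\<in>S. of_rat (f i) * g i) = (\<Sum>i\<in>S. f i * h (g i))"
proof -
  \<comment> \<open>The functional will be the coordinate of \<open>c\<close> with respect to a
    rational basis of the complex numbers that contains \<open>c\<close>.\<close>
  define b where "b = ratv.extend_basis {c}"
  have i1: "ratv.independent {c}" using assms by simp
  have b: "{c} \<subseteq> b" "ratv.independent b" "ratv.span b = UNIV" unfolding b_def
    using ratv.extend_basis_superset[OF i1] ratv.independent_extend_basis[OF i1] ratv.span_extend_basis[OF i1] by auto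
  define h where "h v = ratv.representation b v c" for v
  have add: "h (u + v) = h u + h v" for u v
    unfolding h_def using ratv.representation_add[OF b(2), of u v] b(3) by (simp add: add.commute)
  have scale: "h (of_rat q * v) = q * h v" for q v
    unfolding h_def using ratv.representation_scale[OF b(2), of v q] b(3) by simp
  have h0: "h 0 = 0" using add[of 0 0] by simp
  have "h c = 1" unfolding h_def using ratv.representation_basis[OF b(2), of c] b(1) by simp
  then have "h c \<noteq> 0" by simp
  moreover have "h (\<Sum>i\<in>S. of_rat (f i) * g i) = (\<Sum>i\<in>S. f i * h (g i))" if "finite S" for f :: "'a \<Rightarrow> rat" and g S
    using that by induction (simp_all add: h0 add scale)
  ultimately show thesis by (rule that)
qed

lemma fps_deriv_funpow_nth:
  fixes f :: "'a::comm_ring_1 fps"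
  shows "fps_nth ((fps_deriv ^^ k) f) m = pochhammer (of_nat m + 1) k * fps_nth f (m + k)"
proof (induction k arbitrary: m)
  case (Suc k)
  have "fps_nth ((fps_deriv ^^ Suc k) f) m = of_nat (Suc m) * fps_nth ((fps_deriv ^^ k) f) (Suc m)" by simp
  also have "\<dots> = (of_nat m + 1) * pochhammer (of_nat m + 1 + 1) k * fps_nth f (m + Suc k)"
    unfolding Suc by (simp add: add_ac)
  finally show ?case by (simp add: pochhammer_rec)
qed simp

definition poch_poly :: "nat \<Rightarrow> rat poly" where "poch_poly k = (\<Prod>i<k. [:of_nat i, 1:])"

lemma poch_poly: "poly (poch_poly k) x = pochhammer x k" "degree (poch_poly k) = k" "lead_coeff (poch_poly k) = 1"
proof -
  show "poly (poch_poly k) x = pochhammer x k"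
    by (simp add: poch_poly_def pochhammer_prod poly_prod atLeast0LessThan add.commute)
  show "degree (poch_poly k) = k" unfolding poch_poly_def by (subst degree_prod_eq_sum_degree) auto
  show "lead_coeff (poch_poly k) = 1" unfolding poch_poly_def lead_coeff_prod by simp
qed

lemma D_finite_P_recursive:
  assumes "D_finite (Abs_fps (\<lambda>n. of_nat (e n)) :: complex fps)"
  shows "P_recursive (\<lambda>n. of_nat (e n))"
proof -
  let ?E = "Abs_fps (\<lambda>n. of_nat (e n)) :: complex fps"
  obtain r p where nz: "\<exists>k\<le>r. p k \<noteq> 0" and eq: "(\<Sum>k\<le>r. fps_of_poly (p k) * (fps_deriv ^^ k) ?E) = 0"
    using assms unfolding D_finite_def satisfies_lde_def by blast
  obtain k0 where k0: "k0 \<le> r" "p k0 \<noteq> 0" using nz by blast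
  define i0 where "i0 = degree (p k0)"
  have c0: "coeff (p k0) i0 \<noteq> 0" unfolding i0_def using k0 by simp
  define N where "N = Max ((\<lambda>k. degree (p k)) ` {..r})"
  have N: "degree (p k) \<le> N" if "k \<le> r" for k unfolding N_def using that by (intro Max_ge) auto
  obtain h :: "complex \<Rightarrow> rat" where h: "h (coeff (p k0) i0) \<noteq> 0"
    and lin: "\<And>(f :: nat \<times> nat \<Rightarrow> rat) g S. finite S \<Longrightarrow> h (\<Sum>i\<in>S. of_rat (f i) * g i) = (\<Sum>i\<in>S. f i * h (g i))"
    using rat_functional[OF c0] by blast
  define q where "q k i = h (coeff (p k) i)" for k i
  have h0: "h 0 = 0" using lin[of "{}"] by simp
  have eqn: "(\<Sum>(k, i)\<in>{..r} \<times> {..N}. pochhammer (of_nat (n - i) + 1) k * of_nat (e (n - i + k)) * q k i) = 0" if n: "n \<ge> N" for n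
  proof -
    have "0 = fps_nth (\<Sum>k\<le>r. fps_of_poly (p k) * (fps_deriv ^^ k) ?E) n" unfolding eq by simp
    also have "\<dots> = (\<Sum>k\<le>r. \<Sum>i\<le>N. coeff (p k) i * (pochhammer (of_nat (n - i) + 1) k * of_nat (e (n - i + k))))"
      unfolding fps_sum_nth
    proof (intro sum.cong refl)
      fix k assume k: "k \<in> {..r}"
      have "fps_nth (fps_of_poly (p k) * (fps_deriv ^^ k) ?E) n
        = (\<Sum>i=0..n. coeff (p k) i * (pochhammer (of_nat (n - i) + 1) k * of_nat (e (n - i + k))))"
        unfolding fps_mult_nth fps_deriv_funpow_nth by simp
      also have "\<dots> = (\<Sum>i\<le>N. coeff (p k) i * (pochhammer (of_nat (n - i) + 1) k * of_nat (e (n - i + k))))"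
      proof (rule sum.mono_neutral_right)
        show "\<forall>i\<in>{0..n} - {..N}. coeff (p k) i * (pochhammer (of_nat (n - i) + 1) k * of_nat (e (n - i + k))) = 0"
          using N[of k] k by (auto intro!: coeff_eq_0)
      qed (use n in auto)
      finally show "fps_nth (fps_of_poly (p k) * (fps_deriv ^^ k) ?E) n
        = (\<Sum>i\<le>N. coeff (p k) i * (pochhammer (of_nat (n - i) + 1) k * of_nat (e (n - i + k))))" .
    qed
    also have "\<dots> = (\<Sum>(k, i)\<in>{..r} \<times> {..N}. coeff (p k) i * (pochhammer (of_nat (n - i) + 1) k * of_nat (e (n - i + k))))"
      by (rule sum.cartesian_product)
    also have "\<dots> = (\<Sum>z\<in>{..r} \<times> {..N}. of_rat (pochhammer (of_nat (n - snd z) + 1) (fst z) * of_nat (e (n - snd z + fst z))) * coeff (p (fst z)) (snd z))"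
    proof (rule sum.cong[OF refl])
      fix z :: "nat \<times> nat"
      have pc: "of_rat (pochhammer x k) = pochhammer (of_rat x :: complex) k" for x k
        by (simp add: pochhammer_prod of_rat_prod of_rat_add)
      show "(case z of (k, i) \<Rightarrow> coeff (p k) i * (pochhammer (of_nat (n - i) + 1) k * of_nat (e (n - i + k)))) =
        of_rat (pochhammer (of_nat (n - snd z) + 1) (fst z) * of_nat (e (n - snd z + fst z))) * coeff (p (fst z)) (snd z)"
        by (simp add: of_rat_mult pc of_rat_add case_prod_unfold)
    qed
    finally have z: "0 = (\<Sum>z\<in>{..r} \<times> {..N}. of_rat (pochhammer (of_nat (n - snd z) + 1) (fst z) * of_nat (e (n - snd z + fst z))) * coeff (p (fst z)) (snd z))" .
    have "h (\<Sum>z\<in>{..r} \<times> {..N}. of_rat (pochhammer (of_nat (n - snd z) + 1) (fst z) * of_nat (e (n - snd z + fst z))) * coeff (p (fst z)) (snd z))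
      = (\<Sum>z\<in>{..r} \<times> {..N}. (pochhammer (of_nat (n - snd z) + 1) (fst z) * of_nat (e (n - snd z + fst z))) * h (coeff (p (fst z)) (snd z)))"
      by (rule lin) simp
    then have "h 0 = (\<Sum>z\<in>{..r} \<times> {..N}. (pochhammer (of_nat (n - snd z) + 1) (fst z) * of_nat (e (n - snd z + fst z))) * h (coeff (p (fst z)) (snd z)))"
      unfolding z[symmetric] .
    then show ?thesis unfolding q_def h0 by (simp add: case_prod_unfold)
  qed
  define D where "D = N + r"
  \<comment> \<open>With \<open>s = n + r\<close> the pair \<open>(k, i)\<close> refers to the index
    \<open>n - i + k = s - (i + r - k)\<close>; pairs with equal \<open>i + r - k\<close> contribute
    to the same coefficient of the recurrence.\<close>
  define S where "S d = {z\<in>{..r} \<times> {..N}. snd z + r - fst z = d}" for d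
  have Sf: "finite (S d)" for d unfolding S_def by simp
  define P where "P d = (\<Sum>z\<in>S d. Polynomial.smult (q (fst z) (snd z)) (poch_poly (fst z) \<circ>\<^sub>p [:1 - of_nat r - of_nat (snd z), 1:]))" for d
  have rec: "(\<Sum>d\<le>D. poly (P d) (of_nat s) * of_nat (e (s - d))) = 0" if s: "s \<ge> D" for s
  proof -
    define n where "n = s - r"
    have n: "n \<ge> N" "s = n + r" unfolding n_def using s unfolding D_def by auto
    have "0 = (\<Sum>z\<in>{..r} \<times> {..N}. pochhammer (of_nat (n - snd z) + 1) (fst z) * of_nat (e (n - snd z + fst z)) * q (fst z) (snd z))"
      using eqn[OF n(1)] by (simp add: case_prod_unfold)
    also have "\<dots> = (\<Sum>d\<le>D. \<Sum>z\<in>S d. pochhammer (of_nat (n - snd z) + 1) (fst z) * of_nat (e (n - snd z + fst z)) * q (fst z) (snd z))"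
      unfolding S_def by (rule sum.group[symmetric]) (auto simp: D_def)
    also have "\<dots> = (\<Sum>d\<le>D. poly (P d) (of_nat s) * of_nat (e (s - d)))"
    proof (rule sum.cong[OF refl])
      fix d
      have "pochhammer (of_nat (n - snd z) + 1) (fst z) * of_nat (e (n - snd z + fst z)) * q (fst z) (snd z)
        = q (fst z) (snd z) * poly (poch_poly (fst z) \<circ>\<^sub>p [:1 - of_nat r - of_nat (snd z), 1:]) (of_nat s) * of_nat (e (s - d))"
        if z: "z \<in> S d" for z
      proof -
        have zz: "fst z \<le> r" "snd z \<le> N" "snd z + r - fst z = d" using z unfolding S_def by auto
        then have idx: "s - d = n - snd z + fst z" using n by linarith
        have arg: "poly [:1 - of_nat r - of_nat (snd z), 1:] (of_nat s) = (of_nat (n - snd z) + 1 :: rat)"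
          using zz n by (simp add: of_nat_diff)
        show ?thesis by (simp only: poly_pcompose poch_poly arg idx mult_ac)
      qed
      then show "(\<Sum>z\<in>S d. pochhammer (of_nat (n - snd z) + 1) (fst z) * of_nat (e (n - snd z + fst z)) * q (fst z) (snd z))
        = poly (P d) (of_nat s) * of_nat (e (s - d))"
        unfolding P_def poly_sum sum_distrib_right by (intro sum.cong refl) simp
    qed
    finally show ?thesis by simp
  qed
  define d0 where "d0 = i0 + r - k0"
  have in0: "(k0, i0) \<in> S d0" unfolding S_def d0_def i0_def using k0 N by auto
  \<comment> \<open>The grouping might have cancelled everything. Within one group distinct pairs
    differ in \<open>k\<close>, which is the degree of the polynomial they contribute; so the pair
    with the largest \<open>k\<close> and nonzero \<open>q k i\<close> supplies a leading
    coefficient that no other pair touches.\<close>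
  define K where "K = Max {k. \<exists>i. (k, i) \<in> S d0 \<and> q k i \<noteq> 0}"
  have Kf: "finite {k. \<exists>i. (k, i) \<in> S d0 \<and> q k i \<noteq> 0}"
    by (rule finite_subset[of _ "{..r}"]) (auto simp: S_def)
  have Kn: "k0 \<in> {k. \<exists>i. (k, i) \<in> S d0 \<and> q k i \<noteq> 0}" using in0 h unfolding q_def by auto
  have "K \<in> {k. \<exists>i. (k, i) \<in> S d0 \<and> q k i \<noteq> 0}" unfolding K_def using Kf Kn by (intro Max_in) auto
  then obtain I where I: "(K, I) \<in> S d0" "q K I \<noteq> 0" by blast
  have Kmax: "k \<le> K" if "(k, i) \<in> S d0" "q k i \<noteq> 0" for k i unfolding K_def using Kf that by (intro Max_ge) auto
  have "coeff (P d0) K = (\<Sum>z\<in>S d0. q (fst z) (snd z) * coeff (poch_poly (fst z) \<circ>\<^sub>p [:1 - of_nat r - of_nat (snd z), 1:]) K)"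
    unfolding P_def by (simp add: coeff_sum)
  also have "\<dots> = (\<Sum>z\<in>{(K, I)}. q (fst z) (snd z) * coeff (poch_poly (fst z) \<circ>\<^sub>p [:1 - of_nat r - of_nat (snd z), 1:]) K)"
  proof (rule sum.mono_neutral_right[OF Sf])
    show "{(K, I)} \<subseteq> S d0" using I by simp
    show "\<forall>z\<in>S d0 - {(K, I)}. q (fst z) (snd z) * coeff (poch_poly (fst z) \<circ>\<^sub>p [:1 - of_nat r - of_nat (snd z), 1:]) K = 0"
    proof
      fix z assume z: "z \<in> S d0 - {(K, I)}"
      show "q (fst z) (snd z) * coeff (poch_poly (fst z) \<circ>\<^sub>p [:1 - of_nat r - of_nat (snd z), 1:]) K = 0"
      proof (cases "q (fst z) (snd z) = 0")
        case False
        have "fst z \<le> K" using Kmax[of "fst z" "snd z"] z False by simp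
        moreover have "fst z \<noteq> K"
        proof
          assume "fst z = K"
          moreover have "snd z = I" using z I(1) calculation unfolding S_def by auto
          ultimately have "z = (K, I)" by (simp add: prod_eq_iff)
          then show False using z by simp
        qed
        ultimately have "degree (poch_poly (fst z) \<circ>\<^sub>p [:1 - of_nat r - of_nat (snd z), 1:]) < K"
          by (simp add: degree_pcompose poch_poly)
        then show ?thesis by (simp add: coeff_eq_0)
      qed simp
    qed
  qed
  also have "\<dots> = q K I * coeff (poch_poly K \<circ>\<^sub>p [:1 - of_nat r - of_nat I, 1:]) K" by simp
  also have "coeff (poch_poly K \<circ>\<^sub>p [:1 - of_nat r - of_nat I, 1:]) K = 1"
    using lead_coeff_comp[of "[:1 - of_nat r - of_nat I, 1:]" "poch_poly K"] poch_poly(3)[of K] by (simp add: degree_pcompose poch_poly(2))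
  finally have "P d0 \<noteq> 0" using I(2) by auto
  moreover have "d0 \<le> D" unfolding d0_def D_def i0_def using N[OF k0(1)] by linarith
  ultimately have "\<exists>d\<le>D. P d \<noteq> 0" by (intro exI[of _ d0] conjI)
  then show ?thesis by (rule P_recursiveI) (use rec in simp)
qed

text \<open>In the recurrence at \<open>l * s + t\<close> only the shifts congruent to
  \<open>t\<close> modulo \<open>l\<close> meet indices divisible by \<open>l\<close>. Taking
  \<open>t\<close> as the residue of a shift whose coefficient is nonzero keeps the new recurrence
  nontrivial.\<close>

lemma P_recursive_sparse:
  assumes "P_recursive a" and l: "l > 0" and a: "\<And>m. a m \<noteq> 0 \<Longrightarrow> l dvd m"
  shows "P_recursive (\<lambda>k. a (l * k))"
proof -
  obtain D P where nz: "\<exists>d\<le>D. P d \<noteq> 0" and rec: "\<And>s. s \<ge> D \<Longrightarrow> (\<Sum>d\<le>D. poly (P d) (of_nat s) * a (s - d)) = 0"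
    using assms(1) unfolding P_recursive_def by blast
  obtain d0 where d0: "d0 \<le> D" "P d0 \<noteq> 0" using nz by blast
  define t where "t = d0 mod l"
  define R where "R j = (if t + l * j \<le> D then P (t + l * j) \<circ>\<^sub>p [:of_nat t, of_nat l:] else 0)" for j
  have tl: "t < l" unfolding t_def using l by simp
  have "R (d0 div l) \<noteq> 0" unfolding R_def t_def using d0 l by (simp add: pcompose_eq_0_iff)
  moreover have "d0 div l \<le> D" using d0 by (intro order_trans[OF div_le_dividend]) auto
  ultimately have "\<exists>d\<le>D. R d \<noteq> 0" by (intro exI[of _ "d0 div l"] conjI)
  moreover have "(\<Sum>j\<le>D. poly (R j) (of_nat s) * a (l * (s - j))) = 0" if s: "s \<ge> D" for s
  proof -
    define n where "n = l * s + t"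
    have ls: "s \<le> l * s" using l by simp
    have n: "n \<ge> D" unfolding n_def using s ls by linarith
    have "0 = (\<Sum>d\<le>D. poly (P d) (of_nat n) * a (n - d))" using rec[OF n] by simp
    also have "\<dots> = (\<Sum>d\<in>(\<lambda>j. t + l * j) ` {j. j \<le> D \<and> t + l * j \<le> D}. poly (P d) (of_nat n) * a (n - d))"
    proof (rule sum.mono_neutral_right)
      show "\<forall>d\<in>{..D} - (\<lambda>j. t + l * j) ` {j. j \<le> D \<and> t + l * j \<le> D}. poly (P d) (of_nat n) * a (n - d) = 0"
      proof
        fix d assume d: "d \<in> {..D} - (\<lambda>j. t + l * j) ` {j. j \<le> D \<and> t + l * j \<le> D}"
        have "a (n - d) = 0"
        proof (rule ccontr)
          assume "a (n - d) \<noteq> 0"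
          then have "l dvd n - d" by (rule a)
          moreover have "d \<le> n" using n d by auto
          ultimately have "n mod l = d mod l" by (simp add: mod_eq_dvd_iff_nat)
          then have "d mod l = t" unfolding n_def using tl by simp
          then have e: "d = t + l * (d div l)" using mod_mult_div_eq[of d l] by simp
          have "d div l \<le> D" using d by (intro order_trans[OF div_le_dividend]) auto
          moreover have "t + l * (d div l) \<le> D" using d unfolding e[symmetric] by simp
          ultimately have "d div l \<in> {j. j \<le> D \<and> t + l * j \<le> D}" by simp
          with e have "d \<in> (\<lambda>j. t + l * j) ` {j. j \<le> D \<and> t + l * j \<le> D}" by (rule image_eqI)
          then show False using d by simp
        qed
        then show "poly (P d) (of_nat n) * a (n - d) = 0" by simp
      qed
    qed auto
    also have "\<dots> = (\<Sum>j\<in>{j. j \<le> D \<and> t + l * j \<le> D}. poly (P (t + l * j)) (of_nat n) * a (n - (t + l * j)))"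
      using l by (subst sum.reindex) (auto simp: inj_on_def)
    also have "\<dots> = (\<Sum>j\<in>{j. j \<le> D \<and> t + l * j \<le> D}. poly (R j) (of_nat s) * a (l * (s - j)))"
    proof (rule sum.cong[OF refl])
      fix j assume j: "j \<in> {j. j \<le> D \<and> t + l * j \<le> D}"
      have "n - (t + l * j) = l * (s - j)" unfolding n_def by (simp add: diff_mult_distrib2)
      moreover have "poly (R j) (of_nat s) = poly (P (t + l * j)) (of_nat n)"
        using j unfolding R_def n_def by (simp add: poly_pcompose algebra_simps)
      ultimately show "poly (P (t + l * j)) (of_nat n) * a (n - (t + l * j)) = poly (R j) (of_nat s) * a (l * (s - j))" by simp
    qed
    also have "\<dots> = (\<Sum>j\<le>D. poly (R j) (of_nat s) * a (l * (s - j)))"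
      by (rule sum.mono_neutral_left) (auto simp: R_def)
    finally show ?thesis by simp
  qed
  ultimately show ?thesis by (intro P_recursiveI[of D R] allI impI)
qed

lemma P_recursive_scale:
  assumes "P_recursive a" "\<rho> \<noteq> 0" shows "P_recursive (\<lambda>k. a k * \<rho> ^ k)"
proof -
  obtain D P where nz: "\<exists>d\<le>D. P d \<noteq> 0" and rec: "\<And>s. s \<ge> D \<Longrightarrow> (\<Sum>d\<le>D. poly (P d) (of_nat s) * a (s - d)) = 0"
    using assms(1) unfolding P_recursive_def by blast
  have "(\<Sum>d\<le>D. poly (Polynomial.smult (\<rho> ^ d) (P d)) (of_nat s) * (a (s - d) * \<rho> ^ (s - d))) = 0" if "s \<ge> D" for s
  proof -
    have "(\<Sum>d\<le>D. poly (Polynomial.smult (\<rho> ^ d) (P d)) (of_nat s) * (a (s - d) * \<rho> ^ (s - d)))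
      = (\<Sum>d\<le>D. \<rho> ^ s * (poly (P d) (of_nat s) * a (s - d)))"
    proof (rule sum.cong[OF refl])
      fix d assume "d \<in> {..D}"
      then have "\<rho> ^ d * \<rho> ^ (s - d) = \<rho> ^ s" using that by (simp flip: power_add)
      then show "poly (Polynomial.smult (\<rho> ^ d) (P d)) (of_nat s) * (a (s - d) * \<rho> ^ (s - d)) = \<rho> ^ s * (poly (P d) (of_nat s) * a (s - d))"
        by (simp add: mult_ac)
    qed
    then show ?thesis using rec[OF that] by (simp add: sum_distrib_left[symmetric])
  qed
  moreover have "\<exists>d\<le>D. Polynomial.smult (\<rho> ^ d) (P d) \<noteq> 0" using nz assms(2) by auto
  ultimately show ?thesis by (intro P_recursiveI[of D "\<lambda>d. Polynomial.smult (\<rho> ^ d) (P d)"] allI impI)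
qed

text \<open>The coefficient of shift \<open>d\<close> is multiplied by \<open>(s - i) ^ M\<close>
  for all other shifts \<open>i\<close>; the missing factor is \<open>(s - d) ^ M\<close>, which the
  new sequence provides. All terms then carry the same product, which factors out.\<close>

lemma P_recursive_power:
  assumes "P_recursive a" shows "P_recursive (\<lambda>k. a k * of_nat k ^ M)"
proof -
  obtain D P where nz: "\<exists>d\<le>D. P d \<noteq> 0" and rec: "\<And>s. s \<ge> D \<Longrightarrow> (\<Sum>d\<le>D. poly (P d) (of_nat s) * a (s - d)) = 0"
    using assms(1) unfolding P_recursive_def by blast
  define W where "W d = (\<Prod>i\<in>{..D} - {d}. [:- of_nat i, 1:] ^ M) * P d" for d
  have "(\<Sum>d\<le>D. poly (W d) (of_nat s) * (a (s - d) * of_nat (s - d) ^ M)) = 0" if s: "s \<ge> D" for s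
  proof -
    have "poly (W d) (of_nat s) * (a (s - d) * of_nat (s - d) ^ M)
      = (\<Prod>i\<le>D. (of_nat s - of_nat i) ^ M) * (poly (P d) (of_nat s) * a (s - d))" if d: "d \<le> D" for d
    proof -
      have "(\<Prod>i\<le>D. (of_nat s - of_nat i :: rat) ^ M) = (of_nat s - of_nat d) ^ M * (\<Prod>i\<in>{..D} - {d}. (of_nat s - of_nat i) ^ M)"
        using d by (intro prod.remove) auto
      moreover have "(of_nat (s - d) :: rat) = of_nat s - of_nat d" using d s by (simp add: of_nat_diff)
      ultimately show ?thesis unfolding W_def by (simp add: poly_prod)
    qed
    then have "(\<Sum>d\<le>D. poly (W d) (of_nat s) * (a (s - d) * of_nat (s - d) ^ M))
      = (\<Sum>d\<le>D. (\<Prod>i\<le>D. (of_nat s - of_nat i) ^ M) * (poly (P d) (of_nat s) * a (s - d)))"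
      by (intro sum.cong refl) auto
    then show ?thesis using rec[OF s] by (simp add: sum_distrib_left[symmetric])
  qed
  moreover have "\<exists>d\<le>D. W d \<noteq> 0" using nz unfolding W_def by auto
  ultimately show ?thesis by (intro P_recursiveI[of D W] allI impI)
qed

lemma ev_of_rat: "ev p (of_rat x) = of_rat (poly p x)"
  by (induction p) (simp_all add: of_rat_add of_rat_mult)

context tandem
begin

text \<open>Along a closed sequence of \<open>ell\<close> steps the contributions of
  \<open>x1\<close> and \<open>x2\<close> cancel in the product of the step weights. The right-hand
  side is visibly rational, as the \<open>pr i\<close> are.\<close>

lemma exp_ell_lam: "exp (- (real ell * lam)) = pr 0 ^ LA * pr 1 ^ LB * pr 2 ^ LC"
proof -
  define L where "L = lcm A (lcm B C)"
  have l: "real A * LA = L" "real B * LB = L" "real C * LC = L"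
    using LABC unfolding L_def[symmetric] by (metis of_nat_mult)+
  have "pr 0 ^ LA * pr 1 ^ LB * pr 2 ^ LC = exp (LA * (x1 * A - lam) + LB * (x2 * B - x1 * B - lam) + LC * (- (x2 * C) - lam))"
    using step_weight[of 0] step_weight[of 1] step_weight[of 2]
    by (simp add: st_def exp_add exp_of_nat_mult)
  also have "LA * (x1 * A - lam) + LB * (x2 * B - x1 * B - lam) + LC * (- (x2 * C) - lam)
    = x1 * (real A * LA) - x1 * (real B * LB) + x2 * (real B * LB) - x2 * (real C * LC) - (real LA + LB + LC) * lam"
    by (simp add: algebra_simps)
  also have "\<dots> = - (real ell * lam)" unfolding l ell_def by simp
  finally show ?thesis by simp
qed

text \<open>Passing to the lengths divisible by \<open>ell\<close> loses only zeros, makes a lower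
  bound for every term possible, and turns the normalising factor into a power of a rational number,
  so that the recurrence keeps rational coefficients.\<close>

lemma excursion_recursive:
  assumes "D_finite (excursion_gf A B C :: complex fps)"
  shows "\<exists>c :: nat \<Rightarrow> rat. P_recursive c \<and> (\<forall>k. real_of_rat (c k) = weighted_count (ell * k) (0, 0) * real k ^ M)"
proof -
  define e where "e n = tandem_count A B C n (0, 0)" for n
  have "D_finite (Abs_fps (\<lambda>n. of_nat (e n)) :: complex fps)"
    using assms unfolding excursion_gf_def tandem_gf_def tandem_count_def e_def by simp
  then have r0: "P_recursive (\<lambda>n. of_nat (e n))" by (rule D_finite_P_recursive)
  have r1: "P_recursive (\<lambda>k. of_nat (e (ell * k)))"
    by (rule P_recursive_sparse[OF r0 LABC_pos(4)]) (auto simp: e_def intro!: admissible_origin admissible_count)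
  have "S0 \<in> \<rat>" unfolding S0_def by auto
  then have "pr i \<in> \<rat>" for i unfolding pr_def by auto
  then have "exp (- (real ell * lam)) \<in> \<rat>" unfolding exp_ell_lam by auto
  then obtain q where q: "exp (- (real ell * lam)) = of_rat q" by (auto simp: Rats_def)
  have q0: "q \<noteq> 0" using q exp_gt_zero[of "- (real ell * lam)"] by auto
  define c where "c k = of_nat (e (ell * k)) * q ^ k * of_nat k ^ M" for k
  have "P_recursive c" unfolding c_def by (rule P_recursive_power[OF P_recursive_scale[OF r1 q0]])
  moreover have "real_of_rat (c k) = weighted_count (ell * k) (0, 0) * real k ^ M" for k
  proof -
    have "exp (- (real (ell * k) * lam)) = exp (- (real ell * lam)) ^ k"
      unfolding exp_of_nat_mult[symmetric] by (simp add: algebra_simps)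
    then have "weighted_count (ell * k) (0, 0) = real (e (ell * k)) * of_rat q ^ k" unfolding weighted_count_def e_def q by simp
    then show ?thesis unfolding c_def by (simp add: of_rat_mult of_rat_power)
  qed
  ultimately show ?thesis by blast
qed

lemma excursion_not_D_finite:
  assumes h: "real B ^ 2 / ((real A + real B) * (real B + real C)) \<notin> {1/4, 1/2, 3/4}"
  shows "\<not> D_finite (excursion_gf A B C :: complex fps)"
proof
  assume D: "D_finite (excursion_gf A B C :: complex fps)"
  \<comment> \<open>The factor \<open>k ^ m\<close> moves the abscissa of convergence from
    \<open>- alpha\<close> to \<open>m - alpha > 0\<close>, to the right of the poles of the
    factorial series.\<close>
  define m where "m = nat \<lceil>alpha\<rceil> + 1"
  have m: "real m > alpha" unfolding m_def by linarith
  obtain c where c: "P_recursive c" and cb: "\<And>k. real_of_rat (c k) = weighted_count (ell * k) (0, 0) * real k ^ m"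
    using excursion_recursive[OF D, of m] by blast
  obtain J P where nz: "\<exists>d\<le>J. P d \<noteq> 0" and rec: "\<And>s. s \<ge> J \<Longrightarrow> (\<Sum>d\<le>J. poly (P d) (of_nat s) * c (s - d)) = 0"
    using c unfolding P_recursive_def by blast
  define b where "b k = weighted_count (ell * k) (0, 0) * real k ^ m" for k
  have el: "real ell > 0" using LABC_pos by simp
  have shift: "real n powr x * real n ^ m = real n powr (x + m)" if "n > 0" for n x
    using that by (simp add: powr_add powr_realpow)
  interpret algebraic_exponent b "real m - alpha" P J
  proof
    show "real m - alpha > 0" using m by simp
    show "b n \<ge> 0" for n unfolding b_def using weighted_count_nonneg by simp
    show "\<exists>C. \<forall>\<^sub>F n in sequentially. b n \<le> C * n powr (real m - alpha - 1 + \<epsilon>)" if eps: "\<epsilon> > 0" for \<epsilon>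
    proof -
      define x where "x = - (1 + alpha) + \<epsilon>"
      obtain K where K: "\<forall>n\<ge>1. weighted_count n (0, 0) \<le> K * real n powr x" using weighted_count_upper[OF eps] unfolding x_def by blast
      have "b n \<le> (K * real ell powr x) * n powr (real m - alpha - 1 + \<epsilon>)" if n: "n \<ge> 1" for n
      proof -
        have "ell * n \<ge> 1" using n LABC_pos by (simp add: Suc_le_eq)
        then have "weighted_count (ell * n) (0, 0) \<le> K * real (ell * n) powr x" using K by blast
        then have "b n \<le> K * real (ell * n) powr x * real n ^ m" unfolding b_def by (intro mult_right_mono) auto
        also have "\<dots> = (K * real ell powr x) * (real n powr x * real n ^ m)" by (simp add: powr_mult)
        also have "real n powr x * real n ^ m = n powr (x + m)" using n by (intro shift) simp
        also have "x + real m = real m - alpha - 1 + \<epsilon>" unfolding x_def by simp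
        finally show ?thesis .
      qed
      then show ?thesis by (intro exI[of _ "K * real ell powr x"] eventually_sequentiallyI[of 1])
    qed
    show "\<exists>c>0. \<forall>\<^sub>F n in sequentially. c * n powr (real m - alpha - 1 - \<epsilon>) \<le> b n" if eps: "\<epsilon> > 0" for \<epsilon>
    proof -
      define x where "x = - (1 + alpha) - \<epsilon>"
      obtain K N0 where K: "K > 0" "\<forall>N\<ge>N0. K * real N powr x \<le> weighted_count (ell * N) (0, 0)"
        using weighted_count_lower[OF eps] unfolding x_def by blast
      have "K * n powr (real m - alpha - 1 - \<epsilon>) \<le> b n" if n: "n \<ge> max N0 1" for n
      proof -
        have E1: "real m - alpha - 1 - \<epsilon> = x + real m" unfolding x_def by simp
        have E2: "real n powr x * real n ^ m = n powr (x + m)" using n by (intro shift) simp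
        have "K * n powr (real m - alpha - 1 - \<epsilon>) = K * real n powr x * real n ^ m" unfolding E1 mult.assoc E2 ..
        also have "\<dots> \<le> b n" unfolding b_def using K n by (intro mult_right_mono) auto
        finally show ?thesis .
      qed
      then show ?thesis using K(1) by (intro exI[of _ K] conjI eventually_sequentiallyI[of "max N0 1"])
    qed
    show "(\<Sum>j\<le>J. ev (P j) (of_nat k) * of_real (b (k - j))) = 0" if "k \<ge> J" for k
    proof -
      have "ev (P j) (of_nat k) * of_real (b (k - j)) = of_rat (poly (P j) (of_nat k) * c (k - j))" for j
        using ev_of_rat[of "P j" "of_nat k"] unfolding b_def cb[symmetric] of_real_of_rat by (simp add: of_rat_mult)
      then have "(\<Sum>j\<le>J. ev (P j) (of_nat k) * of_real (b (k - j))) = of_rat (\<Sum>j\<le>J. poly (P j) (of_nat k) * c (k - j))"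
        by (simp add: of_rat_sum)
      then show ?thesis using rec[OF that] by simp
    qed
  qed (rule nz)
  have "complex_of_real (real m - alpha) = of_rat (of_nat m) - of_real alpha" by simp
  then have "algebraic (of_rat (of_nat m) - complex_of_real alpha)" using exponent_algebraic by simp
  then have "algebraic (complex_of_real alpha)" by (rule algebraic_diffD)
  then have "algebraic (inverse (complex_of_real alpha))" using alpha_gt by (intro algebraic_inverse_complex) auto
  also have "inverse (complex_of_real alpha) = complex_of_real (theta / pi)" unfolding alpha_def by (simp add: inverse_eq_divide)
  finally show False by (rule angle_transcendental[OF h])
qed

end

theorem theorem2:
  fixes A B C :: nat
  assumes "A > 0" and "B > 0" and "C > 0"
    and "gcd A (gcd B C) = 1"
    and "real B ^ 2 / ((real A + real B) * (real B + real C)) \<notin> {1/4, 1/2, 3/4}"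
  shows "\<not> D_finite3 (tandem_gf A B C :: complex fps fps fps) \<and>
         \<not> D_finite (excursion_gf A B C :: complex fps)"
proof -
  interpret tandem A B C by standard (use assms in auto)
  show ?thesis using excursion_not_D_finite[OF assms(5)] D_finite_excursion by blast
qed

end
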